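(* Let $1<p\le q<\infty$, $\alpha>-1$, $\beta>-1$, $f\in L^q_{\beta}$, and $$\gamma=\frac{n+1+\beta}{q}-\frac{n+1+\alpha}{p}.$$ Then $H^{\beta}_f$ and $H^{\beta}_{\overline{f}}$ are both compact from $A^p_{\alpha}$ to $L^q_{\beta}$ if and only if $f\in VMO^q_{\gamma}$.
   Context: $\mathbb{B}_n$ is the open unit ball of $\mathbb{C}^n$ ($n\ge 1$), $\langle z,w\rangle=\sum_k z_k\overline{w_k}$, and $dv$ is Lebesgue volume measure on $\mathbb{B}_n$ normalized so that $v(\mathbb{B}_n)=1$. For $\alpha>-1$, $dv_\alpha(z)=c_\alpha(1-|z|^2)^\alpha dv(z)$ with $c_\alpha>0$ such that $v_\alpha(\mathbb{B}_n)=1$; $L^p_\alpha=L^p(\mathbb{B}_n,dv_\alpha)$ with norm $\|\cdot\|_{p,\alpha}$, and $A^p_\alpha$ is the subspace of holomorphic functions in $L^p_\alpha$ (weighted Bergman space). Projection and Hankel operators: $P_{\beta} g(z)=\int_{\mathbb{B}_n} \frac{g(w)\,dv_{\beta}(w)}{(1-\langle z,w\rangle )^{n+1+\beta}}$, and $H^\beta_f g=(I-P_\beta)(fg)$, defined for $g$ in the space $H^\infty$ of bounded holomorphic functions, which is dense in $A^p_\alpha$. Compactness from $A^p_\alpha$ to $L^q_\beta$ means that this densely defined operator extends to a compact linear operator $A^p_\alpha\to L^q_\beta$. Bergman metric: for $z,w\in\mathbb{B}_n$, let $\rho(z,w)\in[0,1)$ be given by $1-\rho(z,w)^2=\frac{(1-|z|^2)(1-|w|^2)}{|1-\langle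 z,w\rangle|^2}$; the Bergman distance is $\beta(z,w)=\frac12\log\frac{1+\rho(z,w)}{1-\rho(z,w)}$ (not to be confused with the number $\beta$), and $D(z,r)=\{w\in\mathbb{B}_n:\beta(z,w)<r\}$. Weighted BMO and VMO: for $\gamma\in\mathbb{R}$, $r>0$, $1\le q<\infty$ and $\sigma\in\mathbb{R}$, put $dv_\sigma(z)=(1-|z|^2)^\sigma dv(z)$ (normalization is irrelevant here), $\widehat{f_r}(z)=\frac{1}{v_\sigma(D(z,r))}\int_{D(z,r)}f\,dv_\sigma$, and $MO_{q,r}(f)(z)=\left[\frac{1}{v_\sigma(D(z,r))}\int_{D(z,r)}|f(w)-\widehat{f_r}(z)|^q dv_\sigma(w)\right]^{1/q}$. The space $BMO^q_{r,\gamma}$ consists of all $f\in L^q_{loc}(\mathbb{B}_n)$ with $\sup_{z\in\mathbb{B}_n}(1-|z|^2)^\gamma MO_{q,r}(f)(z)<\infty$, and $VMO^q_{r,\gamma}$ consists of all $f\in BMO^q_{r,\gamma}$ with $\lim_{|z|\to1}(1-|z|^2)^\gamma MO_{q,r}(f)(z)=0$. These spaces do not depend on $\sigma\in\mathbb{R}$ or $r>0$; the latter is denoted $VMO^q_\gamma$. *)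

theory Defs
  imports "HOL-Analysis.Analysis"
begin

section \<open>The unit ball and its weighted measures\<close>

text \<open>
  The space of complex \<open>n\<close>-tuples is \<^typ>\<open>complex ^ 'n\<close> with \<open>n = CARD('n)\<close>; its norm is the
  Euclidean one.  Functions on the ball are total functions whose values outside
  \<^term>\<open>ball 0 1\<close> never matter: all measures below have the ball as their underlying space.
\<close>

definition hinner :: "complex ^ 'n \<Rightarrow> complex ^ 'n \<Rightarrow> complex" where
  "hinner z w = (\<Sum>k\<in>UNIV. z $ k * cnj (w $ k))"

definition ball_vol :: "(complex ^ 'n) measure" where
  "ball_vol = uniform_measure (lebesgue_on (ball 0 1)) (ball 0 1)"

text \<open>
  The measure \<open>(1 - |z|\<^sup>2)\<^sup>\<sigma> dv\<close> without normalising constant, meaningful for every real \<open>\<sigma>\<close>;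
  it is used for the mean oscillation.  The measure \<open>v_prob \<alpha>\<close>, for \<open>\<alpha> > -1\<close>, is the one
  normalised to total mass one.
\<close>

definition v_weight :: "real \<Rightarrow> (complex ^ 'n) measure" where
  "v_weight \<sigma> = density ball_vol (\<lambda>z. ennreal ((1 - (norm z)\<^sup>2) powr \<sigma>))"

definition c_const :: "'n::finite itself \<Rightarrow> real \<Rightarrow> real" where
  "c_const _ \<alpha> = 1 / (\<integral>z. (1 - (norm z)\<^sup>2) powr \<alpha> \<partial>(ball_vol :: (complex ^ 'n) measure))"

definition v_prob :: "real \<Rightarrow> (complex ^ 'n) measure" where
  "v_prob \<alpha> = density ball_vol
     (\<lambda>z. ennreal (c_const TYPE('n) \<alpha> * (1 - (norm z)\<^sup>2) powr \<alpha>))"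

section \<open>Function spaces\<close>

text \<open>
  Elements are functions rather than classes modulo equality almost everywhere, so
  \<open>Lp_norm\<close> is a seminorm.
\<close>

definition Lp_space :: "real \<Rightarrow> 'a measure \<Rightarrow> ('a \<Rightarrow> complex) set" where
  "Lp_space p M = {f. f \<in> borel_measurable M \<and> integrable M (\<lambda>x. norm (f x) powr p)}"

definition Lp_norm :: "real \<Rightarrow> 'a measure \<Rightarrow> ('a \<Rightarrow> complex) \<Rightarrow> real" where
  "Lp_norm p M f = (\<integral>x. norm (f x) powr p \<partial>M) powr (1 / p)"

text \<open>Holomorphy: a complex-linear Frechet derivative at every point of the ball.\<close>

definition holomorphic_ball :: "(complex ^ 'n \<Rightarrow> complex) \<Rightarrow> bool" where
  "holomorphic_ball f \<longleftrightarrow>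
     (\<forall>z\<in>ball 0 1. \<exists>D. (f has_derivative D) (at z) \<and> (\<forall>c x. D (c *s x) = c * D x))"

definition bergman_space :: "real \<Rightarrow> real \<Rightarrow> (complex ^ 'n \<Rightarrow> complex) set" where
  "bergman_space p \<alpha> = {f \<in> Lp_space p (v_prob \<alpha>). holomorphic_ball f}"

definition H_infinity :: "(complex ^ 'n \<Rightarrow> complex) set" where
  "H_infinity = {g. holomorphic_ball g \<and> bounded (g ` ball 0 1)}"

section \<open>Hankel operators and compactness\<close>

text \<open>
  The principal branch of the complex power is the intended one, since
  \<open>Re (1 - \<langle>z, w\<rangle>) > 0\<close> on the ball.
\<close>

definition bergman_proj ::
  "real \<Rightarrow> (complex ^ 'n \<Rightarrow> complex) \<Rightarrow> complex ^ 'n \<Rightarrow> complex" where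
  "bergman_proj \<beta> g z =
     (\<integral>w. g w / (1 - hinner z w) powr complex_of_real (real CARD('n) + 1 + \<beta>) \<partial>(v_prob \<beta>))"

definition hankel ::
  "real \<Rightarrow> (complex ^ 'n \<Rightarrow> complex) \<Rightarrow> (complex ^ 'n \<Rightarrow> complex) \<Rightarrow> complex ^ 'n \<Rightarrow> complex" where
  "hankel \<beta> f g z = f z * g z - bergman_proj \<beta> (\<lambda>w. f w * g w) z"

text \<open>
  \<open>compact_operator X p M q N T\<close>: on the linear space \<open>X\<close> of functions, seminormed by
  \<open>Lp_norm p M\<close>, the map \<open>T\<close> induces a compact linear operator into \<open>L\<^sup>q(N)\<close>.  All identities
  are modulo null sets, and compactness means that bounded sequences are mapped to sequences
  having a subsequence that converges in \<open>L\<^sup>q(N)\<close>.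
\<close>

definition compact_operator ::
  "('a \<Rightarrow> complex) set \<Rightarrow> real \<Rightarrow> 'a measure \<Rightarrow> real \<Rightarrow> 'a measure \<Rightarrow>
     (('a \<Rightarrow> complex) \<Rightarrow> 'a \<Rightarrow> complex) \<Rightarrow> bool" where
  "compact_operator X p M q N T \<longleftrightarrow>
     (\<forall>g\<in>X. T g \<in> Lp_space q N) \<and>
     (\<forall>g\<in>X. \<forall>h\<in>X. (AE x in M. g x = h x) \<longrightarrow> (AE x in N. T g x = T h x)) \<and>
     (\<forall>g\<in>X. \<forall>h\<in>X. AE x in N. T (\<lambda>y. g y + h y) x = T g x + T h x) \<and>
     (\<forall>c. \<forall>g\<in>X. AE x in N. T (\<lambda>y. c * g y) x = c * T g x) \<and>
     (\<forall>g :: nat \<Rightarrow> 'a \<Rightarrow> complex.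
        (\<forall>k. g k \<in> X) \<and> (\<exists>C. \<forall>k. Lp_norm p M (g k) \<le> C) \<longrightarrow>
        (\<exists>h\<in>Lp_space q N. \<exists>s :: nat \<Rightarrow> nat. strict_mono s \<and>
           (\<lambda>k. Lp_norm q N (\<lambda>x. T (g (s k)) x - h x)) \<longlonglongrightarrow> 0))"

definition hankel_compact ::
  "real \<Rightarrow> real \<Rightarrow> real \<Rightarrow> real \<Rightarrow> (complex ^ 'n \<Rightarrow> complex) \<Rightarrow> bool" where
  "hankel_compact p \<alpha> q \<beta> f \<longleftrightarrow>
     (\<exists>T. compact_operator (bergman_space p \<alpha>) p (v_prob \<alpha>) q (v_prob \<beta>) T \<and>
          (\<forall>g\<in>H_infinity. AE z in v_prob \<beta>. T g z = hankel \<beta> f g z))"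

section \<open>Bergman metric, mean oscillation, BMO and VMO\<close>

definition bergman_rho :: "complex ^ 'n \<Rightarrow> complex ^ 'n \<Rightarrow> real" where
  "bergman_rho z w =
     sqrt (1 - (1 - (norm z)\<^sup>2) * (1 - (norm w)\<^sup>2) / (norm (1 - hinner z w))\<^sup>2)"

definition bergman_dist :: "complex ^ 'n \<Rightarrow> complex ^ 'n \<Rightarrow> real" where
  "bergman_dist z w = 1 / 2 * ln ((1 + bergman_rho z w) / (1 - bergman_rho z w))"

definition bergman_ball :: "complex ^ 'n \<Rightarrow> real \<Rightarrow> (complex ^ 'n) set" where
  "bergman_ball z r = {w \<in> ball 0 1. bergman_dist z w < r}"

definition bergman_avg ::
  "real \<Rightarrow> real \<Rightarrow> (complex ^ 'n \<Rightarrow> complex) \<Rightarrow> complex ^ 'n \<Rightarrow> complex" where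
  "bergman_avg \<sigma> r f z =
     (1 / measure (v_weight \<sigma>) (bergman_ball z r)) *\<^sub>R (LINT w:bergman_ball z r|v_weight \<sigma>. f w)"

definition mean_osc ::
  "real \<Rightarrow> real \<Rightarrow> real \<Rightarrow> (complex ^ 'n \<Rightarrow> complex) \<Rightarrow> complex ^ 'n \<Rightarrow> real" where
  "mean_osc \<sigma> q r f z =
     (1 / measure (v_weight \<sigma>) (bergman_ball z r) *
       (LINT w:bergman_ball z r|v_weight \<sigma>. norm (f w - bergman_avg \<sigma> r f z) powr q)) powr (1 / q)"

definition Lq_loc :: "real \<Rightarrow> (complex ^ 'n \<Rightarrow> complex) set" where
  "Lq_loc q = {f \<in> borel_measurable ball_vol.
     \<forall>K. compact K \<and> K \<subseteq> ball 0 1 \<longrightarrow> set_integrable ball_vol K (\<lambda>z. norm (f z) powr q)}"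

definition BMO :: "real \<Rightarrow> real \<Rightarrow> real \<Rightarrow> real \<Rightarrow> (complex ^ 'n \<Rightarrow> complex) set" where
  "BMO \<sigma> q r \<gamma> = {f \<in> Lq_loc q.
     bdd_above ((\<lambda>z. (1 - (norm z)\<^sup>2) powr \<gamma> * mean_osc \<sigma> q r f z) ` ball 0 1)}"

definition VMO :: "real \<Rightarrow> real \<Rightarrow> real \<Rightarrow> real \<Rightarrow> (complex ^ 'n \<Rightarrow> complex) set" where
  "VMO \<sigma> q r \<gamma> = {f \<in> BMO \<sigma> q r \<gamma>.
     ((\<lambda>z. (1 - (norm z)\<^sup>2) powr \<gamma> * mean_osc \<sigma> q r f z) \<longlongrightarrow> 0)
       (filtercomap norm (at_left 1))}"

end

theory Submission
  imports Defs "HOL-Complex_Analysis.Complex_Analysis" "HOL-Real_Asymp.Real_Asymp"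
begin

text \<open>
  If \<open>f\<close> has vanishing oscillation, then for every \<open>e > 0\<close> its local oscillation, raised to the power
  \<open>q\<close>, is at most \<open>e (1-|u|\<^sup>2)\<close> to the power \<open>-\<gamma>q\<close> plus a term with a faster decaying weight. Comparing the
  averages of \<open>f\<close> along chains of Bergman balls gives a bound for \<open>\<integral> |f(z)-f(w)| |g(w)| |1-\<langle>z,w\<rangle>|\<^sup>-\<^sup>N dw\<close>
  in \<open>L\<^sup>q\<close>, hence for the Hankel operator \<open>E\<close> formed with a large weight. The second term tends
  to \<open>0\<close> along bounded pointwise convergent sequences, so \<open>E\<close> is compact, and so is \<open>(I - P\<^sub>\<beta>) E\<close>, which
  is \<open>H\<^sub>f\<close>.

  Conversely, the normalized kernels \<open>g\<^sub>a\<close> are bounded and tend to \<open>0\<close> pointwise as \<open>|a| \<rightarrow> 1\<close>, so both Hankel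
  operators send them to null sequences. For holomorphic \<open>G\<close> the projection of \<open>cnj G g\<^sub>a\<close> is \<open>cnj (G a) g\<^sub>a\<close>;
  thus \<open>f g\<^sub>a\<close> is close to a constant multiple of \<open>g\<^sub>a\<close>, and \<open>|g\<^sub>a|\<close> is
  comparable to a constant on the Bergman ball at \<open>a\<close>.
\<close>

text \<open>A bounded \<open>g\<close> makes \<open>f g\<close> integrable for the weight \<beta>; a
  general \<open>g\<close> in the Bergman space need not. But \<open>g\<close> grows at most like
  1-|z|^2 to the power -\<kappa>, with \<kappa> = (n+1+\<alpha>)/p, so \<open>f g\<close> is
  integrable for a weight s with s-\<kappa> \<ge> \<beta>. Hence
  \<open>E g = f g - P\<^sub>s (f g)\<close> exists on the whole space, and
  \<open>(I - P\<^sub>\<beta>) E\<close> agrees with \<open>H\<^sub>f\<close> on bounded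
  \<open>g\<close> because \<open>P\<^sub>\<beta>\<close> fixes the holomorphic function
  \<open>P\<^sub>s (f g)\<close>. A large s also makes the kernel integrals converge. In the
  converse, compactness only gives a subsequence of \<open>H\<^sub>f g\<^sub>a\<close> with some
  limit h. It vanishes because \<open>P\<^sub>\<beta>\<close> annihilates each
  \<open>H\<^sub>f g\<^sub>a\<close>, hence h, while \<open>I - P\<^sub>s\<close> maps the sequence
  to functions tending to 0 pointwise, so that h is holomorphic and equal to
  \<open>P\<^sub>\<beta> h\<close>. The kernels \<open>g\<^sub>a\<close> carry the exponent of
  \<open>P\<^sub>s\<close>, which turns the projection of \<open>cnj G g\<^sub>a\<close> into a
  reproducing formula at a. Integration over the ball rests on linear changes of variables: moments
  come from Gaussian integrals, mean values from ellipsoids inside Bergman balls.\<close>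

abbreviation (input) unit_ball :: "'a :: real_normed_vector set" ("\<B>") where
  "\<B> \<equiv> ball 0 1"

section \<open>Invariance of Lebesgue measure under affine maps and linear isometries\<close>

lemma nn_integral_lborel_translate:
  fixes f :: "'a::euclidean_space \<Rightarrow> ennreal"
  assumes [measurable]: "f \<in> borel_measurable borel"
  shows "(\<integral>\<^sup>+x. f (x + c) \<partial>lborel) = (\<integral>\<^sup>+x. f x \<partial>lborel)"
proof -
  have "(\<integral>\<^sup>+x. f x \<partial>lborel) = (\<integral>\<^sup>+x. f x \<partial>density (distr lborel borel (\<lambda>x. c + 1 *\<^sub>R x)) (\<lambda>_. ennreal (\<bar>1\<bar>^DIM('a))))"
    by (subst lborel_affine[of 1 c]) auto
  also have "\<dots> = (\<integral>\<^sup>+x. f (x + c) \<partial>lborel)"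
    by (simp add: nn_integral_density nn_integral_distr add.commute)
  finally show ?thesis by simp
qed

lemma nn_integral_lborel_reflect:
  fixes f :: "'a::euclidean_space \<Rightarrow> ennreal"
  assumes [measurable]: "f \<in> borel_measurable borel"
  shows "(\<integral>\<^sup>+x. f (c - x) \<partial>lborel) = (\<integral>\<^sup>+x. f x \<partial>lborel)"
proof -
  have "(\<integral>\<^sup>+x. f x \<partial>lborel) = (\<integral>\<^sup>+x. f x \<partial>density (distr lborel borel (\<lambda>x. c + (-1) *\<^sub>R x)) (\<lambda>_. ennreal (\<bar>-1\<bar>^DIM('a))))"
    by (subst lborel_affine[of "-1" c]) auto
  also have "\<dots> = (\<integral>\<^sup>+x. f (c - x) \<partial>lborel)"
    by (simp add: nn_integral_density nn_integral_distr)
  finally show ?thesis by simp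
qed

lemma nn_integral_lborel_scaleR:
  fixes f :: "'a::euclidean_space \<Rightarrow> ennreal"
  assumes [measurable]: "f \<in> borel_measurable borel" and "c > 0"
  shows "ennreal (c ^ DIM('a)) * (\<integral>\<^sup>+x. f (c *\<^sub>R x) \<partial>lborel) = (\<integral>\<^sup>+x. f x \<partial>lborel)"
proof -
  have "(\<integral>\<^sup>+x. f x \<partial>lborel) = (\<integral>\<^sup>+x. f x \<partial>density (distr lborel borel (\<lambda>x. 0 + c *\<^sub>R x)) (\<lambda>_. \<bar>c\<bar>^DIM('a)))"
    using \<open>c > 0\<close> by (subst lborel_affine[of c 0]) auto
  also have "\<dots> = ennreal (c ^ DIM('a)) * (\<integral>\<^sup>+x. f (c *\<^sub>R x) \<partial>lborel)"
    using \<open>c > 0\<close> by (simp add: nn_integral_density nn_integral_distr nn_integral_cmult)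
  finally show ?thesis by simp
qed

text \<open>Uniqueness of Haar measure in one double integral: both orders of integration of
  \<open>1\<^sub>A(U x) 1\<^sub>E(U x + y)\<close>, with \<open>E\<close> the unit ball, which \<open>U\<close> preserves.\<close>

lemma lborel_distr_isometry:
  fixes U :: "'a::euclidean_space \<Rightarrow> 'a"
  assumes U: "linear U" and nU: "\<And>x. norm (U x) = norm x"
  shows "distr lborel borel U = lborel"
proof (rule measure_eqI)
  have mU[measurable]: "U \<in> borel_measurable borel"
    using U linear_continuous_on linear_conv_bounded_linear borel_measurable_continuous_onI by blast
  fix A assume "A \<in> sets (distr lborel borel U)"
  then have A[measurable]: "A \<in> sets borel" by simp
  define E :: "'a set" where "E = \<B>"
  have E[measurable]: "E \<in> sets borel" by (simp add: E_def)
  have inj: "inj U"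
    by (metis U linear_injective_0 nU norm_eq_zero)
  then have surj: "surj U" by (simp add: U linear_injective_imp_surjective)
  let ?e = "emeasure lborel E"
  have "(\<integral>\<^sup>+y. (\<integral>\<^sup>+x. indicator A (U x) * indicator E (U x + y) \<partial>lborel) \<partial>lborel)
      = (\<integral>\<^sup>+x. (\<integral>\<^sup>+y. indicator A (U x) * indicator E (U x + y) \<partial>lborel) \<partial>lborel)"
    by (rule lborel_pair.Fubini') measurable
  also have "\<dots> = (\<integral>\<^sup>+x. indicator A (U x) * ?e \<partial>lborel)"
  proof (rule nn_integral_cong)
    fix x
    have "(\<integral>\<^sup>+y. indicator E (y + U x) \<partial>lborel) = ?e"
      by (subst nn_integral_lborel_translate) auto
    then show "(\<integral>\<^sup>+y. indicator A (U x) * indicator E (U x + y) \<partial>lborel) = indicator A (U x) * ?e"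
      by (subst nn_integral_cmult) (auto simp: add.commute)
  qed
  also have "\<dots> = emeasure (distr lborel borel U) A * ?e"
    by (simp add: nn_integral_multc emeasure_distr nn_integral_distr[symmetric, of U lborel borel])
  finally have 1: "(\<integral>\<^sup>+y. (\<integral>\<^sup>+x. indicator A (U x) * indicator E (U x + y) \<partial>lborel) \<partial>lborel)
      = emeasure (distr lborel borel U) A * ?e" .
  have "(\<integral>\<^sup>+y. (\<integral>\<^sup>+x. indicator A (U x) * indicator E (U x + y) \<partial>lborel) \<partial>lborel)
     = (\<integral>\<^sup>+y. (\<integral>\<^sup>+x. indicator A (U x - y) * indicator E x \<partial>lborel) \<partial>lborel)"
  proof (rule nn_integral_cong)
    fix y
    \<comment> \<open>Translating \<open>x\<close> by a preimage of \<open>y\<close> moves the shift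
      from the argument of \<open>E\<close> to that of \<open>A\<close>; afterwards \<open>U\<close>
      drops out of \<open>E\<close> because it preserves norms.\<close>
    obtain y0 where y0: "y = U y0" using surj by (metis surjE)
    have "(\<integral>\<^sup>+x. indicator A (U x - y) * indicator E (U x) \<partial>lborel)
       = (\<integral>\<^sup>+x. indicator A (U (x + y0) - y) * indicator E (U (x + y0)) \<partial>lborel)"
      by (rule nn_integral_lborel_translate[symmetric]) measurable
    also have "\<dots> = (\<integral>\<^sup>+x. indicator A (U x) * indicator E (U x + y) \<partial>lborel)"
      by (simp add: linear_add[OF U] y0)
    finally show "(\<integral>\<^sup>+x. indicator A (U x) * indicator E (U x + y) \<partial>lborel)
        = (\<integral>\<^sup>+x. indicator A (U x - y) * indicator E x \<partial>lborel)"
      by (simp add: E_def indicator_def nU)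
  qed
  also have "\<dots> = (\<integral>\<^sup>+x. (\<integral>\<^sup>+y. indicator A (U x - y) * indicator E x \<partial>lborel) \<partial>lborel)"
    by (rule lborel_pair.Fubini') measurable
  also have "\<dots> = (\<integral>\<^sup>+x. emeasure lborel A * indicator E x \<partial>lborel)"
  proof (rule nn_integral_cong)
    fix x
    have "(\<integral>\<^sup>+y. indicator A (U x - y) \<partial>lborel) = emeasure lborel A"
      by (subst nn_integral_lborel_reflect) auto
    then show "(\<integral>\<^sup>+y. indicator A (U x - y) * indicator E x \<partial>lborel) = emeasure lborel A * indicator E x"
      by (subst nn_integral_multc) auto
  qed
  also have "\<dots> = emeasure lborel A * ?e"
    by (simp add: nn_integral_cmult)
  finally have 2: "emeasure (distr lborel borel U) A * ?e = emeasure lborel A * ?e"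
    using 1 by simp
  have "?e \<noteq> 0" "?e \<noteq> \<infinity>"
    using emeasure_lborel_ball_finite[of 0 1] content_ball_pos[of 1 "0::'a"]
    unfolding E_def by (auto simp: measure_def)
  then show "emeasure (distr lborel borel U) A = emeasure lborel A"
    using 2 by (metis (no_types, lifting) ennreal_mult_cancel_left infinity_ennreal_def mult.commute)
qed simp

section \<open>The Hermitian inner product and linear maps adapted to a complex line\<close>

lemma hinner_add_left: "hinner (x + y) w = hinner x w + hinner y w"
  and hinner_add_right: "hinner w (x + y) = hinner w x + hinner w y"
  and hinner_diff_left: "hinner (x - y) w = hinner x w - hinner y w"
  and hinner_diff_right: "hinner w (x - y) = hinner w x - hinner w y"
  by (simp_all add: hinner_def algebra_simps sum.distrib sum_subtractf sum_negf)

lemma hinner_smult_left: "hinner (c *s x) w = c * hinner x w"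
  and hinner_smult_right: "hinner w (c *s x) = cnj c * hinner w x"
  by (simp_all add: hinner_def sum_distrib_left algebra_simps)

lemma scaleR_eq_smult: "r *\<^sub>R x = complex_of_real r *s (x :: complex ^ 'n)"
  by (auto simp: vec_eq_iff complex_eq_iff)

lemma hinner_scaleR_left: "hinner (r *\<^sub>R x) w = of_real r * hinner x w"
  and hinner_scaleR_right: "hinner w (r *\<^sub>R x) = of_real r * hinner w x"
  by (simp_all add: scaleR_eq_smult hinner_smult_left hinner_smult_right)

lemma hinner_zero_left [simp]: "hinner 0 w = 0"
  and hinner_zero_right [simp]: "hinner w 0 = 0"
  by (simp_all add: hinner_def)

lemma hinner_commute: "hinner w z = cnj (hinner z w)"
  by (simp add: hinner_def mult.commute)

lemma Re_hinner: "Re (hinner z w) = inner z w"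
  by (simp add: hinner_def inner_vec_def inner_complex_def)

lemma hinner_self: "hinner z z = of_real ((norm z)\<^sup>2)"
proof -
  have "Im (hinner z z) = 0"
    by (simp add: hinner_def)
  then show ?thesis
    by (simp add: complex_eq_iff Re_hinner power2_norm_eq_inner)
qed

lemma norm_smult [simp]: "norm (c *s z) = cmod c * norm (z :: complex ^ 'n)"
proof -
  have "hinner (c *s z) (c *s z) = of_real ((cmod c * norm z)\<^sup>2)"
    unfolding hinner_smult_left hinner_smult_right
    by (simp only: hinner_self power_mult_distrib of_real_mult complex_norm_square mult_ac)
  then have "(norm (c *s z))\<^sup>2 = (cmod c * norm z)\<^sup>2"
    using hinner_self[of "c *s z"] of_real_eq_iff by metis
  then show ?thesis
    by (simp add: power2_eq_iff_nonneg)
qed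

text \<open>A unimodular factor turns \<open>hinner z w\<close> into its modulus, and the real part
  of \<open>hinner\<close> is the real inner product, so the real Cauchy-Schwarz inequality
  suffices.\<close>

lemma norm_hinner_le: "cmod (hinner z w) \<le> norm z * norm w"
proof -
  obtain \<theta> where \<theta>: "cmod \<theta> = 1" "\<theta> * hinner z w = of_real (cmod (hinner z w))"
  proof (cases "hinner z w = 0")
    case True then show ?thesis using that[of 1] by simp
  next
    case False then show ?thesis using that[of "cnj (hinner z w) / cmod (hinner z w)"]
      by (simp add: norm_divide complex_norm_square[symmetric] power2_eq_square mult.commute)
  qed
  have "cmod (hinner z w) = inner (\<theta> *s z) w"
    by (metis Re_complex_of_real Re_hinner \<theta>(2) hinner_smult_left)
  also have "\<dots> \<le> norm (\<theta> *s z) * norm w" by (rule norm_cauchy_schwarz)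
  finally show ?thesis using \<theta> by simp
qed

lemma continuous_on_hinner [continuous_intros]:
  "continuous_on A f \<Longrightarrow> continuous_on A g \<Longrightarrow> continuous_on A (\<lambda>x. hinner (f x) (g x))"
  unfolding hinner_def by (intro continuous_intros)

lemma hinner_measurable [measurable (raw)]:
  fixes f g :: "'a \<Rightarrow> complex ^ 'n"
  assumes [measurable]: "f \<in> borel_measurable M" "g \<in> borel_measurable M"
  shows "(\<lambda>x. hinner (f x) (g x)) \<in> borel_measurable M"
proof -
  have "(\<lambda>x. f x $ k) \<in> borel_measurable M" "(\<lambda>x. cnj (g x $ k)) \<in> borel_measurable M" for k
    using measurable_compose[OF assms(1) borel_measurable_continuous_onI[of "\<lambda>v. v $ k"]]
      measurable_compose[OF assms(2) borel_measurable_continuous_onI[of "\<lambda>v. cnj (v $ k)"]]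
    by (simp_all add: continuous_intros)
  then show ?thesis unfolding hinner_def by simp
qed

text \<open>For a unit vector \<open>u\<close> the component along \<open>u\<close> is multiplied by
  \<open>c\<close>, the orthogonal complement by \<open>d\<close>. Real factors give anisotropic
  dilations and ellipsoids, unimodular factors give the rotations over which functions are
  averaged.\<close>

definition two_scale :: "complex ^ 'n \<Rightarrow> complex \<Rightarrow> complex \<Rightarrow> complex ^ 'n \<Rightarrow> complex ^ 'n" where
  "two_scale u c d w = d *s w + ((c - d) * hinner w u) *s u"

lemma linear_two_scale: "linear (two_scale u c d)"
  by (rule linearI)
     (simp_all add: two_scale_def scaleR_eq_smult hinner_add_left hinner_smult_left vec_eq_iff algebra_simps)

lemma two_scale_measurable [measurable]: "two_scale u c d \<in> borel_measurable borel"
  using linear_two_scale linear_continuous_on linear_conv_bounded_linear borel_measurable_continuous_onI by blast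

lemma hinner_two_scale: "norm u = 1 \<Longrightarrow> hinner (two_scale u c d w) u = c * hinner w u"
  unfolding two_scale_def hinner_add_left hinner_smult_left hinner_self by (simp add: algebra_simps)

lemma norm_two_scale:
  assumes u: "norm u = 1"
  shows "(norm (two_scale u c d w))\<^sup>2
     = (cmod d)\<^sup>2 * ((norm w)\<^sup>2 - (cmod (hinner w u))\<^sup>2) + (cmod c)\<^sup>2 * (cmod (hinner w u))\<^sup>2"
proof -
  have "hinner (two_scale u c d w) (two_scale u c d w)
     = of_real ((cmod d)\<^sup>2 * ((norm w)\<^sup>2 - (cmod (hinner w u))\<^sup>2) + (cmod c)\<^sup>2 * (cmod (hinner w u))\<^sup>2)"
    unfolding two_scale_def hinner_add_left hinner_add_right hinner_smult_left hinner_smult_right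
    unfolding hinner_self u hinner_commute[of u w]
    unfolding of_real_add of_real_mult of_real_diff complex_norm_square
    by (simp add: algebra_simps)
  then show ?thesis by (metis hinner_self of_real_eq_iff)
qed

lemma norm_two_scale_isometry:
  "norm u = 1 \<Longrightarrow> cmod c = 1 \<Longrightarrow> cmod d = 1 \<Longrightarrow> norm (two_scale u c d w) = norm w"
  using norm_two_scale[of u c d w] by (simp add: power2_eq_iff_nonneg)

text \<open>In the real basis, \<open>axis k 1\<close> and \<open>axis k \<i>\<close> are scaled by
  \<open>a\<close> and the remaining 2n-2 vectors by \<open>b\<close>; this is the origin of the two
  exponents of the Jacobian.\<close>

lemma nn_integral_two_scale_axis:
  fixes F :: "complex ^ 'n \<Rightarrow> ennreal"
  assumes [measurable]: "F \<in> borel_measurable borel" and "a > 0" "b > 0"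
  shows "ennreal (a\<^sup>2 * b ^ (2 * CARD('n) - 2)) *
     (\<integral>\<^sup>+w. F (two_scale (axis k 1) (of_real a) (of_real b) w) \<partial>lborel) = (\<integral>\<^sup>+w. F w \<partial>lborel)"
proof -
  define E :: "(complex ^ 'n) set" where "E = {axis k 1, axis k \<i>}"
  define c where "c j = (if j \<in> E then a else b)" for j :: "complex ^ 'n"
  have E: "E \<subseteq> Basis" by (auto simp: E_def Basis_vec_def Basis_complex_def)
  have cE: "card E = 2" by (simp add: E_def axis_eq_axis)
  have T: "0 + (\<Sum>j\<in>Basis. (c j * (w \<bullet> j)) *\<^sub>R j) = two_scale (axis k 1) (of_real a) (of_real b) w" for w
  proof (rule euclidean_eqI)
    fix j :: "complex ^ 'n" assume j: "j \<in> Basis"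
    then obtain i v where iv: "j = axis i v" "v \<in> Basis" by (auto simp: Basis_vec_def)
    have wj: "w \<bullet> j = w $ i \<bullet> v" by (simp add: iv inner_axis)
    have jE: "j \<in> E \<longleftrightarrow> i = k" using iv
      by (auto simp: E_def axis_eq_axis Basis_complex_def)
    have hw: "hinner w (axis k 1) = w $ k"
      by (simp add: hinner_def axis_def if_distrib cong: if_cong)
    have "two_scale (axis k 1) (of_real a) (of_real b) w \<bullet> j = (two_scale (axis k 1) (of_real a) (of_real b) w $ i) \<bullet> v"
      by (simp add: iv inner_axis)
    also have "\<dots> = c j * (w $ i \<bullet> v)"
      unfolding two_scale_def hw by (auto simp: c_def jE axis_def inner_complex_def algebra_simps)
    finally show "(0 + (\<Sum>j\<in>Basis. (c j * (w \<bullet> j)) *\<^sub>R j)) \<bullet> j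
        = two_scale (axis k 1) (of_real a) (of_real b) w \<bullet> j"
      using j by (simp add: wj)
  qed
  have prod: "(\<Prod>j\<in>Basis. \<bar>c j\<bar>) = a\<^sup>2 * b ^ (2 * CARD('n) - 2)"
  proof -
    have "(\<Prod>j\<in>Basis. \<bar>c j\<bar>) = (\<Prod>j\<in>E. \<bar>c j\<bar>) * (\<Prod>j\<in>Basis - E. \<bar>c j\<bar>)"
      using E by (metis (no_types, lifting) finite_Basis mult.commute prod.subset_diff)
    also have "(\<Prod>j\<in>E. \<bar>c j\<bar>) = a\<^sup>2" using \<open>a > 0\<close> cE by (simp add: c_def)
    also have "(\<Prod>j\<in>Basis - E. \<bar>c j\<bar>) = (\<Prod>j\<in>Basis - E. b)"
      using \<open>b > 0\<close> by (intro prod.cong) (auto simp: c_def)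
    also have "\<dots> = b ^ (2 * CARD('n) - 2)"
      using E cE by (simp add: card_Diff_subset finite_subset[OF E] mult.commute)
    finally show ?thesis .
  qed
  have cnz: "c j \<noteq> 0" for j using assms by (simp add: c_def)
  have "(\<integral>\<^sup>+w. F w \<partial>lborel) = (\<integral>\<^sup>+w. F w \<partial>density (distr lborel borel
       (two_scale (axis k 1) (of_real a) (of_real b))) (\<lambda>_. ennreal (\<Prod>j\<in>Basis. \<bar>c j\<bar>)))"
    using lborel_affine_euclidean[of c 0] cnz unfolding T by simp
  also have "\<dots> = ennreal (a\<^sup>2 * b ^ (2 * CARD('n) - 2)) *
     (\<integral>\<^sup>+w. F (two_scale (axis k 1) (of_real a) (of_real b) w) \<partial>lborel)"
    unfolding prod by (simp add: nn_integral_density nn_integral_distr nn_integral_cmult)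
  finally show ?thesis by simp
qed

text \<open>A Householder reflection carries a unimodular multiple of a coordinate vector to \<open>u\<close>.\<close>

lemma nn_integral_two_scale:
  fixes F :: "complex ^ 'n \<Rightarrow> ennreal" and u :: "complex ^ 'n"
  assumes F[measurable]: "F \<in> borel_measurable borel" and ab: "a > 0" "b > 0" and u: "norm u = 1"
  shows "ennreal (a\<^sup>2 * b ^ (2 * CARD('n) - 2)) *
     (\<integral>\<^sup>+w. F (two_scale u (of_real a) (of_real b) w) \<partial>lborel) = (\<integral>\<^sup>+w. F w \<partial>lborel)"
proof -
  fix k :: 'n
  \<comment> \<open>The phase makes \<open>hinner e u\<close> real. Only then is |e-u|^2 = 2 <e,
    e-u>, which is the condition for the reflection along \<open>e - u\<close> to send
    \<open>e\<close> to \<open>u\<close>.\<close>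
  define \<theta> where "\<theta> = (if u $ k = 0 then 1 else u $ k / cmod (u $ k))"
  have \<theta>: "cmod \<theta> = 1" by (simp add: \<theta>_def norm_divide)
  define e where "e = \<theta> *s axis k (1::complex)"
  have ne: "norm e = 1" by (simp add: e_def \<theta>)
  have heu: "hinner e u = of_real (cmod (u $ k))"
    by (auto simp: e_def \<theta>_def hinner_def axis_def if_distrib if_distribR complex_norm_square[symmetric]
        power2_eq_square cong: if_cong)
  define v where "v = e - u"
  define U where "U w = w - (2 * hinner w v / of_real ((norm v)\<^sup>2)) *s v" for w
  have linU: "linear U"
    by (rule linearI)
       (simp_all add: U_def scaleR_eq_smult hinner_add_left hinner_smult_left vec_eq_iff algebra_simps add_divide_distrib)
  have hU: "hinner (U w) (U w') = hinner w w'" for w w'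
  proof (cases "v = 0")
    case True then show ?thesis by (simp add: U_def)
  next
    case False
    then have nz: "of_real ((norm v)\<^sup>2) \<noteq> (0::complex)" by simp
    show ?thesis
      using nz unfolding U_def hinner_diff_left hinner_diff_right hinner_smult_left hinner_smult_right hinner_self
        hinner_commute[of v w']
      by (simp add: field_simps)
  qed
  have nU: "norm (U w) = norm w" for w
    using hU[of w w] unfolding hinner_self of_real_eq_iff by (simp add: power2_eq_iff_nonneg)
  have Ue: "U e = u"
  proof (cases "v = 0")
    case True then show ?thesis by (simp add: U_def v_def)
  next
    case False
    have "of_real ((norm v)\<^sup>2) = 2 * hinner e v"
      unfolding hinner_self[symmetric] unfolding v_def hinner_diff_left hinner_diff_right
      unfolding hinner_self ne u hinner_commute[of u e] heu by simp
    moreover have "of_real ((norm v)\<^sup>2) \<noteq> (0::complex)" using False by simp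
    ultimately have "2 * hinner e v / of_real ((norm v)\<^sup>2) = 1" by simp
    then show ?thesis unfolding U_def by (simp add: v_def)
  qed
  have conj: "two_scale u c d (U w) = U (two_scale (axis k 1) c d w)" for c d w
  proof -
    have 1: "hinner (U w) u = hinner w e" using hU[of w e] Ue by simp
    have th: "cnj \<theta> * \<theta> = 1" using complex_norm_square[of \<theta>] \<theta> by (simp add: mult.commute)
    \<comment> \<open>\<open>two_scale\<close> depends only on the complex line spanned by its unit
      vector, so the phase of \<open>e\<close> cancels.\<close>
    have 2: "two_scale (axis k 1) c d w = two_scale e c d w"
      using th unfolding two_scale_def e_def hinner_smult_right
      by (simp add: vec_eq_iff axis_def)
    have "U (two_scale e c d w) = d *s U w + ((c - d) * hinner w e) *s U e"
      unfolding two_scale_def U_def hinner_add_left hinner_smult_left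
      by (simp add: vec_eq_iff algebra_simps add_divide_distrib diff_divide_distrib)
    then show ?thesis unfolding 2 Ue two_scale_def[of u] 1 by simp
  qed
  have mU[measurable]: "U \<in> borel_measurable borel"
    using linU linear_continuous_on linear_conv_bounded_linear borel_measurable_continuous_onI by blast
  have isoU: "(\<integral>\<^sup>+w. G (U w) \<partial>lborel) = (\<integral>\<^sup>+w. G w \<partial>lborel)"
    if [measurable]: "G \<in> borel_measurable borel" for G :: "complex ^ 'n \<Rightarrow> ennreal"
    using nn_integral_distr[of U lborel borel G] lborel_distr_isometry[OF linU nU] by simp
  have "(\<integral>\<^sup>+w. F (two_scale u (of_real a) (of_real b) w) \<partial>lborel)
      = (\<integral>\<^sup>+w. F (U (two_scale (axis k 1) (of_real a) (of_real b) w)) \<partial>lborel)"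
    by (subst isoU[symmetric]) (simp_all add: conj)
  then show ?thesis
    using nn_integral_two_scale_axis[of "\<lambda>w. F (U w)" a b k] ab isoU[of F] by simp
qed

section \<open>Gaussian moments in one complex direction and their transfer to the ball\<close>

lemma gauss_moment_scaled:
  fixes u :: "complex ^ 'n"
  assumes u: "norm u = 1" and a: "a > 0"
  shows "(\<integral>\<^sup>+v. ennreal (cmod (hinner v u) ^ (2 * k) * exp (- ((norm v)\<^sup>2 - (cmod (hinner v u))\<^sup>2) - a * (cmod (hinner v u))\<^sup>2)) \<partial>lborel)
    = ennreal (1 / a ^ Suc k) * (\<integral>\<^sup>+v. ennreal (cmod (hinner v u) ^ (2 * k) * exp (- (norm v)\<^sup>2)) \<partial>lborel)"
    (is "?L = _ * ?R")
proof -
  define F where "F v = ennreal (cmod (hinner v u) ^ (2 * k) *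
     exp (- ((norm v)\<^sup>2 - (cmod (hinner v u))\<^sup>2) - a * (cmod (hinner v u))\<^sup>2))" for v :: "complex ^ 'n"
  have mF: "F \<in> borel_measurable borel" unfolding F_def by measurable
  \<comment> \<open>Contracting the complex line of \<open>u\<close> by this factor has Jacobian
    1/a; the moment itself contributes the other \<open>k\<close> factors.\<close>
  let ?c = "1 / sqrt a"
  have "F (two_scale u (of_real ?c) (of_real 1) w) = ennreal (1 / a ^ k) * ennreal (cmod (hinner w u) ^ (2 * k) * exp (- (norm w)\<^sup>2))" for w
  proof -
    have h: "cmod (hinner (two_scale u (of_real ?c) (of_real 1) w) u) = ?c * cmod (hinner w u)"
      using a by (simp add: hinner_two_scale[OF u] norm_divide)
    have h2: "(?c * cmod (hinner w u))\<^sup>2 = (cmod (hinner w u))\<^sup>2 / a"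
      using a by (simp add: power_mult_distrib power_divide)
    have h3: "(?c * cmod (hinner w u)) ^ (2 * k) = cmod (hinner w u) ^ (2 * k) / a ^ k"
      unfolding power_mult h2 by (simp add: power_divide)
    have nn: "(norm (two_scale u (of_real ?c) (of_real 1) w))\<^sup>2 = ((norm w)\<^sup>2 - (cmod (hinner w u))\<^sup>2) + (cmod (hinner w u))\<^sup>2 / a"
      unfolding norm_two_scale[OF u] using a by (simp add: norm_divide power_divide)
    show ?thesis unfolding F_def h h2 h3 nn using a
      by (simp add: ennreal_mult'[symmetric])
  qed
  then have "ennreal (1 / a) * (ennreal (1 / a ^ k) * ?R) = ?L"
    using nn_integral_two_scale[OF mF, of ?c 1 u] a u
    by (simp add: F_def nn_integral_cmult power_divide)
  then show ?thesis using a by (simp add: mult.assoc[symmetric] ennreal_mult'[symmetric])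
qed

text \<open>The zero set lies in the real hyperplane orthogonal to \<open>u\<close>. It has to be
  excluded because the integral representation of exp(-t) behind the moment recursion fails at t =
  0.\<close>

lemma AE_hinner_nonzero:
  fixes u :: "complex ^ 'n"
  assumes "u \<noteq> 0"
  shows "AE v in lborel. hinner v u \<noteq> 0"
proof -
  have "AE v in lebesgue. v \<notin> {v. u \<bullet> v = 0}"
    using negligible_hyperplane[of u 0] assms
    by (intro AE_not_in) (simp add: negligible_iff_null_sets)
  then have "AE v in lborel. v \<notin> {v. u \<bullet> v = 0}"
    by (simp only: AE_completion_iff)
  then show ?thesis
    by eventually_elim (metis (mono_tags, lifting) Re_hinner inner_commute mem_Collect_eq zero_complex.simps(1))
qed

text \<open>The recursion comes from \<open>exp (-t) = \<integral>\<^sub>1\<^sup>\<infinity> t exp (-a t) da\<close> with \<open>t = |\<langle>v,u\<rangle>|\<^sup>2\<close>.\<close>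

lemma gauss_moment_Suc:
  fixes u :: "complex ^ 'n"
  assumes u: "norm u = 1"
  shows "ennreal (real (Suc k)) * (\<integral>\<^sup>+v. ennreal (cmod (hinner v u) ^ (2 * k) * exp (- (norm v)\<^sup>2)) \<partial>lborel)
     = (\<integral>\<^sup>+v. ennreal (cmod (hinner v u) ^ (2 * Suc k) * exp (- (norm v)\<^sup>2)) \<partial>lborel)"
    (is "_ * ?mk = ?mS")
proof -
  define t where "t v = (cmod (hinner v u))\<^sup>2" for v :: "complex ^ 'n"
  have une: "u \<noteq> 0" using u by auto
  have t0: "t v \<ge> 0" for v by (simp add: t_def)
  have [measurable]: "t \<in> borel_measurable borel" unfolding t_def by measurable
  have pw: "cmod (hinner v u) ^ (2 * k) = t v ^ k" for v k by (simp add: t_def power_mult)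
  have E: "(\<integral>\<^sup>+a. ennreal (t v * exp (- a * t v)) * indicator {1..} a \<partial>lborel) = ennreal (exp (- t v))" if "t v \<noteq> 0" for v
  proof -
    have "(\<integral>\<^sup>+a. ennreal (t v * exp (- a * t v)) * indicator {1..} a \<partial>lborel) = ennreal (0 - (- exp (- 1 * t v)))"
    proof (rule nn_integral_FTC_atLeast)
      show "((\<lambda>a. - exp (- a * t v)) has_real_derivative t v * exp (- a * t v)) (at a)" for a
        by (auto intro!: derivative_eq_intros)
      have "t v > 0" using that t0[of v] by simp
      then show "((\<lambda>a. - exp (- a * t v)) \<longlongrightarrow> 0) at_top" by real_asymp
    qed (use t0 in auto)
    then show ?thesis by simp
  qed
  have "?mk = (\<integral>\<^sup>+v. (\<integral>\<^sup>+a. ennreal (t v ^ k * exp (- ((norm v)\<^sup>2 - t v))) * (ennreal (t v * exp (- a * t v)) * indicator {1..} a) \<partial>lborel) \<partial>lborel)"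
  proof (rule nn_integral_cong_AE)
    show "AE v in lborel. ennreal (cmod (hinner v u) ^ (2 * k) * exp (- (norm v)\<^sup>2))
       = (\<integral>\<^sup>+a. ennreal (t v ^ k * exp (- ((norm v)\<^sup>2 - t v))) * (ennreal (t v * exp (- a * t v)) * indicator {1..} a) \<partial>lborel)"
      using AE_hinner_nonzero[OF une]
    proof eventually_elim
      case (elim v)
      then have "t v \<noteq> 0" by (simp add: t_def)
      have "(\<integral>\<^sup>+a. ennreal (t v ^ k * exp (- ((norm v)\<^sup>2 - t v))) * (ennreal (t v * exp (- a * t v)) * indicator {1..} a) \<partial>lborel)
        = ennreal (t v ^ k * exp (- ((norm v)\<^sup>2 - t v))) * ennreal (exp (- t v))"
        by (subst nn_integral_cmult) (use E[OF \<open>t v \<noteq> 0\<close>] in auto)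
      also have "\<dots> = ennreal (t v ^ k * exp (- (norm v)\<^sup>2))"
        using t0[of v] by (simp add: ennreal_mult'[symmetric] exp_add[symmetric] mult.assoc)
      finally show ?case by (simp add: pw)
    qed
  qed
  also have "\<dots> = (\<integral>\<^sup>+a. (\<integral>\<^sup>+v. ennreal (t v ^ k * exp (- ((norm v)\<^sup>2 - t v))) * (ennreal (t v * exp (- a * t v)) * indicator {1..} a) \<partial>lborel) \<partial>lborel)"
    by (rule lborel_pair.Fubini') measurable
  \<comment> \<open>For fixed \<open>a\<close> the inner integral is a rescaled moment of order k+1.
    Integrating 1/a^(k+2) over a \<ge> 1 then produces the factor 1/(k+1) of the recursion.\<close>
  also have "\<dots> = (\<integral>\<^sup>+a. ?mS * (ennreal (1 / a ^ Suc (Suc k)) * indicator {1..} a) \<partial>lborel)"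
  proof (rule nn_integral_cong)
    fix a :: real
    show "(\<integral>\<^sup>+v. ennreal (t v ^ k * exp (- ((norm v)\<^sup>2 - t v))) * (ennreal (t v * exp (- a * t v)) * indicator {1..} a) \<partial>lborel)
       = ?mS * (ennreal (1 / a ^ Suc (Suc k)) * indicator {1..} a)"
    proof (cases "a \<ge> 1")
      case True
      have "(\<integral>\<^sup>+v. ennreal (t v ^ k * exp (- ((norm v)\<^sup>2 - t v))) * (ennreal (t v * exp (- a * t v)) * indicator {1..} a) \<partial>lborel)
        = (\<integral>\<^sup>+v. ennreal (cmod (hinner v u) ^ (2 * Suc k) * exp (- ((norm v)\<^sup>2 - (cmod (hinner v u))\<^sup>2) - a * (cmod (hinner v u))\<^sup>2)) \<partial>lborel)"
        using True t0 unfolding pw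
        by (intro nn_integral_cong)
           (simp add: ennreal_mult'[symmetric] exp_add[symmetric] exp_diff exp_minus t_def[symmetric] field_simps)
      also have "\<dots> = ennreal (1 / a ^ Suc (Suc k)) * ?mS"
        by (rule gauss_moment_scaled[OF u]) (use True in auto)
      finally show ?thesis using True by (simp add: mult.commute)
    qed auto
  qed
  also have "\<dots> = ?mS * (\<integral>\<^sup>+a. ennreal (1 / a ^ Suc (Suc k)) * indicator {1..} a \<partial>lborel)"
    by (rule nn_integral_cmult) measurable
  also have "(\<integral>\<^sup>+a. ennreal (1 / a ^ Suc (Suc k)) * indicator {1..} a \<partial>lborel) = ennreal (0 - (- (inverse 1 ^ Suc k / real (Suc k))))"
  proof (rule nn_integral_FTC_atLeast)
    show "((\<lambda>a. - (inverse a ^ Suc k / real (Suc k))) has_real_derivative 1 / a ^ Suc (Suc k)) (at a)" if "1 \<le> a" for a :: real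
    proof -
      have "((\<lambda>a. - (inverse a ^ Suc k / real (Suc k))) has_real_derivative
          - (real (Suc k) * (- (inverse a ^ Suc (Suc 0)) * inverse a ^ (Suc k - Suc 0)) / real (Suc k))) (at a)"
        using that by (intro DERIV_minus DERIV_cdivide DERIV_power DERIV_inverse) auto
      also have "- (real (Suc k) * (- (inverse a ^ Suc (Suc 0)) * inverse a ^ (Suc k - Suc 0)) / real (Suc k)) = 1 / a ^ Suc (Suc k)"
        using that by (simp add: field_simps del: of_nat_Suc)
      finally show ?thesis .
    qed
    show "((\<lambda>a. - (inverse a ^ Suc k / real (Suc k))) \<longlongrightarrow> 0) at_top"
      by real_asymp
  qed auto
  finally have "?mk = ?mS * ennreal (1 / real (Suc k))" by simp
  then have "ennreal (real (Suc k)) * ?mk = ?mS * (ennreal (real (Suc k)) * ennreal (1 / real (Suc k)))"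
    by (simp add: mult_ac)
  also have "ennreal (real (Suc k)) * ennreal (1 / real (Suc k)) = 1"
    by (subst ennreal_mult'[symmetric]) auto
  finally show ?thesis by simp
qed

lemma gauss_moment:
  fixes u :: "complex ^ 'n"
  assumes u: "norm u = 1"
  shows "(\<integral>\<^sup>+v. ennreal (cmod (hinner v u) ^ (2 * k) * exp (- (norm v)\<^sup>2)) \<partial>lborel)
     = ennreal (fact k) * (\<integral>\<^sup>+v. ennreal (exp (- (norm v)\<^sup>2)) \<partial>(lborel :: (complex ^ 'n) measure))"
proof (induction k)
  case (Suc k)
  show ?case
    unfolding gauss_moment_Suc[OF u, symmetric] Suc.IH mult.assoc[symmetric]
    by (subst ennreal_mult'[symmetric]) (auto simp: mult.commute)
qed simp

definition defect :: "complex ^ 'n \<Rightarrow> real" where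
  "defect z = 1 - (norm z)\<^sup>2"

lemma defect_pos: "z \<in> \<B> \<Longrightarrow> defect z > 0"
  and defect_le_1: "defect z \<le> 1"
  by (auto simp: defect_def power_less_one_iff abs_square_less_1)

abbreviation (input) wt :: "real \<Rightarrow> complex ^ 'n \<Rightarrow> real" where
  "wt t z \<equiv> defect z powr t"

lemma defect_measurable [measurable]: "defect \<in> borel_measurable borel"
  unfolding defect_def by measurable

text \<open>Multiplying the integral over the ball by \<open>\<Gamma>(n+k+s+1) = \<integral> \<tau>\<^sup>n\<^sup>+\<^sup>k\<^sup>+\<^sup>s exp (-\<tau>) d\<tau>\<close>
  and substituting \<open>w = v / sqrt \<tau>\<close> turns it into a Gaussian integral.\<close>

lemma ball_gauss_moment:
  fixes u :: "complex ^ 'n"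
  assumes s: "s > -1"
  shows "ennreal (Gamma (real CARD('n) + real k + s + 1)) *
     (\<integral>\<^sup>+w. ennreal (cmod (hinner w u) ^ (2 * k) * wt s w) * indicator \<B> w \<partial>lborel)
     = ennreal (Gamma (s + 1)) * (\<integral>\<^sup>+v. ennreal (cmod (hinner v u) ^ (2 * k) * exp (- (norm v)\<^sup>2)) \<partial>lborel)"
proof -
  let ?n = "real CARD('n)"
  define I where "I = (\<integral>\<^sup>+w. ennreal (cmod (hinner w u) ^ (2 * k) * wt s w) * indicator \<B> w \<partial>lborel)"
  define J where "J \<tau> v = (if (norm v)\<^sup>2 < \<tau> then ennreal (cmod (hinner v u) ^ (2 * k) * (\<tau> - (norm v)\<^sup>2) powr s * exp (- \<tau>)) else 0)"
    for \<tau> and v :: "complex ^ 'n"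
  have J_meas[measurable]: "(\<lambda>(\<tau>, v). J \<tau> v) \<in> borel_measurable (lborel \<Otimes>\<^sub>M lborel)"
    unfolding J_def by measurable
  have G: "ennreal (Gamma (?n + real k + s + 1)) = (\<integral>\<^sup>+t. ennreal (t powr (?n + real k + s) / exp t) * indicator {0<..} t \<partial>lborel)"
    if "?n + real k + s + 1 > 0" for k
    unfolding Gamma_conv_nn_integral_real[OF that]
    by (intro nn_integral_cong) (auto simp: indicator_def)
  have sc: "ennreal (\<tau> powr (?n + real k + s) / exp \<tau>) * indicator {0<..} \<tau> * I = (\<integral>\<^sup>+v. J \<tau> v \<partial>lborel)" for \<tau> :: real
  proof (cases "\<tau> > 0")
    case True
    define F where "F w = ennreal (cmod (hinner w u) ^ (2 * k) * wt s w) * indicator \<B> w" for w :: "complex ^ 'n"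
    have [measurable]: "ball (0 :: complex ^ 'n) 1 \<in> sets borel" by simp
    have [measurable]: "F \<in> borel_measurable borel" unfolding F_def by measurable
    have "I = ennreal ((1 / sqrt \<tau>) ^ DIM(complex ^ 'n)) * (\<integral>\<^sup>+v. F ((1 / sqrt \<tau>) *\<^sub>R v) \<partial>lborel)"
      unfolding I_def F_def[symmetric] by (rule nn_integral_lborel_scaleR[symmetric]) (use True in auto)
    also have "(1 / sqrt \<tau>) ^ DIM(complex ^ 'n) = \<tau> powr (- ?n)"
    proof -
      have "(1 / sqrt \<tau>) ^ DIM(complex ^ 'n) = ((1 / sqrt \<tau>)\<^sup>2) ^ CARD('n)"
        by (simp add: power_mult[symmetric] mult.commute)
      also have "\<dots> = \<tau> powr (- ?n)" using True by (simp add: power_divide powr_minus powr_realpow power_one_over divide_simps)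
      finally show ?thesis .
    qed
    finally have I: "I = ennreal (\<tau> powr (- ?n)) * (\<integral>\<^sup>+v. F ((1 / sqrt \<tau>) *\<^sub>R v) \<partial>lborel)" .
    have "ennreal (\<tau> powr (?n + real k + s) / exp \<tau>) * indicator {0<..} \<tau> * I
       = (\<integral>\<^sup>+v. ennreal (\<tau> powr (real k + s) / exp \<tau>) * F ((1 / sqrt \<tau>) *\<^sub>R v) \<partial>lborel)"
    proof -
      have "\<tau> powr (?n + real k + s) / exp \<tau> * \<tau> powr (- ?n) = \<tau> powr (real k + s) / exp \<tau>"
        using True by (simp add: powr_add powr_minus field_simps)
      then have "ennreal (\<tau> powr (?n + real k + s) / exp \<tau>) * ennreal (\<tau> powr (- ?n)) = ennreal (\<tau> powr (real k + s) / exp \<tau>)"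
        by (metis ennreal_mult'' powr_ge_zero)
      then show ?thesis using True unfolding I
        by (subst nn_integral_cmult) (auto simp flip: mult.assoc)
    qed
    also have "\<dots> = (\<integral>\<^sup>+v. J \<tau> v \<partial>lborel)"
    proof (rule nn_integral_cong)
      fix v :: "complex ^ 'n"
      have nv: "(norm ((1 / sqrt \<tau>) *\<^sub>R v))\<^sup>2 = (norm v)\<^sup>2 / \<tau>"
        using True by (simp add: power_mult_distrib power_divide)
      have h: "cmod (hinner ((1 / sqrt \<tau>) *\<^sub>R v) u) ^ (2 * k) = cmod (hinner v u) ^ (2 * k) / \<tau> ^ k"
        using True by (simp add: hinner_scaleR_left norm_mult norm_divide power_mult power_mult_distrib power_divide)
      have mem: "(1 / sqrt \<tau>) *\<^sub>R v \<in> \<B> \<longleftrightarrow> (norm v)\<^sup>2 < \<tau>"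
        using True nv by (simp add: divide_less_eq real_less_rsqrt real_sqrt_less_iff[symmetric, of "(norm v)\<^sup>2" \<tau>] del: real_sqrt_less_iff)
      show "ennreal (\<tau> powr (real k + s) / exp \<tau>) * F ((1 / sqrt \<tau>) *\<^sub>R v) = J \<tau> v"
      proof (cases "(norm v)\<^sup>2 < \<tau>")
        case lt: True
        have d: "wt s ((1 / sqrt \<tau>) *\<^sub>R v) = (\<tau> - (norm v)\<^sup>2) powr s / \<tau> powr s"
          unfolding defect_def nv using True lt by (simp add: powr_divide[symmetric] diff_divide_distrib)
        show ?thesis
          unfolding F_def J_def d h using True lt mem
          by (simp add: ennreal_mult'[symmetric] powr_add powr_realpow exp_minus field_simps)
      qed (use mem in \<open>simp add: F_def J_def\<close>)
    qed
    finally show ?thesis .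
  next
    case False
    then have "J \<tau> v = 0" for v
      using order.strict_trans1[OF zero_le_power2[of "norm v"], of \<tau>] by (auto simp: J_def)
    then show ?thesis using False by simp
  qed
  have "ennreal (Gamma (?n + real k + s + 1)) * I = (\<integral>\<^sup>+\<tau>. ennreal (\<tau> powr (?n + real k + s) / exp \<tau>) * indicator {0<..} \<tau> * I \<partial>lborel)"
    using s by (subst G) (auto simp: nn_integral_multc)
  also have "\<dots> = (\<integral>\<^sup>+\<tau>. (\<integral>\<^sup>+v. J \<tau> v \<partial>lborel) \<partial>lborel)"
    unfolding sc ..
  also have "\<dots> = (\<integral>\<^sup>+v. (\<integral>\<^sup>+\<tau>. J \<tau> v \<partial>lborel) \<partial>lborel)"
    by (rule lborel_pair.Fubini'[symmetric]) measurable
  also have "\<dots> = (\<integral>\<^sup>+v. ennreal (Gamma (s + 1)) * ennreal (cmod (hinner v u) ^ (2 * k) * exp (- (norm v)\<^sup>2)) \<partial>lborel)"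
  proof (rule nn_integral_cong)
    fix v :: "complex ^ 'n"
    \<comment> \<open>Shifting \<open>\<tau>\<close> by |v|^2 splits exp(-\<tau>) into the Gaussian
      in \<open>v\<close> and the integrand of Gamma(s+1).\<close>
    have "(\<integral>\<^sup>+\<tau>. J \<tau> v \<partial>lborel) = (\<integral>\<^sup>+\<tau>. J (\<tau> + (norm v)\<^sup>2) v \<partial>lborel)"
      by (rule nn_integral_lborel_translate[symmetric]) (simp add: J_def indicator_def)
    also have "\<dots> = (\<integral>\<^sup>+\<tau>. ennreal (indicator {0..} \<tau> * \<tau> powr (s + 1 - 1) / exp \<tau>) * ennreal (cmod (hinner v u) ^ (2 * k) * exp (- (norm v)\<^sup>2)) \<partial>lborel)"
      by (intro nn_integral_cong)
         (auto simp: J_def indicator_def ennreal_mult'[symmetric] exp_minus exp_add exp_diff field_simps)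
    also have "\<dots> = ennreal (Gamma (s + 1)) * ennreal (cmod (hinner v u) ^ (2 * k) * exp (- (norm v)\<^sup>2))"
      using s by (subst nn_integral_multc) (auto simp: Gamma_conv_nn_integral_real)
    finally show "(\<integral>\<^sup>+\<tau>. J \<tau> v \<partial>lborel) = \<dots>" .
  qed
  also have "\<dots> = ennreal (Gamma (s + 1)) * (\<integral>\<^sup>+v. ennreal (cmod (hinner v u) ^ (2 * k) * exp (- (norm v)\<^sup>2)) \<partial>lborel)"
    by (rule nn_integral_cmult) measurable
  finally show ?thesis unfolding I_def .
qed

section \<open>Weighted integrals over the ball\<close>

definition ball_leb :: "(complex ^ 'n) measure" where
  "ball_leb = lebesgue_on \<B>"

abbreviation (input) measB :: "(complex ^ 'n \<Rightarrow> 'b::topological_space) \<Rightarrow> bool" where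
  "measB f \<equiv> f \<in> borel_measurable ball_leb"

lemma space_ball_leb [simp]: "space ball_leb = \<B>"
  by (simp add: ball_leb_def)

lemma nn_integral_ball_leb:
  "(\<integral>\<^sup>+w. f w \<partial>ball_leb) = (\<integral>\<^sup>+w. f w * indicator \<B> w \<partial>lborel)"
  by (simp add: ball_leb_def nn_integral_restrict_space nn_integral_completion)

abbreviation (input) ball_nn :: "(complex ^ 'n \<Rightarrow> real) \<Rightarrow> ennreal" (binder "\<integral>B" 10) where
  "ball_nn F \<equiv> \<integral>\<^sup>+z. ennreal (F z) \<partial>ball_leb"

text \<open>The mass is taken with respect to Lebesgue measure; the normalizing constants
  \<open>c_const\<close> become quotients of such masses (\<open>v_prob_eq\<close>).\<close>

definition ball_mass :: "'n::finite itself \<Rightarrow> real \<Rightarrow> real" where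
  "ball_mass _ s = enn2real (\<integral>\<^sup>+w. ennreal (wt s w) \<partial>(ball_leb :: (complex ^ 'n) measure))"

text \<open>Read off from \<open>ball_gauss_moment\<close> with k = 0 and s = 0, where the ball
  integral is the volume of the ball, a positive real number.\<close>

lemma gauss_mass:
  obtains G where "G > 0" "(\<integral>\<^sup>+v. ennreal (exp (- (norm v)\<^sup>2)) \<partial>(lborel :: (complex ^ 'n) measure)) = ennreal G"
proof -
  define g where "g = (\<integral>\<^sup>+v. ennreal (exp (- (norm v)\<^sup>2)) \<partial>(lborel :: (complex ^ 'n) measure))"
  let ?u = "axis undefined 1 :: complex ^ 'n"
  let ?B = "\<B> :: (complex ^ 'n) set"
  have "ennreal (Gamma (real CARD('n) + 1)) * (\<integral>\<^sup>+w. ennreal (wt 0 w) * indicator ?B w \<partial>lborel) = g"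
    using ball_gauss_moment[of 0 0 ?u] by (simp add: g_def)
  also have "(\<integral>\<^sup>+w. ennreal (wt 0 w) * indicator ?B w \<partial>lborel) = (\<integral>\<^sup>+w. indicator ?B w \<partial>lborel)"
    by (intro nn_integral_cong) (use defect_pos in \<open>force simp: indicator_def\<close>)
  also have "\<dots> = emeasure lborel ?B" by simp
  finally have g: "ennreal (Gamma (real CARD('n) + 1)) * emeasure lborel ?B = g" .
  have "emeasure lborel ?B \<noteq> \<infinity>" "emeasure lborel ?B \<noteq> 0"
    using emeasure_lborel_ball_finite[of 0 1] content_ball_pos[of 1 "0::complex ^ 'n"]
    by (auto simp: measure_def)
  moreover have "Gamma (real CARD('n) + 1) > 0" by (rule Gamma_real_pos) simp
  ultimately have "g \<noteq> \<infinity>" "g > 0"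
    using g by (auto simp: ennreal_mult_eq_top_iff zero_less_iff_neq_zero ennreal_eq_0_iff simp flip: not_less)
  then have "g = ennreal (enn2real g)" "enn2real g > 0"
    by (auto simp: enn2real_positive_iff less_top)
  then show ?thesis using that unfolding g_def by blast
qed

text \<open>All three facts come from one closed form in Gamma values for unit vectors, in which
  Gamma(N+k)/Gamma(N) is the Pochhammer symbol. Homogeneity in \<open>z\<close> gives the general
  case.\<close>

lemma
  fixes z :: "complex ^ 'n"
  assumes s: "s > -1"
  shows ball_moment: "(\<integral>B w. cmod (hinner w z) ^ (2 * k) * wt s w)
      = ennreal (norm z ^ (2 * k) * fact k / pochhammer (real CARD('n) + 1 + s) k * ball_mass TYPE('n) s)"
    and ball_mass_pos: "ball_mass TYPE('n) s > 0"
    and ball_mass: "(\<integral>\<^sup>+w. ennreal (wt s w) \<partial>(ball_leb :: (complex ^ 'n) measure)) = ennreal (ball_mass TYPE('n) s)"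
proof -
  obtain G where G: "G > 0" "(\<integral>\<^sup>+v. ennreal (exp (- (norm v)\<^sup>2)) \<partial>(lborel :: (complex ^ 'n) measure)) = ennreal G"
    by (rule gauss_mass)
  let ?N = "real CARD('n) + 1 + s"
  have N: "?N > 0" using s by simp
  have Gp: "Gamma (?N + real k) > 0" for k using N by (simp add: Gamma_real_pos)
  have main: "(\<integral>B w. cmod (hinner w u) ^ (2 * k) * wt s w)
      = ennreal (Gamma (s + 1) * fact k * G / Gamma (?N + real k))" if u: "norm u = 1" for u :: "complex ^ 'n" and k
  proof -
    define I where "I = (\<integral>B w. cmod (hinner w u) ^ (2 * k) * wt s w)"
    have "ennreal (Gamma (?N + real k)) * I = ennreal (Gamma (s + 1) * fact k * G)"
      using ball_gauss_moment[OF s, of k u] s G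
      unfolding gauss_moment[OF u] nn_integral_ball_leb[symmetric] I_def
      by (simp add: ennreal_mult'[symmetric] add_ac mult_ac)
    then have "ennreal (1 / Gamma (?N + real k)) * (ennreal (Gamma (?N + real k)) * I)
       = ennreal (1 / Gamma (?N + real k)) * ennreal (Gamma (s + 1) * fact k * G)" by simp
    then show ?thesis
      using Gp[of k] unfolding I_def[symmetric] mult.assoc[symmetric]
      by (simp add: ennreal_mult'[symmetric])
  qed
  let ?u = "axis undefined 1 :: complex ^ 'n"
  have gs: "Gamma (s + 1) > 0" using s by (simp add: Gamma_real_pos)
  have "(\<integral>\<^sup>+w. ennreal (wt s w) \<partial>(ball_leb :: (complex ^ 'n) measure)) = ennreal (Gamma (s + 1) * G / Gamma ?N)"
    using main[of ?u 0] unfolding nn_integral_ball_leb by simp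
  then have m: "ball_mass TYPE('n) s = Gamma (s + 1) * G / Gamma ?N"
    and m': "(\<integral>\<^sup>+w. ennreal (wt s w) \<partial>(ball_leb :: (complex ^ 'n) measure)) = ennreal (ball_mass TYPE('n) s)"
    using gs G Gp[of 0] by (simp_all add: ball_mass_def)
  show "ball_mass TYPE('n) s > 0" using m gs G Gp[of 0] by simp
  show "(\<integral>\<^sup>+w. ennreal (wt s w) \<partial>(ball_leb :: (complex ^ 'n) measure)) = ennreal (ball_mass TYPE('n) s)"
    by (rule m')
  have mk: "Gamma (s + 1) * fact k * G / Gamma (?N + real k) = fact k / pochhammer ?N k * ball_mass TYPE('n) s" for k
  proof -
    have "?N \<notin> \<int>\<^sub>\<le>\<^sub>0" using N by (auto elim!: nonpos_Ints_cases)
    then have "pochhammer ?N k = Gamma (?N + real k) / Gamma ?N" by (rule pochhammer_Gamma)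
    then show ?thesis unfolding m using Gp[of k] Gp[of 0] by (simp add: field_simps)
  qed
  show "(\<integral>B w. cmod (hinner w z) ^ (2 * k) * wt s w)
      = ennreal (norm z ^ (2 * k) * fact k / pochhammer ?N k * ball_mass TYPE('n) s)"
  proof (cases "z = 0")
    case True
    then show ?thesis using m' by (cases k) simp_all
  next
    case False
    define u where "u = (1 / norm z) *\<^sub>R z"
    have u: "norm u = 1" using False by (simp add: u_def)
    have z: "z = norm z *\<^sub>R u" using False by (simp add: u_def)
    have hz: "cmod (hinner w z) ^ (2 * k) * wt s w = norm z ^ (2 * k) * (cmod (hinner w u) ^ (2 * k) * wt s w)" for w
      by (subst z) (simp add: hinner_scaleR_right norm_mult power_mult_distrib)
    have [measurable]: "ball (0 :: complex ^ 'n) 1 \<in> sets borel" by simp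
    have "(\<integral>B w. cmod (hinner w z) ^ (2 * k) * wt s w)
       = ennreal (norm z ^ (2 * k)) * (\<integral>B w. cmod (hinner w u) ^ (2 * k) * wt s w)"
      unfolding nn_integral_ball_leb hz
      by (subst nn_integral_cmult[symmetric], measurable)
         (simp only: ennreal_mult''[OF mult_nonneg_nonneg[OF zero_le_power[OF norm_ge_zero] powr_ge_zero]] mult.assoc)
    also have "\<dots> = ennreal (norm z ^ (2 * k)) * ennreal (fact k / pochhammer ?N k * ball_mass TYPE('n) s)"
      unfolding main[OF u] mk ..
    finally show ?thesis by (simp add: ennreal_mult'[symmetric] mult.assoc)
  qed
qed

section \<open>Averages over rotations and Taylor coefficients\<close>

abbreviation (input) L1w :: "real \<Rightarrow> (complex ^ 'n \<Rightarrow> complex) \<Rightarrow> bool" where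
  "L1w s g \<equiv> integrable ball_leb (\<lambda>w. wt s w *\<^sub>R g w)"

lemma sets_ball_01 [measurable]: "ball (0 :: complex ^ 'n) R \<in> sets borel"
  by simp

text \<open>Cauchy's formula on the unit circle, where the reciprocal of a point is its conjugate.
  The parametrization over [0,1] matches an average over a circle of rotations.\<close>

lemma circle_coefficient:
  assumes h: "u holomorphic_on ball 0 \<rho>" and \<rho>: "\<rho> > 1"
  shows "((\<lambda>t. u (cis (2 * pi * t)) * cnj (cis (2 * pi * t)) ^ k) has_integral (deriv ^^ k) u 0 / fact k) {0..1}"
proof -
  have "((\<lambda>w. u w / (w - 0) ^ Suc k) has_contour_integral (2 * pi * \<i> / fact k) * (deriv ^^ k) u 0) (circlepath 0 1)"
  proof (rule Cauchy_has_contour_integral_higher_derivative_circlepath)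
    have "cball 0 1 \<subseteq> ball (0::complex) \<rho>" using \<rho> by auto
    then show "continuous_on (cball 0 1) u" using h holomorphic_on_imp_continuous_on continuous_on_subset by blast
    show "u holomorphic_on \<B>" by (rule holomorphic_on_subset[OF h]) (use \<rho> in auto)
  qed auto
  then have "((\<lambda>t. u (cis (2 * pi * t)) / cis (2 * pi * t) ^ Suc k * (2 * pi * \<i> * cis (2 * pi * t)))
      has_integral (2 * pi * \<i> / fact k) * (deriv ^^ k) u 0) {0..1}"
    unfolding has_contour_integral_def
  proof (rule has_integral_eq[rotated])
    fix t :: real assume t: "t \<in> {0..1}"
    have "circlepath 0 1 t = cis (2 * pi * t)"
      by (simp add: circlepath cis_conv_exp mult_ac)
    moreover have "vector_derivative (circlepath 0 1) (at t within {0..1}) = 2 * pi * \<i> * cis (2 * pi * t)"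
      using t vector_derivative_circlepath01[of t 0 1] by (simp add: cis_conv_exp mult_ac)
    ultimately show "u (circlepath 0 1 t) / (circlepath 0 1 t - 0) ^ Suc k * vector_derivative (circlepath 0 1) (at t within {0..1})
      = u (cis (2 * pi * t)) / cis (2 * pi * t) ^ Suc k * (2 * pi * \<i> * cis (2 * pi * t))"
      by simp
  qed
  then have "((\<lambda>t. 1 / (2 * pi * \<i>) * (u (cis (2 * pi * t)) / cis (2 * pi * t) ^ Suc k * (2 * pi * \<i> * cis (2 * pi * t))))
      has_integral 1 / (2 * pi * \<i>) * ((2 * pi * \<i> / fact k) * (deriv ^^ k) u 0)) {0..1}"
    by (rule has_integral_mult_right)
  moreover have "1 / (2 * pi * \<i>) * (u (cis (2 * pi * t)) / cis (2 * pi * t) ^ Suc k * (2 * pi * \<i> * cis (2 * pi * t)))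
     = u (cis (2 * pi * t)) * cnj (cis (2 * pi * t)) ^ k" for t
    by (simp add: cis_cnj cis_inverse[symmetric] field_simps flip: power_inverse)
  ultimately show ?thesis by simp
qed

lemma integral_ball_leb:
  fixes f :: "complex ^ 'n \<Rightarrow> 'b::{banach, second_countable_topology}"
  assumes f: "(\<lambda>w. indicator \<B> w *\<^sub>R f w) \<in> borel_measurable borel"
  shows "(\<integral>w. f w \<partial>ball_leb) = (\<integral>w. indicator \<B> w *\<^sub>R f w \<partial>lborel)"
  using f unfolding ball_leb_def
  by (simp add: integral_restrict_space integral_completion)

lemma defect_powr_bounded:
  assumes "R < 1" "R \<ge> 0"
  obtains C where "C > 0" "\<And>w. w \<in> ball 0 R \<Longrightarrow> wt s w \<le> C"
proof -
  have R2: "1 - R\<^sup>2 > 0" using assms by (simp add: abs_square_less_1)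
  have "wt s w \<le> 1 + (1 - R\<^sup>2) powr s" if "w \<in> ball 0 R" for w :: "complex ^ 'a"
  proof (cases "s \<ge> 0")
    case True
    have "defect w > 0" using that assms by (intro defect_pos) auto
    then have "wt s w \<le> 1" using True defect_le_1[of w] powr_mono2[of s "defect w" 1] by simp
    then show ?thesis by (smt (verit) powr_ge_zero)
  next
    case False
    have "norm w ^ 2 \<le> R ^ 2" using that by (intro power_mono) auto
    then have "1 - R\<^sup>2 \<le> defect w" by (simp add: defect_def)
    then have "wt s w \<le> (1 - R\<^sup>2) powr s" using False R2 by (intro powr_mono2') auto
    then show ?thesis by simp
  qed
  then show ?thesis using that[of "1 + (1 - R\<^sup>2) powr s"] by (metis add_pos_nonneg powr_ge_zero zero_less_one)
qed

lemma defect_two_scale: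
  "norm u = 1 \<Longrightarrow> cmod c = 1 \<Longrightarrow> cmod d = 1 \<Longrightarrow> defect (two_scale u c d w) = defect w"
  by (simp add: defect_def norm_two_scale_isometry)

abbreviation (input) cut_int :: "real \<Rightarrow> real \<Rightarrow> (complex ^ 'n \<Rightarrow> complex) \<Rightarrow> complex" where
  "cut_int R s F \<equiv> \<integral>w. indicator (ball 0 R) w *\<^sub>R (wt s w *\<^sub>R F w) \<partial>lborel"

text \<open>Every rotation of the family preserves Lebesgue measure, the ball of radius
  \<open>R\<close> and the weight, so the rotated integrals all agree; integrating over
  \<open>t\<close> and exchanging the order replaces \<open>F\<close> by its circle mean. The
  cut-off at R < 1 keeps \<open>F\<close> bounded and the double integral absolutely
  convergent.\<close>

lemma integral_circle_average:
  fixes F A :: "complex ^ 'n \<Rightarrow> complex" and c d :: "real \<Rightarrow> complex"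
  assumes F: "continuous_on \<B> F" and R: "0 \<le> R" "R < 1" and u: "norm u = 1"
    and c: "continuous_on UNIV c" "\<And>t. cmod (c t) = 1"
    and d: "continuous_on UNIV d" "\<And>t. cmod (d t) = 1"
    and A: "\<And>w. w \<in> \<B> \<Longrightarrow> ((\<lambda>t. F (two_scale u (c t) (d t) w)) has_integral A w) {0..1}"
  shows "cut_int R s (\<lambda>w. F w)
       = cut_int R s (\<lambda>w. A w)"
proof -
  \<comment> \<open>\<open>F\<close> is arbitrary outside the ball; the cut-off makes it Borel
    measurable on the whole space.\<close>
  define F' where "F' w = indicator \<B> w *\<^sub>R F w" for w
  have F'[measurable]: "F' \<in> borel_measurable borel"
    unfolding F'_def by (intro borel_measurable_continuous_on_indicator F) auto
  have [measurable]: "c \<in> borel_measurable borel" "d \<in> borel_measurable borel"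
    using c d by (auto intro: borel_measurable_continuous_onI)
  define T where "T t = two_scale u (c t) (d t)" for t
  have cT: "continuous_on UNIV (\<lambda>p. T (snd p) (fst p))"
  proof -
    have eq: "T (snd p) (fst p) = (\<chi> i. d (snd p) * fst p $ i + (c (snd p) - d (snd p)) * hinner (fst p) u * u $ i)" for p
      by (simp add: T_def two_scale_def vec_eq_iff)
    show ?thesis unfolding eq
      by (intro continuous_intros continuous_on_compose2[OF c(1)] continuous_on_compose2[OF d(1)]) auto
  qed
  have mT[measurable]: "(\<lambda>p. T (snd p) (fst p)) \<in> borel_measurable (lborel \<Otimes>\<^sub>M lborel)"
    using borel_measurable_continuous_onI[OF cT] by (simp add: borel_prod measurable_lborel1 lborel_prod)
  define G where "G w t = indicator (ball 0 R) w *\<^sub>R (wt s w *\<^sub>R F' (T t w)) * indicator {0..1} t" for w t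
  have nT: "norm (T t w) = norm w" for t w
    unfolding T_def by (rule norm_two_scale_isometry) (use u c d in auto)
  have dT: "defect (T t w) = defect w" for t w
    unfolding T_def by (rule defect_two_scale) (use u c d in auto)
  have mG: "(\<lambda>(w, t). G w t) \<in> borel_measurable (lborel \<Otimes>\<^sub>M lborel)"
  proof -
    have "(\<lambda>p. F' (T (snd p) (fst p))) \<in> borel_measurable (lborel \<Otimes>\<^sub>M lborel)"
      by (rule measurable_compose[OF mT F'])
    then show ?thesis unfolding G_def split_beta' by measurable
  qed
  obtain C where C: "C > 0" "\<And>w :: complex ^ 'n. w \<in> ball 0 R \<Longrightarrow> wt s w \<le> C"
    by (rule defect_powr_bounded[of R s]) (use R in auto)
  have "compact (F ` cball 0 R)"
    by (intro compact_continuous_image continuous_on_subset[OF F]) (use R in auto)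
  then obtain K where K: "\<And>w. w \<in> cball 0 R \<Longrightarrow> cmod (F w) \<le> K"
    by (metis bounded_iff compact_imp_bounded imageI)
  have K0: "K \<ge> 0" using K[of 0] R by (meson centre_in_cball norm_ge_zero order_trans)
  have intG: "integrable (lborel \<Otimes>\<^sub>M lborel) (\<lambda>(w, t). G w t)"
  proof (rule integrableI_bounded_set[where A = "ball 0 R \<times> {0..1}" and B = "C * K"])
    show "ball 0 R \<times> {0..1} \<in> sets (lborel \<Otimes>\<^sub>M lborel :: ((complex ^ 'n) \<times> real) measure)" by simp
    have "emeasure (lborel \<Otimes>\<^sub>M lborel) (ball (0 :: complex ^ 'n) R \<times> {0..1::real}) = emeasure lborel (ball (0 :: complex ^ 'n) R) * emeasure lborel {0..1::real}"
      by (rule lborel.emeasure_pair_measure_Times) auto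
    also have "\<dots> < \<infinity>" using emeasure_lborel_ball_finite[of 0 R] by simp
    finally show "emeasure (lborel \<Otimes>\<^sub>M lborel) (ball (0 :: complex ^ 'n) R \<times> {0..1::real}) < \<infinity>" .
    have "norm (G w t) \<le> C * K" if "w \<in> ball 0 R" for w t
    proof -
      have Tw: "T t w \<in> \<B>" "T t w \<in> cball 0 R" using that R by (auto simp: nT)
      have "norm (F' (T t w)) \<le> K" using K[OF Tw(2)] Tw(1) by (simp add: F'_def)
      then have "wt s w * norm (F' (T t w)) \<le> C * K"
        using C(2)[OF that] by (intro mult_mono) (use C(1) in auto)
      then show ?thesis using that C(1) K0 by (simp add: G_def norm_mult indicator_def)
    qed
    then show "AE p in lborel \<Otimes>\<^sub>M lborel. p \<in> ball 0 R \<times> {0..1} \<longrightarrow> norm (case p of (w, t) \<Rightarrow> G w t) \<le> C * K"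
      by auto
    show "AE p in lborel \<Otimes>\<^sub>M lborel. p \<notin> ball 0 R \<times> {0..1} \<longrightarrow> (case p of (w, t) \<Rightarrow> G w t) = 0"
      by (auto simp: G_def indicator_def)
  qed (rule mG)
  have inner_t: "(\<integral>t. G w t \<partial>lborel) = indicator (ball 0 R) w *\<^sub>R (wt s w *\<^sub>R A w)" for w
  proof (cases "w \<in> ball 0 R")
    case True
    then have w: "w \<in> \<B>" using R by auto
    have Tw: "T t w \<in> \<B>" for t using w by (simp add: nT)
    have cont: "continuous_on {0..1} (\<lambda>t. F (T t w))"
    proof (rule continuous_on_compose2[OF F])
      show "continuous_on {0..1} (\<lambda>t. T t w)"
        using continuous_on_compose2[OF cT, of "{0..1}" "\<lambda>t. (w, t)"]
          continuous_on_Pair[OF continuous_on_const[of "{0..1::real}" w] continuous_on_id] by simp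
    qed (use Tw in auto)
    have "set_integrable lborel {0..1} (\<lambda>t. F (T t w))"
      by (rule borel_integrable_atLeastAtMost'[OF cont])
    then have "(LINT t:{0..1}|lborel. F (T t w)) = A w"
      using set_borel_integral_eq_integral(2) A[OF w] integral_unique unfolding T_def by metis
    then have "(\<integral>t. indicator {0..1} t *\<^sub>R F' (T t w) \<partial>lborel) = A w"
      unfolding set_lebesgue_integral_def F'_def using Tw by simp
    moreover have "G w t = wt s w *\<^sub>R (indicator {0..1} t *\<^sub>R F' (T t w))" for t
      using True by (simp add: G_def indicator_def)
    ultimately show ?thesis using True by (simp del: scaleR_scaleR)
  qed (simp add: G_def)
  have inner_w: "(\<integral>w. G w t \<partial>lborel) = indicator {0..1} t *\<^sub>R cut_int R s (\<lambda>w. F w)" for t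
  proof -
    have lin: "linear (T t)" unfolding T_def by (rule linear_two_scale)
    have [measurable]: "T t \<in> borel_measurable borel" unfolding T_def by measurable
    have "cut_int R s (\<lambda>w. F' w)
      = (\<integral>w. indicator (ball 0 R) w *\<^sub>R (wt s w *\<^sub>R F' w) \<partial>(distr lborel borel (T t)))"
      using lborel_distr_isometry[OF lin nT] by simp
    also have "\<dots> = (\<integral>w. indicator (ball 0 R) (T t w) *\<^sub>R (wt s (T t w) *\<^sub>R F' (T t w)) \<partial>lborel)"
      by (rule integral_distr) measurable
    also have "\<dots> = cut_int R s (\<lambda>w. F' (T t w))"
      by (simp add: dT nT indicator_def)
    finally have *: "cut_int R s (\<lambda>w. F' (T t w))
       = cut_int R s (\<lambda>w. F' w)" ..
    also have "\<dots> = cut_int R s (\<lambda>w. F w)"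
      by (intro Bochner_Integration.integral_cong) (use R in \<open>auto simp: F'_def indicator_def\<close>)
    finally show ?thesis by (cases "t \<in> {0..1}") (simp_all add: G_def)
  qed
  have "(\<integral>t. (\<integral>w. G w t \<partial>lborel) \<partial>lborel) = (\<integral>w. (\<integral>t. G w t \<partial>lborel) \<partial>lborel)"
    by (rule lborel_pair.Fubini_integral[OF intG])
  then show ?thesis unfolding inner_t inner_w by simp
qed

lemma holomorphic_ball_continuous: "holomorphic_ball g \<Longrightarrow> continuous_on \<B> g"
  unfolding holomorphic_ball_def
  by (metis continuous_at_imp_continuous_on has_derivative_continuous)

lemma holomorphic_ball_line:
  assumes g: "holomorphic_ball g" and S: "\<And>\<eta>. \<eta> \<in> S \<Longrightarrow> a + \<eta> *s b \<in> \<B>"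
  shows "(\<lambda>\<eta>. g (a + \<eta> *s b)) holomorphic_on S"
  unfolding holomorphic_on_def
proof
  fix \<eta> assume "\<eta> \<in> S"
  then obtain D where D: "(g has_derivative D) (at (a + \<eta> *s b))" "\<And>c x. D (c *s x) = c * D x"
    using g S unfolding holomorphic_ball_def by blast
  have "((\<lambda>\<eta>. a + \<eta> *s b) has_derivative (\<lambda>h. h *s b)) (at \<eta> within S)"
  proof -
    have "bounded_linear (\<lambda>h. h *s b)"
      by (rule bounded_linear_intro[where K = "norm b"])
         (simp_all add: vec_eq_iff algebra_simps)
    then have "((\<lambda>\<eta>. \<eta> *s b) has_derivative (\<lambda>h. h *s b)) (at \<eta> within S)"
      by (rule bounded_linear_imp_has_derivative)
    then show ?thesis by (auto intro!: derivative_eq_intros)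
  qed
  from has_derivative_compose[OF this D(1)]
  have "((\<lambda>\<eta>. g (a + \<eta> *s b)) has_derivative (\<lambda>h. D (h *s b))) (at \<eta> within S)"
    by simp
  moreover have "(\<lambda>h. D (h *s b)) = (*) (D b)" by (rule ext) (simp add: D(2) mult.commute)
  ultimately have "((\<lambda>\<eta>. g (a + \<eta> *s b)) has_derivative (*) (D b)) (at \<eta> within S)"
    by simp
  then show "(\<lambda>\<eta>. g (a + \<eta> *s b)) field_differentiable at \<eta> within S"
    unfolding field_differentiable_def has_field_derivative_def by blast
qed

text \<open>Two averages are taken. Rotating only the complement of \<open>u\<close> replaces
  \<open>g\<close> by its restriction to the complex line through \<open>u\<close>, by the mean
  value property; rotating all coordinates then isolates the \<open>k\<close>-th Taylor coefficient
  of that restriction.\<close>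

lemma integral_ball_coefficient:
  fixes g :: "complex ^ 'n \<Rightarrow> complex"
  assumes g: "holomorphic_ball g" and R: "0 \<le> R" "R < 1" and u: "norm u = 1"
  shows "cut_int R s (\<lambda>w. (g w * cnj (hinner w u) ^ k))
       = ((deriv ^^ k) (\<lambda>\<zeta>. g (\<zeta> *s u)) 0 / fact k) *
         cut_int R s (\<lambda>w. of_real (cmod (hinner w u) ^ (2 * k)))"
proof -
  define h where "h \<zeta> = g (\<zeta> *s u)" for \<zeta>
  have h: "h holomorphic_on \<B>"
    using holomorphic_ball_line[OF g, of "\<B>" 0 u] u unfolding h_def[abs_def] by simp
  have hu: "cmod (hinner w u) < 1" if "w \<in> \<B>" for w
    using norm_hinner_le[of w u] u that by simp
  have cis: "continuous_on UNIV (\<lambda>t. cis (2 * pi * t))"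
    by (intro continuous_intros)
  note gc = holomorphic_ball_continuous[OF g]
  have "cut_int R s (\<lambda>w. (g w * cnj (hinner w u) ^ k))
     = cut_int R s (\<lambda>w. (h (hinner w u) * cnj (hinner w u) ^ k))"
  proof (rule integral_circle_average[where u = u and c = "\<lambda>t. 1" and d = "\<lambda>t. cis (2 * pi * t)"])
    show "continuous_on \<B> (\<lambda>w. g w * cnj (hinner w u) ^ k)"
      by (intro continuous_intros gc)
    fix w :: "complex ^ 'n" assume w: "w \<in> \<B>"
    \<comment> \<open>A radius above 1 for which the rotated line stays in the ball; the maximum
      with 1/2 avoids dividing by zero at w = 0.\<close>
    define \<rho> where "\<rho> = 1 / max (norm w) (1 / 2)"
    have \<rho>: "\<rho> > 1" using w by (simp add: \<rho>_def)
    define a where "a = hinner w u *s u"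
    define b where "b = w - a"
    have ts: "two_scale u 1 d w = a + d *s b" for d
      by (simp add: two_scale_def a_def b_def vec_eq_iff algebra_simps)
    have inb: "a + \<eta> *s b \<in> \<B>" if "\<eta> \<in> ball 0 \<rho>" for \<eta>
    proof -
      have eta: "cmod \<eta> * norm w < 1"
      proof -
        have "cmod \<eta> * max (norm w) (1 / 2) < 1"
          using that w by (simp add: \<rho>_def less_divide_eq max_def split: if_splits)
        then show ?thesis by (smt (verit) max.cobounded1 mult_left_mono norm_ge_zero)
      qed
      have 1: "(norm (a + \<eta> *s b))\<^sup>2 = (cmod \<eta>)\<^sup>2 * ((norm w)\<^sup>2 - (cmod (hinner w u))\<^sup>2) + (cmod (hinner w u))\<^sup>2"
        unfolding ts[symmetric] norm_two_scale[OF u] by simp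
      have 2: "(cmod (hinner w u))\<^sup>2 \<le> (norm w)\<^sup>2"
        using norm_hinner_le[of w u] u by (intro power_mono) auto
      have "(norm (a + \<eta> *s b))\<^sup>2 < 1"
      proof (cases "cmod \<eta> \<le> 1")
        case True
        then have "(cmod \<eta>)\<^sup>2 * ((norm w)\<^sup>2 - (cmod (hinner w u))\<^sup>2) \<le> 1 * ((norm w)\<^sup>2 - (cmod (hinner w u))\<^sup>2)"
          using 2 by (intro mult_right_mono) (auto simp: power_le_one)
        then have "(norm (a + \<eta> *s b))\<^sup>2 \<le> (norm w)\<^sup>2" using 1 by simp
        also have "\<dots> < 1" using w by (simp add: abs_square_less_1)
        finally show ?thesis .
      next
        case False
        then have "1 * (cmod (hinner w u))\<^sup>2 \<le> (cmod \<eta>)\<^sup>2 * (cmod (hinner w u))\<^sup>2"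
          by (intro mult_right_mono) (auto simp: one_le_power)
        then have "(norm (a + \<eta> *s b))\<^sup>2 \<le> (cmod \<eta> * norm w)\<^sup>2" using 1 by (simp add: algebra_simps power_mult_distrib)
        also have "\<dots> < 1" using eta by (simp add: abs_square_less_1 norm_mult abs_mult)
        finally show ?thesis .
      qed
      then show ?thesis by (simp add: abs_square_less_1)
    qed
    have "(\<lambda>\<eta>. g (a + \<eta> *s b)) holomorphic_on ball 0 \<rho>"
      by (rule holomorphic_ball_line[OF g inb])
    from circle_coefficient[OF this \<rho>, of 0]
    have "((\<lambda>t. g (a + cis (2 * pi * t) *s b)) has_integral g a) {0..1}" by simp
    then have "((\<lambda>t. g (a + cis (2 * pi * t) *s b) * cnj (hinner w u) ^ k) has_integral g a * cnj (hinner w u) ^ k) {0..1}"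
      by (rule has_integral_mult_left)
    moreover have "hinner (two_scale u 1 (cis (2 * pi * t)) w) u = hinner w u" for t
      by (simp add: hinner_two_scale[OF u])
    ultimately show "((\<lambda>t. g (two_scale u 1 (cis (2 * pi * t)) w) * cnj (hinner (two_scale u 1 (cis (2 * pi * t)) w) u) ^ k)
      has_integral h (hinner w u) * cnj (hinner w u) ^ k) {0..1}"
      by (simp add: ts h_def a_def)
  qed (use R u cis in auto)
  also have "\<dots> = cut_int R s (\<lambda>w. (((deriv ^^ k) h 0 / fact k) * of_real (cmod (hinner w u) ^ (2 * k))))"
  proof (rule integral_circle_average[where u = u and c = "\<lambda>t. cis (2 * pi * t)" and d = "\<lambda>t. cis (2 * pi * t)"])
    have "continuous_on \<B> (\<lambda>w. h (hinner w u))"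
      by (rule continuous_on_compose2[OF holomorphic_on_imp_continuous_on[OF h]])
         (use hu in \<open>auto intro!: continuous_intros\<close>)
    then show "continuous_on \<B> (\<lambda>w. h (hinner w u) * cnj (hinner w u) ^ k)"
      by (intro continuous_intros)
    fix w :: "complex ^ 'n" assume w: "w \<in> \<B>"
    define \<zeta> where "\<zeta> = hinner w u"
    define \<rho> where "\<rho> = 1 / max (cmod \<zeta>) (1 / 2)"
    have \<zeta>1: "cmod \<zeta> < 1" unfolding \<zeta>_def by (rule hu[OF w])
    have \<rho>: "\<rho> > 1" using \<zeta>1 by (simp add: \<rho>_def)
    have mem: "\<zeta> * \<eta> \<in> \<B>" if "\<eta> \<in> ball 0 \<rho>" for \<eta>
    proof -
      have "cmod \<eta> * max (cmod \<zeta>) (1 / 2) < 1"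
        using that by (simp add: \<rho>_def less_divide_eq max_def split: if_splits)
      then show ?thesis by (simp add: norm_mult) (smt (verit) max.cobounded1 mult_left_mono norm_ge_zero mult.commute)
    qed
    have hol: "(\<lambda>\<eta>. h (\<zeta> * \<eta>)) holomorphic_on ball 0 \<rho>"
    proof -
      have "h \<circ> (\<lambda>\<eta>. \<zeta> * \<eta>) holomorphic_on ball 0 \<rho>"
        by (rule holomorphic_on_compose_gen[OF _ h]) (use mem in \<open>auto intro!: holomorphic_intros\<close>)
      then show ?thesis by (simp add: o_def)
    qed
    have der: "(deriv ^^ k) (\<lambda>\<eta>. h (\<zeta> * \<eta>)) 0 = \<zeta> ^ k * (deriv ^^ k) h 0"
      using higher_deriv_compose_linear[OF h, of "ball 0 \<rho>" 0 \<zeta> k] mem \<rho> by auto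
    from circle_coefficient[OF hol \<rho>, of k]
    have "((\<lambda>t. h (\<zeta> * cis (2 * pi * t)) * cnj (cis (2 * pi * t)) ^ k) has_integral \<zeta> ^ k * (deriv ^^ k) h 0 / fact k) {0..1}"
      unfolding der .
    then have "((\<lambda>t. h (\<zeta> * cis (2 * pi * t)) * cnj (cis (2 * pi * t)) ^ k * cnj \<zeta> ^ k) has_integral \<zeta> ^ k * (deriv ^^ k) h 0 / fact k * cnj \<zeta> ^ k) {0..1}"
      by (rule has_integral_mult_left)
    moreover have eqc: "h (hinner (two_scale u c c w) u) * cnj (hinner (two_scale u c c w) u) ^ k = h (\<zeta> * c) * cnj c ^ k * cnj \<zeta> ^ k" for c
      by (simp add: hinner_two_scale[OF u] \<zeta>_def power_mult_distrib mult_ac)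
    moreover have "\<zeta> ^ k * (deriv ^^ k) h 0 / fact k * cnj \<zeta> ^ k = ((deriv ^^ k) h 0 / fact k) * of_real (cmod \<zeta> ^ (2 * k))"
    proof -
      have "of_real (cmod \<zeta> ^ (2 * k)) = complex_of_real ((cmod \<zeta>)\<^sup>2) ^ k" by (simp add: power_mult)
      then show ?thesis unfolding complex_norm_square by (simp add: power_mult_distrib)
    qed
    ultimately show "((\<lambda>t. h (hinner (two_scale u (cis (2 * pi * t)) (cis (2 * pi * t)) w) u) *
              cnj (hinner (two_scale u (cis (2 * pi * t)) (cis (2 * pi * t)) w) u) ^ k)
       has_integral ((deriv ^^ k) h 0 / fact k) * of_real (cmod (hinner w u) ^ (2 * k))) {0..1}"
      unfolding eqc by (simp only: \<zeta>_def)
  qed (use R u cis in auto)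
  also have "\<dots> = (\<integral>w. ((deriv ^^ k) h 0 / fact k) * (indicator (ball 0 R) w *\<^sub>R (wt s w *\<^sub>R of_real (cmod (hinner w u) ^ (2 * k)))) \<partial>lborel)"
    by (intro Bochner_Integration.integral_cong) (auto simp: indicator_def)
  also have "\<dots> = ((deriv ^^ k) h 0 / fact k) * cut_int R s (\<lambda>w. of_real (cmod (hinner w u) ^ (2 * k)))"
    by (rule integral_mult_right_zero)
  finally show ?thesis by (simp add: h_def[abs_def])
qed

lemma borel_measurable_ball_leb_continuous:
  fixes f :: "complex ^ 'n \<Rightarrow> 'b::real_normed_vector"
  assumes "continuous_on \<B> f"
  shows "measB f"
  unfolding ball_leb_def by (rule continuous_imp_measurable_on_sets_lebesgue[OF assms]) simp

lemma measurable_ball_leb: "f \<in> borel_measurable borel \<Longrightarrow> measB f"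
  unfolding ball_leb_def by (simp add: measurable_completion measurable_restrict_space1)

lemma sigma_finite_ball_leb: "sigma_finite_measure (ball_leb :: (complex ^ 'n) measure)"
proof -
  have "finite_measure (ball_leb :: (complex ^ 'n) measure)"
    unfolding ball_leb_def by (rule finite_measure_lebesgue_on) simp
  then show ?thesis by (rule finite_measure.axioms(1))
qed

text \<open>Treating the kernel as a function of the single variable x = \<open>hinner z w\<close>
  makes one-variable power series and derivatives available.\<close>

definition bkern :: "real \<Rightarrow> complex \<Rightarrow> complex" where
  "bkern N x = (1 - x) powr of_real (- N)"

definition bcoef :: "real \<Rightarrow> nat \<Rightarrow> real" where
  "bcoef N k = pochhammer N k / fact k"

section \<open>Reproducing kernels\<close>

lemma bkern_sums:
  assumes "cmod x < 1"
  shows "(\<lambda>k. of_real (bcoef N k) * x ^ k) sums bkern N x"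
proof -
  have "(\<lambda>k. (of_real (- N) gchoose k) * (- x) ^ k) sums (1 + - x) powr of_real (- N)"
    by (rule gen_binomial_complex) (use assms in simp)
  moreover have "(of_real (- N) gchoose k) * (- x) ^ k = of_real (bcoef N k) * x ^ k" for k
  proof -
    have "(complex_of_real (- N) gchoose k) = (-1) ^ k / fact k * pochhammer (of_real N) k"
      by (simp add: gbinomial_pochhammer)
    moreover have "(- x) ^ k = (-1) ^ k * x ^ k" by (rule power_minus)
    moreover have "(-1) ^ k * (-1) ^ k = (1::complex)" by (simp flip: power_mult_distrib)
    ultimately show ?thesis
      by (simp add: bcoef_def pochhammer_of_real)
  qed
  ultimately show ?thesis by (simp add: bkern_def)
qed

lemma bcoef_pos: "N > 0 \<Longrightarrow> bcoef N k > 0"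
  by (simp add: bcoef_def pochhammer_pos)

lemma bcoef_sums:
  assumes "0 \<le> x" "x < 1"
  shows "(\<lambda>k. bcoef N k * x ^ k) sums (1 - x) powr (- N)"
proof -
  have "(\<lambda>k. of_real (bcoef N k) * (of_real x) ^ k) sums bkern N (of_real x)"
    by (rule bkern_sums) (use assms in simp)
  moreover have "bkern N (of_real x) = of_real ((1 - x) powr (- N))"
  proof -
    have "bkern N (of_real x) = of_real (1 - x) powr of_real (- N)" by (simp add: bkern_def)
    also have "\<dots> = of_real ((1 - x) powr (- N))" by (rule powr_of_real) (use assms in auto)
    finally show ?thesis .
  qed
  ultimately have "(\<lambda>k. complex_of_real (bcoef N k * x ^ k)) sums of_real ((1 - x) powr (- N))" by simp
  then show ?thesis by (simp only: sums_of_real_iff)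
qed

text \<open>The moments of \<open>g\<close> against \<open>\<langle>w,u\<rangle>\<^sup>k\<close> are computed on smaller balls, where \<open>g\<close> is bounded,
  and passed to the limit.\<close>

lemma integral_coefficient:
  fixes g :: "complex ^ 'n \<Rightarrow> complex"
  assumes s: "s > -1" and g: "holomorphic_ball g" and u: "norm u = 1"
    and int: "L1w s g"
  shows "(\<integral>w. wt s w *\<^sub>R (g w * cnj (hinner w u) ^ k) \<partial>ball_leb)
       = ((deriv ^^ k) (\<lambda>\<zeta>. g (\<zeta> *s u)) 0 / fact k) *
         of_real (fact k / pochhammer (real CARD('n) + 1 + s) k * ball_mass TYPE('n) s)"
proof -
  define R where "R j = 1 - 1 / real (j + 2)" for j
  have R: "0 \<le> R j" "R j < 1" for j by (auto simp: R_def field_simps)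
  have Rlim: "R \<longlonglongrightarrow> 1" unfolding R_def by real_asymp
  note gc = holomorphic_ball_continuous[OF g]
  let ?G = "\<lambda>w. wt s w *\<^sub>R (g w * cnj (hinner w u) ^ k)"
  let ?H = "\<lambda>w. wt s w *\<^sub>R complex_of_real (cmod (hinner w u) ^ (2 * k))"
  have hu: "cmod (hinner w u) \<le> 1" if "w \<in> \<B>" for w
    using norm_hinner_le[of w u] u that by simp
  have dc: "continuous_on \<B> (\<lambda>w. wt s w :: real)" for s
    unfolding defect_def by (intro continuous_intros) (use defect_pos in \<open>force simp: defect_def\<close>)
  have ind: "eventually (\<lambda>j. indicator (ball 0 (R j)) w = (1::real)) sequentially" if "w \<in> \<B>" for w :: "complex ^ 'n"
    using order_tendstoD(1)[OF Rlim, of "norm w"] that by (auto elim!: eventually_mono)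
  have lim: "(\<lambda>j. \<integral>w. indicator (ball 0 (R j)) w *\<^sub>R F w \<partial>ball_leb) \<longlonglongrightarrow> (\<integral>w. F w \<partial>ball_leb)"
    if F: "integrable ball_leb F" for F :: "complex ^ 'n \<Rightarrow> complex"
  proof (rule integral_dominated_convergence)
    show "AE w in ball_leb. (\<lambda>j. indicator (ball 0 (R j)) w *\<^sub>R F w) \<longlonglongrightarrow> F w"
    proof (rule AE_I2)
      fix w :: "complex ^ 'n" assume "w \<in> space ball_leb"
      then have "eventually (\<lambda>j. indicator (ball 0 (R j)) w *\<^sub>R F w = F w) sequentially"
        using ind[of w] by (auto elim!: eventually_mono)
      then show "(\<lambda>j. indicator (ball 0 (R j)) w *\<^sub>R F w) \<longlonglongrightarrow> F w" by (rule tendsto_eventually)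
    qed
    show "integrable ball_leb (\<lambda>w. norm (F w))" using F by simp
    have [measurable]: "measB F" using F by simp
    have "(\<lambda>w. indicator (ball 0 (R j)) w :: real) \<in> borel_measurable (ball_leb :: (complex ^ 'n) measure)" for j
      by (rule measurable_ball_leb) measurable
    then show "measB (\<lambda>w. indicator (ball 0 (R j)) w *\<^sub>R F w)" for j
      by measurable
  qed (use F in \<open>auto simp: indicator_def\<close>)
  have conv: "(\<integral>w. indicator (ball 0 (R j)) w *\<^sub>R F w \<partial>ball_leb) = (\<integral>w. indicator (ball 0 (R j)) w *\<^sub>R F w \<partial>lborel)"
    if F: "continuous_on \<B> F" for F :: "complex ^ 'n \<Rightarrow> complex" and j
  proof -
    have eq: "indicator \<B> w *\<^sub>R (indicator (ball 0 (R j)) w *\<^sub>R F w) = indicator (ball 0 (R j)) w *\<^sub>R (indicator \<B> w *\<^sub>R F w)" for w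
      by (simp add: indicator_def)
    have [measurable]: "(\<lambda>w. indicator \<B> w *\<^sub>R F w) \<in> borel_measurable borel"
      by (intro borel_measurable_continuous_on_indicator F) auto
    have "(\<integral>w. indicator (ball 0 (R j)) w *\<^sub>R F w \<partial>ball_leb) = (\<integral>w. indicator \<B> w *\<^sub>R (indicator (ball 0 (R j)) w *\<^sub>R F w) \<partial>lborel)"
      by (rule integral_ball_leb) (unfold eq, measurable)
    also have "\<dots> = (\<integral>w. indicator (ball 0 (R j)) w *\<^sub>R F w \<partial>lborel)"
      by (intro Bochner_Integration.integral_cong) (use R[of j] in \<open>auto simp: indicator_def\<close>)
    finally show ?thesis .
  qed
  have cG: "continuous_on \<B> ?G" by (intro continuous_intros gc dc)
  have cH: "continuous_on \<B> ?H" by (intro continuous_intros dc)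
  have iG: "integrable ball_leb ?G"
  proof (rule Bochner_Integration.integrable_bound[OF int])
    show "measB ?G" by (rule borel_measurable_ball_leb_continuous[OF cG])
    show "AE w in ball_leb. norm (?G w) \<le> norm (wt s w *\<^sub>R g w)"
    proof (rule AE_I2)
      fix w :: "complex ^ 'n" assume "w \<in> space ball_leb"
      then have "cmod (g w) * cmod (hinner w u) ^ k \<le> cmod (g w)"
        using hu[of w] by (intro mult_left_le power_le_one) auto
      then show "norm (?G w) \<le> norm (wt s w *\<^sub>R g w)"
        by (simp add: norm_mult norm_power mult_left_mono)
    qed
  qed
  have nnH: "(\<integral>B w. norm (?H w)) = ennreal (fact k / pochhammer (real CARD('n) + 1 + s) k * ball_mass TYPE('n) s)"
    using ball_moment[OF s, of u k] u by (simp add: norm_mult norm_power mult.commute)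
  have iH: "integrable ball_leb ?H"
    by (rule integrableI_bounded) (use nnH borel_measurable_ball_leb_continuous[OF cH] in auto)
  have valH: "(\<integral>w. ?H w \<partial>ball_leb) = of_real (fact k / pochhammer (real CARD('n) + 1 + s) k * ball_mass TYPE('n) s)"
  proof -
    have "(\<integral>w. ?H w \<partial>ball_leb) = (\<integral>w. complex_of_real (norm (?H w)) \<partial>ball_leb)"
    proof (intro Bochner_Integration.integral_cong refl)
      fix w :: "complex ^ 'n"
      have "?H w = of_real (wt s w * cmod (hinner w u) ^ (2 * k))" by (simp add: scaleR_conv_of_real)
      then show "?H w = of_real (norm (?H w))"
        by (metis abs_of_nonneg mult_nonneg_nonneg norm_ge_zero norm_of_real powr_ge_zero zero_le_power)
    qed
    also have "\<dots> = of_real (\<integral>w. norm (?H w) \<partial>ball_leb)" by (rule integral_complex_of_real)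
    also have "(\<integral>w. norm (?H w) \<partial>ball_leb) = enn2real (\<integral>B w. norm (?H w))"
      by (rule integral_eq_nn_integral)
         (rule measurable_compose[OF borel_measurable_ball_leb_continuous[OF cH] borel_measurable_norm], auto)
    also have "\<dots> = fact k / pochhammer (real CARD('n) + 1 + s) k * ball_mass TYPE('n) s"
      unfolding nnH using s less_imp_le[OF ball_mass_pos[OF s, where 'n = 'n]]
      by (intro enn2real_ennreal mult_nonneg_nonneg divide_nonneg_nonneg pochhammer_nonneg) simp_all
    finally show ?thesis .
  qed
  let ?a = "(deriv ^^ k) (\<lambda>\<zeta>. g (\<zeta> *s u)) 0 / fact k"
  have "(\<lambda>j. ?a * (\<integral>w. indicator (ball 0 (R j)) w *\<^sub>R ?H w \<partial>ball_leb)) \<longlonglongrightarrow> ?a * (\<integral>w. ?H w \<partial>ball_leb)"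
    by (intro tendsto_mult tendsto_const lim[OF iH])
  moreover have "?a * (\<integral>w. indicator (ball 0 (R j)) w *\<^sub>R ?H w \<partial>ball_leb) = (\<integral>w. indicator (ball 0 (R j)) w *\<^sub>R ?G w \<partial>ball_leb)" for j
    unfolding conv[OF cH] conv[OF cG] by (rule integral_ball_coefficient[OF g R u, symmetric])
  ultimately have "(\<lambda>j. \<integral>w. indicator (ball 0 (R j)) w *\<^sub>R ?G w \<partial>ball_leb) \<longlonglongrightarrow> ?a * (\<integral>w. ?H w \<partial>ball_leb)" by simp
  then show ?thesis using LIMSEQ_unique[OF lim[OF iG]] valH by simp
qed

lemma cmod_bkern: "cmod x < 1 \<Longrightarrow> cmod (bkern N x) = cmod (1 - x) powr (- N)"
  unfolding bkern_def by (subst norm_powr_real_powr') (auto simp: norm_powr_real_powr')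

lemma Re_one_minus_pos: "cmod x < 1 \<Longrightarrow> Re (1 - x) > 0"
  using complex_Re_le_cmod[of x] by simp

lemma one_minus_nonpos_Reals: "cmod x < 1 \<Longrightarrow> 1 - x \<notin> \<real>\<^sub>\<le>\<^sub>0"
  using Re_one_minus_pos[of x] by (auto simp: complex_nonpos_Reals_iff)

lemma bkern_has_field_derivative:
  assumes "cmod x < 1"
  shows "(bkern N has_field_derivative of_real N * bkern (N + 1) x) (at x)"
proof -
  have "((\<lambda>x. (1 - x) powr of_real (- N)) has_field_derivative
     of_real (- N) * (1 - x) powr (of_real (- N) - 1) * (0 - 1)) (at x)"
    using one_minus_nonpos_Reals[OF assms] assms
    by (intro DERIV_chain2[OF has_field_derivative_powr] derivative_intros) auto
  then show ?thesis by (simp add: bkern_def[abs_def])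
qed

lemma bkern_holomorphic [holomorphic_intros]: "bkern N holomorphic_on \<B>"
  unfolding holomorphic_on_def field_differentiable_def
  using bkern_has_field_derivative has_field_derivative_at_within by fastforce

lemma continuous_on_bkern: "continuous_on \<B> (bkern N)"
  using bkern_holomorphic holomorphic_on_imp_continuous_on by blast

lemma bkern_cnj: "cmod x < 1 \<Longrightarrow> bkern N (cnj x) = cnj (bkern N x)"
  unfolding bkern_def using Re_one_minus_pos[of x]
  by (subst cnj_powr) auto

lemma bkern_mult: "bkern a x * bkern b x = bkern (a + b) x"
  by (simp add: bkern_def flip: powr_add)

lemma norm_hinner_less_1: "z \<in> \<B> \<Longrightarrow> w \<in> cball 0 1 \<Longrightarrow> cmod (hinner z w) < 1"
  and norm_hinner_less_1': "z \<in> cball 0 1 \<Longrightarrow> w \<in> \<B> \<Longrightarrow> cmod (hinner z w) < 1"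
  using norm_hinner_le[of z w] mult_left_le[of "norm w" "norm z"] mult_left_le[of "norm z" "norm w"]
  by (auto simp: mult.commute)

lemma holomorphic_ball_bkern:
  fixes a :: "complex ^ 'n"
  assumes a: "a \<in> cball 0 1"
  shows "holomorphic_ball (\<lambda>w. bkern N (hinner w a))"
  unfolding holomorphic_ball_def
proof
  fix z :: "complex ^ 'n" assume z: "z \<in> \<B>"
  have lin: "bounded_linear (\<lambda>h. hinner h a)"
    by (rule bounded_linear_intro[where K = "norm a"])
       (auto simp: hinner_add_left scaleR_eq_smult hinner_smult_left norm_hinner_le scaleR_conv_of_real)
  have d1: "((\<lambda>w. hinner w a) has_derivative (\<lambda>h. hinner h a)) (at z)"
    by (rule bounded_linear_imp_has_derivative[OF lin])
  have "(bkern N has_derivative (*) (of_real N * bkern (N + 1) (hinner z a))) (at (hinner z a))"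
    using bkern_has_field_derivative[of "hinner z a" N] norm_hinner_less_1[OF z a]
    by (simp add: has_field_derivative_def)
  from has_derivative_compose[OF d1 this]
  have "((\<lambda>w. bkern N (hinner w a)) has_derivative (\<lambda>h. of_real N * bkern (N + 1) (hinner z a) * hinner h a)) (at z)" .
  then show "\<exists>D. ((\<lambda>w. bkern N (hinner w a)) has_derivative D) (at z) \<and> (\<forall>c x. D (c *s x) = c * D x)"
    by (intro exI conjI) (auto simp: hinner_smult_left)
qed

lemma defect_measurable_ball_leb [measurable]: "measB defect"
  by (rule measurable_ball_leb) measurable

lemma hinner_measurable_ball_leb [measurable]: "measB (\<lambda>w. hinner z w)"
    "measB (\<lambda>w. hinner w z)"
  by (rule measurable_ball_leb, measurable)+

lemma cnj_measurable [measurable (raw)]: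
  "f \<in> borel_measurable M \<Longrightarrow> (\<lambda>x. cnj (f x)) \<in> borel_measurable M"
  by (rule measurable_compose[OF _ borel_measurable_continuous_onI]) (auto intro!: continuous_intros)

lemma id_measurable_ball_leb [measurable]: "measB (\<lambda>x. x)"
  by (rule measurable_ball_leb) measurable

lemma borel_measurable_bkern:
  assumes [measurable]: "h \<in> borel_measurable M" and h: "\<And>x. x \<in> space M \<Longrightarrow> cmod (h x) < 1"
  shows "(\<lambda>x. bkern N (h x)) \<in> borel_measurable M"
proof -
  have [measurable]: "(\<lambda>y. indicator \<B> y *\<^sub>R bkern N y) \<in> borel_measurable borel"
    by (intro borel_measurable_continuous_on_indicator continuous_on_bkern) auto
  have "(\<lambda>x. indicator \<B> (h x) *\<^sub>R bkern N (h x)) \<in> borel_measurable M"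
    by (rule measurable_compose[of h M borel "\<lambda>y. indicator \<B> y *\<^sub>R bkern N y"]) measurable
  then show ?thesis
    by (rule measurable_cong[THEN iffD1, rotated]) (use h in auto)
qed

lemma unit_direction:
  fixes z :: "complex ^ 'n"
  obtains u where "norm u = 1" "z = norm z *\<^sub>R u"
proof (cases "z = 0")
  case True
  then show ?thesis using that[of "axis undefined 1"] by simp
next
  case False
  then show ?thesis using that[of "(1 / norm z) *\<^sub>R z"] by simp
qed

text \<open>For fixed \<open>z\<close> one has |<z,w>| \<le> \<rho> < 1, so the kernel series is
  dominated by a convergent series uniformly in \<open>w\<close> and may be integrated term by term;
  each term is given by \<open>integral_coefficient\<close>. The exponent \<open>\<mu>\<close> is
  independent of the weight: the reproducing formula takes n+1+s, the Forelli-Rudin estimate half of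
  its own exponent.\<close>

lemma integral_bkern_sums:
  fixes g :: "complex ^ 'n \<Rightarrow> complex"
  assumes s: "s > -1" and g: "holomorphic_ball g" and \<mu>: "\<mu> > 0"
    and int: "L1w s g"
    and u: "norm u = 1" and z: "z = \<rho> *\<^sub>R u" and \<rho>: "0 \<le> \<rho>" "\<rho> < 1"
  shows "(\<lambda>k. of_real (bcoef \<mu> k * \<rho> ^ k) * ((deriv ^^ k) (\<lambda>\<zeta>. g (\<zeta> *s u)) 0 / fact k *
         of_real (fact k / pochhammer (real CARD('n) + 1 + s) k * ball_mass TYPE('n) s)))
     sums (\<integral>w. wt s w *\<^sub>R (g w * bkern \<mu> (hinner z w)) \<partial>ball_leb)"
proof -
  define f where "f k w = of_real (bcoef \<mu> k * \<rho> ^ k) * (wt s w *\<^sub>R (g w * cnj (hinner w u) ^ k))" for k w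
  have gm: "measB g"
    by (rule borel_measurable_ball_leb_continuous[OF holomorphic_ball_continuous[OF g]])
  note [measurable] = gm
  have hu: "cmod (hinner w u) \<le> 1" if "w \<in> \<B>" for w
    using norm_hinner_le[of w u] u that by simp
  have b0: "bcoef \<mu> k * \<rho> ^ k \<ge> 0" for k using bcoef_pos[OF \<mu>, of k] \<rho> by simp
  have bs: "summable (\<lambda>k. bcoef \<mu> k * \<rho> ^ k)" using bcoef_sums[OF \<rho>, of \<mu>] by (rule sums_summable)
  have nf: "norm (f k w) \<le> (bcoef \<mu> k * \<rho> ^ k) * norm (wt s w *\<^sub>R g w)" if "w \<in> \<B>" for k w
  proof -
    have "cmod (g w) * cmod (hinner w u) ^ k \<le> cmod (g w)"
      using hu[OF that] by (intro mult_left_le power_le_one) auto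
    then show ?thesis
      using b0[of k] unfolding f_def norm_mult norm_scaleR norm_power complex_mod_cnj norm_of_real
      by (simp only: abs_of_nonneg) (intro mult_left_mono, auto)
  qed
  have f_int: "integrable ball_leb (f k)" for k
  proof (rule Bochner_Integration.integrable_bound[OF integrable_mult_right[OF integrable_norm[OF int]]])
    show "f k \<in> borel_measurable ball_leb" unfolding f_def by measurable
    show "AE w in ball_leb. norm (f k w) \<le> norm (bcoef \<mu> k * \<rho> ^ k * norm (wt s w *\<^sub>R g w))"
      by (intro AE_I2) (simp only: real_norm_def space_ball_leb order_trans[OF nf abs_ge_self])
  qed
  have "(\<lambda>k. integral\<^sup>L ball_leb (f k)) sums (\<integral>w. (\<Sum>k. f k w) \<partial>ball_leb)"
  proof (rule sums_integral)
    show "AE w in ball_leb. summable (\<lambda>k. norm (f k w))"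
    proof (rule AE_I2)
      fix w :: "complex ^ 'n" assume "w \<in> space ball_leb"
      then show "summable (\<lambda>k. norm (f k w))"
        using nf by (intro summable_comparison_test'[OF summable_mult2[OF bs], of 0 _ "norm (wt s w *\<^sub>R g w)"]) simp
    qed
    show "summable (\<lambda>k. \<integral>w. norm (f k w) \<partial>ball_leb)"
    proof (rule summable_comparison_test'[OF summable_mult2[OF bs], of 0 _ "\<integral>w. norm (wt s w *\<^sub>R g w) \<partial>ball_leb"])
      fix k
      have "(\<integral>w. norm (f k w) \<partial>ball_leb) \<le> (\<integral>w. bcoef \<mu> k * \<rho> ^ k * norm (wt s w *\<^sub>R g w) \<partial>ball_leb)"
        using nf by (intro integral_mono integrable_norm integrable_mult_right f_int int) auto
      then show "norm (\<integral>w. norm (f k w) \<partial>ball_leb) \<le> bcoef \<mu> k * \<rho> ^ k * (\<integral>w. norm (wt s w *\<^sub>R g w) \<partial>ball_leb)"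
        by simp
    qed
  qed (rule f_int)
  moreover have "integral\<^sup>L ball_leb (f k) = of_real (bcoef \<mu> k * \<rho> ^ k) * ((deriv ^^ k) (\<lambda>\<zeta>. g (\<zeta> *s u)) 0 / fact k *
         of_real (fact k / pochhammer (real CARD('n) + 1 + s) k * ball_mass TYPE('n) s))" for k
    unfolding f_def integral_coefficient[OF s g u int, of k, symmetric]
    by (rule integral_mult_right_zero)
  moreover have "(\<integral>w. (\<Sum>k. f k w) \<partial>ball_leb) = (\<integral>w. wt s w *\<^sub>R (g w * bkern \<mu> (hinner z w)) \<partial>ball_leb)"
  proof (rule Bochner_Integration.integral_cong[OF refl])
    fix w :: "complex ^ 'n" assume "w \<in> space ball_leb"
    then have w: "w \<in> \<B>" by simp
    have zw: "hinner z w = of_real \<rho> * cnj (hinner w u)"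
      unfolding z hinner_scaleR_left using hinner_commute[of u w] by simp
    have "cmod (hinner z w) \<le> \<rho> * 1"
      unfolding zw using hu[OF w] \<rho> by (simp add: norm_mult mult_left_le)
    then have "cmod (hinner z w) < 1" using \<rho> by simp
    then have "(\<lambda>k. of_real (bcoef \<mu> k) * hinner z w ^ k) sums bkern \<mu> (hinner z w)"
      by (rule bkern_sums)
    then have "(\<lambda>k. (of_real (wt s w) * g w) * (of_real (bcoef \<mu> k) * hinner z w ^ k)) sums ((of_real (wt s w) * g w) * bkern \<mu> (hinner z w))"
      by (rule sums_mult)
    then have "(\<lambda>k. f k w) sums ((of_real (wt s w) * g w) * bkern \<mu> (hinner z w))"
      unfolding zw by (simp add: f_def scaleR_conv_of_real power_mult_distrib mult_ac)
    then show "(\<Sum>k. f k w) = wt s w *\<^sub>R (g w * bkern \<mu> (hinner z w))"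
      by (simp add: sums_iff scaleR_conv_of_real mult.assoc)
  qed
  ultimately show ?thesis by simp
qed

text \<open>For the exponent n+1+s each kernel coefficient \<open>bcoef\<close> cancels the
  corresponding moment, and the series becomes the Taylor series of \<open>g\<close> on the complex
  line through \<open>z\<close>.\<close>

theorem bergman_reproducing:
  fixes g :: "complex ^ 'n \<Rightarrow> complex"
  assumes s: "s > -1" and g: "holomorphic_ball g"
    and int: "L1w s g" and z: "z \<in> \<B>"
  shows "(\<integral>w. wt s w *\<^sub>R (g w * bkern (real CARD('n) + 1 + s) (hinner z w)) \<partial>ball_leb)
     = of_real (ball_mass TYPE('n) s) * g z"
proof -
  let ?N = "real CARD('n) + 1 + s"
  have N: "?N > 0" using s by simp
  obtain u where u: "norm u = 1" "z = norm z *\<^sub>R u" by (rule unit_direction)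
  have nz: "0 \<le> norm z" "norm z < 1" using z by auto
  define h where "h = (\<lambda>\<zeta>. g (\<zeta> *s u))"
  have h: "h holomorphic_on \<B>"
    using holomorphic_ball_line[OF g, of "\<B>" 0 u] u unfolding h_def by simp
  have "(\<lambda>k. (deriv ^^ k) h 0 / fact k * (of_real (norm z) - 0) ^ k) sums h (of_real (norm z))"
    by (rule holomorphic_power_series[OF h]) (use z in auto)
  then have "(\<lambda>k. of_real (ball_mass TYPE('n) s) * ((deriv ^^ k) h 0 / fact k * of_real (norm z) ^ k)) sums (of_real (ball_mass TYPE('n) s) * h (of_real (norm z)))"
    by (intro sums_mult) simp
  moreover have "of_real (bcoef ?N k * norm z ^ k) * ((deriv ^^ k) h 0 / fact k *
         of_real (fact k / pochhammer ?N k * ball_mass TYPE('n) s)) = of_real (ball_mass TYPE('n) s) * ((deriv ^^ k) h 0 / fact k * of_real (norm z) ^ k)" for k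
  proof -
    have "bcoef ?N k * (fact k / pochhammer ?N k) = 1"
      using pochhammer_pos[OF N, of k] by (simp add: bcoef_def)
    then have 1: "of_real (bcoef ?N k) * of_real (fact k / pochhammer ?N k) = (1::complex)"
      by (metis of_real_1 of_real_mult)
    have "of_real (bcoef ?N k * norm z ^ k) * ((deriv ^^ k) h 0 / fact k * of_real (fact k / pochhammer ?N k * ball_mass TYPE('n) s))
      = (of_real (bcoef ?N k) * of_real (fact k / pochhammer ?N k)) * (of_real (ball_mass TYPE('n) s) * ((deriv ^^ k) h 0 / fact k * of_real (norm z) ^ k))"
      by (simp only: of_real_mult of_real_power mult_ac)
    then show ?thesis unfolding 1 by simp
  qed
  ultimately have "(\<integral>w. wt s w *\<^sub>R (g w * bkern ?N (hinner z w)) \<partial>ball_leb) = of_real (ball_mass TYPE('n) s) * h (of_real (norm z))"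
    using integral_bkern_sums[OF s g N int u(1) u(2) nz] unfolding h_def[symmetric] by (simp add: sums_unique2)
  then show ?thesis using u(2) by (simp add: h_def flip: scaleR_eq_smult)
qed

text \<open>The quotient of the two sides is a quotient of \<open>Gamma_series\<close> terms, the
  powers of n cancelling because 2a = b+c; it converges to Gamma values and is therefore bounded.
  \<open>Gamma_series\<close> at n contains the Pochhammer symbol of order n+1, whence the index
  shift in the proof.\<close>

lemma pochhammer_square_bound:
  fixes a b c :: real
  assumes "a > 0" "b > 0" "c > 0" and eq: "2 * a = b + c"
  obtains C where "C > 0" "\<And>k. (pochhammer a k)\<^sup>2 \<le> C * (pochhammer b k * pochhammer c k)"
proof -
  define R where "R k = (pochhammer a k)\<^sup>2 / (pochhammer b k * pochhammer c k)" for k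
  have pos: "pochhammer x k > 0" if "x > 0" for x :: real and k using that by (rule pochhammer_pos)
  have R: "R (Suc n) = Gamma_series b n * Gamma_series c n / (Gamma_series a n)\<^sup>2" for n
  proof -
    have "exp (b * ln (real n)) * exp (c * ln (real n)) = (exp (a * ln (real n)))\<^sup>2"
      by (simp add: exp_add[symmetric] exp_double[symmetric] distrib_right[symmetric] eq flip: mult.assoc)
    then show ?thesis
      using pos[OF assms(1), of "Suc n"] pos[OF assms(2), of "Suc n"] pos[OF assms(3), of "Suc n"]
      by (simp add: R_def Gamma_series_def field_simps power2_eq_square)
  qed
  have "(\<lambda>n. Gamma_series b n * Gamma_series c n / (Gamma_series a n)\<^sup>2) \<longlonglongrightarrow> Gamma b * Gamma c / (Gamma a)\<^sup>2"
    using Gamma_real_pos[OF \<open>a > 0\<close>] by (intro tendsto_intros) auto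
  then have "Bseq (\<lambda>n. R (Suc n))" unfolding R by (metis convergentI convergent_imp_Bseq)
  then obtain K where K: "K > 0" "\<And>n. norm (R (Suc n)) \<le> K" by (auto simp: Bseq_def)
  have "R k \<le> 1 + K" for k
  proof (cases k)
    case (Suc n) then show ?thesis using K(2)[of n] by simp
  qed (use K in \<open>simp add: R_def\<close>)
  then have "(pochhammer a k)\<^sup>2 \<le> (1 + K) * (pochhammer b k * pochhammer c k)" for k
    using pos[OF assms(2), of k] pos[OF assms(3), of k] by (simp add: R_def divide_le_eq)
  then show ?thesis using that[of "1 + K"] K by auto
qed

lemma higher_deriv_bkern:
  assumes \<rho>: "0 \<le> \<rho>" "\<rho> < 1"
  shows "(deriv ^^ k) (\<lambda>\<zeta>. bkern \<mu> (\<zeta> * of_real \<rho>)) 0 / fact k = of_real (bcoef \<mu> k * \<rho> ^ k)"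
proof -
  define F where "F = Abs_fps (\<lambda>k. complex_of_real (bcoef \<mu> k * \<rho> ^ k))"
  have sums: "(\<lambda>k. fps_nth F k * \<zeta> ^ k) sums bkern \<mu> (\<zeta> * of_real \<rho>)" if "cmod \<zeta> < 1" for \<zeta>
  proof -
    have "cmod (\<zeta> * of_real \<rho>) < 1"
      using that \<rho> by (simp add: norm_mult) (smt (verit) mult_left_le norm_ge_zero)
    from bkern_sums[OF this, of \<mu>] show ?thesis by (simp add: F_def power_mult_distrib mult_ac)
  qed
  have "fps_conv_radius F \<ge> norm (1 / 2 :: complex)"
    unfolding fps_conv_radius_def by (rule conv_radius_geI) (rule sums_summable[OF sums], simp)
  then have "fps_conv_radius F > 0" by (rule order.strict_trans2[rotated]) simp
  moreover have "eventually (\<lambda>\<zeta>. eval_fps F \<zeta> = bkern \<mu> (\<zeta> * of_real \<rho>)) (nhds 0)"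
  proof -
    have "eventually (\<lambda>\<zeta>::complex. \<zeta> \<in> \<B>) (nhds 0)" by (intro eventually_nhds_in_open) auto
    then show ?thesis by eventually_elim (use sums in \<open>auto simp: eval_fps_def sums_iff\<close>)
  qed
  ultimately have "(\<lambda>\<zeta>. bkern \<mu> (\<zeta> * of_real \<rho>)) has_fps_expansion F"
    by (simp add: has_fps_expansion_def)
  from fps_nth_fps_expansion[OF this, of k] show ?thesis by (simp add: F_def)
qed

text \<open>With \<open>\<mu>\<close> half the exponent, the integrand is the weight times |G|^2 for
  a holomorphic kernel power \<open>G\<close>. \<open>integral_bkern_sums\<close> then expands the
  integral in powers of |z|^2, and \<open>pochhammer_square_bound\<close> compares the coefficients
  with those of (1-|z|^2)^(-c).\<close>

theorem forelli_rudin: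
  assumes t: "t > -1" and c: "c > 0"
  obtains C where "C > 0" "\<And>z :: complex ^ 'n. z \<in> \<B> \<Longrightarrow>
    (\<integral>B w. wt t w * cmod (1 - hinner z w) powr (- (real CARD('n) + 1 + t + c)))
      \<le> ennreal (C * wt (- c) z)"
proof -
  let ?N = "real CARD('n) + 1 + t"
  define \<mu> where "\<mu> = (?N + c) / 2"
  have N: "?N > 0" and \<mu>: "\<mu> > 0" using t c by (auto simp: \<mu>_def)
  have eq: "2 * \<mu> = ?N + c" by (simp add: \<mu>_def)
  obtain K where K: "K > 0" "\<And>k. (pochhammer \<mu> k)\<^sup>2 \<le> K * (pochhammer ?N k * pochhammer c k)"
    using pochhammer_square_bound[OF \<mu> N c eq] by metis
  define m where "m = ball_mass TYPE('n) t"
  have m: "m > 0" unfolding m_def by (rule ball_mass_pos[OF t])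
  show ?thesis
  proof (rule that[of "K * m"])
    show "K * m > 0" using K m by simp
    fix z :: "complex ^ 'n" assume z: "z \<in> \<B>"
    obtain u where u: "norm u = 1" "z = norm z *\<^sub>R u" by (rule unit_direction)
    define \<rho> where "\<rho> = norm z"
    have \<rho>: "0 \<le> \<rho>" "\<rho> < 1" using z by (auto simp: \<rho>_def)
    define G where "G w = bkern \<mu> (hinner w z)" for w
    have G: "holomorphic_ball G" unfolding G_def by (rule holomorphic_ball_bkern) (use z in auto)
    have Gc: "continuous_on \<B> G" by (rule holomorphic_ball_continuous[OF G])
    have wz: "cmod (hinner w z) \<le> \<rho>" if "w \<in> \<B>" for w
      using norm_hinner_le[of w z] mult_right_le_one_le[of "norm z" "norm w"] that
      by (simp add: \<rho>_def mult.commute)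
    have nG: "cmod (G w) = cmod (1 - hinner w z) powr (- \<mu>)" if "w \<in> \<B>" for w
      unfolding G_def using wz[OF that] \<rho> by (intro cmod_bkern) auto
    have Gb: "cmod (G w) \<le> (1 - \<rho>) powr (- \<mu>)" if "w \<in> \<B>" for w
    proof -
      have "1 - \<rho> \<le> cmod (1 - hinner w z)"
        using wz[OF that] norm_triangle_ineq2[of 1 "hinner w z"] by simp
      then show ?thesis unfolding nG[OF that] using \<rho> \<mu> by (intro powr_mono2') auto
    qed
    have dint: "integrable ball_leb (\<lambda>w :: complex ^ 'n. wt t w)"
      by (rule integrableI_bounded) (auto simp: ball_mass[OF t])
    have bint: "integrable ball_leb (\<lambda>w. wt t w *\<^sub>R H w)"
      if H: "continuous_on \<B> H" "\<And>w. w \<in> \<B> \<Longrightarrow> norm (H w) \<le> B"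
      for H :: "complex ^ 'n \<Rightarrow> 'b::{banach, second_countable_topology}" and B
    proof (rule Bochner_Integration.integrable_bound[OF integrable_mult_left[OF dint, of B]])
      have [measurable]: "measB H" by (rule borel_measurable_ball_leb_continuous[OF H(1)])
      show "measB (\<lambda>w. wt t w *\<^sub>R H w)" by measurable
      have "norm (wt t w *\<^sub>R H w) \<le> norm (wt t w * B)" if "w \<in> \<B>" for w
      proof -
        have "norm (H w) \<le> \<bar>B\<bar>" using H(2)[OF that] by simp
        then show ?thesis by (simp add: abs_mult mult_left_mono)
      qed
      then show "AE w in ball_leb. norm (wt t w *\<^sub>R H w) \<le> norm (wt t w * B)" by auto
    qed
    have int: "integrable ball_leb (\<lambda>w. wt t w *\<^sub>R G w)" by (rule bint[OF Gc Gb])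
    define f where "f w = wt t w * cmod (1 - hinner z w) powr (- (?N + c))" for w
    have feq: "f w = wt t w * (cmod (G w))\<^sup>2" if "w \<in> \<B>" for w
    proof -
      have "cmod (1 - hinner z w) = cmod (cnj (1 - hinner w z))" by (simp add: hinner_commute[of z w])
      also have "\<dots> = cmod (1 - hinner w z)" by (rule complex_mod_cnj)
      finally have e: "cmod (1 - hinner z w) = cmod (1 - hinner w z)" .
      have "cmod (1 - hinner z w) powr (- (?N + c)) = (cmod (G w))\<^sup>2"
        unfolding nG[OF that] e power2_eq_square powr_add[symmetric] by (simp add: \<mu>_def)
      then show ?thesis by (simp add: f_def)
    qed
    have fint: "integrable ball_leb f"
    proof -
      have "integrable ball_leb (\<lambda>w. wt t w *\<^sub>R (cmod (G w))\<^sup>2)"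
      proof (rule bint)
        show "continuous_on \<B> (\<lambda>w. (cmod (G w))\<^sup>2)" by (intro continuous_intros Gc)
        show "norm ((cmod (G w))\<^sup>2) \<le> ((1 - \<rho>) powr (- \<mu>))\<^sup>2" if "w \<in> \<B>" for w
          using Gb[OF that] by (simp add: power_mono)
      qed
      then show ?thesis
        by (rule Bochner_Integration.integrable_cong[THEN iffD1, rotated -1]) (use feq in auto)
    qed
    have "(\<lambda>k. of_real (bcoef \<mu> k * \<rho> ^ k) * ((deriv ^^ k) (\<lambda>\<zeta>. G (\<zeta> *s u)) 0 / fact k *
         of_real (fact k / pochhammer ?N k * m))) sums (\<integral>w. wt t w *\<^sub>R (G w * bkern \<mu> (hinner z w)) \<partial>ball_leb)"
      unfolding m_def by (rule integral_bkern_sums[OF t G \<mu> int u(1) _ \<rho>]) (use u in \<open>simp add: \<rho>_def\<close>)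
    moreover have "(\<lambda>\<zeta>. G (\<zeta> *s u)) = (\<lambda>\<zeta>. bkern \<mu> (\<zeta> * of_real \<rho>))"
    proof
      fix \<zeta>
      have "hinner u z = of_real \<rho>"
        by (subst u(2)) (simp add: hinner_scaleR_right hinner_self u(1) \<rho>_def)
      then show "G (\<zeta> *s u) = bkern \<mu> (\<zeta> * of_real \<rho>)" by (simp add: G_def hinner_smult_left)
    qed
    moreover have "(\<integral>w. wt t w *\<^sub>R (G w * bkern \<mu> (hinner z w)) \<partial>ball_leb) = of_real (\<integral>w. f w \<partial>ball_leb)"
    proof -
      have "(\<integral>w. wt t w *\<^sub>R (G w * bkern \<mu> (hinner z w)) \<partial>ball_leb) = (\<integral>w. complex_of_real (f w) \<partial>ball_leb)"
      proof (rule Bochner_Integration.integral_cong[OF refl])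
        fix w :: "complex ^ 'n" assume "w \<in> space ball_leb"
        then have w: "w \<in> \<B>" by simp
        have "bkern \<mu> (hinner z w) = cnj (G w)"
          unfolding G_def hinner_commute[of z w] using wz[OF w] \<rho> by (intro bkern_cnj) auto
        then show "wt t w *\<^sub>R (G w * bkern \<mu> (hinner z w)) = of_real (f w)"
          using complex_norm_square[of "G w"] by (simp add: feq[OF w] scaleR_conv_of_real)
      qed
      then show ?thesis by simp
    qed
    ultimately have "(\<lambda>k. complex_of_real (bcoef \<mu> k * \<rho> ^ k * (bcoef \<mu> k * \<rho> ^ k * (fact k / pochhammer ?N k * m)))) sums of_real (\<integral>w. f w \<partial>ball_leb)"
      by (simp only: higher_deriv_bkern[OF \<rho>] of_real_mult)
    then have S1: "(\<lambda>k. bcoef \<mu> k * \<rho> ^ k * (bcoef \<mu> k * \<rho> ^ k * (fact k / pochhammer ?N k * m))) sums (\<integral>w. f w \<partial>ball_leb)"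
      by (simp only: sums_of_real_iff)
    have "\<rho>\<^sup>2 < 1" using \<rho> by (simp add: abs_square_less_1)
    then have S2: "(\<lambda>k. K * m * (bcoef c k * (\<rho>\<^sup>2) ^ k)) sums (K * m * (1 - \<rho>\<^sup>2) powr (- c))"
      by (intro sums_mult bcoef_sums) auto
    have "(\<integral>w. f w \<partial>ball_leb) \<le> K * m * (1 - \<rho>\<^sup>2) powr (- c)"
    proof (rule sums_le[OF _ S1 S2])
      fix k
      have pN: "pochhammer ?N k > 0" by (rule pochhammer_pos[OF N])
      have "(pochhammer \<mu> k)\<^sup>2 / pochhammer ?N k \<le> K * pochhammer c k"
        using K(2)[of k] pN by (simp add: divide_le_eq mult_ac)
      then have "(pochhammer \<mu> k)\<^sup>2 / pochhammer ?N k * (m * \<rho> ^ (2 * k) / fact k) \<le> K * pochhammer c k * (m * \<rho> ^ (2 * k) / fact k)"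
        using m \<rho> by (intro mult_right_mono) auto
      then show "bcoef \<mu> k * \<rho> ^ k * (bcoef \<mu> k * \<rho> ^ k * (fact k / pochhammer ?N k * m)) \<le> K * m * (bcoef c k * (\<rho>\<^sup>2) ^ k)"
        by (simp add: bcoef_def power2_eq_square power_mult[symmetric] mult_ac) (simp add: power_mult power2_eq_square power_mult_distrib mult_ac)
    qed
    then have "ennreal (\<integral>w. f w \<partial>ball_leb) \<le> ennreal (K * m * wt (- c) z)"
      by (simp add: defect_def \<rho>_def ennreal_leI)
    then show "(\<integral>B w. wt t w * cmod (1 - hinner z w) powr (- (?N + c))) \<le> ennreal (K * m * wt (- c) z)"
      unfolding f_def[symmetric]
      by (subst nn_integral_eq_integral[OF fint]) (simp add: f_def, simp only:)
  qed
qed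

lemma defect_alt: "of_real (defect z) = 1 - hinner z z"
  by (simp add: defect_def hinner_self)

section \<open>Automorphisms and the Bergman metric\<close>

text \<open>The involution of the ball exchanging 0 and \<open>u\<close>. The usual formula projects
  onto \<open>u\<close> and divides by |u|^2; with s = sqrt(1-|u|^2) the quotient (1-s)/|u|^2 is
  1/(1+s), and in this form u = 0 is not exceptional.\<close>

definition mobius :: "complex ^ 'n \<Rightarrow> complex ^ 'n \<Rightarrow> complex ^ 'n" where
  "mobius u w = (1 / (1 - hinner w u)) *s
     (u - of_real (sqrt (defect u)) *s w - (hinner w u / (1 + of_real (sqrt (defect u)))) *s u)"

lemma mobius_sqrt:
  assumes u: "u \<in> \<B>"
  shows "hinner u u = 1 - (of_real (sqrt (defect u)))\<^sup>2" "1 + complex_of_real (sqrt (defect u)) \<noteq> 0"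
proof -
  have "(complex_of_real (sqrt (defect u)))\<^sup>2 = of_real (defect u)"
    using defect_pos[OF u] by (simp flip: of_real_power)
  then show "hinner u u = 1 - (of_real (sqrt (defect u)))\<^sup>2" by (simp add: defect_alt)
  have "1 + sqrt (defect u) > 0" using defect_pos[OF u] by (simp add: add_pos_nonneg)
  then show "1 + complex_of_real (sqrt (defect u)) \<noteq> 0"
    by (metis less_irrefl of_real_1 of_real_add of_real_eq_0_iff)
qed

lemma one_minus_hinner_nonzero:
  "z \<in> \<B> \<Longrightarrow> w \<in> \<B> \<Longrightarrow> 1 - hinner z w \<noteq> 0"
  using norm_hinner_less_1[of z w] by auto

text \<open>The source of the metric facts that follow: z = w gives \<open>defect_mobius\<close>, w
  = 0 gives \<open>one_minus_hinner_mobius\<close>, and quotients give the invariance of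
  \<open>bergman_rho\<close>.\<close>

lemma mobius_identity:
  assumes u: "u \<in> \<B>" and z: "z \<in> \<B>" and w: "w \<in> \<B>"
  shows "1 - hinner (mobius u z) (mobius u w)
    = of_real (defect u) * (1 - hinner z w) / ((1 - hinner z u) * (1 - hinner u w))"
proof -
  define s where "s = complex_of_real (sqrt (defect u))"
  have s: "hinner u u = 1 - s\<^sup>2" "1 + s \<noteq> 0" using mobius_sqrt[OF u] by (auto simp: s_def)
  have cs: "cnj s = s" by (simp add: s_def)
  have du: "of_real (defect u) = s\<^sup>2" unfolding defect_alt s by simp
  define c where "c = hinner z u"
  define d where "d = hinner u w"
  have wu: "hinner w u = cnj d" by (simp add: d_def hinner_commute[of w u])
  have nz: "1 - c \<noteq> 0" "1 - d \<noteq> 0"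
    unfolding c_def d_def using one_minus_hinner_nonzero u z w by auto
  have k: "(1 - s\<^sup>2) / (1 + s) = 1 - s"
    using s(2) by (simp add: field_simps power2_eq_square)
  have N: "hinner (u - s *s z - (c / (1 + s)) *s u) (u - s *s w - (cnj d / (1 + s)) *s u)
     = 1 - s\<^sup>2 - c - d + s\<^sup>2 * hinner z w + c * d"
  proof -
    have "hinner (u - s *s z - (c / (1 + s)) *s u) (u - s *s w - (cnj d / (1 + s)) *s u)
      = (1 - s\<^sup>2) - s * d - d * ((1 - s\<^sup>2) / (1 + s)) - s * c + s * s * hinner z w + s * c * d / (1 + s)
        - c * ((1 - s\<^sup>2) / (1 + s)) + c * s * d / (1 + s) + c * d * ((1 - s\<^sup>2) / (1 + s)) / (1 + s)"
      unfolding hinner_diff_left hinner_diff_right hinner_smult_left hinner_smult_right s(1)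
        c_def[symmetric] d_def[symmetric]
      by (simp add: cs algebra_simps) (simp add: add_divide_distrib diff_divide_distrib)
    also have "\<dots> = (1 - s\<^sup>2) - s * d - d * (1 - s) - s * c + s * s * hinner z w - c * (1 - s)
        + (s * c * d / (1 + s) + c * s * d / (1 + s) + c * d * (1 - s) / (1 + s))"
      unfolding k by simp
    also have "s * c * d / (1 + s) + c * s * d / (1 + s) + c * d * (1 - s) / (1 + s) = c * d * (1 + s) / (1 + s)"
      by (simp add: algebra_simps flip: add_divide_distrib)
    also have "\<dots> = c * d" using s(2) by simp
    finally have "hinner (u - s *s z - (c / (1 + s)) *s u) (u - s *s w - (cnj d / (1 + s)) *s u)
      = (1 - s\<^sup>2) - s * d - d * (1 - s) - s * c + s * s * hinner z w - c * (1 - s) + c * d" .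
    also have "\<dots> = 1 - s\<^sup>2 - c - d + s\<^sup>2 * hinner z w + c * d"
      by (simp add: algebra_simps power2_eq_square)
    finally show ?thesis .
  qed
  have "hinner (mobius u z) (mobius u w) = (1 - s\<^sup>2 - c - d + s\<^sup>2 * hinner z w + c * d) / ((1 - c) * (1 - d))"
    unfolding mobius_def s_def[symmetric] wu c_def[symmetric] hinner_smult_left hinner_smult_right N
    by simp
  then have "1 - hinner (mobius u z) (mobius u w)
     = ((1 - c) * (1 - d) - (1 - s\<^sup>2 - c - d + s\<^sup>2 * hinner z w + c * d)) / ((1 - c) * (1 - d))"
    using nz by (simp add: diff_divide_distrib)
  also have "(1 - c) * (1 - d) - (1 - s\<^sup>2 - c - d + s\<^sup>2 * hinner z w + c * d) = s\<^sup>2 * (1 - hinner z w)"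
    by (simp add: algebra_simps)
  finally show ?thesis
    unfolding du c_def[symmetric] d_def[symmetric] .
qed

lemma mobius_zero: "mobius u 0 = u"
  by (simp add: mobius_def)

lemma defect_mobius:
  assumes u: "u \<in> \<B>" and w: "w \<in> \<B>"
  shows "defect (mobius u w) = defect u * defect w / (cmod (1 - hinner w u))\<^sup>2"
proof -
  have "complex_of_real (defect (mobius u w)) = of_real (defect u * defect w / (cmod (1 - hinner w u))\<^sup>2)"
    unfolding defect_alt mobius_identity[OF u w w] of_real_divide of_real_mult complex_norm_square
    by (simp add: hinner_commute[of u w])
  then show ?thesis using of_real_eq_iff by blast
qed

lemma mobius_in_ball:
  assumes u: "u \<in> \<B>" and w: "w \<in> \<B>"
  shows "mobius u w \<in> \<B>"
proof -
  have "defect (mobius u w) > 0"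
    unfolding defect_mobius[OF u w] using defect_pos[OF u] defect_pos[OF w] one_minus_hinner_nonzero[OF w u]
    by simp
  then show ?thesis by (simp add: defect_def abs_square_less_1)
qed

lemma one_minus_hinner_mobius:
  assumes u: "u \<in> \<B>" and w: "w \<in> \<B>"
  shows "1 - hinner (mobius u w) u = of_real (defect u) / (1 - hinner w u)"
  using mobius_identity[OF u w, of 0] by (simp add: mobius_zero)

lemma mobius_mobius:
  assumes u: "u \<in> \<B>" and w: "w \<in> \<B>"
  shows "mobius u (mobius u w) = w"
proof -
  define s where "s = complex_of_real (sqrt (defect u))"
  have s: "hinner u u = 1 - s\<^sup>2" "1 + s \<noteq> 0" using mobius_sqrt[OF u] by (auto simp: s_def)
  have du: "of_real (defect u) = s\<^sup>2" unfolding defect_alt s by simp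
  have s0: "s \<noteq> 0" using defect_pos[OF u] by (simp add: s_def)
  define c where "c = hinner w u"
  have nz: "1 - c \<noteq> 0" unfolding c_def by (rule one_minus_hinner_nonzero[OF w u])
  have h: "hinner (mobius u w) u = 1 - s\<^sup>2 / (1 - c)"
    using one_minus_hinner_mobius[OF u w] unfolding du c_def by (simp add: algebra_simps)
  have m: "mobius u w $ i = (u $ i - s * w $ i - c / (1 + s) * u $ i) / (1 - c)" for i
    by (simp add: mobius_def s_def[symmetric] c_def[symmetric] diff_divide_distrib mult.commute)
  have "mobius u (mobius u w) $ i = w $ i" for i
  proof -
    have "mobius u (mobius u w) $ i = (1 - c) / s\<^sup>2 * (u $ i - s * (mobius u w $ i) - (1 - s\<^sup>2 / (1 - c)) / (1 + s) * u $ i)"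
      by (subst mobius_def)
         (simp only: vector_smult_component vector_minus_component s_def[symmetric] h, simp)
    also have "\<dots> = w $ i"
      unfolding m using nz s0 s(2) by (simp add: divide_simps) (simp add: algebra_simps power2_eq_square power3_eq_cube)
    finally show ?thesis .
  qed
  then show ?thesis by (simp add: vec_eq_iff)
qed

lemma bergman_rho_sq_arg:
  assumes z: "z \<in> \<B>" and w: "w \<in> \<B>"
  shows "(norm (mobius z w))\<^sup>2 = 1 - defect z * defect w / (cmod (1 - hinner z w))\<^sup>2"
proof -
  have "cmod (1 - hinner w z) = cmod (cnj (1 - hinner z w))" by (simp add: hinner_commute[of w z])
  also have "\<dots> = cmod (1 - hinner z w)" by (rule complex_mod_cnj)
  finally show ?thesis using defect_mobius[OF z w] by (simp add: defect_def)
qed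

lemma bergman_rho_mobius:
  assumes z: "z \<in> \<B>" and w: "w \<in> \<B>"
  shows "bergman_rho z w = norm (mobius z w)"
  unfolding bergman_rho_def defect_def[symmetric] bergman_rho_sq_arg[OF z w, symmetric] by simp

lemma cmod_one_minus_hinner_commute: "cmod (1 - hinner w z) = cmod (1 - hinner z w)"
proof -
  have "cmod (1 - hinner w z) = cmod (cnj (1 - hinner z w))" by (simp add: hinner_commute[of w z])
  then show ?thesis by (simp only: complex_mod_cnj)
qed

lemma bergman_rho_commute: "bergman_rho z w = bergman_rho w z"
  unfolding bergman_rho_def cmod_one_minus_hinner_commute[of z w] by (simp add: mult.commute)

lemma bergman_dist_artanh: "bergman_dist z w = artanh (bergman_rho z w)"
  by (simp add: bergman_dist_def artanh_def)

lemma bergman_dist_commute: "bergman_dist z w = bergman_dist w z"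
  by (simp add: bergman_dist_def bergman_rho_commute)

lemma tanh_artanh_real: "\<bar>x\<bar> < 1 \<Longrightarrow> tanh (artanh x) = (x::real)"
proof -
  assume x: "\<bar>x\<bar> < 1"
  have p: "(1 + x) / (1 - x) > 0" using x by (auto intro!: divide_pos_pos)
  have "artanh x = ln (sqrt ((1 + x) / (1 - x)))"
    using p by (simp add: artanh_def ln_sqrt)
  then have "tanh (artanh x) = ((1 + x) / (1 - x) - 1) / ((1 + x) / (1 - x) + 1)"
    using p by (simp add: tanh_ln_real)
  also have "\<dots> = x" using x by (simp add: field_simps)
  finally show ?thesis .
qed

lemma bergman_rho_bounds:
  assumes z: "z \<in> \<B>" and w: "w \<in> \<B>"
  shows "0 \<le> bergman_rho z w" "bergman_rho z w < 1"
  using mobius_in_ball[OF z w] by (auto simp: bergman_rho_mobius[OF z w])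

lemma tanh_bergman_dist:
  assumes z: "z \<in> \<B>" and w: "w \<in> \<B>"
  shows "tanh (bergman_dist z w) = bergman_rho z w"
  unfolding bergman_dist_artanh by (rule tanh_artanh_real) (use bergman_rho_bounds[OF z w] in auto)

lemma bergman_rho_sq:
  assumes z: "z \<in> \<B>" and w: "w \<in> \<B>"
  shows "1 - (bergman_rho z w)\<^sup>2 = defect z * defect w / (cmod (1 - hinner z w))\<^sup>2"
  unfolding bergman_rho_mobius[OF z w] bergman_rho_sq_arg[OF z w] by simp

lemma bergman_dist_nonneg: "z \<in> \<B> \<Longrightarrow> w \<in> \<B> \<Longrightarrow> bergman_dist z w \<ge> 0"
  using tanh_bergman_dist[of z w] bergman_rho_bounds[of z w] tanh_real_nonneg_iff by metis

lemma bergman_rho_mobius_invariant: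
  assumes u: "u \<in> \<B>" and z: "z \<in> \<B>" and w: "w \<in> \<B>"
  shows "bergman_rho (mobius u z) (mobius u w) = bergman_rho z w"
proof -
  have "1 - (bergman_rho (mobius u z) (mobius u w))\<^sup>2 = 1 - (bergman_rho z w)\<^sup>2"
    unfolding bergman_rho_sq[OF mobius_in_ball[OF u z] mobius_in_ball[OF u w]] bergman_rho_sq[OF z w]
      defect_mobius[OF u z] defect_mobius[OF u w] mobius_identity[OF u z w]
      norm_divide norm_mult norm_of_real cmod_one_minus_hinner_commute[of u w]
    using defect_pos[OF u] one_minus_hinner_nonzero[OF z u] one_minus_hinner_nonzero[OF w u] one_minus_hinner_nonzero[OF z w]
    by (simp add: power_mult_distrib power_divide field_simps power2_eq_square)
  then show ?thesis
    using bergman_rho_bounds(1)[OF mobius_in_ball[OF u z] mobius_in_ball[OF u w]] bergman_rho_bounds(1)[OF z w]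
    by (simp add: power2_eq_iff_nonneg)
qed

lemma bergman_dist_mobius_invariant:
  "u \<in> \<B> \<Longrightarrow> z \<in> \<B> \<Longrightarrow> w \<in> \<B> \<Longrightarrow>
    bergman_dist (mobius u z) (mobius u w) = bergman_dist z w"
  by (simp add: bergman_dist_def bergman_rho_mobius_invariant)

text \<open>Moving \<open>u\<close> to the origin, \<open>|1 - \<langle>\<phi>\<^sub>u z, \<phi>\<^sub>u w\<rangle>| \<le> 1 + \<rho>(u,z) \<rho>(u,w)\<close> is the addition theorem for \<open>tanh\<close>.\<close>

lemma bergman_dist_triangle:
  assumes u: "u \<in> \<B>" and z: "z \<in> \<B>" and w: "w \<in> \<B>"
  shows "bergman_dist z w \<le> bergman_dist z u + bergman_dist u w"
proof -
  define a where "a = bergman_rho u z"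
  define b where "b = bergman_rho u w"
  define z' where "z' = mobius u z"
  define w' where "w' = mobius u w"
  have zw: "z' \<in> \<B>" "w' \<in> \<B>" unfolding z'_def w'_def by (intro mobius_in_ball u z w)+
  have ab: "0 \<le> a" "a < 1" "0 \<le> b" "b < 1" using bergman_rho_bounds u z w by (auto simp: a_def b_def)
  have na: "norm z' = a" "norm w' = b" by (simp_all add: a_def b_def z'_def w'_def bergman_rho_mobius[OF u z] bergman_rho_mobius[OF u w])
  have "cmod (1 - hinner z' w') \<le> 1 + a * b"
    using norm_triangle_ineq4[of 1 "hinner z' w'"] norm_hinner_le[of z' w'] na by simp
  then have le: "(cmod (1 - hinner z' w'))\<^sup>2 \<le> (1 + a * b)\<^sup>2" by (rule power_mono) simp
  have p: "(cmod (1 - hinner z' w'))\<^sup>2 > 0" using one_minus_hinner_nonzero[OF zw] by simp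
  have ab1: "1 + a * b > 0" using ab by (simp add: add_pos_nonneg)
  have "(1 - a\<^sup>2) * (1 - b\<^sup>2) / (1 + a * b)\<^sup>2 \<le> (1 - a\<^sup>2) * (1 - b\<^sup>2) / (cmod (1 - hinner z' w'))\<^sup>2"
    using le p ab by (intro divide_left_mono mult_nonneg_nonneg) (auto simp: abs_square_le_1 zero_less_mult_iff)
  also have "\<dots> = 1 - (bergman_rho z' w')\<^sup>2" using bergman_rho_sq[OF zw] by (simp add: defect_def na)
  also have "(1 - a\<^sup>2) * (1 - b\<^sup>2) / (1 + a * b)\<^sup>2 = 1 - ((a + b) / (1 + a * b))\<^sup>2"
  proof -
    have "(1 - a\<^sup>2) * (1 - b\<^sup>2) = (1 + a * b)\<^sup>2 - (a + b)\<^sup>2" by (simp add: algebra_simps power2_eq_square)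
    then show ?thesis using ab1 by (simp add: power_divide diff_divide_distrib)
  qed
  finally have "(bergman_rho z' w')\<^sup>2 \<le> ((a + b) / (1 + a * b))\<^sup>2" by simp
  then have "bergman_rho z' w' \<le> (a + b) / (1 + a * b)"
    by (rule power2_le_imp_le) (use ab ab1 in auto)
  also have "\<dots> = tanh (bergman_dist z u + bergman_dist u w)"
    by (subst tanh_add) (simp_all add: tanh_bergman_dist[OF u z] tanh_bergman_dist[OF u w] bergman_dist_commute[of z u] a_def b_def)
  finally have "tanh (bergman_dist z w) \<le> tanh (bergman_dist z u + bergman_dist u w)"
    by (simp add: tanh_bergman_dist[OF z w] z'_def w'_def bergman_rho_mobius_invariant[OF u z w])
  then show ?thesis by simp
qed

lemma bergman_ball_subset_ball: "bergman_ball z r \<subseteq> \<B>"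
  by (auto simp: bergman_ball_def)

lemma bergman_ball_rho:
  assumes z: "z \<in> \<B>"
  shows "bergman_ball z r = {w \<in> \<B>. bergman_rho z w < tanh r}"
proof -
  have "bergman_dist z w < r \<longleftrightarrow> bergman_rho z w < tanh r" if "w \<in> \<B>" for w
    using tanh_bergman_dist[OF z that] tanh_real_less_iff by metis
  then show ?thesis by (auto simp: bergman_ball_def)
qed

text \<open>Writing \<open>w = \<phi>\<^sub>z(\<zeta>)\<close> with \<open>|\<zeta>| < tanh r\<close>, all ratios become explicit in \<open>\<zeta>\<close>.\<close>

lemma bergman_ball_comparable:
  fixes r :: real
  assumes r: "r > 0"
  obtains K where "K \<ge> 1"
    "\<And>z w :: complex ^ 'n. z \<in> \<B> \<Longrightarrow> w \<in> bergman_ball z r \<Longrightarrow> defect w \<le> K * defect z"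
    "\<And>z w v :: complex ^ 'n. z \<in> \<B> \<Longrightarrow> w \<in> bergman_ball z r \<Longrightarrow> v \<in> \<B> \<Longrightarrow>
       cmod (1 - hinner w v) \<le> K * cmod (1 - hinner z v)"
proof -
  define R where "R = tanh r"
  have R: "0 < R" "R < 1" using r by (auto simp: R_def tanh_real_lt_1)
  \<comment> \<open>One constant for both comparisons: the first needs 1/(1-R)^2, the second
    2/(1-R).\<close>
  define K where "K = 4 / (1 - R)\<^sup>2"
  have sq: "(1 - R)\<^sup>2 \<le> 1" using R by (simp add: power_le_one)
  have sq0: "(1 - R)\<^sup>2 > 0" using R by simp
  have K1: "K \<ge> 1" using sq sq0 by (simp add: K_def le_divide_eq)
  have K2: "2 / (1 - R) \<le> K"
  proof -
    have "2 / (1 - R) = 2 * (1 - R) / (1 - R)\<^sup>2" using R by (simp add: power2_eq_square divide_simps)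
    also have "\<dots> \<le> 4 / (1 - R)\<^sup>2" using R sq0 by (intro divide_right_mono) auto
    finally show ?thesis by (simp add: K_def)
  qed
  show ?thesis
  proof (rule that[of K])
    show "K \<ge> 1" by (rule K1)
    fix z w :: "complex ^ 'n" assume z: "z \<in> \<B>" and w: "w \<in> bergman_ball z r"
    have wb: "w \<in> \<B>" using w bergman_ball_subset_ball by blast
    define \<zeta> where "\<zeta> = mobius z w"
    have \<zeta>: "\<zeta> \<in> \<B>" unfolding \<zeta>_def by (rule mobius_in_ball[OF z wb])
    have wz: "w = mobius z \<zeta>" unfolding \<zeta>_def by (rule mobius_mobius[OF z wb, symmetric])
    have n\<zeta>: "norm \<zeta> < R" using w wb by (simp add: bergman_ball_rho[OF z] bergman_rho_mobius[OF z wb] \<zeta>_def R_def)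
    have lb: "1 - R \<le> cmod (1 - hinner \<zeta> v)" if "v \<in> \<B>" for v
    proof -
      have "cmod (hinner \<zeta> v) \<le> norm \<zeta> * norm v" by (rule norm_hinner_le)
      also have "\<dots> \<le> R * 1" using n\<zeta> that R by (intro mult_mono) auto
      finally show ?thesis using norm_triangle_ineq2[of 1 "hinner \<zeta> v"] by simp
    qed
    have "defect w = defect z * (defect \<zeta> / (cmod (1 - hinner \<zeta> z))\<^sup>2)"
      unfolding wz defect_mobius[OF z \<zeta>] by simp
    also have "\<dots> \<le> defect z * K"
    proof (intro mult_left_mono)
      have "defect \<zeta> / (cmod (1 - hinner \<zeta> z))\<^sup>2 \<le> 1 / (1 - R)\<^sup>2"
        using lb[OF z] R defect_pos[OF \<zeta>] by (intro frac_le defect_le_1 power_mono) auto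
      also have "\<dots> \<le> K" unfolding K_def by (intro divide_right_mono) auto
      finally show "defect \<zeta> / (cmod (1 - hinner \<zeta> z))\<^sup>2 \<le> K" .
    qed (use defect_pos[OF z] in auto)
    finally show "defect w \<le> K * defect z" by (simp add: mult.commute)
    fix v :: "complex ^ 'n" assume v: "v \<in> \<B>"
    define \<eta> where "\<eta> = mobius z v"
    have \<eta>: "\<eta> \<in> \<B>" unfolding \<eta>_def by (rule mobius_in_ball[OF z v])
    have vz: "v = mobius z \<eta>" unfolding \<eta>_def by (rule mobius_mobius[OF z v, symmetric])
    have z0: "z = mobius z 0" by (simp add: mobius_zero)
    have "cmod (1 - hinner w v) = cmod (1 - hinner \<zeta> \<eta>) / cmod (1 - hinner \<zeta> z) * cmod (1 - hinner z v)"
    proof -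
      have 1: "1 - hinner z v = of_real (defect z) / (1 - hinner z \<eta>)"
        using mobius_identity[OF z _ \<eta>, of 0] vz by (simp add: mobius_zero)
      have 2: "1 - hinner w v = of_real (defect z) * (1 - hinner \<zeta> \<eta>) / ((1 - hinner \<zeta> z) * (1 - hinner z \<eta>))"
        unfolding wz vz by (rule mobius_identity[OF z \<zeta> \<eta>])
      show ?thesis unfolding 1 2 by (simp add: norm_divide norm_mult)
    qed
    also have "\<dots> \<le> K * cmod (1 - hinner z v)"
    proof (intro mult_right_mono)
      have "cmod (1 - hinner \<zeta> \<eta>) \<le> 2"
        using norm_triangle_ineq4[of 1 "hinner \<zeta> \<eta>"] norm_hinner_less_1[OF \<zeta>, of \<eta>] \<eta> by simp
      then have "cmod (1 - hinner \<zeta> \<eta>) / cmod (1 - hinner \<zeta> z) \<le> 2 / (1 - R)"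
        using lb[OF z] R by (intro frac_le) auto
      then show "cmod (1 - hinner \<zeta> \<eta>) / cmod (1 - hinner \<zeta> z) \<le> K" using K2 by simp
    qed auto
    finally show "cmod (1 - hinner w v) \<le> K * cmod (1 - hinner z v)" .
  qed
qed

lemma bergman_ball_measurable [measurable]: "bergman_ball z r \<in> sets borel"
proof -
  have "bergman_ball z r = \<B> \<inter> {w. bergman_dist z w < r}" by (auto simp: bergman_ball_def)
  also have "\<dots> \<in> sets borel"
    unfolding bergman_dist_def bergman_rho_def by measurable
  finally show ?thesis .
qed

text \<open>The points cut the geodesic from \<open>u\<close> to \<open>v\<close> into equal
  hyperbolic steps; after \<open>u\<close> is moved to the origin it is a Euclidean radius. The
  upper and the lower bound on the defect control its positive and its negative powers along the
  chain.\<close>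

lemma bergman_chain:
  fixes u v :: "complex ^ 'n"
  assumes u: "u \<in> \<B>" and v: "v \<in> \<B>" and \<delta>: "\<delta> > 0"
  defines "E \<equiv> cmod (1 - hinner u v)"
  obtains m :: nat and p :: "nat \<Rightarrow> complex ^ 'n" where
    "p 0 = u" "p m = v" "real m \<le> 1 + bergman_dist u v / \<delta>"
    "\<And>j. j \<le> m \<Longrightarrow> p j \<in> \<B>"
    "\<And>j. j < m \<Longrightarrow> bergman_dist (p j) (p (Suc j)) \<le> \<delta>"
    "\<And>j. j \<le> m \<Longrightarrow> defect (p j) \<le> 4 * E"
    "\<And>j. j \<le> m \<Longrightarrow> (defect u)\<^sup>2 * defect v / (4 * E\<^sup>2) \<le> defect (p j)"
proof -
  define d where "d = bergman_dist u v"
  have d0: "d \<ge> 0" unfolding d_def by (rule bergman_dist_nonneg[OF u v])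
  \<comment> \<open>At least one step is taken, so that dividing by \<open>m\<close> is legitimate
    even when u = v.\<close>
  define m where "m = nat \<lfloor>d / \<delta>\<rfloor> + 1"
  have m1: "real m \<le> 1 + d / \<delta>" using d0 \<delta> by (simp add: m_def)
  have "d / \<delta> \<le> real m" using d0 \<delta> by (simp add: m_def) linarith
  then have m2: "d / real m \<le> \<delta>" using \<delta> by (simp add: m_def field_simps)
  have m0: "m > 0" by (simp add: m_def)
  define \<zeta> where "\<zeta> = mobius u v"
  have \<zeta>: "\<zeta> \<in> \<B>" unfolding \<zeta>_def by (rule mobius_in_ball[OF u v])
  have v\<zeta>: "v = mobius u \<zeta>" unfolding \<zeta>_def by (rule mobius_mobius[OF u v, symmetric])
  define T where "T = norm \<zeta>"
  have T: "T = tanh d" unfolding T_def d_def \<zeta>_def tanh_bergman_dist[OF u v] bergman_rho_mobius[OF u v] ..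
  obtain e where e: "norm e = 1" "\<zeta> = norm \<zeta> *\<^sub>R e" by (rule unit_direction)
  have \<zeta>e: "\<zeta> = T *\<^sub>R e" using e unfolding T_def by simp
  define t where "t j = tanh (real j * (d / real m))" for j
  have t0: "0 \<le> t j" for j using d0 by (simp add: t_def tanh_real_nonneg_iff)
  have t1: "t j < 1" for j by (simp add: t_def tanh_real_lt_1)
  have tT: "t j \<le> T" if "j \<le> m" for j
    unfolding T t_def using that d0 m0 by (simp add: divide_le_eq mult.commute mult_left_mono)
  define p where "p j = mobius u (t j *\<^sub>R e)" for j
  have te: "t j *\<^sub>R e \<in> \<B>" for j using t0[of j] t1[of j] e by simp
  have pin: "p j \<in> \<B>" for j unfolding p_def by (rule mobius_in_ball[OF u te])
  have step: "bergman_dist (p j) (p (Suc j)) = d / real m" for j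
  proof -
    let ?a = "t j" and ?b = "t (Suc j)"
    have ab: "1 - ?a * ?b > 0"
      using mult_strict_mono[OF t1[of j] t1[of "Suc j"]] t0[of j] t0[of "Suc j"] by simp
    have diff: "tanh (d / real m) = (?b - ?a) / (1 - ?a * ?b)"
    proof -
      have "tanh (d / real m) = tanh ((real (Suc j) * (d / real m)) + - (real j * (d / real m)))"
        by (simp add: distrib_right add_divide_distrib)
      also have "\<dots> = (?b - ?a) / (1 - ?a * ?b)"
        by (subst tanh_add) (simp_all add: t_def mult.commute)
      finally show ?thesis .
    qed
    have "cmod (1 - hinner (?a *\<^sub>R e) (?b *\<^sub>R e)) = 1 - ?a * ?b"
    proof -
      have "1 - hinner (?a *\<^sub>R e) (?b *\<^sub>R e) = of_real (1 - ?a * ?b)"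
        by (simp add: hinner_scaleR_left hinner_scaleR_right hinner_self e)
      then show ?thesis using ab by (simp only: norm_of_real abs_of_pos)
    qed
    moreover have "defect (?a *\<^sub>R e) = 1 - ?a\<^sup>2" "defect (?b *\<^sub>R e) = 1 - ?b\<^sup>2"
      using t0 by (auto simp: defect_def e)
    ultimately have "1 - (bergman_rho (?a *\<^sub>R e) (?b *\<^sub>R e))\<^sup>2 = (1 - ?a\<^sup>2) * (1 - ?b\<^sup>2) / (1 - ?a * ?b)\<^sup>2"
      using bergman_rho_sq[OF te te, of j "Suc j"] by simp
    also have "\<dots> = 1 - ((?b - ?a) / (1 - ?a * ?b))\<^sup>2"
    proof -
      have "(1 - ?a\<^sup>2) * (1 - ?b\<^sup>2) = (1 - ?a * ?b)\<^sup>2 - (?b - ?a)\<^sup>2" by (simp add: algebra_simps power2_eq_square)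
      then show ?thesis unfolding power_divide using ab by (subst \<open>(1 - ?a\<^sup>2) * (1 - ?b\<^sup>2) = _\<close>, subst diff_divide_distrib) simp
    qed
    finally have "(bergman_rho (?a *\<^sub>R e) (?b *\<^sub>R e))\<^sup>2 = (tanh (d / real m))\<^sup>2" unfolding diff by simp
    then have "bergman_rho (?a *\<^sub>R e) (?b *\<^sub>R e) = tanh (d / real m)"
      using bergman_rho_bounds(1)[OF te te] d0 by (simp add: power2_eq_iff_nonneg tanh_real_nonneg_iff)
    then have "tanh (bergman_dist (?a *\<^sub>R e) (?b *\<^sub>R e)) = tanh (d / real m)"
      using tanh_bergman_dist[OF te te] by simp
    then have "bergman_dist (?a *\<^sub>R e) (?b *\<^sub>R e) = d / real m" by simp
    then show ?thesis unfolding p_def using bergman_dist_mobius_invariant[OF u te te] by simp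
  qed
  define c where "c = hinner e u"
  have c1: "cmod c < 1" unfolding c_def by (rule norm_hinner_less_1') (use e u in auto)
  have du: "defect u > 0" by (rule defect_pos[OF u])
  have Ev: "E = defect u / cmod (1 - of_real T * c)"
  proof -
    have "E = cmod (1 - hinner v u)" unfolding E_def by (rule cmod_one_minus_hinner_commute)
    also have "1 - hinner v u = of_real (defect u) / (1 - hinner \<zeta> u)"
      unfolding v\<zeta> by (rule one_minus_hinner_mobius[OF u \<zeta>])
    also have "hinner \<zeta> u = of_real T * c" unfolding c_def by (subst \<zeta>e) (rule hinner_scaleR_left)
    finally show ?thesis using du by (simp add: norm_divide)
  qed
  have T1: "0 \<le> T" "T < 1" using d0 by (auto simp: T tanh_real_lt_1 tanh_real_nonneg_iff)
  have dpj: "defect (p j) = defect u * (1 - (t j)\<^sup>2) / (cmod (1 - of_real (t j) * c))\<^sup>2" for j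
    unfolding p_def defect_mobius[OF u te] using t0 by (simp add: defect_def e c_def hinner_scaleR_left)
  have low: "1 - s \<le> cmod (1 - of_real s * c)" if "0 \<le> s" "s \<le> 1" for s
  proof -
    have "cmod (of_real s * c) \<le> s * 1" using that c1 by (simp add: norm_mult mult_left_le)
    then show ?thesis using norm_triangle_ineq2[of 1 "of_real s * c"] by simp
  qed
  have pos: "cmod (1 - of_real s * c) > 0" if "0 \<le> s" "s < 1" for s
    using low[OF that(1) less_imp_le[OF that(2)]] that by linarith
  show ?thesis
  proof (rule that[of p m])
    show "p 0 = u" by (simp add: p_def t_def mobius_zero)
    show "p m = v" using m0 by (simp add: p_def t_def v\<zeta> \<zeta>e T)
    show "real m \<le> 1 + bergman_dist u v / \<delta>" using m1 by (simp add: d_def)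
    show "p j \<in> \<B>" for j by (rule pin)
    show "bergman_dist (p j) (p (Suc j)) \<le> \<delta>" for j using step m2 by simp
    fix j assume j: "j \<le> m"
    let ?P = "cmod (1 - of_real (t j) * c)"
    have P: "?P > 0" using pos t0 t1 by simp
    have "1 - (t j)\<^sup>2 = (1 - t j) * (1 + t j)" by (simp add: algebra_simps power2_eq_square)
    also have "\<dots> \<le> ?P * 2" using low[of "t j"] t0[of j] t1[of j] by (intro mult_mono) auto
    finally have 1: "defect (p j) \<le> defect u * (?P * 2) / ?P\<^sup>2"
      unfolding dpj using du P by (intro divide_right_mono mult_left_mono) auto
    \<comment> \<open>Moving from \<open>t j\<close> to the end \<open>T\<close> of the radius
      changes the denominator by at most T - t j \<le> 1 - t j, which is at most
      \<open>?P\<close>.\<close>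
    have "cmod (1 - of_real T * c) \<le> 2 * ?P"
    proof -
      have "1 - of_real T * c = (1 - of_real (t j) * c) - of_real (T - t j) * c" by (simp add: algebra_simps)
      then have "cmod (1 - of_real T * c) \<le> ?P + cmod (of_real (T - t j) * c)"
        using norm_triangle_ineq4 by metis
      also have "cmod (of_real (T - t j) * c) \<le> (T - t j) * 1"
        unfolding norm_mult norm_of_real using tT[OF j] c1 by (intro mult_mono) auto
      also have "(T - t j) * 1 \<le> ?P" using low[of "t j"] t0[of j] t1[of j] T1 by simp
      finally show ?thesis by simp
    qed
    then have "2 / ?P \<le> 4 / cmod (1 - of_real T * c)" using P pos[OF T1] by (simp add: field_simps)
    then have "defect u * (2 / ?P) \<le> defect u * (4 / cmod (1 - of_real T * c))" using du by (intro mult_left_mono) auto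
    then show "defect (p j) \<le> 4 * E" using 1 P by (simp add: Ev power2_eq_square mult.commute)
    have E0: "E > 0" unfolding E_def using one_minus_hinner_nonzero[OF u v] by simp
    have "1 - T\<^sup>2 = defect \<zeta>" by (simp add: T_def defect_def)
    also have "\<dots> = defect u * defect v / E\<^sup>2"
      unfolding \<zeta>_def defect_mobius[OF u v] E_def cmod_one_minus_hinner_commute[of v u] ..
    finally have T2: "defect u * defect v / E\<^sup>2 = 1 - T\<^sup>2" ..
    have "(t j)\<^sup>2 \<le> T\<^sup>2" using tT[OF j] t0 by (intro power_mono)
    then have "(1 - T\<^sup>2) / 4 \<le> (1 - (t j)\<^sup>2) / 4" by simp
    also have "\<dots> \<le> (1 - (t j)\<^sup>2) / ?P\<^sup>2"
    proof (intro divide_left_mono)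
      have "?P \<le> 1 + cmod (of_real (t j) * c)" using norm_triangle_ineq4[of 1 "of_real (t j) * c"] by simp
      also have "\<dots> \<le> 2" using c1 t0[of j] t1[of j] by (simp add: norm_mult mult_le_one)
      finally have "?P\<^sup>2 \<le> 2\<^sup>2" by (intro power_mono) auto
      then show "?P\<^sup>2 \<le> 4" by simp
      show "0 \<le> 1 - (t j)\<^sup>2" using t0[of j] t1[of j] by (simp add: power_le_one)
    qed (use P in auto)
    finally have "defect u * ((1 - T\<^sup>2) / 4) \<le> defect u * ((1 - (t j)\<^sup>2) / ?P\<^sup>2)" using du by (intro mult_left_mono) auto
    then have "defect u * ((1 - T\<^sup>2) / 4) \<le> defect (p j)" unfolding dpj by simp
    then show "(defect u)\<^sup>2 * defect v / (4 * E\<^sup>2) \<le> defect (p j)"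
      unfolding T2[symmetric] using E0 by (simp add: power2_eq_square mult_ac)
  qed
qed

text \<open>Young's inequality, read as the graph of the power lying above its tangent at
  \<open>a\<close>. Integrated at a suitable \<open>a\<close>, it yields the convexity and Hoelder
  type estimates used later.\<close>

lemma powr_tangent:
  fixes a y p :: real
  assumes p: "p > 1" and "a \<ge> 0" "y \<ge> 0"
  shows "p * (a powr (p - 1) * y) \<le> y powr p + (p - 1) * a powr p"
proof -
  let ?q = "p / (p - 1)"
  have q: "?q > 1" "1 / p + 1 / ?q = 1" using p by (auto simp: field_simps)
  have "y * a powr (p - 1) \<le> y powr p / p + (a powr (p - 1)) powr ?q / ?q"
    by (rule Youngs_inequality[OF p q]) (use assms in auto)
  moreover have "(a powr (p - 1)) powr ?q = a powr p" using p by (simp add: powr_powr)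
  ultimately have "p * (y * a powr (p - 1)) \<le> p * (y powr p / p + a powr p / ?q)"
    using p by (intro mult_left_mono) auto
  moreover have "p * (y powr p / p + a powr p / ?q) = y powr p + (p - 1) * a powr p"
    using p by (simp add: distrib_left)
  ultimately show ?thesis by (simp add: mult.commute)
qed

text \<open>A Bergman ball has Euclidean size 1-|z|^2 along \<open>z\<close> and the square root of
  this across, so an ellipsoid with such axes fits inside. Being a linear image of the unit ball, it
  has a constant Jacobian; the bound on the defect keeps it in a compact part of the ball.\<close>

lemma ball_ellipsoid:
  fixes r :: real
  assumes r: "r > 0"
  obtains c where "0 < c" "c < 1"
    "\<And>(z :: complex ^ 'n) e h. z \<in> \<B> \<Longrightarrow> norm e = 1 \<Longrightarrow> z = norm z *\<^sub>R e \<Longrightarrow> h \<in> \<B> \<Longrightarrow>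
       z + two_scale e (of_real (defect z * c)) (of_real (sqrt (defect z) * c)) h \<in> bergman_ball z r \<and>
       defect (z + two_scale e (of_real (defect z * c)) (of_real (sqrt (defect z) * c)) h) \<ge> defect z * (1 - 3 * c)"
    "3 * c < 1"
proof -
  define R where "R = tanh r"
  have R: "0 < R" "R < 1" using r by (auto simp: R_def tanh_real_lt_1)
  have R2: "0 < R\<^sup>2" "R\<^sup>2 < 1" using R by (auto simp: power_less_one_iff)
  \<comment> \<open>Chosen so that 1-R^2 = 1-7c lies below (1-3c)/(1+3c), the lower bound obtained
    for 1-\<rho>^2 on the ellipsoid.\<close>
  define c where "c = R\<^sup>2 / 7"
  have c: "0 < c" "7 * c < 1" using R2 by (auto simp: c_def)
  show ?thesis
  proof (rule that[of c])
    show "0 < c" "c < 1" "3 * c < 1" using c by auto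
    fix z e h :: "complex ^ 'n"
    assume z: "z \<in> \<B>" and e: "norm e = 1" and ze: "z = norm z *\<^sub>R e" and h: "h \<in> \<B>"
    define x where "x = defect z"
    have x: "0 < x" "x \<le> 1" using defect_pos[OF z] defect_le_1[of z] by (auto simp: x_def)
    define y where "y = two_scale e (of_real (x * c)) (of_real (sqrt x * c)) h"
    have h1: "norm h < 1" using h by simp
    have he: "cmod (hinner h e) \<le> 1" using norm_hinner_le[of h e] e h1 by simp
    have hz: "cmod (hinner y z) \<le> x * c"
    proof -
      have "hinner y z = of_real (norm z) * (of_real (x * c) * hinner h e)"
        unfolding y_def by (subst ze) (simp add: hinner_scaleR_right hinner_two_scale[OF e])
      then have "cmod (hinner y z) = norm z * (x * c * cmod (hinner h e))" using x c by (simp add: norm_mult)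
      also have "\<dots> \<le> 1 * (x * c * 1)" using z he x c by (intro mult_mono) auto
      finally show ?thesis by simp
    qed
    have ny: "(norm y)\<^sup>2 \<le> x * c\<^sup>2"
    proof -
      have le: "(cmod (hinner h e))\<^sup>2 \<le> (norm h)\<^sup>2" using norm_hinner_le[of h e] e by (intro power_mono) auto
      have "(norm y)\<^sup>2 = x * c\<^sup>2 * ((norm h)\<^sup>2 - (cmod (hinner h e))\<^sup>2) + x * x * c\<^sup>2 * (cmod (hinner h e))\<^sup>2"
        unfolding y_def norm_two_scale[OF e] using x c
        by (simp add: norm_mult power_mult_distrib power2_eq_square)
      also have "x * x * c\<^sup>2 * (cmod (hinner h e))\<^sup>2 \<le> x * 1 * c\<^sup>2 * (cmod (hinner h e))\<^sup>2"
        using x by (intro mult_right_mono mult_left_mono) auto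
      finally have "(norm y)\<^sup>2 \<le> x * c\<^sup>2 * (norm h)\<^sup>2" by (simp add: algebra_simps)
      also have "\<dots> \<le> x * c\<^sup>2 * 1" using h1 x by (intro mult_left_mono) (auto simp: power_le_one)
      finally show ?thesis by simp
    qed
    have dw: "defect (z + y) \<ge> x * (1 - 3 * c)"
    proof -
      have "(norm (z + y))\<^sup>2 = (norm z)\<^sup>2 + 2 * (y \<bullet> z) + (norm y)\<^sup>2"
        by (simp add: power2_norm_eq_inner inner_add_left inner_add_right inner_commute)
      moreover have "y \<bullet> z \<le> x * c" using hz complex_Re_le_cmod[of "hinner y z"] by (simp add: Re_hinner)
      ultimately have "defect (z + y) \<ge> x - 2 * (x * c) - x * c\<^sup>2"
        using ny by (simp add: defect_def x_def)
      moreover have "x * c\<^sup>2 \<le> x * c" using c x by (intro mult_left_mono) (auto simp: power2_eq_square mult_left_le)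
      ultimately show ?thesis by (simp add: algebra_simps)
    qed
    have "x * (1 - 3 * c) > 0" using x c by (intro mult_pos_pos) auto
    then have "defect (z + y) > 0" using dw by simp
    then have zy: "z + y \<in> \<B>" by (simp add: defect_def abs_square_less_1)
    have n1: "cmod (1 - hinner (z + y) z) \<le> x * (1 + c)"
    proof -
      have "1 - hinner (z + y) z = of_real x - hinner y z"
        by (simp add: hinner_add_left x_def defect_alt)
      then have "cmod (1 - hinner (z + y) z) \<le> x + cmod (hinner y z)"
        using norm_triangle_ineq4[of "of_real x" "hinner y z"] x by simp
      then show ?thesis using hz by (simp add: algebra_simps)
    qed
    have p1: "cmod (1 - hinner (z + y) z) > 0" using one_minus_hinner_nonzero[OF zy z] by simp
    have "(1 - 3 * c) / (1 + 3 * c) \<le> x * (x * (1 - 3 * c)) / (x * (1 + c))\<^sup>2"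
    proof -
      have "(1 + c)\<^sup>2 \<le> 1 + 3 * c"
        using c mult_left_le[of c c] by (simp add: power2_eq_square algebra_simps)
      then have "(1 - 3 * c) / (1 + 3 * c) \<le> (1 - 3 * c) / (1 + c)\<^sup>2"
        using c by (intro divide_left_mono) auto
      also have "\<dots> = x * (x * (1 - 3 * c)) / (x * (1 + c))\<^sup>2" using x by (simp add: power2_eq_square)
      finally show ?thesis .
    qed
    also have "\<dots> \<le> x * defect (z + y) / (cmod (1 - hinner (z + y) z))\<^sup>2"
      using dw n1 p1 x c \<open>defect (z + y) > 0\<close> by (intro frac_le mult_left_mono power_mono) auto
    also have "\<dots> = 1 - (bergman_rho z (z + y))\<^sup>2"
      unfolding bergman_rho_sq[OF z zy] x_def cmod_one_minus_hinner_commute[of "z + y" z] ..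
    finally have A: "(1 - 3 * c) / (1 + 3 * c) \<le> 1 - (bergman_rho z (z + y))\<^sup>2" .
    have "1 - R\<^sup>2 < (1 - 3 * c) / (1 + 3 * c)"
    proof -
      have "(1 - R\<^sup>2) * (1 + 3 * c) = (1 - 7 * c) * (1 + 3 * c)" by (simp add: c_def)
      also have "\<dots> < 1 - 3 * c" using c by (simp add: algebra_simps) (smt (verit) mult_nonneg_nonneg)
      finally show ?thesis using c by (simp add: less_divide_eq)
    qed
    then have "(bergman_rho z (z + y))\<^sup>2 < R\<^sup>2" using A by simp
    then have "bergman_rho z (z + y) < R" using R by (simp add: power2_less_imp_less)
    then have "z + y \<in> bergman_ball z r" using zy by (simp add: bergman_ball_rho[OF z] R_def)
    then show "z + two_scale e (of_real (defect z * c)) (of_real (sqrt (defect z) * c)) h \<in> bergman_ball z r \<and>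
       defect (z + two_scale e (of_real (defect z * c)) (of_real (sqrt (defect z) * c)) h) \<ge> defect z * (1 - 3 * c)"
      using dw by (simp only: y_def x_def)
  qed
qed

lemma holomorphic_ball_const [simp]: "holomorphic_ball (\<lambda>_. c)"
  unfolding holomorphic_ball_def by (auto intro!: exI[of _ "\<lambda>_. 0"])

lemma holomorphic_ball_affine:
  fixes g :: "complex ^ 'n \<Rightarrow> complex"
  assumes g: "holomorphic_ball g" and in_ball: "\<And>h. h \<in> \<B> \<Longrightarrow> z + two_scale e a b h \<in> \<B>"
  shows "holomorphic_ball (\<lambda>h. g (z + two_scale e a b h))"
  unfolding holomorphic_ball_def
proof
  fix h :: "complex ^ 'n" assume "h \<in> \<B>"
  then obtain D where D: "(g has_derivative D) (at (z + two_scale e a b h))" "\<And>c x. D (c *s x) = c * D x"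
    using g in_ball unfolding holomorphic_ball_def by blast
  have "(two_scale e a b has_derivative two_scale e a b) (at h)"
    using linear_two_scale[of e a b] by (simp add: linear_conv_bounded_linear bounded_linear_imp_has_derivative)
  then have "((\<lambda>h. z + two_scale e a b h) has_derivative two_scale e a b) (at h)"
    by (auto intro!: derivative_eq_intros)
  from has_derivative_compose[OF this D(1)]
  have "((\<lambda>h. g (z + two_scale e a b h)) has_derivative (\<lambda>x. D (two_scale e a b x))) (at h)" .
  moreover have "D (two_scale e a b (c *s x)) = c * D (two_scale e a b x)" for c x
  proof -
    have "two_scale e a b (c *s x) = c *s two_scale e a b x"
      by (simp add: two_scale_def hinner_smult_left vec_eq_iff algebra_simps)
    then show ?thesis by (simp add: D(2))
  qed
  ultimately show "\<exists>D. ((\<lambda>h. g (z + two_scale e a b h)) has_derivative D) (at h) \<and> (\<forall>c x. D (c *s x) = c * D x)"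
    by blast
qed

lemma bkern_0 [simp]: "bkern N 0 = 1"
  by (simp add: bkern_def)

lemma finite_measure_ball_leb: "finite_measure (ball_leb :: (complex ^ 'n) measure)"
  unfolding ball_leb_def by (rule finite_measure_lebesgue_on) simp

section \<open>Submean value property\<close>

text \<open>The indicator of a Bergman ball as a real function that is symmetric and jointly
  measurable in both points, as required when the order of integration is exchanged.\<close>

definition near :: "real \<Rightarrow> complex ^ 'n \<Rightarrow> complex ^ 'n \<Rightarrow> real" where
  "near r z w = (if bergman_dist z w < r then 1 else 0)"

lemma near_commute: "near r z w = near r w z"
  by (simp add: near_def bergman_dist_commute)

lemma near_nonneg [simp]: "near r z w \<ge> 0" and near_le_1 [simp]: "near r z w \<le> 1"
  by (auto simp: near_def)

lemma near_indicator: "w \<in> \<B> \<Longrightarrow> indicator (bergman_ball z r) w = near r z w"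
  by (simp add: near_def bergman_ball_def)

lemma near_measurable [measurable (raw)]:
  fixes f g :: "'a \<Rightarrow> complex ^ 'n"
  assumes [measurable]: "f \<in> borel_measurable M" "g \<in> borel_measurable M"
  shows "(\<lambda>x. near r (f x) (g x)) \<in> borel_measurable M"
  unfolding near_def bergman_dist_def bergman_rho_def by measurable

lemma emeasure_ball_leb: "emeasure ball_leb (\<B> :: (complex ^ 'n) set) = ennreal (ball_mass TYPE('n) 0)"
proof -
  have "emeasure ball_leb (\<B> :: (complex ^ 'n) set) = (\<integral>\<^sup>+w. 1 \<partial>(ball_leb :: (complex ^ 'n) measure))"
    by simp
  also have "\<dots> = (\<integral>\<^sup>+w. ennreal (wt 0 w) \<partial>(ball_leb :: (complex ^ 'n) measure))"
    by (rule nn_integral_cong) (use defect_pos in force)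
  finally show ?thesis using ball_mass[of 0, where 'n = 'n] by simp
qed

text \<open>Mean value property over the ellipsoid \<open>z + L(h)\<close>, followed by Jensen's inequality.\<close>

lemma bergman_submean:
  fixes r p :: real
  assumes r: "r > 0" and p: "p > 1"
  obtains C where "C > 0" "\<And>(g :: complex ^ 'n \<Rightarrow> complex) z. holomorphic_ball g \<Longrightarrow> z \<in> \<B> \<Longrightarrow>
    ennreal (cmod (g z) powr p) \<le> ennreal (C * wt (- (real CARD('n) + 1)) z) *
      (\<integral>B w. near r z w * cmod (g w) powr p)"
proof -
  obtain c where c: "0 < c" "c < 1" "3 * c < 1" and
    ell: "\<And>(z :: complex ^ 'n) e h. z \<in> \<B> \<Longrightarrow> norm e = 1 \<Longrightarrow> z = norm z *\<^sub>R e \<Longrightarrow> h \<in> \<B> \<Longrightarrow>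
       z + two_scale e (of_real (defect z * c)) (of_real (sqrt (defect z) * c)) h \<in> bergman_ball z r \<and>
       defect (z + two_scale e (of_real (defect z * c)) (of_real (sqrt (defect z) * c)) h) \<ge> defect z * (1 - 3 * c)"
    using ball_ellipsoid[OF r, where 'n = 'n] by metis
  define m where "m = ball_mass TYPE('n) 0"
  have m: "m > 0" unfolding m_def by (rule ball_mass_pos) simp
  have mE: "(\<integral>\<^sup>+w. 1 \<partial>(ball_leb :: (complex ^ 'n) measure)) = ennreal m"
    by (simp add: m_def emeasure_ball_leb)
  define C where "C = 1 / (m * c ^ (2 * CARD('n)))"
  show ?thesis
  proof (rule that[of C])
    show "C > 0" using m c by (simp add: C_def)
    fix g :: "complex ^ 'n \<Rightarrow> complex" and z :: "complex ^ 'n" assume g: "holomorphic_ball g" and z: "z \<in> \<B>"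
    obtain e where e: "norm e = 1" "z = norm z *\<^sub>R e" by (rule unit_direction)
    define x where "x = defect z"
    have x: "x > 0" using defect_pos[OF z] by (simp add: x_def)
    define L where "L = two_scale e (of_real (x * c)) (of_real (sqrt x * c))"
    note Lell = ell[OF z e, folded x_def, folded L_def]
    have Lb: "z + L h \<in> \<B>" if "h \<in> \<B>" for h
      using Lell[OF that] bergman_ball_subset_ball by blast
    define G where "G h = g (z + L h)" for h
    have G: "holomorphic_ball G"
      unfolding G_def L_def by (rule holomorphic_ball_affine[OF g]) (use Lb in \<open>simp add: L_def\<close>)
    have Gm: "measB G"
      by (rule borel_measurable_ball_leb_continuous[OF holomorphic_ball_continuous[OF G]])
    note [measurable] = Gm
    \<comment> \<open>The ellipsoid lies in a compact part of the ball, so \<open>G\<close> is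
      bounded and the reproducing formula applies to it.\<close>
    have "\<exists>B. \<forall>h\<in>\<B>. cmod (G h) \<le> B"
    proof -
      let ?S = "{w :: complex ^ 'n. x * (1 - 3 * c) \<le> defect w}"
      have xc: "x * (1 - 3 * c) > 0" using x c by simp
      have sub: "?S \<subseteq> \<B>"
      proof
        fix w :: "complex ^ 'n" assume "w \<in> ?S"
        then have "(norm w)\<^sup>2 < 1" using xc by (simp add: defect_def)
        then show "w \<in> \<B>" by (simp add: abs_square_less_1)
      qed
      have "closed ?S" unfolding defect_def by (intro closed_Collect_le continuous_intros)
      moreover have "bounded ?S" using sub bounded_ball bounded_subset by blast
      ultimately have "compact ?S" using compact_eq_bounded_closed by blast
      then have "compact (g ` ?S)"
        using compact_continuous_image continuous_on_subset[OF holomorphic_ball_continuous[OF g] sub] by blast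
      then obtain B where "\<forall>w\<in>?S. cmod (g w) \<le> B" by (metis bounded_iff compact_imp_bounded imageI)
      then show ?thesis using Lell unfolding G_def by blast
    qed
    then obtain B where B: "\<And>h. h \<in> \<B> \<Longrightarrow> cmod (G h) \<le> B" by blast
    have Gint: "integrable ball_leb G"
    proof (rule finite_measure.integrable_const_bound[OF finite_measure_ball_leb])
      show "AE h in ball_leb. cmod (G h) \<le> B" using B by (intro AE_I2) auto
    qed (rule Gm)
    have d0: "wt 0 w *\<^sub>R v = v" if "w \<in> \<B>" for w and v :: complex
      using defect_pos[OF that] by simp
    \<comment> \<open>The reproducing formula at the origin with weight 0: the kernel is identically
      1 there, which leaves the mean value property.\<close>
    have rep: "(\<integral>h. G h \<partial>ball_leb) = of_real m * g z"
    proof -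
      have "integrable ball_leb (\<lambda>h. wt 0 h *\<^sub>R G h)"
        by (subst Bochner_Integration.integrable_cong[OF refl, of _ _ G]) (simp_all only: d0 Gint space_ball_leb)
      from bergman_reproducing[OF _ G this, of 0]
      have "(\<integral>h. wt 0 h *\<^sub>R (G h * bkern (real CARD('n) + 1 + 0) (hinner 0 h)) \<partial>ball_leb) = of_real m * G 0"
        by (simp add: m_def)
      also have "(\<integral>h. wt 0 h *\<^sub>R (G h * bkern (real CARD('n) + 1 + 0) (hinner 0 h)) \<partial>ball_leb) = (\<integral>h. G h \<partial>ball_leb)"
        by (rule Bochner_Integration.integral_cong[OF refl]) (simp only: d0 space_ball_leb, simp)
      also have "G 0 = g z" by (simp add: G_def L_def two_scale_def)
      finally show ?thesis .
    qed
    define a where "a = cmod (g z)"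
    have "m * a = cmod (\<integral>h. G h \<partial>ball_leb)" unfolding rep a_def using m by (simp add: norm_mult)
    also have "ennreal \<dots> \<le> (\<integral>B h. cmod (G h))"
      by (rule integral_norm_bound_ennreal[OF Gint])
    finally have avg: "ennreal (m * a) \<le> (\<integral>B h. cmod (G h))" .
    have a0: "a \<ge> 0" by (simp add: a_def)
    let ?I = "\<integral>B h. cmod (G h) powr p"
    have "ennreal (p * a powr (p - 1)) * ennreal (m * a) \<le> ennreal (p * a powr (p - 1)) * (\<integral>B h. cmod (G h))"
      by (intro mult_left_mono avg) auto
    also have "\<dots> = (\<integral>B h. p * (a powr (p - 1) * cmod (G h)))"
      using p by (subst nn_integral_cmult[symmetric]) (auto simp: ennreal_mult'[symmetric] mult.assoc)
    also have "\<dots> \<le> (\<integral>\<^sup>+h. ennreal (cmod (G h) powr p) + ennreal ((p - 1) * a powr p) \<partial>ball_leb)"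
      using powr_tangent[OF p a0] p
      by (intro nn_integral_mono) (simp add: ennreal_plus[symmetric] ennreal_leI del: ennreal_plus)
    also have "\<dots> = ?I + ennreal ((p - 1) * a powr p) * ennreal m"
    proof -
      have "(\<integral>\<^sup>+h. ennreal ((p - 1) * a powr p) \<partial>(ball_leb :: (complex ^ 'n) measure)) = ennreal ((p - 1) * a powr p) * (\<integral>\<^sup>+h. 1 \<partial>(ball_leb :: (complex ^ 'n) measure))"
        by (subst nn_integral_cmult[symmetric]) auto
      then show ?thesis unfolding mE by (subst nn_integral_add) auto
    qed
    also have "ennreal (p * a powr (p - 1)) * ennreal (m * a) = ennreal (m * a powr p) + ennreal ((p - 1) * a powr p) * ennreal m"
    proof -
      have "a powr (p - 1) * a = a powr p" using a0 p by (cases "a = 0") (auto simp: powr_diff)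
      then have "p * a powr (p - 1) * (m * a) = m * a powr p + (p - 1) * a powr p * m"
        by (simp add: algebra_simps)
      then show ?thesis using p m a0
        by (simp add: ennreal_mult'[symmetric] ennreal_plus[symmetric] del: ennreal_plus)
    qed
    finally have jens: "ennreal (m * a powr p) \<le> ?I"
      by (simp add: ennreal_mult_eq_top_iff)
    let ?N = "\<integral>B w. near r z w * cmod (g w) powr p"
    define D where "D = bergman_ball z r"
    have [measurable]: "D \<in> sets borel" unfolding D_def by (rule bergman_ball_measurable)
    have [measurable]: "(\<lambda>w. indicator \<B> w *\<^sub>R g w) \<in> borel_measurable borel"
      by (intro borel_measurable_continuous_on_indicator holomorphic_ball_continuous g) auto
    define H where "H w = ennreal (cmod (indicator \<B> w *\<^sub>R g w) powr p) * indicator D w" for w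
    have Hm[measurable]: "H \<in> borel_measurable borel" unfolding H_def by measurable
    have "?I = (\<integral>\<^sup>+h. ennreal (cmod (G h) powr p) * indicator \<B> h \<partial>lborel)"
      by (rule nn_integral_ball_leb)
    also have "\<dots> \<le> (\<integral>\<^sup>+h. H (L h + z) \<partial>lborel)"
    proof (rule nn_integral_mono)
      fix h show "ennreal (cmod (G h) powr p) * indicator \<B> h \<le> H (L h + z)"
      proof (cases "h \<in> \<B>")
        case True
        then have "L h + z \<in> D" "L h + z \<in> \<B>" using Lell[of h] Lb[of h] by (auto simp: D_def add.commute)
        then show ?thesis using True by (simp add: H_def G_def add.commute)
      qed simp
    qed
    also have "\<dots> = ennreal (1 / ((x * c)\<^sup>2 * (sqrt x * c) ^ (2 * CARD('n) - 2))) * (\<integral>\<^sup>+w. H w \<partial>lborel)"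
    proof -
      let ?k = "(x * c)\<^sup>2 * (sqrt x * c) ^ (2 * CARD('n) - 2)"
      have k: "?k > 0" using x c by simp
      have "ennreal ?k * (\<integral>\<^sup>+h. H (L h + z) \<partial>lborel) = (\<integral>\<^sup>+w. H (w + z) \<partial>lborel)"
        unfolding L_def by (rule nn_integral_two_scale) (use x c e in auto)
      also have "\<dots> = (\<integral>\<^sup>+w. H w \<partial>lborel)" by (rule nn_integral_lborel_translate) measurable
      finally have "ennreal (1 / ?k) * (ennreal ?k * (\<integral>\<^sup>+h. H (L h + z) \<partial>lborel)) = ennreal (1 / ?k) * (\<integral>\<^sup>+w. H w \<partial>lborel)" by simp
      moreover have cancel: "ennreal (1 / K) * ennreal K = 1" if "K > 0" for K :: real
        using that by (simp flip: ennreal_mult')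
      moreover note cancel[OF k]
      ultimately show ?thesis by (simp only: mult.assoc[symmetric] mult_1_left)
    qed
    also have "(\<integral>\<^sup>+w. H w \<partial>lborel) = ?N"
      unfolding nn_integral_ball_leb H_def D_def
      by (intro nn_integral_cong) (auto simp: indicator_def near_def bergman_ball_def)
    finally have I: "ennreal (m * a powr p) \<le> ennreal (1 / ((x * c)\<^sup>2 * (sqrt x * c) ^ (2 * CARD('n) - 2))) * ?N"
      using jens by (rule order_trans[rotated])
    \<comment> \<open>The Jacobian of the ellipsoid; its exponent n+1 is 2 real axes of order
      \<open>x\<close> plus 2n-2 axes of order sqrt(x).\<close>
    have ke: "(x * c)\<^sup>2 * (sqrt x * c) ^ (2 * CARD('n) - 2) = x powr (real CARD('n) + 1) * c ^ (2 * CARD('n))"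
    proof -
      obtain k where k: "CARD('n) = Suc k" by (metis not0_implies_Suc zero_less_card_finite less_irrefl)
      have "(sqrt x * c) ^ (2 * CARD('n) - 2) = x ^ k * c ^ (2 * k)"
        using x by (simp add: k power_mult power_mult_distrib)
      moreover have "x powr (real CARD('n) + 1) = x ^ (k + 2)"
        using x by (simp add: k powr_realpow[symmetric] powr_add power2_eq_square)
      ultimately show ?thesis by (simp add: k power2_eq_square mult_ac)
    qed
    have "ennreal (a powr p) = ennreal (1 / m) * ennreal (m * a powr p)" using m by (simp flip: ennreal_mult')
    also have "\<dots> \<le> ennreal (1 / m) * (ennreal (1 / ((x * c)\<^sup>2 * (sqrt x * c) ^ (2 * CARD('n) - 2))) * ?N)"
      by (intro mult_left_mono I) auto
    also have "\<dots> = ennreal (C * x powr (- (real CARD('n) + 1))) * ?N"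
    proof -
      have "1 / m * (1 / (x powr (real CARD('n) + 1) * c ^ (2 * CARD('n)))) = C * x powr (- (real CARD('n) + 1))"
        unfolding C_def powr_minus using m c x by (simp add: field_simps)
      moreover have "ennreal (1 / m) * ennreal (1 / (x powr (real CARD('n) + 1) * c ^ (2 * CARD('n))))
        = ennreal (1 / m * (1 / (x powr (real CARD('n) + 1) * c ^ (2 * CARD('n)))))"
        using m by (intro ennreal_mult'[symmetric]) auto
      ultimately show ?thesis unfolding ke mult.assoc[symmetric] by simp
    qed
    finally show "ennreal (cmod (g z) powr p) \<le> ennreal (C * wt (- (real CARD('n) + 1)) z) *
      (\<integral>B w. near r z w * cmod (g w) powr p)"
      by (simp add: a_def x_def)
  qed
qed

section \<open>Integration over the ball and the given measures as densities\<close>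

lemma ball_leb_fst_snd_measurable [measurable]:
  "fst \<in> borel_measurable (ball_leb \<Otimes>\<^sub>M M)" "snd \<in> borel_measurable (M \<Otimes>\<^sub>M ball_leb)"
  using measurable_compose[OF measurable_fst id_measurable_ball_leb]
    measurable_compose[OF measurable_snd id_measurable_ball_leb] by simp_all

lemma ball_leb_Fubini:
  assumes "(\<lambda>(z, w). f z w) \<in> borel_measurable (ball_leb \<Otimes>\<^sub>M (ball_leb :: (complex ^ 'n) measure))"
  shows "(\<integral>\<^sup>+z. (\<integral>\<^sup>+w. f z w \<partial>ball_leb) \<partial>(ball_leb :: (complex ^ 'n) measure)) = (\<integral>\<^sup>+w. (\<integral>\<^sup>+z. f z w \<partial>ball_leb) \<partial>ball_leb)"
proof -
  interpret pair_sigma_finite "ball_leb :: (complex ^ 'n) measure" "ball_leb :: (complex ^ 'n) measure"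
    using sigma_finite_ball_leb by (simp add: pair_sigma_finite_def)
  show ?thesis by (rule Fubini'[symmetric]) (use assms in simp)
qed

lemma ball_nn_cmult: "c \<ge> 0 \<Longrightarrow> measB G \<Longrightarrow> ennreal c * (\<integral>B z. G z) = (\<integral>B z. c * G z)"
  by (simp add: ennreal_mult' nn_integral_cmult)

lemma ball_nn_le1:
  fixes F G :: "complex ^ 'n \<Rightarrow> real"
  assumes "\<And>z. z \<in> \<B> \<Longrightarrow> F z \<le> c * G z" and I: "(\<integral>B z. G z) \<le> I" and c: "c \<ge> 0" and G: "measB G"
  shows "(\<integral>B z. F z) \<le> ennreal c * I"
proof -
  have "(\<integral>B z. F z) \<le> (\<integral>\<^sup>+z. ennreal c * ennreal (G z) \<partial>ball_leb)"
    using assms by (intro nn_integral_mono) (simp add: ennreal_leI flip: ennreal_mult')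
  also have "\<dots> = ennreal c * (\<integral>B z. G z)" using G by (intro nn_integral_cmult) simp
  also have "\<dots> \<le> ennreal c * I" by (intro mult_left_mono I) simp
  finally show ?thesis .
qed

lemma ball_nn_le2:
  fixes F G H :: "complex ^ 'n \<Rightarrow> real"
  assumes "\<And>z. z \<in> \<B> \<Longrightarrow> F z \<le> a * G z + b * H z" and I: "(\<integral>B z. G z) \<le> ennreal X" "(\<integral>B z. H z) \<le> ennreal Y"
    and pos: "a \<ge> 0" "b \<ge> 0" "X \<ge> 0" "Y \<ge> 0" and [measurable]: "measB G" "measB H"
  shows "(\<integral>B z. F z) \<le> ennreal (a * X + b * Y)"
proof -
  have "ennreal (x + y) \<le> ennreal x + ennreal y" for x y by (cases "x \<ge> 0"; cases "y \<ge> 0") (auto simp: ennreal_neg ennreal_leI)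
  then have "(\<integral>B z. F z) \<le> (\<integral>\<^sup>+z. ennreal a * ennreal (G z) + ennreal b * ennreal (H z) \<partial>ball_leb)"
    using pos by (intro nn_integral_mono order_trans[OF ennreal_leI[OF assms(1)]]) (auto simp flip: ennreal_mult')
  also have "\<dots> = ennreal a * (\<integral>B z. G z) + ennreal b * (\<integral>B z. H z)" by (simp add: nn_integral_add nn_integral_cmult)
  also have "\<dots> \<le> ennreal a * ennreal X + ennreal b * ennreal Y" by (intro add_mono mult_left_mono I) auto
  finally show ?thesis using pos by (simp add: ennreal_mult')
qed

lemma ball_vol_eq: "(ball_vol :: (complex ^ 'n) measure) = density ball_leb (\<lambda>_. ennreal (1 / ball_mass TYPE('n) 0))"
proof -
  have m: "ball_mass TYPE('n) 0 > 0" by (rule ball_mass_pos) simp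
  have "(ball_vol :: (complex ^ 'n) measure) = density ball_leb (\<lambda>z. indicator \<B> z / ennreal (ball_mass TYPE('n) 0))"
    unfolding ball_vol_def uniform_measure_def ball_leb_def[symmetric] emeasure_ball_leb ..
  also have "\<dots> = density ball_leb (\<lambda>_. ennreal (1 / ball_mass TYPE('n) 0))"
  proof (rule density_cong)
    show "(\<lambda>z. indicator \<B> z / ennreal (ball_mass TYPE('n) 0)) \<in> borel_measurable (ball_leb :: (complex ^ 'n) measure)"
      by (rule measurable_ball_leb) measurable
    show "AE z in ball_leb. indicator \<B> z / ennreal (ball_mass TYPE('n) 0) = ennreal (1 / ball_mass TYPE('n) 0)"
      using m by (intro AE_I2) (simp add: divide_ennreal[symmetric])
  qed simp
  finally show ?thesis .
qed

lemma v_weight_eq: "(v_weight \<sigma> :: (complex ^ 'n) measure) = density ball_leb (\<lambda>z. ennreal (wt \<sigma> z / ball_mass TYPE('n) 0))"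
proof -
  have m: "ball_mass TYPE('n) 0 > 0" by (rule ball_mass_pos) simp
  show ?thesis
    unfolding v_weight_def ball_vol_eq defect_def[symmetric]
    using m by (subst density_density_eq) (auto simp: ennreal_mult'[symmetric])
qed

lemma v_prob_eq:
  assumes \<alpha>: "\<alpha> > -1"
  shows "(v_prob \<alpha> :: (complex ^ 'n) measure) = density ball_leb (\<lambda>z. ennreal (wt \<alpha> z / ball_mass TYPE('n) \<alpha>))"
proof -
  have m: "ball_mass TYPE('n) 0 > 0" by (rule ball_mass_pos) simp
  have m\<alpha>: "ball_mass TYPE('n) \<alpha> > 0" by (rule ball_mass_pos[OF \<alpha>])
  have "(\<integral>z. wt \<alpha> z \<partial>(ball_vol :: (complex ^ 'n) measure)) = enn2real (\<integral>\<^sup>+z. ennreal (wt \<alpha> z) \<partial>(ball_vol :: (complex ^ 'n) measure))"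
    by (rule integral_eq_nn_integral) (auto simp: ball_vol_eq)
  also have "(\<integral>\<^sup>+z. ennreal (wt \<alpha> z) \<partial>(ball_vol :: (complex ^ 'n) measure)) = ennreal (1 / ball_mass TYPE('n) 0) * ennreal (ball_mass TYPE('n) \<alpha>)"
    unfolding ball_vol_eq by (subst nn_integral_density) (auto simp: nn_integral_cmult ball_mass[OF \<alpha>])
  also have "enn2real \<dots> = ball_mass TYPE('n) \<alpha> / ball_mass TYPE('n) 0"
    using m m\<alpha> by (simp flip: ennreal_mult')
  finally have c: "c_const TYPE('n) \<alpha> = ball_mass TYPE('n) 0 / ball_mass TYPE('n) \<alpha>"
    by (simp add: c_const_def defect_def[symmetric])
  show ?thesis
    unfolding v_prob_def ball_vol_eq defect_def[symmetric] c
    using m m\<alpha> by (subst density_density_eq) (auto simp: ennreal_mult'[symmetric])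
qed

lemma measurable_v_prob [simp]: "\<alpha> > -1 \<Longrightarrow> borel_measurable (v_prob \<alpha>) = borel_measurable ball_leb"
  by (simp add: v_prob_eq measurable_def)

lemma space_v_prob [simp]: "\<alpha> > -1 \<Longrightarrow> space (v_prob \<alpha>) = \<B>"
  by (simp add: v_prob_eq)

lemma AE_v_prob:
  assumes "\<alpha> > -1"
  shows "(AE z in (v_prob \<alpha> :: (complex ^ 'n) measure). P z) \<longleftrightarrow> (AE z in ball_leb. P z)"
proof -
  have m: "ball_mass TYPE('n) \<alpha> > 0" by (rule ball_mass_pos[OF assms])
  have "(AE z in (v_prob \<alpha> :: (complex ^ 'n) measure). P z) \<longleftrightarrow> (AE z in ball_leb. 0 < ennreal (wt \<alpha> z / ball_mass TYPE('n) \<alpha>) \<longrightarrow> P z)"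
    unfolding v_prob_eq[OF assms] by (rule AE_density) measurable
  also have "\<dots> \<longleftrightarrow> (AE z in ball_leb. P z)"
    using m defect_pos by (intro AE_cong) (force simp: less_imp_neq[symmetric])
  finally show ?thesis .
qed

text \<open>The \<open>q\<close>-th power of the norm of \<open>v_prob \<beta>\<close> up to the
  factor \<open>ball_mass\<close>. Extended values allow estimates before integrability is
  known.\<close>

definition Lint :: "real \<Rightarrow> real \<Rightarrow> (complex ^ 'n \<Rightarrow> complex) \<Rightarrow> ennreal" where
  "Lint q \<beta> f = (\<integral>B w. wt \<beta> w * cmod (f w) powr q)"

lemma Lint_cong_AE: "(AE w in ball_leb. f w = g w) \<Longrightarrow> Lint q \<beta> f = Lint q \<beta> g"
  unfolding Lint_def by (rule nn_integral_cong_AE) auto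

lemma nn_integral_v_prob_powr:
  fixes f :: "complex ^ 'n \<Rightarrow> complex"
  assumes \<beta>: "\<beta> > -1" and [measurable]: "measB f"
  shows "(\<integral>\<^sup>+w. ennreal (cmod (f w) powr q) \<partial>v_prob \<beta>) = ennreal (1 / ball_mass TYPE('n) \<beta>) * Lint q \<beta> f"
proof -
  have m: "ball_mass TYPE('n) \<beta> > 0" by (rule ball_mass_pos[OF \<beta>])
  have "(\<integral>\<^sup>+w. ennreal (cmod (f w) powr q) \<partial>v_prob \<beta>)
    = (\<integral>\<^sup>+w. ennreal (1 / ball_mass TYPE('n) \<beta>) * ennreal (wt \<beta> w * cmod (f w) powr q) \<partial>ball_leb)"
    unfolding v_prob_eq[OF \<beta>] using m
    by (subst nn_integral_density) (auto simp: ennreal_mult'[symmetric])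
  also have "\<dots> = ennreal (1 / ball_mass TYPE('n) \<beta>) * Lint q \<beta> f"
    unfolding Lint_def by (rule nn_integral_cmult) measurable
  finally show ?thesis .
qed

lemma Lp_space_iff:
  fixes f :: "complex ^ 'n \<Rightarrow> complex"
  assumes \<beta>: "\<beta> > -1"
  shows "f \<in> Lp_space q (v_prob \<beta>) \<longleftrightarrow> f \<in> borel_measurable ball_leb \<and> Lint q \<beta> f < \<infinity>"
proof (cases "measB f")
  case True
  note [measurable] = True
  have m: "ball_mass TYPE('n) \<beta> > 0" by (rule ball_mass_pos[OF \<beta>])
  have "integrable (v_prob \<beta>) (\<lambda>x. norm (f x) powr q) \<longleftrightarrow> (\<integral>\<^sup>+w. ennreal (cmod (f w) powr q) \<partial>v_prob \<beta>) < \<infinity>"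
    unfolding integrable_iff_bounded by (simp add: \<beta>)
  also have "\<dots> \<longleftrightarrow> Lint q \<beta> f < \<infinity>"
    unfolding nn_integral_v_prob_powr[OF \<beta> True] using m by (auto simp: ennreal_mult_less_top)
  finally show ?thesis using True by (simp add: Lp_space_def \<beta>)
qed (simp add: Lp_space_def \<beta>)

lemma Lp_norm_powr:
  fixes f :: "complex ^ 'n \<Rightarrow> complex"
  assumes \<beta>: "\<beta> > -1" and q: "q > 0" and f: "f \<in> Lp_space q (v_prob \<beta>)"
  shows "Lint q \<beta> f = ennreal (ball_mass TYPE('n) \<beta> * Lp_norm q (v_prob \<beta>) f powr q)"
proof -
  have m: "ball_mass TYPE('n) \<beta> > 0" by (rule ball_mass_pos[OF \<beta>])
  have fm: "measB f" using f Lp_space_iff[OF \<beta>] by blast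
  have "ennreal (\<integral>x. norm (f x) powr q \<partial>v_prob \<beta>) = ennreal (1 / ball_mass TYPE('n) \<beta>) * Lint q \<beta> f"
    unfolding nn_integral_v_prob_powr[OF \<beta> fm, symmetric]
    using f by (intro nn_integral_eq_integral[symmetric]) (auto simp: Lp_space_def)
  moreover have "Lp_norm q (v_prob \<beta>) f powr q = (\<integral>x. norm (f x) powr q \<partial>v_prob \<beta>)"
    using q by (simp add: Lp_norm_def powr_powr)
  ultimately have "ennreal (ball_mass TYPE('n) \<beta>) * ennreal (Lp_norm q (v_prob \<beta>) f powr q)
     = ennreal (ball_mass TYPE('n) \<beta>) * (ennreal (1 / ball_mass TYPE('n) \<beta>) * Lint q \<beta> f)" by simp
  moreover have "ennreal (ball_mass TYPE('n) \<beta>) * ennreal (1 / ball_mass TYPE('n) \<beta>) = 1"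
    using m by (simp flip: ennreal_mult')
  ultimately show ?thesis by (simp add: mult.assoc[symmetric] ennreal_mult'')
qed

lemma Lp_norm_nonneg: "Lp_norm q M f \<ge> 0"
  by (simp add: Lp_norm_def)

text \<open>The tangent inequality of \<open>t \<mapsto> t\<^sup>q\<close> at the extremal point is integrated.\<close>

lemma holder_weighted:
  fixes F k h :: "'a \<Rightarrow> real"
  assumes q: "q > 1" and S: "S > 0" and a: "a \<ge> 0"
    and m: "F \<in> borel_measurable M" "k \<in> borel_measurable M" "h \<in> borel_measurable M"
    and pos: "\<And>w. w \<in> space M \<Longrightarrow> F w \<ge> 0" "\<And>w. w \<in> space M \<Longrightarrow> k w \<ge> 0" "\<And>w. w \<in> space M \<Longrightarrow> h w > 0"
    and le: "ennreal a \<le> (\<integral>\<^sup>+w. ennreal (F w * k w) \<partial>M)"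
    and Sb: "(\<integral>\<^sup>+w. ennreal (k w * h w powr (- 1 / (q - 1))) \<partial>M) \<le> ennreal S"
  shows "ennreal (a powr q) \<le> ennreal (S powr (q - 1)) * (\<integral>\<^sup>+w. ennreal (F w powr q * k w * h w) \<partial>M)"
proof (cases "a = 0")
  case False
  then have a0: "a > 0" using a by simp
  note [measurable] = m
  define T where "T = a / S"
  have T: "T > 0" using a0 S by (simp add: T_def)
  let ?I = "\<integral>\<^sup>+w. ennreal (F w powr q * k w * h w) \<partial>M"
  have pt: "q * T powr (q - 1) * (F w * k w) \<le> F w powr q * k w * h w + (q - 1) * T powr q * (k w * h w powr (- 1 / (q - 1)))"
    if w: "w \<in> space M" for w
  proof -
    define A where "A = T * h w powr (- 1 / (q - 1))"
    have hw: "h w > 0" "k w \<ge> 0" using pos w by auto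
    have A0: "A \<ge> 0" using T by (simp add: A_def)
    have A1: "A powr (q - 1) * h w = T powr (q - 1)"
    proof -
      have "(h w powr (- 1 / (q - 1))) powr (q - 1) = h w powr (- 1)" using q by (simp only: powr_powr) simp
      then have "A powr (q - 1) = T powr (q - 1) * h w powr (- 1)" by (simp only: A_def powr_mult)
      then show ?thesis using hw by (simp add: powr_minus)
    qed
    have "(h w powr (- 1 / (q - 1))) powr q * h w = h w powr (- 1 / (q - 1))"
    proof -
      have "(h w powr (- 1 / (q - 1))) powr q * h w = h w powr (- 1 / (q - 1) * q + 1)"
        unfolding powr_powr powr_add using hw by simp
      also have "- 1 / (q - 1) * q + 1 = - 1 / (q - 1)" using q by (simp add: field_simps)
      finally show ?thesis .
    qed
    then have A2: "A powr q * h w = T powr q * h w powr (- 1 / (q - 1))"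
      by (simp add: A_def powr_mult mult.assoc)
    have "q * (A powr (q - 1) * F w) \<le> F w powr q + (q - 1) * A powr q"
      by (rule powr_tangent[OF q A0 pos(1)[OF w]])
    then have "q * (A powr (q - 1) * F w) * (h w * k w) \<le> (F w powr q + (q - 1) * A powr q) * (h w * k w)"
      using hw by (intro mult_right_mono) auto
    moreover have "q * (A powr (q - 1) * F w) * (h w * k w) = q * T powr (q - 1) * (F w * k w)"
      unfolding A1[symmetric] by (simp only: mult_ac)
    moreover have "(F w powr q + (q - 1) * A powr q) * (h w * k w) = F w powr q * k w * h w + (q - 1) * (A powr q * h w) * k w"
      by (simp add: algebra_simps)
    moreover have "(q - 1) * (A powr q * h w) * k w = (q - 1) * T powr q * (k w * h w powr (- 1 / (q - 1)))"
      unfolding A2 by (simp only: mult_ac)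
    ultimately show ?thesis by (simp only:)
  qed
  have "ennreal (q * T powr (q - 1) * a) = ennreal (q * T powr (q - 1)) * ennreal a"
    using q by (simp add: ennreal_mult')
  also have "\<dots> \<le> ennreal (q * T powr (q - 1)) * (\<integral>\<^sup>+w. ennreal (F w * k w) \<partial>M)"
    by (intro mult_left_mono le) auto
  also have "\<dots> = (\<integral>\<^sup>+w. ennreal (q * T powr (q - 1) * (F w * k w)) \<partial>M)"
    using q by (subst nn_integral_cmult[symmetric]) (auto simp: ennreal_mult')
  also have "\<dots> \<le> (\<integral>\<^sup>+w. ennreal (F w powr q * k w * h w) + ennreal ((q - 1) * T powr q) * ennreal (k w * h w powr (- 1 / (q - 1))) \<partial>M)"
  proof (rule nn_integral_mono)
    fix w assume w: "w \<in> space M"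
    have "ennreal (q * T powr (q - 1) * (F w * k w)) \<le> ennreal (F w powr q * k w * h w + (q - 1) * T powr q * (k w * h w powr (- 1 / (q - 1))))"
      by (rule ennreal_leI[OF pt[OF w]])
    also have "\<dots> = ennreal (F w powr q * k w * h w) + ennreal ((q - 1) * T powr q) * ennreal (k w * h w powr (- 1 / (q - 1)))"
      using q pos(2)[OF w] pos(3)[OF w] by (subst ennreal_mult'[symmetric], simp, subst ennreal_plus[symmetric]) auto
    finally show "ennreal (q * T powr (q - 1) * (F w * k w)) \<le> \<dots>" .
  qed
  also have "\<dots> = ?I + ennreal ((q - 1) * T powr q) * (\<integral>\<^sup>+w. ennreal (k w * h w powr (- 1 / (q - 1))) \<partial>M)"
    by (subst nn_integral_add) (auto simp: nn_integral_cmult)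
  also have "\<dots> \<le> ?I + ennreal ((q - 1) * T powr q) * ennreal S"
    by (intro add_left_mono mult_left_mono Sb) auto
  finally have 1: "ennreal (q * T powr (q - 1) * a) \<le> ?I + ennreal ((q - 1) * T powr q) * ennreal S" .
  have Tq: "T powr q * S = T powr (q - 1) * a"
    using S a0 T by (simp add: T_def powr_diff)
  have e1: "q * T powr (q - 1) * a = T powr (q - 1) * a + (q - 1) * T powr q * S"
    unfolding mult.assoc Tq by (simp add: algebra_simps)
  have "ennreal (T powr (q - 1) * a) \<le> ?I"
  proof -
    have "ennreal (T powr (q - 1) * a) + ennreal ((q - 1) * T powr q) * ennreal S \<le> ?I + ennreal ((q - 1) * T powr q) * ennreal S"
      using 1 unfolding e1 using q S a0
      by (subst (asm) ennreal_plus) (auto simp: ennreal_mult'[symmetric])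
    then show ?thesis by (simp add: ennreal_mult_eq_top_iff)
  qed
  then have "ennreal (S powr (q - 1)) * ennreal (T powr (q - 1) * a) \<le> ennreal (S powr (q - 1)) * ?I"
    by (intro mult_left_mono) auto
  moreover have "S powr (q - 1) * (T powr (q - 1) * a) = a powr q"
    using S a0 by (simp add: T_def powr_divide powr_diff)
  ultimately show ?thesis by (simp flip: ennreal_mult')
qed (use q in simp)

section \<open>Kernel estimates\<close>

text \<open>The modulus of the kernel of \<open>bergman_proj s\<close>; shifting the exponent by n+1
  lets \<open>s\<close> be compared directly with exponents of weights.\<close>

definition kern :: "real \<Rightarrow> complex ^ 'n \<Rightarrow> complex ^ 'n \<Rightarrow> real" where
  "kern s z w = cmod (1 - hinner z w) powr (- (real CARD('n) + 1 + s))"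

lemma kern_nonneg [simp]: "kern s z w \<ge> 0"
  by (simp add: kern_def)

lemma kern_commute: "kern s z w = kern s w z"
  by (simp add: kern_def cmod_one_minus_hinner_commute[of z w])

lemma kern_measurable [measurable (raw)]:
  fixes f g :: "'a \<Rightarrow> complex ^ 'n"
  assumes [measurable]: "f \<in> borel_measurable M" "g \<in> borel_measurable M"
  shows "(\<lambda>x. kern s (f x) (g x)) \<in> borel_measurable M"
  unfolding kern_def by measurable

lemma forelli_rudin_kern:
  assumes t: "t > -1" and c: "s - t > 0"
  obtains C where "C > 0" "\<And>z :: complex ^ 'n. z \<in> \<B> \<Longrightarrow>
    (\<integral>B w. wt t w * kern s z w) \<le> ennreal (C * wt (t - s) z)"
proof (cases rule: forelli_rudin[OF t c, where 'n = 'n])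
  case (1 C)
  note C = this
  have eq: "- (real CARD('n) + 1 + t + (s - t)) = - (real CARD('n) + 1 + s)" "- (s - t) = t - s" by auto
  show ?thesis by (rule that[OF C(1)]) (use C(2) in \<open>simp only: kern_def eq\<close>)
  qed

text \<open>Hoelder's inequality with the test weight \<open>wt e\<close>. The dual factor is a
  Forelli-Rudin integral with exponent s - e/(q-1), and the upper bound on \<open>e\<close> says
  that this exceeds -1. The powers -e at \<open>z\<close> and e at \<open>w\<close> are balanced by
  a later integration in \<open>z\<close>.\<close>

lemma kern_holder:
  assumes q: "q > 1" and s: "s > -1" and e: "0 < e" "e < (s + 1) * (q - 1)"
  obtains C where "C > 0" "\<And>(F :: complex ^ 'n \<Rightarrow> real) z a. z \<in> \<B> \<Longrightarrow> a \<ge> 0 \<Longrightarrow>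
     F \<in> borel_measurable ball_leb \<Longrightarrow> (\<And>w. F w \<ge> 0) \<Longrightarrow>
     ennreal a \<le> (\<integral>B w. F w * (wt s w * kern s z w)) \<Longrightarrow>
     ennreal (a powr q) \<le> ennreal (C * wt (- e) z) *
       (\<integral>B w. F w powr q * (wt (s + e) w * kern s z w))"
proof -
  define t where "t = s - e / (q - 1)"
  have t: "t > -1" using e q by (simp add: t_def field_simps)
  have st: "s - t > 0" using e q by (simp add: t_def)
  show ?thesis
  proof (cases rule: forelli_rudin_kern[OF t st, where 'n = 'n])
  case (1 C)
  note C = this
  show ?thesis
  proof (rule that[of "C powr (q - 1)"])
    show "C powr (q - 1) > 0" using C by simp
    fix F :: "complex ^ 'n \<Rightarrow> real" and z a
    assume z: "z \<in> \<B>" and a: "a \<ge> 0" and F[measurable]: "measB F" and F0: "\<And>w. F w \<ge> 0"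
      and le: "ennreal a \<le> (\<integral>B w. F w * (wt s w * kern s z w))"
    have x: "defect z > 0" by (rule defect_pos[OF z])
    have km: "measB (\<lambda>w. wt s w * kern s z w)" by measurable
    have "ennreal (a powr q) \<le> ennreal ((C * wt (t - s) z) powr (q - 1)) *
       (\<integral>B w. F w powr q * (wt s w * kern s z w) * wt e w)"
    proof (rule holder_weighted[OF q _ a F km _ F0 _ _ le])
      show "C * wt (t - s) z > 0" using C x by simp
      show "wt e w > 0" if "w \<in> space ball_leb" for w :: "complex ^ 'n"
        using defect_pos[of w] that by simp
      have "(\<integral>B w. wt s w * kern s z w * (wt e w) powr (- 1 / (q - 1)))
        = (\<integral>B w. wt t w * kern s z w)"
      proof (rule nn_integral_cong)
        fix w :: "complex ^ 'n" assume "w \<in> space ball_leb"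
        have "wt s w * (wt e w) powr (- 1 / (q - 1)) = wt t w"
          unfolding powr_powr powr_add[symmetric] by (simp add: t_def)
        then show "ennreal (wt s w * kern s z w * (wt e w) powr (- 1 / (q - 1))) = ennreal (wt t w * kern s z w)"
          by (simp add: mult_ac)
      qed
      then show "(\<integral>B w. wt s w * kern s z w * (wt e w) powr (- 1 / (q - 1))) \<le> ennreal (C * wt (t - s) z)"
        using C(2)[OF z] by simp
    qed auto
    also have "(C * wt (t - s) z) powr (q - 1) = C powr (q - 1) * wt (- e) z"
      using C x q by (simp add: powr_mult powr_powr t_def)
    also have "(\<integral>B w. F w powr q * (wt s w * kern s z w) * wt e w)
      = (\<integral>B w. F w powr q * (wt (s + e) w * kern s z w))"
      by (intro nn_integral_cong) (simp add: powr_add mult_ac)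
    finally show "ennreal (a powr q) \<le> ennreal (C powr (q - 1) * wt (- e) z) *
       (\<integral>B w. F w powr q * (wt (s + e) w * kern s z w))" .
  qed qed
qed

text \<open>Schur's test with powers of the defect as test functions: \<open>kern_holder\<close> in
  one variable, exchange of the integrals, Forelli-Rudin in the other. The parameter
  \<open>e\<close> is taken small enough for both integrals to converge.\<close>

lemma schur_bound:
  assumes q: "q > 1" and \<beta>: "\<beta> > -1" and s: "s \<ge> \<beta>"
  obtains C where "C > 0" "\<And>(F :: complex ^ 'n \<Rightarrow> real) \<Phi>. F \<in> borel_measurable ball_leb \<Longrightarrow> (\<And>w. F w \<ge> 0) \<Longrightarrow>
     (\<And>z. z \<in> \<B> \<Longrightarrow> \<Phi> z \<ge> 0) \<Longrightarrow>
     (\<And>z. z \<in> \<B> \<Longrightarrow> ennreal (\<Phi> z) \<le> (\<integral>B w. F w * (wt s w * kern s z w))) \<Longrightarrow>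
     (\<integral>B z. wt \<beta> z * \<Phi> z powr q) \<le> ennreal C * (\<integral>B w. wt \<beta> w * F w powr q)"
proof -
  define e where "e = min (\<beta> + 1) ((s + 1) * (q - 1)) / 2"
  have sp: "s > -1" using s \<beta> by simp
  have "(s + 1) * (q - 1) > 0" using sp q by simp
  then have e: "0 < e" "e < (s + 1) * (q - 1)" "\<beta> - e > -1" using \<beta> by (auto simp: e_def min_def field_simps)
  have se: "s - (\<beta> - e) > 0" using s e by simp
  show ?thesis
  proof (cases rule: kern_holder[OF q sp e(1,2), where 'n = 'n])
  case (1 C)
  note C = this
  show ?thesis
  proof (cases rule: forelli_rudin_kern[OF e(3) se, where 'n = 'n])
  case (1 D)
  note D = this
  show ?thesis
  proof (rule that[of "C * D"])
    show "C * D > 0" using C D by simp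
    fix F \<Phi> :: "complex ^ 'n \<Rightarrow> real"
    assume F[measurable]: "measB F" and F0: "\<And>w. F w \<ge> 0"
      and \<Phi>0: "\<And>z. z \<in> \<B> \<Longrightarrow> \<Phi> z \<ge> 0"
      and le: "\<And>z. z \<in> \<B> \<Longrightarrow> ennreal (\<Phi> z) \<le> (\<integral>B w. F w * (wt s w * kern s z w))"
    let ?g = "\<lambda>z w. C * (F w powr q * wt (s + e) w) * (wt (\<beta> - e) z * kern s w z)"
    have "(\<integral>B z. wt \<beta> z * \<Phi> z powr q) \<le> (\<integral>\<^sup>+z. (\<integral>B w. ?g z w) \<partial>ball_leb)"
    proof (rule nn_integral_mono)
      fix z :: "complex ^ 'n" assume "z \<in> space ball_leb"
      then have z: "z \<in> \<B>" by simp
      let ?W = "\<lambda>w. F w powr q * (wt (s + e) w * kern s z w)"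
      have "ennreal (wt \<beta> z * \<Phi> z powr q) = ennreal (wt \<beta> z) * ennreal (\<Phi> z powr q)" by (rule ennreal_mult') simp
      also have "\<dots> \<le> ennreal (wt \<beta> z) * (ennreal (C * wt (- e) z) * (\<integral>B w. ?W w))"
        by (intro mult_left_mono C(2) z \<Phi>0 F F0 le) auto
      also have "\<dots> = (\<integral>B w. wt \<beta> z * (C * wt (- e) z * ?W w))"
        using C(1) by (subst ball_nn_cmult, simp, measurable, subst ball_nn_cmult) auto
      also have "\<dots> = (\<integral>B w. ?g z w)"
      proof -
        have "wt \<beta> z * wt (- e) z = wt (\<beta> - e) z" by (simp flip: powr_add)
        moreover have "wt \<beta> z * (C * wt (- e) z * ?W w) = C * (F w powr q * wt (s + e) w) * ((wt \<beta> z * wt (- e) z) * kern s w z)" for w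
          unfolding kern_commute[of s w z] by (simp only: mult_ac)
        ultimately show ?thesis by (simp only:)
      qed
      finally show "ennreal (wt \<beta> z * \<Phi> z powr q) \<le> \<dots>" .
    qed
    also have "\<dots> = (\<integral>\<^sup>+w. (\<integral>B z. ?g z w) \<partial>ball_leb)"
      by (rule ball_leb_Fubini) measurable
    also have "\<dots> \<le> (\<integral>B w. C * D * (wt \<beta> w * F w powr q))"
    proof (rule nn_integral_mono)
      fix w :: "complex ^ 'n" assume "w \<in> space ball_leb"
      then have w: "w \<in> \<B>" by simp
      have "(\<integral>B z. ?g z w) \<le> ennreal (C * (F w powr q * wt (s + e) w)) * ennreal (D * wt (\<beta> - e - s) w)"
        using C by (intro ball_nn_le1[OF order_refl D(2)[OF w]]) auto
      also have "\<dots> = ennreal (C * D * (F w powr q * (wt (s + e) w * wt (\<beta> - e - s) w)))"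
        using C D by (subst ennreal_mult'[symmetric]) (auto simp: mult_ac)
      also have "wt (s + e) w * wt (\<beta> - e - s) w = wt \<beta> w" by (simp flip: powr_add)
      finally show "(\<integral>B z. ?g z w) \<le> ennreal (C * D * (wt \<beta> w * F w powr q))" by (simp only: mult_ac)
    qed
    also have "\<dots> = ennreal (C * D) * (\<integral>B w. wt \<beta> w * F w powr q)"
      using C D by (intro ball_nn_cmult[symmetric]) auto
    finally show "(\<integral>B z. wt \<beta> z * \<Phi> z powr q) \<le> \<dots>" .
  qed qed qed
qed

section \<open>The weighted Bergman projection\<close>

definition bint :: "real \<Rightarrow> real \<Rightarrow> (complex ^ 'n \<Rightarrow> complex) \<Rightarrow> complex ^ 'n \<Rightarrow> complex" where
  "bint s N g z = (\<integral>w. wt s w *\<^sub>R (g w * bkern N (hinner z w)) \<partial>ball_leb)"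

lemma L1w_measurable:
  fixes g :: "complex ^ 'n \<Rightarrow> complex"
  assumes "L1w s g"
  shows "measB g"
proof -
  have [measurable]: "measB (\<lambda>w. wt s w *\<^sub>R g w)" using assms by simp
  have "measB (\<lambda>w. (1 / wt s w) *\<^sub>R (wt s w *\<^sub>R g w))" by measurable
  then show ?thesis
    by (rule measurable_cong[THEN iffD1, rotated]) (use defect_pos in \<open>force\<close>)
qed

lemma bergman_proj_eq:
  fixes g :: "complex ^ 'n \<Rightarrow> complex"
  assumes s: "s > -1" and [measurable]: "measB g" and z: "z \<in> \<B>"
  shows "bergman_proj s g z = of_real (1 / ball_mass TYPE('n) s) * bint s (real CARD('n) + 1 + s) g z"
proof -
  let ?N = "real CARD('n) + 1 + s"
  have m: "ball_mass TYPE('n) s > 0" by (rule ball_mass_pos[OF s])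
  have km: "measB (\<lambda>w. bkern ?N (hinner z w))"
    by (rule borel_measurable_bkern) (use norm_hinner_less_1[OF z] in auto)
  note [measurable] = km
  have "g w / (1 - hinner z w) powr complex_of_real ?N = g w * bkern ?N (hinner z w)" for w
    by (simp only: bkern_def of_real_minus powr_minus_divide) simp
  then have "bergman_proj s g z = (\<integral>w. g w * bkern ?N (hinner z w) \<partial>v_prob s)"
    by (simp add: bergman_proj_def)
  also have "\<dots> = (\<integral>w. (wt s w / ball_mass TYPE('n) s) *\<^sub>R (g w * bkern ?N (hinner z w)) \<partial>ball_leb)"
    unfolding v_prob_eq[OF s] using m by (intro integral_density) (auto intro!: AE_I2)
  also have "\<dots> = (\<integral>w. of_real (1 / ball_mass TYPE('n) s) * (wt s w *\<^sub>R (g w * bkern ?N (hinner z w))) \<partial>ball_leb)"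
    by (simp add: scaleR_conv_of_real)
  also have "\<dots> = of_real (1 / ball_mass TYPE('n) s) * (\<integral>w. wt s w *\<^sub>R (g w * bkern ?N (hinner z w)) \<partial>ball_leb)"
    by (rule integral_mult_right_zero)
  finally show ?thesis by (simp add: bint_def)
qed

lemma bkern_bound:
  assumes "cmod x \<le> \<rho>" "\<rho> < 1" "N \<ge> 0"
  shows "cmod (bkern N x) \<le> (1 - \<rho>) powr (- N)"
proof -
  have "1 - \<rho> \<le> cmod (1 - x)" using assms norm_triangle_ineq2[of 1 x] by simp
  then show ?thesis using assms by (subst cmod_bkern) (auto intro!: powr_mono2')
qed

lemma L1w_mult_bounded:
  fixes g k :: "complex ^ 'n \<Rightarrow> complex"
  assumes g: "L1w s g" and [measurable]: "measB k" and B: "\<And>w. w \<in> \<B> \<Longrightarrow> cmod (k w) \<le> B"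
  shows "L1w s (\<lambda>w. g w * k w)"
proof (rule Bochner_Integration.integrable_bound[OF integrable_mult_right[OF g, of "of_real B"]])
  note [measurable] = L1w_measurable[OF g]
  show "measB (\<lambda>w. wt s w *\<^sub>R (g w * k w))" by measurable
  have "norm (wt s w *\<^sub>R (g w * k w)) \<le> norm (of_real B * (wt s w *\<^sub>R g w))" if "w \<in> \<B>" for w
  proof -
    have "cmod (k w) \<le> \<bar>B\<bar>" using B[OF that] by simp
    then have "wt s w * cmod (g w) * cmod (k w) \<le> wt s w * cmod (g w) * \<bar>B\<bar>"
      by (intro mult_left_mono) auto
    then show ?thesis by (simp add: norm_mult mult_ac)
  qed
  then show "AE w in ball_leb. norm (wt s w *\<^sub>R (g w * k w)) \<le> norm (of_real B * (wt s w *\<^sub>R g w))"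
    by (intro AE_I2) simp
qed

lemma L1w_bkern:
  fixes g :: "complex ^ 'n \<Rightarrow> complex"
  assumes g: "L1w s g" and z: "z \<in> \<B>" and N: "N \<ge> 0"
  shows "L1w s (\<lambda>w. g w * bkern N (hinner z w))"
proof (rule L1w_mult_bounded[OF g])
  show "measB (\<lambda>w. bkern N (hinner z w))"
    by (rule borel_measurable_bkern) (use norm_hinner_less_1[OF z] in auto)
  show "cmod (bkern N (hinner z w)) \<le> (1 - norm z) powr (- N)" if "w \<in> \<B>" for w
  proof (rule bkern_bound)
    show "cmod (hinner z w) \<le> norm z" using norm_hinner_le[of z w] that mult_left_le[of "norm w" "norm z"] by simp
  qed (use z N in auto)
qed

text \<open>The constant depends only on the radius of the disc, so the remainder can be integrated
  over all \<open>w\<close>.\<close>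

lemma bkern_taylor:
  assumes \<rho>: "\<rho> < 1" and a: "cmod a \<le> \<rho>" and b: "cmod (a + b) \<le> \<rho>" and N: "N > 0"
  shows "cmod (bkern N (a + b) - bkern N a - of_real N * bkern (N + 1) a * b)
     \<le> N * (N + 1) * (1 - \<rho>) powr (- (N + 2)) * (cmod b)\<^sup>2"
proof -
  define f where "f i = (if i = 0 then bkern N else if i = 1 then (\<lambda>x. of_real N * bkern (N + 1) x)
     else (\<lambda>x. of_real (N * (N + 1)) * bkern (N + 2) x))" for i :: nat
  have "cmod (f 0 (a + b) - (\<Sum>i\<le>1. f i a * ((a + b) - a) ^ i / fact i)) \<le> (N * (N + 1) * (1 - \<rho>) powr (- (N + 2))) * cmod ((a + b) - a) ^ Suc 1 / fact 1"
  proof (rule field_Taylor[where S = "cball 0 \<rho>"])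
    fix i :: nat and x :: complex assume x: "x \<in> cball 0 \<rho>" and i: "i \<le> 1"
    have x1: "cmod x < 1" using x \<rho> by simp
    have "(bkern N has_field_derivative of_real N * bkern (N + 1) x) (at x within cball 0 \<rho>)"
      by (rule has_field_derivative_at_within[OF bkern_has_field_derivative[OF x1]])
    moreover have "((\<lambda>x. of_real N * bkern (N + 1) x) has_field_derivative of_real N * (of_real (N + 1) * bkern (N + 1 + 1) x)) (at x within cball 0 \<rho>)"
      by (intro DERIV_cmult has_field_derivative_at_within[OF bkern_has_field_derivative[OF x1]])
    ultimately show "(f i has_field_derivative f (Suc i) x) (at x within cball 0 \<rho>)"
      using i by (cases "i = 0") (auto simp: f_def add.assoc mult.assoc)
  next
    fix x :: complex assume x: "x \<in> cball 0 \<rho>"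
    have "cmod (bkern (N + 2) x) \<le> (1 - \<rho>) powr (- (N + 2))" using x \<rho> N by (intro bkern_bound) auto
    then have "N * (N + 1) * cmod (bkern (N + 2) x) \<le> N * (N + 1) * (1 - \<rho>) powr (- (N + 2))"
      using N by (intro mult_left_mono) auto
    moreover have "cmod (f (Suc 1) x) = N * (N + 1) * cmod (bkern (N + 2) x)"
      using N by (simp add: f_def norm_mult del: of_real_mult of_real_add)
    ultimately show "cmod (f (Suc 1) x) \<le> N * (N + 1) * (1 - \<rho>) powr (- (N + 2))" by simp
  qed (use a b in auto)
  then show ?thesis by (simp add: f_def power2_eq_square algebra_simps)
qed

text \<open>Differentiation under the integral sign: the candidate \<open>D\<close> integrates the
  derivative of the kernel, and by \<open>bkern_taylor\<close> the error is at most a constant times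
  |y-z|^2.\<close>

lemma holomorphic_ball_bint:
  fixes g :: "complex ^ 'n \<Rightarrow> complex"
  assumes g: "L1w s g" and N: "N > 0"
  shows "holomorphic_ball (bint s N g)"
  unfolding holomorphic_ball_def
proof
  fix z :: "complex ^ 'n" assume z: "z \<in> \<B>"
  define \<rho> where "\<rho> = (1 + norm z) / 2"
  have \<rho>: "norm z \<le> \<rho>" "0 < \<rho>" "\<rho> < 1" "norm z + (1 - norm z) / 2 = \<rho>" using z by (auto simp: \<rho>_def field_simps add_pos_nonneg)
  note gm[measurable] = L1w_measurable[OF g]
  define k where "k h w = of_real N * bkern (N + 1) (hinner z w) * hinner h w" for h w
  define D where "D h = (\<integral>w. wt s w *\<^sub>R (g w * k h w) \<partial>ball_leb)" for h
  define M where "M = (\<integral>w. norm (wt s w *\<^sub>R g w) \<partial>ball_leb)"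
  have M0: "M \<ge> 0" by (simp add: M_def)
  have zw: "cmod (hinner y w) \<le> norm y" if "w \<in> \<B>" for y w :: "complex ^ 'n"
    using norm_hinner_le[of y w] that mult_left_le[of "norm w" "norm y"] by simp
  have km: "measB (\<lambda>w. bkern (N + 1) (hinner z w))"
    by (rule borel_measurable_bkern) (use norm_hinner_less_1[OF z] in auto)
  note [measurable] = km
  have k_m[measurable]: "k h \<in> borel_measurable ball_leb" for h unfolding k_def by measurable
  define B where "B = N * (1 - \<rho>) powr (- (N + 1))"
  have B0: "B \<ge> 0" using N by (simp add: B_def)
  have kb: "cmod (k h w) \<le> B * norm h" if "w \<in> \<B>" for h w
  proof -
    have "cmod (k h w) = N * cmod (bkern (N + 1) (hinner z w)) * cmod (hinner h w)"
      using N by (simp add: k_def norm_mult)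
    also have "\<dots> \<le> N * (1 - \<rho>) powr (- (N + 1)) * norm h"
      using N zw[OF that] \<rho> order_trans[OF zw[OF that, of z] \<rho>(1)]
      by (intro mult_mono bkern_bound) auto
    finally show ?thesis by (simp add: B_def)
  qed
  have ki: "L1w s (\<lambda>w. g w * k h w)" for h by (rule L1w_mult_bounded[OF g k_m kb])
  have normb: "cmod (\<integral>w. wt s w *\<^sub>R (g w * u w) \<partial>ball_leb) \<le> M * c"
    if u: "L1w s (\<lambda>w. g w * u w)" and uc: "\<And>w. w \<in> \<B> \<Longrightarrow> cmod (u w) \<le> c" for u c
  proof -
    have "cmod (\<integral>w. wt s w *\<^sub>R (g w * u w) \<partial>ball_leb) \<le> (\<integral>w. norm (wt s w *\<^sub>R g w) * c \<partial>ball_leb)"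
    proof (rule order_trans[OF integral_norm_bound integral_mono[OF integrable_norm[OF u]]])
      show "integrable ball_leb (\<lambda>w. norm (wt s w *\<^sub>R g w) * c)"
        by (intro integrable_mult_left integrable_norm g)
      fix w :: "complex ^ 'n" assume "w \<in> space ball_leb"
      then have "cmod (u w) \<le> c" using uc by simp
      then have "wt s w * cmod (g w) * cmod (u w) \<le> wt s w * cmod (g w) * c"
        by (intro mult_left_mono) auto
      then show "norm (wt s w *\<^sub>R (g w * u w)) \<le> norm (wt s w *\<^sub>R g w) * c"
        by (simp add: norm_mult mult_ac)
    qed
    also have "\<dots> = M * c" unfolding M_def by (rule integral_mult_left_zero)
    finally show ?thesis .
  qed
  have Dl: "D (x + y) = D x + D y" for x y
  proof -
    have "D x + D y = (\<integral>w. wt s w *\<^sub>R (g w * k x w) + wt s w *\<^sub>R (g w * k y w) \<partial>ball_leb)"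
      unfolding D_def by (rule Bochner_Integration.integral_add[symmetric]) (rule ki)+
    also have "\<dots> = D (x + y)" unfolding D_def k_def by (simp add: hinner_add_left algebra_simps)
    finally show ?thesis ..
  qed
  have Dc: "D (c *s x) = c * D x" for c x
  proof -
    have "c * D x = (\<integral>w. c * (wt s w *\<^sub>R (g w * k x w)) \<partial>ball_leb)"
      unfolding D_def by (rule integral_mult_right_zero[symmetric])
    also have "\<dots> = D (c *s x)" unfolding D_def k_def by (simp add: hinner_smult_left mult_ac)
    finally show ?thesis ..
  qed
  have Dbl: "bounded_linear D"
  proof (rule bounded_linear_intro[where K = "M * B"])
    show "D (x + y) = D x + D y" for x y by (rule Dl)
    show "D (r *\<^sub>R x) = r *\<^sub>R D x" for r x by (simp add: scaleR_eq_smult Dc scaleR_conv_of_real)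
    show "norm (D x) \<le> norm x * (M * B)" for x
      using normb[OF ki kb, of x] unfolding D_def by (simp add: mult_ac)
  qed
  define C where "C = N * (N + 1) * (1 - \<rho>) powr (- (N + 2))"
  have C0: "C \<ge> 0" using N by (simp add: C_def)
  have "(bint s N g has_derivative D) (at z within UNIV)"
  proof (rule has_derivativeI_sandwich[of "(1 - norm z) / 2"])
    show "0 < (1 - norm z) / 2" using z by simp
    show "bounded_linear D" by (rule Dbl)
    show "((\<lambda>y. M * C * norm (y - z)) \<longlongrightarrow> 0) (at z)"
      by (auto intro!: tendsto_eq_intros)
    fix y :: "complex ^ 'n" assume "y \<in> UNIV" "y \<noteq> z" and dist: "dist y z < (1 - norm z) / 2"
    define h where "h = y - z"
    have h0: "norm h > 0" using \<open>y \<noteq> z\<close> by (simp add: h_def)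
    have ny: "norm y \<le> \<rho>"
      using dist norm_triangle_ineq2[of y z] by (simp add: dist_norm \<rho>_def field_simps)
    have y: "y \<in> \<B>" using ny \<rho> by simp
    have iy: "L1w s (\<lambda>w. g w * bkern N (hinner y w))" "L1w s (\<lambda>w. g w * bkern N (hinner z w))"
      by (rule L1w_bkern[OF g]; use y z N in auto)+
    define u where "u w = bkern N (hinner y w) - bkern N (hinner z w) - k h w" for w
    have eq: "wt s w *\<^sub>R (g w * u w) = wt s w *\<^sub>R (g w * bkern N (hinner y w)) - wt s w *\<^sub>R (g w * bkern N (hinner z w)) - wt s w *\<^sub>R (g w * k h w)" for w
      by (simp add: u_def algebra_simps)
    have ui: "L1w s (\<lambda>w. g w * u w)" unfolding eq by (intro Bochner_Integration.integrable_diff iy ki)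
    have "bint s N g y - bint s N g z - D (y - z) = (\<integral>w. wt s w *\<^sub>R (g w * u w) \<partial>ball_leb)"
      unfolding eq bint_def D_def h_def[symmetric] using iy ki by simp
    moreover have "cmod (u w) \<le> C * (norm h)\<^sup>2" if w: "w \<in> \<B>" for w
    proof -
      have "hinner y w = hinner z w + hinner h w" by (simp add: h_def hinner_diff_left)
      then have "cmod (u w) \<le> C * (cmod (hinner h w))\<^sup>2"
        using bkern_taylor[of \<rho> "hinner z w" "hinner h w" N] zw[OF w, of z] zw[OF w, of y] ny \<rho> N
        by (simp add: u_def k_def C_def)
      also have "\<dots> \<le> C * (norm h)\<^sup>2" using zw[OF w, of h] C0 by (intro mult_left_mono power_mono) auto
      finally show ?thesis .
    qed
    ultimately have "cmod (bint s N g y - bint s N g z - D (y - z)) \<le> M * (C * (norm h)\<^sup>2)"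
      using normb[OF ui] by metis
    then show "norm (bint s N g y - bint s N g z - D (y - z)) / norm (y - z) \<le> M * C * norm (y - z)"
      using h0 by (simp add: h_def[symmetric] divide_le_eq power2_eq_square mult_ac)
  qed
  then show "\<exists>D. (bint s N g has_derivative D) (at z) \<and> (\<forall>c x. D (c *s x) = c * D x)"
    using Dc by auto
qed

lemma holomorphic_ball_cong:
  assumes "holomorphic_ball f" "\<And>z. z \<in> \<B> \<Longrightarrow> f z = g z"
  shows "holomorphic_ball g"
  unfolding holomorphic_ball_def
proof
  fix z :: "complex ^ 'a" assume z: "z \<in> \<B>"
  then obtain D where "(f has_derivative D) (at z)" "\<And>c x. D (c *s x) = c * D x"
    using assms(1) unfolding holomorphic_ball_def by blast
  moreover from this(1) have "(g has_derivative D) (at z)"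
    by (rule has_derivative_transform_within_open[OF _ open_ball z]) (use assms(2) in auto)
  ultimately show "\<exists>D. (g has_derivative D) (at z) \<and> (\<forall>c x. D (c *s x) = c * D x)" by blast
qed

lemma holomorphic_ball_mult:
  assumes f: "holomorphic_ball f" and g: "holomorphic_ball g"
  shows "holomorphic_ball (\<lambda>z. f z * g z)"
  unfolding holomorphic_ball_def
proof
  fix z :: "complex ^ 'a" assume z: "z \<in> \<B>"
  obtain D where D: "(f has_derivative D) (at z)" "\<And>c x. D (c *s x) = c * D x"
    using f z unfolding holomorphic_ball_def by blast
  obtain E where E: "(g has_derivative E) (at z)" "\<And>c x. E (c *s x) = c * E x"
    using g z unfolding holomorphic_ball_def by blast
  have "((\<lambda>z. f z * g z) has_derivative (\<lambda>h. f z * E h + D h * g z)) (at z)"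
    by (rule has_derivative_mult[OF D(1) E(1)])
  then show "\<exists>D. ((\<lambda>z. f z * g z) has_derivative D) (at z) \<and> (\<forall>c x. D (c *s x) = c * D x)"
    by (intro exI conjI) (auto simp: D(2) E(2) algebra_simps)
qed

lemma holomorphic_ball_add:
  assumes f: "holomorphic_ball f" and g: "holomorphic_ball g"
  shows "holomorphic_ball (\<lambda>z. f z + g z)"
  unfolding holomorphic_ball_def
proof
  fix z :: "complex ^ 'a" assume z: "z \<in> \<B>"
  obtain D where D: "(f has_derivative D) (at z)" "\<And>c x. D (c *s x) = c * D x"
    using f z unfolding holomorphic_ball_def by blast
  obtain E where E: "(g has_derivative E) (at z)" "\<And>c x. E (c *s x) = c * E x"
    using g z unfolding holomorphic_ball_def by blast
  have "((\<lambda>z. f z + g z) has_derivative (\<lambda>h. D h + E h)) (at z)"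
    by (rule has_derivative_add[OF D(1) E(1)])
  then show "\<exists>D. ((\<lambda>z. f z + g z) has_derivative D) (at z) \<and> (\<forall>c x. D (c *s x) = c * D x)"
    by (intro exI conjI) (auto simp: D(2) E(2) algebra_simps)
qed

lemma holomorphic_ball_cmult: "holomorphic_ball g \<Longrightarrow> holomorphic_ball (\<lambda>z. c * g z)"
  using holomorphic_ball_mult[OF holomorphic_ball_const] by blast

lemma holomorphic_ball_bergman_proj:
  fixes g :: "complex ^ 'n \<Rightarrow> complex"
  assumes s: "s > -1" and g: "L1w s g"
  shows "holomorphic_ball (bergman_proj s g)"
proof (rule holomorphic_ball_cong)
  show "holomorphic_ball (\<lambda>z. of_real (1 / ball_mass TYPE('n) s) * bint s (real CARD('n) + 1 + s) g z)"
    by (intro holomorphic_ball_cmult holomorphic_ball_bint g) (use s in simp)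
  show "of_real (1 / ball_mass TYPE('n) s) * bint s (real CARD('n) + 1 + s) g z = bergman_proj s g z" if "z \<in> \<B>" for z
    by (rule bergman_proj_eq[OF s L1w_measurable[OF g] that, symmetric])
qed

lemma bergman_proj_holomorphic:
  fixes g :: "complex ^ 'n \<Rightarrow> complex"
  assumes s: "s > -1" and g: "holomorphic_ball g" "L1w s g" and z: "z \<in> \<B>"
  shows "bergman_proj s g z = g z"
  unfolding bergman_proj_eq[OF s L1w_measurable[OF g(2)] z] bint_def bergman_reproducing[OF s g z]
  using ball_mass_pos[OF s, where 'n = 'n] by simp

lemma bergman_proj_add:
  fixes f g :: "complex ^ 'n \<Rightarrow> complex"
  assumes s: "s > -1" and f: "L1w s f" and g: "L1w s g" and z: "z \<in> \<B>"
  shows "bergman_proj s (\<lambda>w. f w + g w) z = bergman_proj s f z + bergman_proj s g z"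
proof -
  have N: "real CARD('n) + 1 + s \<ge> 0" using s by simp
  have "bint s (real CARD('n) + 1 + s) (\<lambda>w. f w + g w) z = bint s (real CARD('n) + 1 + s) f z + bint s (real CARD('n) + 1 + s) g z"
    unfolding bint_def
    by (subst Bochner_Integration.integral_add[symmetric, OF L1w_bkern[OF f z N] L1w_bkern[OF g z N]])
       (simp add: algebra_simps)
  then show ?thesis
    using L1w_measurable[OF f] L1w_measurable[OF g]
    by (simp add: bergman_proj_eq[OF s _ z] distrib_left)
qed

lemma bergman_proj_cmult: "bergman_proj s (\<lambda>w. c * g w) z = c * bergman_proj s g z"
proof -
  have "bergman_proj s (\<lambda>w. c * g w) z = (\<integral>w. c * (g w / (1 - hinner z w) powr complex_of_real (real CARD('a) + 1 + s)) \<partial>(v_prob s))"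
    by (simp add: bergman_proj_def)
  also have "\<dots> = c * bergman_proj s g z"
    unfolding bergman_proj_def by (rule integral_mult_right_zero)
  finally show ?thesis .
qed

lemma bergman_proj_diff:
  fixes f g :: "complex ^ 'n \<Rightarrow> complex"
  assumes "s > -1" "L1w s f" "L1w s g" "z \<in> \<B>"
  shows "bergman_proj s (\<lambda>w. f w - g w) z = bergman_proj s f z - bergman_proj s g z"
  using bergman_proj_add[of s f "\<lambda>w. -1 * g w" z] bergman_proj_cmult[of s "-1" g z] assms by simp

lemma bergman_proj_cong_AE:
  fixes f g :: "complex ^ 'n \<Rightarrow> complex"
  assumes s: "s > -1" and f: "measB f" and g: "measB g"
    and ae: "AE w in ball_leb. f w = g w" and z: "z \<in> \<B>"
  shows "bergman_proj s f z = bergman_proj s g z"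
proof -
  have [measurable]: "measB (\<lambda>w. bkern (real CARD('n) + 1 + s) (hinner z w))"
    by (rule borel_measurable_bkern) (use norm_hinner_less_1[OF z] in auto)
  note [measurable] = f g
  have "bint s (real CARD('n) + 1 + s) f z = bint s (real CARD('n) + 1 + s) g z"
    unfolding bint_def by (rule integral_cong_AE) (measurable, use ae in auto)
  then show ?thesis by (simp add: bergman_proj_eq[OF s _ z] f g)
qed

lemma bergman_proj_bound:
  fixes g :: "complex ^ 'n \<Rightarrow> complex"
  assumes s: "s > -1" and g: "L1w s g" and z: "z \<in> \<B>"
  shows "ennreal (ball_mass TYPE('n) s * cmod (bergman_proj s g z))
    \<le> (\<integral>B w. cmod (g w) * (wt s w * kern s z w))"
proof -
  let ?N = "real CARD('n) + 1 + s"
  have m: "ball_mass TYPE('n) s > 0" by (rule ball_mass_pos[OF s])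
  have "ball_mass TYPE('n) s * cmod (bergman_proj s g z) = cmod (bint s ?N g z)"
    unfolding bergman_proj_eq[OF s L1w_measurable[OF g] z] using m by (simp add: norm_mult norm_divide)
  also have "ennreal \<dots> \<le> (\<integral>B w. norm (wt s w *\<^sub>R (g w * bkern ?N (hinner z w))))"
    unfolding bint_def by (rule integral_norm_bound_ennreal[OF L1w_bkern[OF g z]]) (use s in simp)
  also have "\<dots> = (\<integral>B w. cmod (g w) * (wt s w * kern s z w))"
  proof (rule nn_integral_cong)
    fix w :: "complex ^ 'n" assume "w \<in> space ball_leb"
    then have "cmod (hinner z w) < 1" by (intro norm_hinner_less_1 z) auto
    then have "norm (wt s w *\<^sub>R (g w * bkern ?N (hinner z w))) = cmod (g w) * (wt s w * kern s z w)"
      by (simp add: norm_mult cmod_bkern kern_def)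
    then show "ennreal (norm (wt s w *\<^sub>R (g w * bkern ?N (hinner z w)))) = ennreal (cmod (g w) * (wt s w * kern s z w))"
      by simp
  qed
  finally show ?thesis .
qed

text \<open>The weight has finite mass and t \<le> 1 + t^q, so the \<open>q\<close>-th power
  controls the first; increasing the exponent from \<beta> to \<open>s\<close> only lowers the
  weight.\<close>

lemma L1w_Lint:
  fixes g :: "complex ^ 'n \<Rightarrow> complex"
  assumes q: "q \<ge> 1" and \<beta>: "\<beta> > -1" and s: "s \<ge> \<beta>" and [measurable]: "measB g"
    and fin: "Lint q \<beta> g < \<infinity>"
  shows "L1w s g"
proof (rule integrableI_bounded)
  show "measB (\<lambda>w. wt s w *\<^sub>R g w)" by measurable
  have "(\<integral>B w. norm (wt s w *\<^sub>R g w))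
    \<le> (\<integral>\<^sup>+w. ennreal (wt \<beta> w) + ennreal (wt \<beta> w * cmod (g w) powr q) \<partial>ball_leb)"
  proof (rule nn_integral_mono)
    fix w :: "complex ^ 'n" assume "w \<in> space ball_leb"
    then have x: "0 < defect w" "defect w \<le> 1" using defect_pos defect_le_1 by auto
    have "cmod (g w) \<le> 1 + cmod (g w) powr q"
    proof (cases "cmod (g w) \<le> 1")
      case False
      then have "cmod (g w) powr 1 \<le> cmod (g w) powr q" using q by (intro powr_mono) auto
      then show ?thesis by simp
    qed (smt (verit) powr_ge_zero)
    moreover have "wt s w \<le> wt \<beta> w" using x s by (intro powr_mono') auto
    ultimately have "wt s w * cmod (g w) \<le> wt \<beta> w * (1 + cmod (g w) powr q)"
      by (intro mult_mono) auto
    then show "ennreal (norm (wt s w *\<^sub>R g w)) \<le> ennreal (wt \<beta> w) + ennreal (wt \<beta> w * cmod (g w) powr q)"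
      by (simp add: algebra_simps ennreal_leI flip: ennreal_plus)
  qed
  also have "\<dots> = (\<integral>\<^sup>+w. ennreal (wt \<beta> w) \<partial>(ball_leb :: (complex ^ 'n) measure)) + Lint q \<beta> g"
    unfolding Lint_def by (rule nn_integral_add) auto
  also have "\<dots> < \<infinity>" using fin ball_mass[OF \<beta>, where 'n = 'n] by simp
  finally show "(\<integral>B w. norm (wt s w *\<^sub>R g w)) < \<infinity>" .
qed

lemma holomorphic_ball_measurable: "holomorphic_ball g \<Longrightarrow> measB g"
  by (rule borel_measurable_ball_leb_continuous[OF holomorphic_ball_continuous])

lemma bergman_proj_Lint:
  assumes q: "q > 1" and \<beta>: "\<beta> > -1" and s: "s \<ge> \<beta>"
  obtains C where "C > 0" "\<And>g :: complex ^ 'n \<Rightarrow> complex. g \<in> borel_measurable ball_leb \<Longrightarrow> Lint q \<beta> g < \<infinity> \<Longrightarrow>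
    Lint q \<beta> (bergman_proj s g) \<le> ennreal C * Lint q \<beta> g"
proof -
  have sp: "s > -1" using s \<beta> by simp
  let ?m = "ball_mass TYPE('n) s"
  have m: "?m > 0" by (rule ball_mass_pos[OF sp])
  show ?thesis
  proof (cases rule: schur_bound[OF q \<beta> s, where 'n = 'n])
  case (1 C)
  note C = this
  show ?thesis
  proof (rule that[of "C / ?m powr q"])
    show "C / ?m powr q > 0" using C m by simp
    fix g :: "complex ^ 'n \<Rightarrow> complex" assume g[measurable]: "measB g" and fin: "Lint q \<beta> g < \<infinity>"
    have L1: "L1w s g" by (rule L1w_Lint[OF _ \<beta> s g fin]) (use q in simp)
    have "(\<integral>B z. wt \<beta> z * (?m * cmod (bergman_proj s g z)) powr q) \<le> ennreal C * (\<integral>B w. wt \<beta> w * cmod (g w) powr q)"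
      by (rule C(2)) (use bergman_proj_bound[OF sp L1] m in auto)
    moreover have "(\<integral>B z. wt \<beta> z * (?m * cmod (bergman_proj s g z)) powr q)
      = ennreal (?m powr q) * Lint q \<beta> (bergman_proj s g)"
    proof -
      have pm[measurable]: "bergman_proj s g \<in> borel_measurable ball_leb"
        by (rule holomorphic_ball_measurable[OF holomorphic_ball_bergman_proj[OF sp L1]])
      show ?thesis unfolding Lint_def using m
        by (subst nn_integral_cmult[symmetric]) (auto simp: powr_mult ennreal_mult'[symmetric] mult_ac)
    qed
    ultimately have le: "ennreal (?m powr q) * Lint q \<beta> (bergman_proj s g) \<le> ennreal C * Lint q \<beta> g"
      by (simp add: Lint_def)
    have "Lint q \<beta> (bergman_proj s g) = ennreal (1 / ?m powr q) * (ennreal (?m powr q) * Lint q \<beta> (bergman_proj s g))"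
      using m by (simp add: mult.assoc[symmetric] flip: ennreal_mult')
    also have "\<dots> \<le> ennreal (1 / ?m powr q) * (ennreal C * Lint q \<beta> g)" by (intro mult_left_mono le) auto
    also have "\<dots> = ennreal (C / ?m powr q) * Lint q \<beta> g"
      using C m by (simp add: mult.assoc[symmetric] flip: ennreal_mult')
    finally show "Lint q \<beta> (bergman_proj s g) \<le> ennreal (C / ?m powr q) * Lint q \<beta> g" .
  qed qed
qed

lemma powr_add_le:
  fixes x y q :: real
  assumes "x \<ge> 0" "y \<ge> 0" "q \<ge> 0"
  shows "(x + y) powr q \<le> 2 powr q * (x powr q + y powr q)"
proof -
  have "(x + y) powr q \<le> (2 * max x y) powr q" using assms by (intro powr_mono2) auto
  also have "\<dots> = 2 powr q * (max x y) powr q" by (rule powr_mult)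
  also have "(max x y) powr q \<le> x powr q + y powr q" by (simp add: max_def)
  finally show ?thesis by simp
qed

lemma cmod_diff_powr_le:
  assumes "q \<ge> 0"
  shows "cmod (x - y) powr q \<le> 2 powr q * (cmod (x - c) powr q + cmod (y - c) powr q)"
proof -
  have "cmod (x - y) \<le> cmod (x - c) + cmod (y - c)"
    using norm_triangle_ineq4[of "x - c" "y - c"] by simp
  then have "cmod (x - y) powr q \<le> (cmod (x - c) + cmod (y - c)) powr q"
    using assms by (intro powr_mono2) auto
  also have "\<dots> \<le> 2 powr q * (cmod (x - c) powr q + cmod (y - c) powr q)"
    using assms by (intro powr_add_le) auto
  finally show ?thesis .
qed

lemma powr_comparable:
  fixes x y K p :: real
  assumes "x > 0" "y > 0" "K \<ge> 1" "x \<le> K * y" "y \<le> K * x"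
  shows "x powr p \<le> K powr \<bar>p\<bar> * y powr p"
proof (cases "p \<ge> 0")
  case True
  then have "x powr p \<le> (K * y) powr p" using assms by (intro powr_mono2) auto
  then show ?thesis using True by (simp add: powr_mult)
next
  case False
  have "y / K \<le> x" using assms by (simp add: divide_le_eq mult.commute)
  then have "x powr p \<le> (y / K) powr p" using False assms by (intro powr_mono2') auto
  also have "\<dots> = K powr \<bar>p\<bar> * y powr p" using False assms by (simp add: powr_divide powr_minus_divide)
  finally show ?thesis .
qed

lemma sq_powr: "x > 0 \<Longrightarrow> (x\<^sup>2) powr s = x powr (2 * s)" for x s :: real
  using powr_powr[of x 2 s] by simp

lemma near_comparable:
  fixes r :: real
  assumes r: "r > 0"
  obtains K where "K \<ge> 1"
    "\<And>z w :: complex ^ 'n. z \<in> \<B> \<Longrightarrow> w \<in> \<B> \<Longrightarrow> bergman_dist z w < r \<Longrightarrow> defect w \<le> K * defect z"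
    "\<And>z w v :: complex ^ 'n. z \<in> \<B> \<Longrightarrow> w \<in> \<B> \<Longrightarrow> bergman_dist z w < r \<Longrightarrow> v \<in> \<B> \<Longrightarrow>
       cmod (1 - hinner w v) \<le> K * cmod (1 - hinner z v)"
  by (rule bergman_ball_comparable[OF r, where 'n = 'n]) (rule that, auto simp: bergman_ball_def)

text \<open>Comparability on Bergman balls with the factor \<open>near r z w\<close> kept on both
  sides: the estimates then hold for all points of the ball and can be used under an
  integral.\<close>

lemma near_powr_le:
  fixes r :: real
  assumes r: "r > 0"
  obtains K where "K \<ge> 1"
    "\<And>(z :: complex ^ 'n) w p. z \<in> \<B> \<Longrightarrow> w \<in> \<B> \<Longrightarrow> near r z w * wt p w \<le> near r z w * (K powr \<bar>p\<bar> * wt p z)"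
    "\<And>(z :: complex ^ 'n) w v s. s > -1 \<Longrightarrow> z \<in> \<B> \<Longrightarrow> w \<in> \<B> \<Longrightarrow> v \<in> \<B> \<Longrightarrow>
        near r z w * kern s w v \<le> near r z w * (K powr (real CARD('n) + 1 + s) * kern s z v)"
proof (cases rule: near_comparable[OF r, where 'n = 'n])
  case (1 K)
  note K = this
  show ?thesis
  proof (rule that[OF K(1)])
    fix z w :: "complex ^ 'n" and p assume z: "z \<in> \<B>" and w: "w \<in> \<B>"
    show "near r z w * wt p w \<le> near r z w * (K powr \<bar>p\<bar> * wt p z)"
    proof (cases "bergman_dist z w < r")
      case True
      then have "wt p w \<le> K powr \<bar>p\<bar> * wt p z"
        using K(1) K(2)[OF z w] K(2)[OF w z] defect_pos[OF z] defect_pos[OF w]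
        by (intro powr_comparable) (auto simp: bergman_dist_commute)
      then show ?thesis by (intro mult_left_mono) auto
    qed (simp add: near_def)
    fix v :: "complex ^ 'n" and s :: real assume s: "s > -1" and v: "v \<in> \<B>"
    show "near r z w * kern s w v \<le> near r z w * (K powr (real CARD('n) + 1 + s) * kern s z v)"
    proof (cases "bergman_dist z w < r")
      case True
      have "cmod (1 - hinner w v) powr (- (real CARD('n) + 1 + s)) \<le> K powr \<bar>- (real CARD('n) + 1 + s)\<bar> * cmod (1 - hinner z v) powr (- (real CARD('n) + 1 + s))"
        using K(1) K(3)[OF z w _ v] K(3)[OF w z _ v] True one_minus_hinner_nonzero[OF z v] one_minus_hinner_nonzero[OF w v]
        by (intro powr_comparable) (auto simp: bergman_dist_commute)
      moreover have "\<bar>- (real CARD('n) + 1 + s)\<bar> = real CARD('n) + 1 + s" using s by simp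
      ultimately have "kern s w v \<le> K powr (real CARD('n) + 1 + s) * kern s z v" unfolding kern_def by (simp only:)
      then show ?thesis by (intro mult_left_mono) auto
    qed (simp add: near_def)
  qed qed

text \<open>The submean value inequality applied to the constant function 1.\<close>

lemma near_volume_lower:
  fixes r :: real
  assumes r: "r > 0"
  obtains C where "C > 0" "\<And>z :: complex ^ 'n. z \<in> \<B> \<Longrightarrow>
    1 \<le> ennreal (C * wt (- (real CARD('n) + 1)) z) * (\<integral>B w. near r z w)"
proof (cases rule: bergman_submean[OF r, of 2, where 'n = 'n])
  case (2 C)
  show ?thesis by (rule that[OF 2(1)]) (use 2(2)[of "\<lambda>_. 1"] in simp)
qed simp

text \<open>Near \<open>z\<close> the quantity |1-<z,w>| is comparable with the defect of
  \<open>z\<close>, so up to a power of that defect the indicator lies below \<open>kern 1\<close>,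
  whose integral is given by Forelli-Rudin.\<close>

lemma near_volume_upper:
  fixes r :: real
  assumes r: "r > 0"
  obtains C where "C > 0" "\<And>z :: complex ^ 'n. z \<in> \<B> \<Longrightarrow>
    (\<integral>B w. near r z w) \<le> ennreal (C * wt (real CARD('n) + 1) z)"
proof (cases rule: near_powr_le[OF r, where 'n = 'n])
  case (1 K)
  note K = this
  have less: "(0 :: real) > -1" "(1 :: real) - 0 > 0" by auto
  show ?thesis
  proof (cases rule: forelli_rudin_kern[OF less, where 'n = 'n])
  case (1 F)
  note F = this
  let ?n = "real CARD('n) + 1" and ?K = "K powr (real CARD('n) + 1 + 1)"
  show ?thesis
  proof (rule that[of "?K * F"])
    show "?K * F > 0" using K F by simp
    fix z :: "complex ^ 'n" assume z: "z \<in> \<B>"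
    have "near r z w \<le> ?K * wt (?n + 1) z * (wt 0 w * kern 1 z w)" if w: "w \<in> \<B>" for w
    proof -
      have "near r w z * kern 1 z z \<le> near r w z * (?K * kern 1 w z)" using K(3)[of 1 w z z] w z by simp
      also have "\<dots> \<le> 1 * (?K * kern 1 w z)" by (intro mult_right_mono) auto
      finally have "near r w z * kern 1 z z * wt (?n + 1) z \<le> 1 * (?K * kern 1 w z) * wt (?n + 1) z"
        by (rule mult_right_mono) simp
      moreover have "near r w z * kern 1 z z * wt (?n + 1) z = near r w z"
        unfolding kern_def defect_alt[symmetric] norm_of_real using defect_pos[OF z]
        by (simp add: mult.assoc flip: powr_add)
      ultimately have "near r w z \<le> 1 * (?K * kern 1 w z) * wt (?n + 1) z" by (simp only:)
      then show ?thesis using defect_pos[OF w]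
        by (simp add: near_commute[of r w] kern_commute[of 1 w] mult_ac)
    qed
    then have "(\<integral>B w. near r z w) \<le> ennreal (?K * wt (?n + 1) z) * ennreal (F * wt (0 - 1) z)"
      by (rule ball_nn_le1) (use F(2)[OF z] in \<open>auto\<close>)
    also have "\<dots> = ennreal (?K * F * (wt (?n + 1) z * wt (0 - 1) z))"
      by (subst ennreal_mult'[symmetric]) (auto simp only: mult_ac powr_ge_zero mult_nonneg_nonneg)
    finally show "(\<integral>B w. near r z w) \<le> ennreal (?K * F * wt ?n z)" unfolding powr_add[symmetric] by (simp add: add.commute)
  qed qed
qed

section \<open>Oscillation\<close>

text \<open>The weight on the right is the order of the volume of the Bergman ball, so
  \<open>M\<close> bounds a mean \<open>q\<close>-th power. The centers \<open>a\<close> stay free;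
  for the given function they will be its averages.\<close>

definition osc_bound :: "real \<Rightarrow> real \<Rightarrow> (complex ^ 'n \<Rightarrow> complex) \<Rightarrow> (complex ^ 'n \<Rightarrow> complex) \<Rightarrow> (complex ^ 'n \<Rightarrow> real) \<Rightarrow> bool" where
  "osc_bound q r f a M \<longleftrightarrow> f \<in> borel_measurable ball_leb \<and> (\<forall>u\<in>\<B>. M u \<ge> 0 \<and>
     (\<integral>B w. near r u w * cmod (f w - a u) powr q) \<le> ennreal (wt (real CARD('n) + 1) u * M u))"

lemma near_weight_le:
  fixes r s t :: real
  assumes r: "r > 0" and s: "s > -1"
  obtains K where "K > 0" "\<And>(z :: complex ^ 'n) w v x. z \<in> \<B> \<Longrightarrow> w \<in> \<B> \<Longrightarrow> v \<in> \<B> \<Longrightarrow> x \<ge> 0 \<Longrightarrow>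
    near r z w * (wt t w * kern s w v * x) \<le> K * (wt t z * kern s z v) * (near r z w * x)"
proof (cases rule: near_powr_le[OF r, where 'n = 'n])
  case (1 K)
  let ?K = "K powr \<bar>t\<bar> * K powr (real CARD('n) + 1 + s)"
  show ?thesis
  proof (rule that[of ?K])
    show "?K > 0" using 1 by simp
    fix z w v :: "complex ^ 'n" and x :: real assume *: "z \<in> \<B>" "w \<in> \<B>" "v \<in> \<B>" "x \<ge> 0"
    show "near r z w * (wt t w * kern s w v * x) \<le> ?K * (wt t z * kern s z v) * (near r z w * x)"
    proof (cases "bergman_dist z w < r")
      case True
      then have "wt t w * kern s w v * x \<le> (K powr \<bar>t\<bar> * wt t z) * (K powr (real CARD('n) + 1 + s) * kern s z v) * x"
        using 1(2)[OF *(1,2), of t] 1(3)[OF s *(1-3)] *(4) by (intro mult_right_mono mult_mono) (auto simp: near_def)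
      then show ?thesis using True by (simp add: near_def mult_ac)
    qed (simp add: near_def)
  qed
qed

text \<open>The ball of radius r/2 about \<open>u\<close> lies in both balls of radius
  \<open>r\<close>. On it \<open>f\<close> is close to both centers, and its volume is bounded
  below, so the centers are close to each other.\<close>

lemma osc_bound_adjacent:
  assumes q: "q \<ge> 0" and r: "r > 0"
  obtains C where "C > 0" "\<And>(f :: complex ^ 'n \<Rightarrow> complex) a M u v. osc_bound q r f a M \<Longrightarrow> u \<in> \<B> \<Longrightarrow> v \<in> \<B> \<Longrightarrow>
     bergman_dist u v \<le> r / 2 \<Longrightarrow> cmod (a u - a v) powr q \<le> C * (M u + M v)"
proof -
  let ?n = "real CARD('n) + 1"
  have r2: "r / 2 > 0" using r by simp
  show ?thesis
  proof (cases rule: near_volume_lower[OF r2, where 'n = 'n])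
  case (1 C)
  note C = this
  show ?thesis
  proof (cases rule: near_comparable[OF r, where 'n = 'n])
  case (1 K)
  note K = this
  show ?thesis
  proof (rule that[of "C * 2 powr q * K powr ?n"])
    show "C * 2 powr q * K powr ?n > 0" using C K by simp
    fix f a :: "complex ^ 'n \<Rightarrow> complex" and M and u v :: "complex ^ 'n"
    assume osc: "osc_bound q r f a M" and u: "u \<in> \<B>" and v: "v \<in> \<B>" and uv: "bergman_dist u v \<le> r / 2"
    note [measurable] = osc[unfolded osc_bound_def, THEN conjunct1]
    have Mu: "M u \<ge> 0" "(\<integral>B w. near r u w * cmod (f w - a u) powr q) \<le> ennreal (wt ?n u * M u)"
      and Mv: "M v \<ge> 0" "(\<integral>B w. near r v w * cmod (f w - a v) powr q) \<le> ennreal (wt ?n v * M v)"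
      using osc u v by (auto simp: osc_bound_def)
    have dvu: "defect v \<le> K * defect u" using uv r by (intro K(2) u v) auto
    have x: "defect u > 0" by (rule defect_pos[OF u])
    define b where "b = cmod (a u - a v) powr q"
    have b0: "b \<ge> 0" by (simp add: b_def)
    have 1: "(\<integral>B w. b * near (r / 2) u w) \<le> ennreal (2 powr q * (wt ?n u * M u) + 2 powr q * (wt ?n v * M v))"
    proof (rule ball_nn_le2[OF _ Mu(2) Mv(2)])
      fix w :: "complex ^ 'n" assume w: "w \<in> \<B>"
      have n: "near (r / 2) u w \<le> near r u w" "near (r / 2) u w \<le> near r v w"
        using r uv bergman_dist_triangle[OF u v w] by (auto simp: near_def bergman_dist_commute)
      have "b * near (r / 2) u w \<le> 2 powr q * (cmod (f w - a u) powr q + cmod (f w - a v) powr q) * near (r / 2) u w"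
        unfolding b_def using cmod_diff_powr_le[OF q, of "a u" "a v" "f w"]
        by (intro mult_right_mono) (auto simp: norm_minus_commute)
      also have "\<dots> = 2 powr q * (near (r / 2) u w * cmod (f w - a u) powr q) + 2 powr q * (near (r / 2) u w * cmod (f w - a v) powr q)"
        by (simp add: algebra_simps)
      also have "\<dots> \<le> 2 powr q * (near r u w * cmod (f w - a u) powr q) + 2 powr q * (near r v w * cmod (f w - a v) powr q)"
        using n by (intro mult_left_mono add_mono mult_right_mono) auto
      finally show "b * near (r / 2) u w \<le> \<dots>" .
    qed (use Mu Mv in auto)
    have "ennreal b \<le> ennreal b * (ennreal (C * wt (- ?n) u) * (\<integral>B w. near (r / 2) u w))"
      using mult_left_mono[OF C(2)[OF u], of "ennreal b"] by simp
    also have "\<dots> = ennreal (C * wt (- ?n) u) * (\<integral>B w. b * near (r / 2) u w)"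
      using b0 by (simp add: nn_integral_cmult ennreal_mult' mult_ac)
    also have "\<dots> \<le> ennreal (C * wt (- ?n) u) * ennreal (2 powr q * (wt ?n u * M u) + 2 powr q * (wt ?n v * M v))"
      by (intro mult_left_mono 1) auto
    also have "\<dots> = ennreal (C * wt (- ?n) u * (2 powr q * (wt ?n u * M u + wt ?n v * M v)))"
      unfolding distrib_left[symmetric] using C by (intro ennreal_mult'[symmetric]) simp
    finally have "b \<le> C * wt (- ?n) u * (2 powr q * (wt ?n u * M u + wt ?n v * M v))"
      using C Mu Mv by (simp add: ennreal_le_iff del: of_nat_add)
    also have "\<dots> \<le> C * wt (- ?n) u * (2 powr q * (K powr ?n * wt ?n u * M u + K powr ?n * wt ?n u * M v))"
    proof -
      have "wt ?n v \<le> (K * defect u) powr ?n" using dvu defect_pos[OF v] by (intro powr_mono2) auto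
      then have 2: "wt ?n v \<le> K powr ?n * wt ?n u" by (simp only: powr_mult)
      have 3: "1 * wt ?n u \<le> K powr ?n * wt ?n u" using K by (intro mult_right_mono ge_one_powr_ge_zero) auto
      show ?thesis using 2 3 Mu(1) Mv(1) C(1) by (intro mult_left_mono add_mono mult_right_mono) auto
    qed
    also have "\<dots> = C * 2 powr q * K powr ?n * (M u + M v) * (wt (- ?n) u * wt ?n u)"
      by (simp only: ring_distribs mult_ac)
    also have "wt (- ?n) u * wt ?n u = 1" using x by (simp flip: powr_add)
    finally show "cmod (a u - a v) powr q \<le> C * 2 powr q * K powr ?n * (M u + M v)" by (simp add: b_def)
  qed qed qed
qed

text \<open>The bound for the power \<open>\<sigma>\<close> of the defect along a chain from
  \<open>u\<close> to \<open>v\<close>, times the power -\<epsilon> of 1-\<rho>^2 that absorbs the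
  number of steps. A positive \<open>\<sigma>\<close> uses the upper bound in
  \<open>bergman_chain\<close>, a negative one the lower bound.\<close>

definition chain_weight :: "real \<Rightarrow> real \<Rightarrow> complex ^ 'n \<Rightarrow> complex ^ 'n \<Rightarrow> real" where
  "chain_weight \<epsilon> \<sigma> u v = wt (- \<epsilon> + 2 * min \<sigma> 0) u * wt (- \<epsilon> + min \<sigma> 0) v *
     cmod (1 - hinner u v) powr (2 * \<epsilon> - 2 * min \<sigma> 0 + max \<sigma> 0)"

text \<open>The number of steps of a chain from \<open>u\<close> to \<open>v\<close> is logarithmic in \<open>1 - \<rho>(u,v)\<^sup>2\<close>.\<close>

lemma bergman_dist_bound:
  assumes \<delta>: "\<delta> > 0" and \<eta>: "\<eta> > 0"
  obtains C where "C > 0" "\<And>u v :: complex ^ 'n. u \<in> \<B> \<Longrightarrow> v \<in> \<B> \<Longrightarrow>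
    1 + bergman_dist u v / \<delta> \<le> C * (defect u * defect v / (cmod (1 - hinner u v))\<^sup>2) powr (- \<eta>)"
proof (rule that[of "1 + 4 powr \<eta> / (2 * \<eta> * \<delta>)"])
  show "1 + 4 powr \<eta> / (2 * \<eta> * \<delta>) > 0" using \<delta> \<eta> by (simp add: add_pos_pos)
  fix u v :: "complex ^ 'n" assume u: "u \<in> \<B>" and v: "v \<in> \<B>"
  define y where "y = defect u * defect v / (cmod (1 - hinner u v))\<^sup>2"
  define \<rho> where "\<rho> = bergman_rho u v"
  have \<rho>: "0 \<le> \<rho>" "\<rho> < 1" using bergman_rho_bounds[OF u v] by (auto simp: \<rho>_def)
  have y\<rho>: "y = 1 - \<rho>\<^sup>2" unfolding y_def \<rho>_def by (rule bergman_rho_sq[OF u v, symmetric])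
  have "\<rho>\<^sup>2 < 1" using \<rho> by (simp add: abs_square_less_1)
  then have y: "0 < y" "y \<le> 1" unfolding y\<rho> by auto
  have "(1 + \<rho>) / (1 - \<rho>) = (1 + \<rho>)\<^sup>2 / y"
  proof -
    have "(1 + \<rho>)\<^sup>2 / y = ((1 + \<rho>) * (1 + \<rho>)) / ((1 - \<rho>) * (1 + \<rho>))"
      unfolding y\<rho> by (simp add: power2_eq_square algebra_simps)
    then show ?thesis using \<rho> by simp
  qed
  also have "\<dots> \<le> 2\<^sup>2 / y" using \<rho> y by (intro divide_right_mono power_mono) auto
  finally have "(1 + \<rho>) / (1 - \<rho>) \<le> 4 / y" by simp
  then have "ln ((1 + \<rho>) / (1 - \<rho>)) \<le> ln (4 / y)" using \<rho> y by (subst ln_le_cancel_iff) auto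
  also have "\<dots> \<le> (4 / y) powr \<eta> / \<eta>" using y \<eta> by (intro ln_powr_bound) auto
  finally have d: "bergman_dist u v \<le> (4 / y) powr \<eta> / \<eta> / 2" by (simp add: bergman_dist_def \<rho>_def)
  have "(4 / y) powr \<eta> = 4 powr \<eta> * y powr (- \<eta>)" using y by (simp add: powr_divide powr_minus_divide)
  then have "bergman_dist u v / \<delta> \<le> 4 powr \<eta> / (2 * \<eta> * \<delta>) * y powr (- \<eta>)"
    using divide_right_mono[OF d, of \<delta>] \<delta> by (simp add: mult_ac)
  moreover have "1 \<le> y powr (- \<eta>)" using y \<eta> powr_mono2'[of "- \<eta>" y 1] by simp
  ultimately show "1 + bergman_dist u v / \<delta> \<le> (1 + 4 powr \<eta> / (2 * \<eta> * \<delta>)) * (defect u * defect v / (cmod (1 - hinner u v))\<^sup>2) powr (- \<eta>)"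
    by (simp add: y_def distrib_right)
qed

text \<open>Adding the increments of \<open>a\<close> along a chain costs the \<open>q\<close>-th
  power of its length, which \<open>bergman_dist_bound\<close> with exponent \<epsilon>/q turns into
  a small power of 1-\<rho>^2. The second summand on the left is the local oscillation at
  \<open>v\<close>. The constant is chosen before \<open>A\<close> and \<open>B\<close>, since one
  of these will be small and the other uncontrolled.\<close>

lemma osc_bound_chain:
  assumes q: "q \<ge> 1" and r: "r > 0" and \<epsilon>: "\<epsilon> > 0"
  obtains C where "C > 0" "\<And>(f :: complex ^ 'n \<Rightarrow> complex) a A B u v. A \<ge> 0 \<Longrightarrow> B \<ge> 0 \<Longrightarrow>
     osc_bound q r f a (\<lambda>u. A * wt \<sigma>1 u + B * wt \<sigma>2 u) \<Longrightarrow> u \<in> \<B> \<Longrightarrow> v \<in> \<B> \<Longrightarrow>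
     cmod (a v - a u) powr q + (A * wt \<sigma>1 v + B * wt \<sigma>2 v) \<le> C * (A * chain_weight \<epsilon> \<sigma>1 u v + B * chain_weight \<epsilon> \<sigma>2 u v)"
proof -
  have q0: "q \<ge> 0" using q by simp
  show ?thesis
  proof (cases rule: osc_bound_adjacent[OF q0 r, where 'n = 'n])
  case (1 C1)
  note C1 = this
  have r2: "r / 2 > 0" using r by simp
  have eq0: "\<epsilon> / q > 0" using \<epsilon> q by simp
  show ?thesis
  proof (cases rule: bergman_dist_bound[OF r2 eq0, where 'n = 'n])
  case (1 C2)
  note C2 = this
  define F where "F = 4 powr \<bar>\<sigma>1\<bar> + 4 powr \<bar>\<sigma>2\<bar>"
  have F: "F > 0" by (simp add: F_def add_pos_pos)
  show ?thesis
  proof (rule that[of "(C2 powr q * (2 * C1) + 1) * F"])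
    show "(C2 powr q * (2 * C1) + 1) * F > 0" using C1 C2 F by (simp add: add_nonneg_pos)
    fix f a :: "complex ^ 'n \<Rightarrow> complex" and A B :: real and u v :: "complex ^ 'n"
    assume AB: "A \<ge> 0" "B \<ge> 0" and osc: "osc_bound q r f a (\<lambda>u. A * wt \<sigma>1 u + B * wt \<sigma>2 u)"
      and u: "u \<in> \<B>" and v: "v \<in> \<B>"
    define E where "E = cmod (1 - hinner u v)"
    have E: "E > 0" unfolding E_def using one_minus_hinner_nonzero[OF u v] by simp
    have x: "defect u > 0" "defect v > 0" using defect_pos u v by auto
    obtain m p where mp: "p 0 = u" "p m = v" "real m \<le> 1 + bergman_dist u v / (r / 2)"
      "\<And>j. j \<le> m \<Longrightarrow> p j \<in> \<B>" "\<And>j. j < m \<Longrightarrow> bergman_dist (p j) (p (Suc j)) \<le> r / 2"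
      "\<And>j. j \<le> m \<Longrightarrow> defect (p j) \<le> 4 * E" "\<And>j. j \<le> m \<Longrightarrow> (defect u)\<^sup>2 * defect v / (4 * E\<^sup>2) \<le> defect (p j)"
      using bergman_chain[OF u v r2] unfolding E_def by metis
    define G where "G \<sigma> = wt (2 * min \<sigma> 0) u * wt (min \<sigma> 0) v * E powr (- 2 * min \<sigma> 0 + max \<sigma> 0)" for \<sigma>
    have G0: "G \<sigma> \<ge> 0" for \<sigma> by (simp add: G_def)
    have Gb: "wt \<sigma> (p j) \<le> 4 powr \<bar>\<sigma>\<bar> * G \<sigma>" if j: "j \<le> m" for j \<sigma>
    proof (cases "\<sigma> \<ge> 0")
      case True
      have "wt \<sigma> (p j) \<le> (4 * E) powr \<sigma>"
        using True mp(6)[OF j] defect_pos[OF mp(4)[OF j]] by (intro powr_mono2) auto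
      then show ?thesis using True x by (simp add: G_def powr_mult)
    next
      case False
      have "wt \<sigma> (p j) \<le> ((defect u)\<^sup>2 * defect v / (4 * E\<^sup>2)) powr \<sigma>"
        using False mp(7)[OF j] x E by (intro powr_mono2') auto
      also have "\<dots> = 4 powr (- \<sigma>) * G \<sigma>"
      proof -
        have "((defect u)\<^sup>2 * defect v / (4 * E\<^sup>2)) powr \<sigma> = wt (2 * \<sigma>) u * wt \<sigma> v / (4 powr \<sigma> * E powr (2 * \<sigma>))"
          using x E by (simp add: powr_divide powr_mult sq_powr)
        then show ?thesis using False by (simp add: G_def powr_minus_divide)
      qed
      finally show ?thesis using False by simp
    qed
    define S where "S = F * (A * G \<sigma>1 + B * G \<sigma>2)"
    have S0: "S \<ge> 0" using AB F G0 by (simp add: S_def)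
    have MS: "A * wt \<sigma>1 (p j) + B * wt \<sigma>2 (p j) \<le> S" if j: "j \<le> m" for j
    proof -
      have "A * wt \<sigma>1 (p j) \<le> A * (F * G \<sigma>1)"
        using AB Gb[OF j, of \<sigma>1] mult_right_mono[of "4 powr \<bar>\<sigma>1\<bar>" F "G \<sigma>1"] G0[of \<sigma>1]
        by (intro mult_left_mono) (auto simp: F_def)
      moreover have "B * wt \<sigma>2 (p j) \<le> B * (F * G \<sigma>2)"
        using AB Gb[OF j, of \<sigma>2] mult_right_mono[of "4 powr \<bar>\<sigma>2\<bar>" F "G \<sigma>2"] G0[of \<sigma>2]
        by (intro mult_left_mono) (auto simp: F_def)
      ultimately show ?thesis by (simp add: S_def algebra_simps)
    qed
    define h where "h = (2 * C1 * S) powr (1 / q)"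
    have step: "cmod (a (p j) - a (p (Suc j))) \<le> h" if j: "j < m" for j
    proof -
      have "cmod (a (p j) - a (p (Suc j))) powr q \<le> C1 * ((A * wt \<sigma>1 (p j) + B * wt \<sigma>2 (p j))
         + (A * wt \<sigma>1 (p (Suc j)) + B * wt \<sigma>2 (p (Suc j))))"
        by (rule C1(2)[OF osc]) (use mp j in auto)
      also have "\<dots> \<le> C1 * (S + S)" using C1(1) MS[of j] MS[of "Suc j"] j by (intro mult_left_mono add_mono) auto
      finally have "(cmod (a (p j) - a (p (Suc j))) powr q) powr (1 / q) \<le> h"
        unfolding h_def using q by (intro powr_mono2) auto
      then show ?thesis using q by (simp add: powr_powr)
    qed
    have h0: "h \<ge> 0" by (simp add: h_def)
    have "cmod (a (p j) - a u) \<le> real j * h" if "j \<le> m" for j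
      using that
    proof (induction j)
      case (Suc j)
      have "cmod (a (p (Suc j)) - a u) \<le> cmod (a (p (Suc j)) - a (p j)) + cmod (a (p j) - a u)"
        using norm_triangle_ineq[of "a (p (Suc j)) - a (p j)" "a (p j) - a u"] by simp
      then show ?case using Suc step[of j] by (simp add: norm_minus_commute algebra_simps)
    qed (simp add: mp)
    from this[of m] have "cmod (a v - a u) \<le> real m * h" by (simp add: mp)
    also have "\<dots> \<le> C2 * (defect u * defect v / E\<^sup>2) powr (- (\<epsilon> / q)) * h"
      using mp(3) C2(2)[OF u v] h0 unfolding E_def by (intro mult_right_mono) auto
    finally have "cmod (a v - a u) powr q \<le> (C2 * (defect u * defect v / E\<^sup>2) powr (- (\<epsilon> / q)) * h) powr q"
      using q by (intro powr_mono2) auto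
    also have "\<dots> = C2 powr q * (defect u * defect v / E\<^sup>2) powr (- \<epsilon>) * (2 * C1 * S)"
      using q C1 S0 by (simp add: powr_mult powr_powr h_def)
    finally have 1: "cmod (a v - a u) powr q \<le> C2 powr q * (2 * C1) * (S * (defect u * defect v / E\<^sup>2) powr (- \<epsilon>))"
      by (simp add: mult_ac)
    \<comment> \<open>Since this quotient is at most 1, its power -\<epsilon> is at least 1 and may
      also be attached to the local term at \<open>v\<close>.\<close>
    have "defect u * defect v / E\<^sup>2 \<le> 1"
      using bergman_rho_sq[OF u v] by (simp add: E_def) (smt (verit) zero_le_power2)
    then have "1 powr (- \<epsilon>) \<le> (defect u * defect v / E\<^sup>2) powr (- \<epsilon>)"
      using x E \<epsilon> by (intro powr_mono2') auto
    then have "S * 1 \<le> S * (defect u * defect v / E\<^sup>2) powr (- \<epsilon>)" using S0 by (intro mult_left_mono) auto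
    then have 2: "A * wt \<sigma>1 v + B * wt \<sigma>2 v \<le> S * (defect u * defect v / E\<^sup>2) powr (- \<epsilon>)"
      using MS[of m] by (simp add: mp)
    have W: "G \<sigma> * (defect u * defect v / E\<^sup>2) powr (- \<epsilon>) = chain_weight \<epsilon> \<sigma> u v" for \<sigma>
    proof -
      have "(defect u * defect v / E\<^sup>2) powr (- \<epsilon>) = wt (- \<epsilon>) u * wt (- \<epsilon>) v / E powr (- (2 * \<epsilon>))"
        using x E sq_powr[OF E, of "- \<epsilon>"] by (simp add: powr_divide powr_mult)
      also have "\<dots> = wt (- \<epsilon>) u * wt (- \<epsilon>) v * E powr (2 * \<epsilon>)"
        by (simp only: powr_minus_divide) simp
      finally have 1: "(defect u * defect v / E\<^sup>2) powr (- \<epsilon>) = wt (- \<epsilon>) u * wt (- \<epsilon>) v * E powr (2 * \<epsilon>)" .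
      have 2: "2 * \<epsilon> - 2 * min \<sigma> 0 + max \<sigma> 0 = (- 2 * min \<sigma> 0 + max \<sigma> 0) + 2 * \<epsilon>" by simp
      show ?thesis
        unfolding G_def chain_weight_def E_def[symmetric] 1 2 powr_add[of _ "- \<epsilon>"] powr_add[of E _ "2 * \<epsilon>"]
        by (simp only: mult_ac)
    qed
    have "cmod (a v - a u) powr q + (A * wt \<sigma>1 v + B * wt \<sigma>2 v)
      \<le> (C2 powr q * (2 * C1) + 1) * (S * (defect u * defect v / E\<^sup>2) powr (- \<epsilon>))"
      using 1 2 by (simp add: distrib_right)
    also have "S * (defect u * defect v / E\<^sup>2) powr (- \<epsilon>) = F * (A * chain_weight \<epsilon> \<sigma>1 u v + B * chain_weight \<epsilon> \<sigma>2 u v)"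
      unfolding S_def W[symmetric] by (simp only: ring_distribs mult_ac)
    finally show "cmod (a v - a u) powr q + (A * wt \<sigma>1 v + B * wt \<sigma>2 v)
      \<le> (C2 powr q * (2 * C1) + 1) * F * (A * chain_weight \<epsilon> \<sigma>1 u v + B * chain_weight \<epsilon> \<sigma>2 u v)"
      by (simp only: mult.assoc)
  qed qed qed
qed

text \<open>Collecting exponents leaves one Forelli-Rudin integral, with weight \<open>t\<close> and
  kernel parameter \<open>s'\<close>; the two hypotheses are exactly t > -1 and s' > t, since s' - t
  = s - \<beta> - |\<sigma>|.\<close>

lemma chain_weight_integral:
  assumes \<beta>: "\<beta> - 2 * e + min \<sigma> 0 > -1" and s: "s > \<beta> + \<bar>\<sigma>\<bar>"
  obtains C where "C > 0" "\<And>u :: complex ^ 'n. u \<in> \<B> \<Longrightarrow>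
    (\<integral>B v. wt (\<beta> - e) v * kern s u v * chain_weight e \<sigma> u v) \<le> ennreal (C * wt (\<beta> - e - s + \<sigma>) u)"
proof -
  define t where "t = \<beta> - 2 * e + min \<sigma> 0"
  define s' where "s' = s - 2 * e + 2 * min \<sigma> 0 - max \<sigma> 0"
  have t: "t > -1" using \<beta> by (simp add: t_def)
  have st: "s' - t > 0" using s by (auto simp: t_def s'_def min_def max_def)
  show ?thesis
  proof (cases rule: forelli_rudin_kern[OF t st, where 'n = 'n])
  case (1 C)
  note C = this
  show ?thesis
  proof (rule that[OF C(1)])
    fix u :: "complex ^ 'n" assume u: "u \<in> \<B>"
    let ?p = "wt (- e + 2 * min \<sigma> 0) u"
    have "(\<integral>B v. wt (\<beta> - e) v * kern s u v * chain_weight e \<sigma> u v) \<le> ennreal ?p * ennreal (C * wt (t - s') u)"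
    proof (rule ball_nn_le1[OF _ C(2)[OF u]])
      fix v :: "complex ^ 'n"
      have "wt (\<beta> - e) v * wt (- e + min \<sigma> 0) v = wt t v"
        unfolding powr_add[symmetric] t_def by (simp add: algebra_simps)
      moreover have "kern s u v * cmod (1 - hinner u v) powr (2 * e - 2 * min \<sigma> 0 + max \<sigma> 0) = kern s' u v"
        unfolding kern_def powr_add[symmetric] s'_def by (simp add: algebra_simps)
      moreover have "wt (\<beta> - e) v * kern s u v * chain_weight e \<sigma> u v = ?p * ((wt (\<beta> - e) v * wt (- e + min \<sigma> 0) v) *
          (kern s u v * cmod (1 - hinner u v) powr (2 * e - 2 * min \<sigma> 0 + max \<sigma> 0)))"
        unfolding chain_weight_def by (simp only: mult_ac)
      ultimately show "wt (\<beta> - e) v * kern s u v * chain_weight e \<sigma> u v \<le> ?p * (wt t v * kern s' u v)" by simp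
    qed auto
    also have "\<dots> = ennreal (C * (?p * wt (t - s') u))"
      by (subst ennreal_mult'[symmetric]) (auto simp: mult_ac)
    also have "?p * wt (t - s') u = wt (\<beta> - e - s + \<sigma>) u"
      unfolding powr_add[symmetric] by (rule arg_cong[where f = "\<lambda>y. wt y u"]) (simp add: t_def s'_def min_def max_def)
    finally show "(\<integral>B v. wt (\<beta> - e) v * kern s u v * chain_weight e \<sigma> u v) \<le> ennreal (C * wt (\<beta> - e - s + \<sigma>) u)" .
  qed qed
qed

text \<open>By \<open>near_volume_lower\<close> one may insert a local average of 1 at
  \<open>z\<close> and exchange the integrals. This produces integrals over Bergman balls, on which
  an \<open>osc_bound\<close> has something to say, out of pointwise values.\<close>

lemma near_average:
  fixes r :: real
  assumes r: "r > 0"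
  obtains C where "C > 0" "\<And>H :: complex ^ 'n \<Rightarrow> real. H \<in> borel_measurable ball_leb \<Longrightarrow> (\<And>z. H z \<ge> 0) \<Longrightarrow>
     (\<integral>B z. H z) \<le> (\<integral>\<^sup>+v. (\<integral>B z. C * (near r v z * wt (- (real CARD('n) + 1)) z * H z)) \<partial>ball_leb)"
proof -
  let ?n = "real CARD('n) + 1"
  show ?thesis
  proof (cases rule: near_volume_lower[OF r, where 'n = 'n])
  case (1 C)
  note C = this
  show ?thesis
  proof (rule that[OF C(1)])
    fix H :: "complex ^ 'n \<Rightarrow> real" assume [measurable]: "measB H" and H: "\<And>z. H z \<ge> 0"
    have "(\<integral>B z. H z) \<le> (\<integral>\<^sup>+z. (\<integral>B v. C * (near r v z * wt (- ?n) z * H z)) \<partial>ball_leb)"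
    proof (rule nn_integral_mono)
      fix z :: "complex ^ 'n" assume "z \<in> space ball_leb"
      then have z: "z \<in> \<B>" by simp
      have "ennreal (H z) \<le> ennreal (H z) * (ennreal (C * wt (- ?n) z) * (\<integral>B w. near r z w))"
        using mult_left_mono[OF C(2)[OF z], of "ennreal (H z)"] by simp
      also have "\<dots> = (\<integral>\<^sup>+w. ennreal (H z) * (ennreal (C * wt (- ?n) z) * ennreal (near r z w)) \<partial>ball_leb)"
        by (simp add: nn_integral_cmult)
      also have "\<dots> = (\<integral>B v. C * (near r v z * wt (- ?n) z * H z))"
        using H C(1) by (intro nn_integral_cong) (simp add: near_commute[of r z] mult_ac flip: ennreal_mult')
      finally show "ennreal (H z) \<le> (\<integral>B v. C * (near r v z * wt (- ?n) z * H z))" .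
    qed
    also have "\<dots> = (\<integral>\<^sup>+v. (\<integral>B z. C * (near r v z * wt (- ?n) z * H z)) \<partial>ball_leb)"
      by (rule ball_leb_Fubini) measurable
    finally show "(\<integral>B z. H z) \<le> \<dots>" .
  qed qed
qed

text \<open>Recentering from \<open>a v\<close> to \<open>c\<close> costs |a v - c|^q times the
  volume of the Bergman ball.\<close>

lemma osc_bound_transfer:
  assumes q: "q \<ge> 0" and r: "r > 0"
  obtains C where "C > 0" "\<And>(f :: complex ^ 'n \<Rightarrow> complex) a M c v. osc_bound q r f a M \<Longrightarrow> v \<in> \<B> \<Longrightarrow>
     (\<integral>B z. near r v z * cmod (f z - c) powr q)
       \<le> ennreal (C * wt (real CARD('n) + 1) v * (cmod (a v - c) powr q + M v))"
proof -
  let ?n = "real CARD('n) + 1"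
  show ?thesis
  proof (cases rule: near_volume_upper[OF r, where 'n = 'n])
  case (1 C)
  note C = this
  show ?thesis
  proof (rule that[of "2 powr q * (1 + C)"])
    show "2 powr q * (1 + C) > 0" using C by simp
    fix f a :: "complex ^ 'n \<Rightarrow> complex" and M c and v :: "complex ^ 'n"
    assume osc: "osc_bound q r f a M" and v: "v \<in> \<B>"
    note [measurable] = osc[unfolded osc_bound_def, THEN conjunct1]
    have M: "M v \<ge> 0" "(\<integral>B w. near r v w * cmod (f w - a v) powr q) \<le> ennreal (wt ?n v * M v)"
      using osc v by (auto simp: osc_bound_def)
    let ?d = "cmod (a v - c) powr q"
    have "(\<integral>B z. near r v z * cmod (f z - c) powr q) \<le> ennreal (2 powr q * (wt ?n v * M v) + 2 powr q * ?d * (C * wt ?n v))"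
    proof (rule ball_nn_le2[OF _ M(2) C(2)[OF v]])
      fix z :: "complex ^ 'n"
      have "near r v z * cmod (f z - c) powr q \<le> near r v z * (2 powr q * (cmod (f z - a v) powr q + cmod (c - a v) powr q))"
        by (intro mult_left_mono cmod_diff_powr_le q) auto
      also have "\<dots> = 2 powr q * (near r v z * cmod (f z - a v) powr q) + 2 powr q * ?d * near r v z"
        by (simp add: algebra_simps norm_minus_commute)
      finally show "near r v z * cmod (f z - c) powr q \<le> \<dots>" .
    qed (use M C in auto)
    also have "\<dots> \<le> ennreal (2 powr q * (1 + C) * wt ?n v * (?d + M v))"
    proof (rule ennreal_leI)
      have "wt ?n v * M v + ?d * (C * wt ?n v) \<le> (1 + C) * wt ?n v * (?d + M v)"
        using C M by (simp add: distrib_right distrib_left)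
      then have "2 powr q * (wt ?n v * M v + ?d * (C * wt ?n v)) \<le> 2 powr q * ((1 + C) * wt ?n v * (?d + M v))"
        by (intro mult_left_mono) auto
      then show "2 powr q * (wt ?n v * M v) + 2 powr q * ?d * (C * wt ?n v) \<le> 2 powr q * (1 + C) * wt ?n v * (?d + M v)"
        by (simp add: algebra_simps)
    qed
    finally show "(\<integral>B z. near r v z * cmod (f z - c) powr q) \<le> \<dots>" .
  qed qed
qed

text \<open>Local averaging replaces \<open>f z\<close> by the center at a nearby \<open>v\<close>,
  the chain estimate compares that center with \<open>a u\<close>, and what remains is an explicit
  kernel integral in \<open>v\<close>.\<close>

lemma oscillation_kernel_integral:
  assumes q: "q \<ge> 1" and r: "r > 0" and e: "e > 0" and s: "s > -1"
    and I1: "\<beta> - 2 * e + min \<sigma>1 0 > -1" "s > \<beta> + \<bar>\<sigma>1\<bar>" and I2: "\<beta> - 2 * e + min \<sigma>2 0 > -1" "s > \<beta> + \<bar>\<sigma>2\<bar>"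
  obtains C where "C > 0" "\<And>(f :: complex ^ 'n \<Rightarrow> complex) a A B u. A \<ge> 0 \<Longrightarrow> B \<ge> 0 \<Longrightarrow>
     osc_bound q r f a (\<lambda>u. A * wt \<sigma>1 u + B * wt \<sigma>2 u) \<Longrightarrow> u \<in> \<B> \<Longrightarrow>
     (\<integral>B z. wt (\<beta> - e) z * kern s u z * cmod (f z - a u) powr q)
       \<le> ennreal (C * wt (\<beta> - e - s) u * (A * wt \<sigma>1 u + B * wt \<sigma>2 u))"
proof -
  let ?n = "real CARD('n) + 1"
  have q0: "q \<ge> 0" using q by simp
  show ?thesis
  proof (cases rule: near_average[OF r, where 'n = 'n])
  case (1 C1)
  note C1 = this
  show ?thesis
  proof (cases rule: osc_bound_transfer[OF q0 r, where 'n = 'n])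
  case (1 C2)
  note C2 = this
  show ?thesis
  proof (cases rule: osc_bound_chain[OF q r e, where 'n = 'n and ?\<sigma>1.0 = \<sigma>1 and ?\<sigma>2.0 = \<sigma>2])
  case (1 C3)
  note C3 = this
  show ?thesis
  proof (cases rule: chain_weight_integral[OF I1, where 'n = 'n])
  case (1 D1)
  note D1 = this
  show ?thesis
  proof (cases rule: chain_weight_integral[OF I2, where 'n = 'n])
  case (1 D2)
  note D2 = this
  show ?thesis
  proof (cases rule: near_weight_le[OF r s, where 'n = 'n and t = "\<beta> - e - ?n"])
  case (1 K)
  note K = this
  define k where "k = C1 * K * C2 * C3"
  have k0: "k > 0" using C1 C2 C3 K by (simp add: k_def)
  show ?thesis
  proof (rule that[of "k * (D1 + D2)"])
    show "k * (D1 + D2) > 0" using k0 D1 D2 by simp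
    fix f a :: "complex ^ 'n \<Rightarrow> complex" and A B :: real and u :: "complex ^ 'n"
    assume AB: "A \<ge> 0" "B \<ge> 0" and osc: "osc_bound q r f a (\<lambda>u. A * wt \<sigma>1 u + B * wt \<sigma>2 u)" and u: "u \<in> \<B>"
    note [measurable] = osc[unfolded osc_bound_def, THEN conjunct1]
    let ?W = "\<lambda>v. A * chain_weight e \<sigma>1 u v + B * chain_weight e \<sigma>2 u v" and ?k = "\<lambda>v. wt (\<beta> - e) v * kern s u v"
    have cwm[measurable]: "measB (chain_weight e \<sigma> u)" for \<sigma>
      unfolding chain_weight_def by measurable
    define H where "H z = ?k z * cmod (f z - a u) powr q" for z
    have pw: "wt (- ?n) z * wt (\<beta> - e) z = wt (\<beta> - e - ?n) z" "wt (\<beta> - e - ?n) z * wt ?n z = wt (\<beta> - e) z" if "z \<in> \<B>" for z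
      using defect_pos[OF that] unfolding powr_add[symmetric] by (simp_all add: algebra_simps)
    have "(\<integral>B z. H z) \<le> (\<integral>\<^sup>+v. (\<integral>B z. C1 * (near r v z * wt (- ?n) z * H z)) \<partial>ball_leb)"
      by (rule C1(2)) (auto simp: H_def)
    also have "\<dots> \<le> (\<integral>B v. k * A * (?k v * chain_weight e \<sigma>1 u v) + k * B * (?k v * chain_weight e \<sigma>2 u v))"
    proof (rule nn_integral_mono)
      fix v :: "complex ^ 'n" assume "v \<in> space ball_leb"
      then have v: "v \<in> \<B>" by simp
      let ?c = "C1 * (K * (wt (\<beta> - e - ?n) v * kern s v u))"
      have "(\<integral>B z. C1 * (near r v z * wt (- ?n) z * H z)) \<le> ennreal ?c * ennreal (C2 * wt ?n v * (cmod (a v - a u) powr q + (A * wt \<sigma>1 v + B * wt \<sigma>2 v)))"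
      proof (rule ball_nn_le1[OF _ C2(2)[OF osc v]])
        fix z :: "complex ^ 'n" assume z: "z \<in> \<B>"
        have "C1 * (near r v z * wt (- ?n) z * H z) = C1 * (near r v z * ((wt (- ?n) z * wt (\<beta> - e) z) * kern s z u * cmod (f z - a u) powr q))"
          unfolding H_def kern_commute[of s u z] by (simp only: mult_ac)
        also have "\<dots> \<le> C1 * (K * (wt (\<beta> - e - ?n) v * kern s v u) * (near r v z * cmod (f z - a u) powr q))"
          unfolding pw(1)[OF z] using C1 by (intro mult_left_mono K(2) u v z) auto
        finally show "C1 * (near r v z * wt (- ?n) z * H z) \<le> ?c * (near r v z * cmod (f z - a u) powr q)" by (simp only: mult.assoc)
      qed (use C1 K in auto)
      also have "\<dots> \<le> ennreal ?c * ennreal (C2 * wt ?n v * (C3 * ?W v))"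
        using C2(1) by (intro mult_left_mono ennreal_leI C3(2)[OF AB osc u v]) auto
      also have "\<dots> = ennreal (?c * (C2 * wt ?n v * (C3 * ?W v)))"
        using C1 K by (intro ennreal_mult'[symmetric]) auto
      also have "?c * (C2 * wt ?n v * (C3 * ?W v)) = k * (((wt (\<beta> - e - ?n) v * wt ?n v) * kern s u v) * ?W v)"
        unfolding k_def kern_commute[of s v u] by (simp only: mult_ac)
      finally show "(\<integral>B z. C1 * (near r v z * wt (- ?n) z * H z)) \<le> ennreal (k * A * (?k v * chain_weight e \<sigma>1 u v) + k * B * (?k v * chain_weight e \<sigma>2 u v))"
        unfolding pw(2)[OF v] by (simp only: distrib_left mult_ac)
    qed
    also have "\<dots> \<le> ennreal (k * A * (D1 * wt (\<beta> - e - s + \<sigma>1) u) + k * B * (D2 * wt (\<beta> - e - s + \<sigma>2) u))"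
      by (rule ball_nn_le2[OF _ D1(2)[OF u] D2(2)[OF u]]) (use k0 AB D1 D2 in auto)
    also have "\<dots> \<le> ennreal (k * (D1 + D2) * wt (\<beta> - e - s) u * (A * wt \<sigma>1 u + B * wt \<sigma>2 u))"
    proof (rule ennreal_leI)
      let ?x = "wt (\<beta> - e - s) u"
      have "k * A * (D1 * (?x * wt \<sigma>1 u)) \<le> k * A * ((D1 + D2) * (?x * wt \<sigma>1 u))"
        using k0 AB D2 by (intro mult_left_mono mult_right_mono) auto
      moreover have "k * B * (D2 * (?x * wt \<sigma>2 u)) \<le> k * B * ((D1 + D2) * (?x * wt \<sigma>2 u))"
        using k0 AB D1 by (intro mult_left_mono mult_right_mono) auto
      ultimately show "k * A * (D1 * wt (\<beta> - e - s + \<sigma>1) u) + k * B * (D2 * wt (\<beta> - e - s + \<sigma>2) u)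
        \<le> k * (D1 + D2) * ?x * (A * wt \<sigma>1 u + B * wt \<sigma>2 u)"
        unfolding powr_add by (simp add: algebra_simps)
    qed
    finally show "(\<integral>B z. ?k z * cmod (f z - a u) powr q)
       \<le> ennreal (k * (D1 + D2) * wt (\<beta> - e - s) u * (A * wt \<sigma>1 u + B * wt \<sigma>2 u))"
      by (simp only: H_def)
  qed qed qed qed qed qed qed
qed

text \<open>Comparing \<open>f z\<close> and \<open>f w\<close> with the center \<open>a u\<close>
  splits the double integral into products: a kernel oscillation times a volume, and a local
  oscillation times a Forelli-Rudin integral.\<close>

lemma local_oscillation_integral:
  assumes q: "q \<ge> 1" and r: "r > 0" and e: "e > 0" and s: "s > -1"
    and I1: "\<beta> - 2 * e + min \<sigma>1 0 > -1" "s > \<beta> + \<bar>\<sigma>1\<bar>" and I2: "\<beta> - 2 * e + min \<sigma>2 0 > -1" "s > \<beta> + \<bar>\<sigma>2\<bar>"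
  obtains C where "C > 0" "\<And>(f :: complex ^ 'n \<Rightarrow> complex) a A B u. A \<ge> 0 \<Longrightarrow> B \<ge> 0 \<Longrightarrow>
     osc_bound q r f a (\<lambda>u. A * wt \<sigma>1 u + B * wt \<sigma>2 u) \<Longrightarrow> u \<in> \<B> \<Longrightarrow>
     (\<integral>\<^sup>+w. (\<integral>B z. near r u w * (wt (\<beta> - e) z * kern s u z * cmod (f z - f w) powr q)) \<partial>ball_leb)
       \<le> ennreal (C * wt (real CARD('n) + 1 + (\<beta> - e - s)) u * (A * wt \<sigma>1 u + B * wt \<sigma>2 u))"
proof -
  let ?n = "real CARD('n) + 1"
  have q0: "q \<ge> 0" using q by simp
  show ?thesis
  proof (cases rule: oscillation_kernel_integral[OF q r e s I1 I2, where 'n = 'n])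
  case (1 C1)
  note C1 = this
  show ?thesis
  proof (cases rule: near_volume_upper[OF r, where 'n = 'n])
  case (1 C2)
  note C2 = this
  have t: "\<beta> - e > -1" "s - (\<beta> - e) > 0" using I1 e by auto
  show ?thesis
  proof (cases rule: forelli_rudin_kern[OF t, where 'n = 'n])
  case (1 C3)
  note C3 = this
  show ?thesis
  proof (rule that[of "2 powr q * (C1 * C2 + C3)"])
    show "2 powr q * (C1 * C2 + C3) > 0" using C1 C2 C3 by (simp add: add_pos_pos)
    fix f a :: "complex ^ 'n \<Rightarrow> complex" and A B :: real and u :: "complex ^ 'n"
    assume AB: "A \<ge> 0" "B \<ge> 0" and osc: "osc_bound q r f a (\<lambda>u. A * wt \<sigma>1 u + B * wt \<sigma>2 u)" and u: "u \<in> \<B>"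
    note [measurable] = osc[unfolded osc_bound_def, THEN conjunct1]
    let ?M = "A * wt \<sigma>1 u + B * wt \<sigma>2 u"
    have M: "?M \<ge> 0" "(\<integral>B w. near r u w * cmod (f w - a u) powr q) \<le> ennreal (wt ?n u * ?M)"
      using osc u by (auto simp: osc_bound_def)
    let ?k = "\<lambda>z. wt (\<beta> - e) z * kern s u z"
    let ?x = "wt (\<beta> - e - s) u"
    have inner: "(\<integral>B z. near r u w * (?k z * cmod (f z - f w) powr q))
      \<le> ennreal (2 powr q * near r u w * (C1 * ?x * ?M) + 2 powr q * (near r u w * cmod (f w - a u) powr q) * (C3 * ?x))" for w
    proof (rule ball_nn_le2[OF _ C1(2)[OF AB osc u] C3(2)[OF u]])
      fix z :: "complex ^ 'n"
      have "near r u w * (?k z * cmod (f z - f w) powr q) \<le> near r u w * (?k z * (2 powr q * (cmod (f z - a u) powr q + cmod (f w - a u) powr q)))"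
        by (intro mult_left_mono cmod_diff_powr_le q0) auto
      then show "near r u w * (?k z * cmod (f z - f w) powr q)
        \<le> 2 powr q * near r u w * (?k z * cmod (f z - a u) powr q) + 2 powr q * (near r u w * cmod (f w - a u) powr q) * ?k z"
        by (simp only: distrib_left mult_ac)
    qed (use C1 C3 M(1) in auto)
    have "(\<integral>\<^sup>+w. (\<integral>B z. near r u w * (?k z * cmod (f z - f w) powr q)) \<partial>ball_leb)
      \<le> (\<integral>B w. 2 powr q * near r u w * (C1 * ?x * ?M) + 2 powr q * (near r u w * cmod (f w - a u) powr q) * (C3 * ?x))"
      by (rule nn_integral_mono[OF inner])
    also have "\<dots> \<le> ennreal (2 powr q * (C1 * ?x * ?M) * (C2 * wt ?n u) + 2 powr q * (C3 * ?x) * (wt ?n u * ?M))"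
    proof (rule ball_nn_le2[OF _ C2(2)[OF u] M(2)])
      show "2 powr q * near r u w * (C1 * ?x * ?M) + 2 powr q * (near r u w * cmod (f w - a u) powr q) * (C3 * ?x)
        \<le> 2 powr q * (C1 * ?x * ?M) * near r u w + 2 powr q * (C3 * ?x) * (near r u w * cmod (f w - a u) powr q)" for w
        by (simp only: mult_ac order_refl)
    qed (use C1 C2 C3 M(1) in auto)
    also have "2 powr q * (C1 * ?x * ?M) * (C2 * wt ?n u) + 2 powr q * (C3 * ?x) * (wt ?n u * ?M)
      = 2 powr q * (C1 * C2 + C3) * (wt ?n u * ?x) * ?M"
      by (simp only: distrib_left distrib_right mult_ac)
    also have "wt ?n u * ?x = wt (?n + (\<beta> - e - s)) u" by (rule powr_add[symmetric])
    finally show "(\<integral>\<^sup>+w. (\<integral>B z. near r u w * (?k z * cmod (f z - f w) powr q)) \<partial>ball_leb)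
       \<le> ennreal (2 powr q * (C1 * C2 + C3) * wt (?n + (\<beta> - e - s)) u * ?M)" .
  qed qed qed qed
qed

text \<open>After Hoelder's inequality, \<open>|g(w)|\<^sup>q\<close> is replaced by its mean over the Bergman ball at \<open>w\<close>,
  so that only averages of the oscillation of \<open>f\<close> occur.\<close>

theorem oscillation_operator_bound:
  assumes q: "q > 1" and r: "r > 0" and \<beta>: "\<beta> + min \<sigma>1 0 > -1" "\<beta> + min \<sigma>2 0 > -1"
    and s: "s > -1" "s > \<beta> + \<bar>\<sigma>1\<bar>" "s > \<beta> + \<bar>\<sigma>2\<bar>"
  obtains C where "C > 0" "\<And>(f :: complex ^ 'n \<Rightarrow> complex) a A B g \<Phi>. A \<ge> 0 \<Longrightarrow> B \<ge> 0 \<Longrightarrow>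
     osc_bound q r f a (\<lambda>u. A * wt \<sigma>1 u + B * wt \<sigma>2 u) \<Longrightarrow> holomorphic_ball g \<Longrightarrow>
     (\<And>z. z \<in> \<B> \<Longrightarrow> \<Phi> z \<ge> 0) \<Longrightarrow>
     (\<And>z. z \<in> \<B> \<Longrightarrow> ennreal (\<Phi> z) \<le> (\<integral>B w. cmod (f z - f w) * cmod (g w) * (wt s w * kern s z w))) \<Longrightarrow>
     (\<integral>B z. wt \<beta> z * \<Phi> z powr q) \<le> ennreal C * (\<integral>B u. cmod (g u) powr q * (A * wt (\<beta> + \<sigma>1) u + B * wt (\<beta> + \<sigma>2) u))"
proof -
  let ?n = "real CARD('n) + 1"
  have q1: "q \<ge> 1" and q0: "q \<ge> 0" using q by auto
  \<comment> \<open>Small enough for \<open>kern_holder\<close> and for both chain integrals; the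
    divisor 3 leaves room for the term 2e.\<close>
  define e where "e = min (min (\<beta> + min \<sigma>1 0 + 1) (\<beta> + min \<sigma>2 0 + 1) / 3) ((s + 1) * (q - 1) / 2)"
  have sq: "(s + 1) * (q - 1) > 0" using s q by simp
  have e0: "e > 0" and es: "e < (s + 1) * (q - 1)" and e1: "\<beta> - 2 * e + min \<sigma>1 0 > -1" and e2: "\<beta> - 2 * e + min \<sigma>2 0 > -1"
    using \<beta> sq by (auto simp: e_def min_def field_simps split: if_splits)
  show ?thesis
  proof (cases rule: kern_holder[OF q s(1) e0 es, where 'n = 'n])
  case (1 C1)
  note C1 = this
  show ?thesis
  proof (cases rule: bergman_submean[OF r q, where 'n = 'n])
  case (1 C2)
  note C2 = this
  show ?thesis
  proof (cases rule: local_oscillation_integral[OF q1 r e0 s(1) e1 s(2) e2 s(3), where 'n = 'n])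
  case (1 C3)
  note C3 = this
  show ?thesis
  proof (cases rule: near_weight_le[OF r s(1), where 'n = 'n and t = "s + e - ?n"])
  case (1 K)
  note K = this
  define k where "k = C1 * C2 * K"
  have k0: "k > 0" using C1 C2 K by (simp add: k_def)
  show ?thesis
  proof (rule that[of "k * C3"])
    show "k * C3 > 0" using k0 C3 by simp
    fix f a :: "complex ^ 'n \<Rightarrow> complex" and A B :: real and g :: "complex ^ 'n \<Rightarrow> complex" and \<Phi> :: "complex ^ 'n \<Rightarrow> real"
    assume AB: "A \<ge> 0" "B \<ge> 0" and osc: "osc_bound q r f a (\<lambda>u. A * wt \<sigma>1 u + B * wt \<sigma>2 u)"
      and g: "holomorphic_ball g" and \<Phi>0: "\<And>z. z \<in> \<B> \<Longrightarrow> \<Phi> z \<ge> 0"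
      and le: "\<And>z. z \<in> \<B> \<Longrightarrow> ennreal (\<Phi> z) \<le> (\<integral>B w. cmod (f z - f w) * cmod (g w) * (wt s w * kern s z w))"
    note [measurable] = osc[unfolded osc_bound_def, THEN conjunct1] holomorphic_ball_measurable[OF g]
    let ?G = "\<lambda>w. cmod (g w) powr q" and ?X = "\<lambda>w z. wt (\<beta> - e) z * cmod (f z - f w) powr q"
    let ?J = "\<lambda>w z. C1 * (wt (s + e) w * kern s w z * ?X w z)"
    let ?T = "\<lambda>u w z. C2 * (wt (- ?n) w * ?J w z) * (near r u w * ?G u)"
    let ?Y = "\<lambda>u w z. near r u w * (wt (\<beta> - e) z * kern s u z * cmod (f z - f w) powr q)"
    have "(\<integral>B z. wt \<beta> z * \<Phi> z powr q) \<le> (\<integral>\<^sup>+z. (\<integral>B w. ?J w z * ?G w) \<partial>ball_leb)"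
    proof (rule nn_integral_mono)
      fix z :: "complex ^ 'n" assume "z \<in> space ball_leb"
      then have z: "z \<in> \<B>" by simp
      let ?W = "\<lambda>w. (cmod (f z - f w) * cmod (g w)) powr q * (wt (s + e) w * kern s z w)"
      have "ennreal (wt \<beta> z * \<Phi> z powr q) = ennreal (wt \<beta> z) * ennreal (\<Phi> z powr q)" by (rule ennreal_mult') simp
      also have "\<dots> \<le> ennreal (wt \<beta> z) * (ennreal (C1 * wt (- e) z) * (\<integral>B w. ?W w))"
        by (intro mult_left_mono C1(2) z \<Phi>0 le) auto
      also have "\<dots> = (\<integral>B w. wt \<beta> z * (C1 * wt (- e) z * ?W w))"
        using C1(1) by (subst ball_nn_cmult, simp, measurable, subst ball_nn_cmult) auto
      also have "\<dots> = (\<integral>B w. ?J w z * ?G w)"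
      proof -
        have "wt \<beta> z * wt (- e) z = wt (\<beta> - e) z" by (simp flip: powr_add)
        moreover have "wt \<beta> z * (C1 * wt (- e) z * ?W w) = C1 * (wt (s + e) w * kern s w z * ((wt \<beta> z * wt (- e) z) * cmod (f z - f w) powr q)) * ?G w" for w
          unfolding kern_commute[of s w z] powr_mult by (simp only: mult_ac)
        ultimately show ?thesis by (simp only:)
      qed
      finally show "ennreal (wt \<beta> z * \<Phi> z powr q) \<le> \<dots>" .
    qed
    also have "\<dots> = (\<integral>\<^sup>+w. (\<integral>B z. ?J w z * ?G w) \<partial>ball_leb)"
      by (rule ball_leb_Fubini) measurable
    also have "\<dots> \<le> (\<integral>\<^sup>+w. (\<integral>\<^sup>+u. (\<integral>B z. ?T u w z) \<partial>ball_leb) \<partial>ball_leb)"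
    proof (rule nn_integral_mono)
      fix w :: "complex ^ 'n" assume "w \<in> space ball_leb"
      then have w: "w \<in> \<B>" by simp
      let ?I = "\<integral>B z. ?J w z"
      have "(\<integral>B z. ?J w z * ?G w) = ?I * ennreal (?G w)" by (simp add: ennreal_mult'' nn_integral_multc)
      also have "\<dots> \<le> ?I * (ennreal (C2 * wt (- ?n) w) * (\<integral>B u. near r u w * ?G u))"
        using mult_left_mono[OF C2(2)[OF g w] zero_le] unfolding near_commute[of r w] .
      also have "\<dots> = (\<integral>\<^sup>+u. ?I * (ennreal (C2 * wt (- ?n) w) * ennreal (near r u w * ?G u)) \<partial>ball_leb)"
        by (simp add: nn_integral_cmult)
      also have "\<dots> = (\<integral>\<^sup>+u. (\<integral>B z. ?T u w z) \<partial>ball_leb)"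
      proof (rule nn_integral_cong)
        fix u :: "complex ^ 'n"
        have "?I * (ennreal (C2 * wt (- ?n) w) * ennreal (near r u w * ?G u)) = ennreal (C2 * wt (- ?n) w * (near r u w * ?G u)) * ?I"
          using C2 by (simp add: ennreal_mult' mult_ac)
        also have "\<dots> = (\<integral>B z. C2 * wt (- ?n) w * (near r u w * ?G u) * ?J w z)" using C2 by (intro ball_nn_cmult) auto
        finally show "?I * (ennreal (C2 * wt (- ?n) w) * ennreal (near r u w * ?G u)) = (\<integral>B z. ?T u w z)" by (simp only: mult_ac)
      qed
      finally show "(\<integral>B z. ?J w z * ?G w) \<le> \<dots>" .
    qed
    also have "\<dots> = (\<integral>\<^sup>+u. (\<integral>\<^sup>+w. (\<integral>B z. ?T u w z) \<partial>ball_leb) \<partial>ball_leb)"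
    proof (rule ball_leb_Fubini)
      interpret sigma_finite_measure "ball_leb :: (complex ^ 'n) measure" by (rule sigma_finite_ball_leb)
      have [measurable]: "(\<lambda>p. fst (fst p)) \<in> borel_measurable ((ball_leb \<Otimes>\<^sub>M ball_leb) \<Otimes>\<^sub>M (ball_leb :: (complex ^ 'n) measure))"
        "(\<lambda>p. snd (fst p)) \<in> borel_measurable ((ball_leb \<Otimes>\<^sub>M ball_leb) \<Otimes>\<^sub>M (ball_leb :: (complex ^ 'n) measure))"
        by (rule measurable_compose[OF measurable_fst ball_leb_fst_snd_measurable(1)],
            rule measurable_compose[OF measurable_fst ball_leb_fst_snd_measurable(2)])
      have [measurable]: "(\<lambda>p. g (snd (fst p))) \<in> borel_measurable ((ball_leb \<Otimes>\<^sub>M ball_leb) \<Otimes>\<^sub>M (ball_leb :: (complex ^ 'n) measure))"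
        by measurable
      show "(\<lambda>(w, u). \<integral>B z. ?T u w z) \<in> borel_measurable (ball_leb \<Otimes>\<^sub>M ball_leb)"
        unfolding split_beta' by (rule borel_measurable_nn_integral) (unfold split_beta', measurable)
    qed
    also have "\<dots> \<le> (\<integral>B u. k * C3 * (?G u * (A * wt (\<beta> + \<sigma>1) u + B * wt (\<beta> + \<sigma>2) u)))"
    proof (rule nn_integral_mono)
      fix u :: "complex ^ 'n" assume "u \<in> space ball_leb"
      then have u: "u \<in> \<B>" by simp
      let ?M = "A * wt \<sigma>1 u + B * wt \<sigma>2 u"
      define c where "c = k * wt (s + e - ?n) u * ?G u"
      have c0: "c \<ge> 0" using k0 by (simp add: c_def)
      interpret sigma_finite_measure "ball_leb :: (complex ^ 'n) measure" by (rule sigma_finite_ball_leb)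
      have imeas: "measB (\<lambda>w. \<integral>B z. ?Y u w z)"
        by (rule borel_measurable_nn_integral) (unfold split_beta', measurable)
      \<comment> \<open>As \<open>w\<close> is near \<open>u\<close>, weight and kernel at
        \<open>w\<close> are replaced by those at \<open>u\<close>; what remains is the integral
        estimated in \<open>local_oscillation_integral\<close>.\<close>
      have "(\<integral>\<^sup>+w. (\<integral>B z. ?T u w z) \<partial>ball_leb) \<le> (\<integral>\<^sup>+w. ennreal c * (\<integral>B z. ?Y u w z) \<partial>ball_leb)"
      proof (intro nn_integral_mono ball_nn_le1[OF _ order_refl c0])
        fix w z :: "complex ^ 'n" assume "w \<in> space ball_leb" and z: "z \<in> \<B>"
        then have w: "w \<in> \<B>" by simp
        have pw: "wt (- ?n) w * wt (s + e) w = wt (s + e - ?n) w"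
          unfolding powr_add[symmetric] by (simp add: algebra_simps)
        have "?T u w z = C1 * C2 * ?G u * (near r u w * ((wt (- ?n) w * wt (s + e) w) * kern s w z * ?X w z))" by (simp only: mult_ac)
        also have "\<dots> \<le> C1 * C2 * ?G u * (K * (wt (s + e - ?n) u * kern s u z) * (near r u w * ?X w z))"
          unfolding pw using C1 C2 by (intro mult_left_mono K(2) u w z) auto
        finally show "?T u w z \<le> c * ?Y u w z" unfolding c_def k_def by (simp only: mult_ac)
      qed measurable
      also have "\<dots> \<le> ennreal c * ennreal (C3 * wt (?n + (\<beta> - e - s)) u * ?M)"
        unfolding nn_integral_cmult[OF imeas] by (intro mult_left_mono C3(2)[OF AB osc u]) auto
      also have "\<dots> = ennreal (c * (C3 * wt (?n + (\<beta> - e - s)) u * ?M))"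
        using c0 by (simp only: ennreal_mult')
      also have "c * (C3 * wt (?n + (\<beta> - e - s)) u * ?M) = k * C3 * (?G u * ((wt (s + e - ?n) u * wt (?n + (\<beta> - e - s)) u) * ?M))"
        unfolding c_def by (simp only: mult_ac)
      also have "wt (s + e - ?n) u * wt (?n + (\<beta> - e - s)) u = wt \<beta> u"
        unfolding powr_add[symmetric] by (simp add: algebra_simps)
      finally show "(\<integral>\<^sup>+w. (\<integral>B z. ?T u w z) \<partial>ball_leb) \<le> ennreal (k * C3 * (?G u * (A * wt (\<beta> + \<sigma>1) u + B * wt (\<beta> + \<sigma>2) u)))"
        by (simp only: powr_add distrib_left mult_ac)
    qed
    also have "\<dots> = ennreal (k * C3) * (\<integral>B u. ?G u * (A * wt (\<beta> + \<sigma>1) u + B * wt (\<beta> + \<sigma>2) u))"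
      using k0 C3 by (intro ball_nn_cmult[symmetric]) auto
    finally show "(\<integral>B z. wt \<beta> z * \<Phi> z powr q) \<le> \<dots>" .
  qed qed qed qed qed
qed

section \<open>Averages over Bergman balls as integrals against probability measures\<close>

definition avg_measure :: "real \<Rightarrow> real \<Rightarrow> complex ^ 'n \<Rightarrow> (complex ^ 'n) measure" where
  "avg_measure \<sigma> r u = density ball_leb (\<lambda>w. ennreal
     (near r u w * wt \<sigma> w / (ball_mass TYPE('n) 0 * measure (v_weight \<sigma>) (bergman_ball u r))))"

lemma sets_avg_measure [simp, measurable_cong]: "sets (avg_measure \<sigma> r u) = sets ball_leb"
  and space_avg_measure [simp]: "space (avg_measure \<sigma> r u) = \<B>"
  by (simp_all add: avg_measure_def)

lemma bergman_ball_sets: "bergman_ball z r \<in> sets (ball_leb :: (complex ^ 'n) measure)"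
proof -
  have "\<B> \<inter> bergman_ball z r \<in> sets (ball_leb :: (complex ^ 'n) measure)"
    unfolding ball_leb_def by (simp add: sets_restrict_space_iff)
  then show ?thesis using bergman_ball_subset_ball[of z r] by (simp add: Int_absorb1)
qed

lemma emeasure_v_weight_bergman_ball:
  "emeasure (v_weight \<sigma>) (bergman_ball (u :: complex ^ 'n) r) = (\<integral>B w. near r u w * wt \<sigma> w / ball_mass TYPE('n) 0)"
proof -
  have "emeasure (v_weight \<sigma>) (bergman_ball u r) = (\<integral>\<^sup>+w. ennreal (wt \<sigma> w / ball_mass TYPE('n) 0) * indicator (bergman_ball u r) w \<partial>ball_leb)"
    unfolding v_weight_eq by (rule emeasure_density) (use bergman_ball_sets in auto)
  also have "\<dots> = (\<integral>B w. near r u w * wt \<sigma> w / ball_mass TYPE('n) 0)"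
    by (rule nn_integral_cong) (auto simp: near_def bergman_ball_def)
  finally show ?thesis .
qed

text \<open>On a Bergman ball the weight is comparable with its value at \<open>u\<close>, so its
  mass is comparable with \<open>wt \<sigma> u\<close> times the volume, of order n+1 in the
  defect.\<close>

lemma v_weight_bergman_ball:
  fixes r \<sigma> :: real
  assumes r: "r > 0"
  obtains C where "C > 0" "\<And>u :: complex ^ 'n. u \<in> \<B> \<Longrightarrow>
      emeasure (v_weight \<sigma>) (bergman_ball u r) = ennreal (measure (v_weight \<sigma>) (bergman_ball u r))"
    "\<And>u :: complex ^ 'n. u \<in> \<B> \<Longrightarrow> measure (v_weight \<sigma>) (bergman_ball u r) > 0"
    "\<And>u :: complex ^ 'n. u \<in> \<B> \<Longrightarrow> measure (v_weight \<sigma>) (bergman_ball u r) \<le> C * wt (real CARD('n) + 1 + \<sigma>) u"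
    "\<And>u :: complex ^ 'n. u \<in> \<B> \<Longrightarrow> wt (real CARD('n) + 1 + \<sigma>) u \<le> C * measure (v_weight \<sigma>) (bergman_ball u r)"
proof -
  let ?n = "real CARD('n) + 1" and ?m = "ball_mass TYPE('n) 0"
  have m: "?m > 0" by (rule ball_mass_pos) simp
  show ?thesis
  proof (cases rule: near_volume_lower[OF r, where 'n = 'n])
  case (1 C1)
  note C1 = this
  show ?thesis
  proof (cases rule: near_volume_upper[OF r, where 'n = 'n])
  case (1 C2)
  note C2 = this
  show ?thesis
  proof (cases rule: near_powr_le[OF r, where 'n = 'n])
  case (1 K)
  note K = this
  define k where "k = K powr \<bar>\<sigma>\<bar>"
  have k: "k > 0" using K by (simp add: k_def)
  let ?E = "\<lambda>u :: complex ^ 'n. emeasure (v_weight \<sigma>) (bergman_ball u r)"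
  have up: "?E u \<le> ennreal (k / ?m * C2 * wt (?n + \<sigma>) u)" if u: "u \<in> \<B>" for u :: "complex ^ 'n"
  proof -
    have "?E u \<le> ennreal (k / ?m * wt \<sigma> u) * ennreal (C2 * wt ?n u)"
      unfolding emeasure_v_weight_bergman_ball
    proof (rule ball_nn_le1[OF _ C2(2)[OF u]])
      show "near r u w * wt \<sigma> w / ?m \<le> k / ?m * wt \<sigma> u * near r u w" if "w \<in> \<B>" for w
        using divide_right_mono[OF K(2)[OF u that, of \<sigma>], of ?m] m by (simp add: k_def mult_ac)
    qed (use k m in auto)
    also have "\<dots> = ennreal (k / ?m * C2 * (wt ?n u * wt \<sigma> u))"
      using m k C2 by (subst ennreal_mult'[symmetric]) (auto simp: mult_ac)
    finally show ?thesis by (simp only: powr_add)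
  qed
  have low: "1 \<le> ennreal (C1 * k * ?m * wt (- (?n + \<sigma>)) u) * ?E u" if u: "u \<in> \<B>" for u :: "complex ^ 'n"
  proof -
    have pw: "wt (- \<sigma>) u * wt \<sigma> u = 1" "wt (- ?n) u * wt (- \<sigma>) u = wt (- (?n + \<sigma>)) u"
      using defect_pos[OF u] unfolding powr_add[symmetric] by simp_all
    have "(\<integral>B w. near r u w) \<le> ennreal (k * ?m * wt (- \<sigma>) u) * ?E u"
      unfolding emeasure_v_weight_bergman_ball
    proof (rule ball_nn_le1[OF _ order_refl])
      fix w :: "complex ^ 'n" assume "w \<in> \<B>"
      then have "near r u w * wt \<sigma> u \<le> near r u w * (k * wt \<sigma> w)"
        using K(2)[of w u \<sigma>] u by (simp add: near_commute[of r w] k_def)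
      note mult_left_mono[OF this powr_ge_zero, of "defect u" "- \<sigma>"]
      moreover have "wt (- \<sigma>) u * (near r u w * wt \<sigma> u) = near r u w * (wt (- \<sigma>) u * wt \<sigma> u)" by (simp only: mult_ac)
      ultimately show "near r u w \<le> k * ?m * wt (- \<sigma>) u * (near r u w * wt \<sigma> w / ?m)" using m pw(1) by (simp add: mult_ac)
    qed (use k m in auto)
    then have "1 \<le> ennreal (C1 * wt (- ?n) u) * (ennreal (k * ?m * wt (- \<sigma>) u) * ?E u)"
      by (intro order_trans[OF C1(2)[OF u]] mult_left_mono) auto
    also have "\<dots> = ennreal (C1 * k * ?m * (wt (- ?n) u * wt (- \<sigma>) u)) * ?E u"
      using k m C1 by (simp add: mult_ac flip: mult.assoc[of "ennreal _" "ennreal _" "?E u"] ennreal_mult')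
    finally show ?thesis unfolding pw .
  qed
  have eq: "?E u = ennreal (measure (v_weight \<sigma>) (bergman_ball u r))" if u: "u \<in> \<B>" for u :: "complex ^ 'n"
    by (rule emeasure_eq_ennreal_measure) (use up[OF u] in \<open>auto simp: top_unique\<close>)
  let ?C = "k / ?m * C2 + C1 * k * ?m"
  show ?thesis
  proof (rule that[of ?C])
    show C: "?C > 0" using k m C1 C2 by (simp add: add_pos_pos)
    fix u :: "complex ^ 'n" assume u: "u \<in> \<B>"
    let ?V = "measure (v_weight \<sigma>) (bergman_ball u r)" and ?y = "wt (?n + \<sigma>) u"
    have y: "?y > 0" using defect_pos[OF u] by simp
    show "?E u = ennreal ?V" by (rule eq[OF u])
    have "?V \<le> k / ?m * C2 * ?y"
      using up[OF u] k m C2 unfolding eq[OF u] by (subst (asm) ennreal_le_iff) auto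
    also have "\<dots> \<le> ?C * ?y" using k m C1 by (intro mult_right_mono) auto
    finally show "?V \<le> ?C * ?y" .
    have "1 \<le> C1 * k * ?m * inverse ?y * ?V"
      using low[OF u] k m C1 unfolding eq[OF u] powr_minus by (subst (asm) ennreal_mult'[symmetric]) (auto simp del: of_nat_add)
    then have "?y \<le> C1 * k * ?m * ?V" using y by (simp add: field_simps)
    also have "\<dots> \<le> ?C * ?V" using k m C2 by (intro mult_right_mono) auto
    finally show *: "?y \<le> ?C * ?V" .
    then show "?V > 0" using C y by (meson less_le_trans zero_less_mult_pos)
  qed qed qed qed
qed

lemma emeasure_avg_measure:
  fixes u :: "complex ^ 'n"
  assumes r: "r > 0" and u: "u \<in> \<B>"
  shows "emeasure (avg_measure \<sigma> r u) \<B> = 1"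
proof -
  let ?V = "measure (v_weight \<sigma>) (bergman_ball u r)"
  have m: "ball_mass TYPE('n) 0 > 0" by (rule ball_mass_pos) simp
  have V: "emeasure (v_weight \<sigma>) (bergman_ball u r) = ennreal ?V" "?V > 0"
  proof -
    show "emeasure (v_weight \<sigma>) (bergman_ball u r) = ennreal ?V"
      by (rule v_weight_bergman_ball[OF r, where 'n = 'n and \<sigma> = \<sigma>]) (use u in simp)
    show "?V > 0"
      by (rule v_weight_bergman_ball[OF r, where 'n = 'n and \<sigma> = \<sigma>]) (use u in simp)
  qed
  have "emeasure (avg_measure \<sigma> r u) \<B> = (\<integral>\<^sup>+w. ennreal (near r u w * wt \<sigma> w / (ball_mass TYPE('n) 0 * ?V)) * indicator \<B> w \<partial>ball_leb)"
    unfolding avg_measure_def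
    by (subst emeasure_density) (use sets.top[of "ball_leb :: (complex ^ 'n) measure"] in auto)
  also have "\<dots> = (\<integral>\<^sup>+w. ennreal (1 / ?V) * ennreal (near r u w * wt \<sigma> w / ball_mass TYPE('n) 0) \<partial>ball_leb)"
    using V m by (intro nn_integral_cong) (auto simp: mult_ac simp flip: ennreal_mult')
  also have "\<dots> = ennreal (1 / ?V) * ennreal ?V"
    unfolding V(1)[symmetric] emeasure_v_weight_bergman_ball by (rule nn_integral_cmult) measurable
  also have "\<dots> = 1" using V(2) by (simp flip: ennreal_mult')
  finally show ?thesis .
qed

text \<open>Links \<open>mean_osc\<close>, which averages with the weight \<open>\<sigma>\<close>,
  to the unweighted local integrals in \<open>osc_bound\<close>.\<close>

lemma avg_measure_comparable:
  fixes r \<sigma> :: real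
  assumes r: "r > 0"
  obtains C where "C > 0"
    "\<And>(u :: complex ^ 'n) F. u \<in> \<B> \<Longrightarrow> measB F \<Longrightarrow> (\<And>w. F w \<ge> 0) \<Longrightarrow>
      (\<integral>\<^sup>+w. ennreal (F w) \<partial>avg_measure \<sigma> r u) \<le> ennreal (C * wt (- (real CARD('n) + 1)) u) * (\<integral>B w. near r u w * F w)"
    "\<And>(u :: complex ^ 'n) F. u \<in> \<B> \<Longrightarrow> measB F \<Longrightarrow> (\<And>w. F w \<ge> 0) \<Longrightarrow>
      (\<integral>B w. near r u w * F w) \<le> ennreal (C * wt (real CARD('n) + 1) u) * (\<integral>\<^sup>+w. ennreal (F w) \<partial>avg_measure \<sigma> r u)"
proof -
  let ?n = "real CARD('n) + 1" and ?m = "ball_mass TYPE('n) 0" and ?V = "\<lambda>u :: complex ^ 'n. measure (v_weight \<sigma>) (bergman_ball u r)"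
  show ?thesis
  proof (cases rule: v_weight_bergman_ball[OF r, where 'n = 'n and \<sigma> = \<sigma>])
  case (1 C0)
  note C0 = this(1,3-5)
  show ?thesis
  proof (cases rule: near_powr_le[OF r, where 'n = 'n])
  case (1 K)
  note K = this
  have m: "?m > 0" by (rule ball_mass_pos) simp
  define k where "k = K powr \<bar>\<sigma>\<bar>"
  have k: "k > 0" using K by (simp add: k_def)
  let ?C = "k * C0 / ?m + k * C0 * ?m"
  show ?thesis
  proof (rule that[of ?C])
    show C: "?C > 0" using k m C0 by (simp add: add_pos_pos)
    fix u :: "complex ^ 'n" and F :: "complex ^ 'n \<Rightarrow> real" assume u: "u \<in> \<B>" and F[measurable]: "measB F" "\<And>w. F w \<ge> 0"
    let ?d = "\<lambda>w. near r u w * wt \<sigma> w / (?m * ?V u)"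
    have int: "(\<integral>\<^sup>+w. ennreal (F w) \<partial>avg_measure \<sigma> r u) = (\<integral>B w. ?d w * F w)"
      unfolding avg_measure_def using m by (subst nn_integral_density) (auto simp del: times_divide_eq_left simp flip: ennreal_mult')
    note V = C0(2,3,4)[OF u]
    have y: "wt (?n + \<sigma>) u > 0" using defect_pos[OF u] by simp
    have pw: "wt \<sigma> u * wt (- \<sigma>) u = 1" "wt (- \<sigma>) u * wt (?n + \<sigma>) u = wt ?n u" "wt \<sigma> u * inverse (wt (?n + \<sigma>) u) = wt (- ?n) u"
      using defect_pos[OF u] unfolding powr_add[symmetric] powr_minus[symmetric] by simp_all
    show "(\<integral>\<^sup>+w. ennreal (F w) \<partial>avg_measure \<sigma> r u) \<le> ennreal (?C * wt (- ?n) u) * (\<integral>B w. near r u w * F w)"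
      unfolding int
    proof (rule ball_nn_le1[OF _ order_refl])
      fix w :: "complex ^ 'n" assume w: "w \<in> \<B>"
      have "1 / ?V u \<le> C0 * inverse (wt (?n + \<sigma>) u)" using V y by (simp add: field_simps)
      from mult_mono[OF K(2)[OF u w, of \<sigma>] this] have "near r u w * wt \<sigma> w * (1 / ?V u) \<le> near r u w * (k * wt \<sigma> u) * (C0 * inverse (wt (?n + \<sigma>) u))"
        using V by (simp add: k_def)
      also have "\<dots> = k * C0 * (wt \<sigma> u * inverse (wt (?n + \<sigma>) u) * near r u w)" by (simp only: mult_ac)
      finally have "?d w \<le> k * C0 / ?m * (wt (- ?n) u * near r u w)"
        unfolding pw using m V by (simp add: field_simps)
      also have "\<dots> \<le> ?C * (wt (- ?n) u * near r u w)" using k m C0 by (intro mult_right_mono) auto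
      finally show "?d w * F w \<le> ?C * wt (- ?n) u * (near r u w * F w)" using mult_right_mono[OF _ F(2)] by (fastforce simp: mult_ac)
    qed (use C in auto)
    show "(\<integral>B w. near r u w * F w) \<le> ennreal (?C * wt ?n u) * (\<integral>\<^sup>+w. ennreal (F w) \<partial>avg_measure \<sigma> r u)"
      unfolding int
    proof (rule ball_nn_le1[OF _ order_refl])
      fix w :: "complex ^ 'n" assume w: "w \<in> \<B>"
      have "near r u w * wt \<sigma> u \<le> near r u w * (k * wt \<sigma> w)" using K(2)[OF w u, of \<sigma>] by (simp add: k_def near_commute[of r w])
      from mult_mono[OF this mult_left_mono[OF V(2), of "wt (- \<sigma>) u"]]
      have "near r u w * wt \<sigma> u * (wt (- \<sigma>) u * ?V u) \<le> near r u w * (k * wt \<sigma> w) * (wt (- \<sigma>) u * (C0 * wt (?n + \<sigma>) u))"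
        using V k by simp
      moreover have "near r u w * wt \<sigma> u * (wt (- \<sigma>) u * ?V u) = near r u w * ((wt \<sigma> u * wt (- \<sigma>) u) * ?V u)"
        "near r u w * (k * wt \<sigma> w) * (wt (- \<sigma>) u * (C0 * wt (?n + \<sigma>) u)) = k * C0 * ((wt (- \<sigma>) u * wt (?n + \<sigma>) u) * (near r u w * wt \<sigma> w))"
        by (simp_all only: mult_ac)
      ultimately have "near r u w * ?V u \<le> k * C0 * (wt ?n u * (near r u w * wt \<sigma> w))" unfolding pw by simp
      then have "near r u w \<le> k * C0 * ?m * (wt ?n u * ?d w)" using m V by (simp add: field_simps)
      also have "\<dots> \<le> ?C * (wt ?n u * ?d w)" using k m C0 V by (intro mult_right_mono) auto
      finally show "near r u w * F w \<le> ?C * wt ?n u * (?d w * F w)" using mult_right_mono[OF _ F(2)] by (fastforce simp: mult_ac)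
    qed (use C in auto)
  qed qed qed
qed

lemma integral_avg_measure:
  fixes u :: "complex ^ 'n" and g :: "complex ^ 'n \<Rightarrow> 'b :: {banach, second_countable_topology}"
  assumes r: "r > 0" and u: "u \<in> \<B>" and [measurable]: "measB g"
  shows "(1 / measure (v_weight \<sigma>) (bergman_ball u r)) *\<^sub>R (LINT w:bergman_ball u r|v_weight \<sigma>. g w) = (\<integral>w. g w \<partial>avg_measure \<sigma> r u)"
proof -
  let ?V = "measure (v_weight \<sigma>) (bergman_ball u r)" and ?m = "ball_mass TYPE('n) 0"
  have m: "?m > 0" by (rule ball_mass_pos) simp
  have [measurable]: "bergman_ball u r \<in> sets (ball_leb :: (complex ^ 'n) measure)" by (rule bergman_ball_sets)
  have "(LINT w:bergman_ball u r|v_weight \<sigma>. g w) = (\<integral>w. (wt \<sigma> w / ?m) *\<^sub>R (indicator (bergman_ball u r) w *\<^sub>R g w) \<partial>ball_leb)"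
    unfolding set_lebesgue_integral_def v_weight_eq using m by (subst integral_density) auto
  then have "(1 / ?V) *\<^sub>R (LINT w:bergman_ball u r|v_weight \<sigma>. g w) = (\<integral>w. (1 / ?V) *\<^sub>R ((wt \<sigma> w / ?m) *\<^sub>R (indicator (bergman_ball u r) w *\<^sub>R g w)) \<partial>ball_leb)"
    by (simp only: integral_scaleR_right)
  also have "\<dots> = (\<integral>w. (near r u w * wt \<sigma> w / (?m * ?V)) *\<^sub>R g w \<partial>ball_leb)"
    by (rule Bochner_Integration.integral_cong) (auto simp: near_indicator mult_ac)
  also have "\<dots> = (\<integral>w. g w \<partial>avg_measure \<sigma> r u)"
    unfolding avg_measure_def using m by (subst integral_density) auto
  finally show ?thesis .
qed

lemma bergman_avg_eq:
  assumes "r > 0" "u \<in> \<B>" "measB f"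
  shows "bergman_avg \<sigma> r f u = (\<integral>w. f w \<partial>avg_measure \<sigma> r u)"
  unfolding bergman_avg_def by (rule integral_avg_measure[OF assms])

lemma mean_osc_eq:
  assumes "r > 0" "u \<in> \<B>" and [measurable]: "measB f"
  shows "mean_osc \<sigma> q r f u = (\<integral>w. cmod (f w - bergman_avg \<sigma> r f u) powr q \<partial>avg_measure \<sigma> r u) powr (1 / q)"
  unfolding mean_osc_def real_scaleR_def[symmetric]
  by (subst integral_avg_measure[OF assms(1,2)]) measurable

lemma finite_measure_avg_measure:
  fixes u :: "complex ^ 'n"
  assumes "r > 0" "u \<in> \<B>"
  shows "finite_measure (avg_measure \<sigma> r u)"
  by (rule finite_measureI) (simp add: emeasure_avg_measure[OF assms])

lemma near_Lint_le:
  fixes r \<beta> q :: real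
  assumes r: "r > 0"
  obtains C where "C > 0" "\<And>(f :: complex ^ 'n \<Rightarrow> complex) u. measB f \<Longrightarrow> u \<in> \<B> \<Longrightarrow>
    (\<integral>B w. near r u w * cmod (f w) powr q) \<le> ennreal (C * wt (- \<beta>) u) * Lint q \<beta> f"
proof (cases rule: near_powr_le[OF r, where 'n = 'n])
  case (1 K)
  let ?k = "K powr \<bar>- \<beta>\<bar>"
  show ?thesis
  proof (rule that[of ?k])
    show "?k > 0" using 1 by simp
    fix f :: "complex ^ 'n \<Rightarrow> complex" and u :: "complex ^ 'n" assume [measurable]: "measB f" and u: "u \<in> \<B>"
    show "(\<integral>B w. near r u w * cmod (f w) powr q) \<le> ennreal (?k * wt (- \<beta>) u) * Lint q \<beta> f"
      unfolding Lint_def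
    proof (rule ball_nn_le1[OF _ order_refl])
      fix w :: "complex ^ 'n" assume w: "w \<in> \<B>"
      have p: "wt (- \<beta>) w * wt \<beta> w = 1" using defect_pos[OF w] by (simp flip: powr_add)
      have "near r u w * wt (- \<beta>) w \<le> near r u w * (?k * wt (- \<beta>) u)" by (rule 1(2)[OF u w])
      also have "\<dots> \<le> 1 * (?k * wt (- \<beta>) u)" by (intro mult_right_mono) auto
      finally have "near r u w * wt (- \<beta>) w * (wt \<beta> w * cmod (f w) powr q) \<le> ?k * wt (- \<beta>) u * (wt \<beta> w * cmod (f w) powr q)"
        by (intro mult_right_mono) auto
      moreover have "near r u w * wt (- \<beta>) w * (wt \<beta> w * cmod (f w) powr q) = near r u w * cmod (f w) powr q * (wt (- \<beta>) w * wt \<beta> w)"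
        by (simp only: mult_ac)
      ultimately show "near r u w * cmod (f w) powr q \<le> ?k * wt (- \<beta>) u * (wt \<beta> w * cmod (f w) powr q)"
        unfolding p by simp
    qed auto
  qed
qed

text \<open>By convexity, \<open>|avg f - c|\<^sup>q\<close> is at most the average of \<open>|f - c|\<^sup>q\<close>.\<close>

lemma mean_osc_powr:
  fixes f :: "complex ^ 'n \<Rightarrow> complex"
  assumes r: "r > 0" and q: "q > 1" and u: "u \<in> \<B>" and f[measurable]: "measB f" and L: "Lint q \<beta> f < \<infinity>"
  shows "ennreal (mean_osc \<sigma> q r f u powr q) = (\<integral>\<^sup>+w. ennreal (cmod (f w - bergman_avg \<sigma> r f u) powr q) \<partial>avg_measure \<sigma> r u)"
    and "(\<integral>\<^sup>+w. ennreal (cmod (f w - bergman_avg \<sigma> r f u) powr q) \<partial>avg_measure \<sigma> r u)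
      \<le> ennreal (2 * 2 powr q) * (\<integral>\<^sup>+w. ennreal (cmod (f w - c) powr q) \<partial>avg_measure \<sigma> r u)"
proof -
  let ?M = "avg_measure \<sigma> r u" and ?a = "bergman_avg \<sigma> r f u"
  interpret finite_measure ?M by (rule finite_measure_avg_measure[OF r u])
  have M1: "measure ?M \<B> = 1" using emeasure_avg_measure[OF r u, of \<sigma>] by (simp add: measure_def)
  have q0: "q > 0" using q by simp
  have fin: "(\<integral>\<^sup>+w. ennreal (cmod (f w) powr q) \<partial>?M) < \<infinity>"
  proof (cases rule: avg_measure_comparable[OF r, where 'n = 'n and \<sigma> = \<sigma>])
    case (1 C1)
    note C1 = this
    show ?thesis
    proof (cases rule: near_Lint_le[OF r, where 'n = 'n and \<beta> = \<beta> and q = q])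
      case (1 C2)
      have "(\<integral>\<^sup>+w. ennreal (cmod (f w) powr q) \<partial>?M) \<le> ennreal (C1 * wt (- (real CARD('n) + 1)) u) * (ennreal (C2 * wt (- \<beta>) u) * Lint q \<beta> f)"
        by (rule order_trans[OF C1(2)[OF u] mult_left_mono[OF 1(2)[OF f u]]]) auto
      also have "\<dots> < \<infinity>" using L by (auto simp: ennreal_mult_less_top)
      finally show ?thesis .
    qed
  qed
  have fq: "integrable ?M (\<lambda>w. cmod (f w) powr q)"
    by (rule integrableI_bounded) (use fin in auto)
  have int: "integrable ?M (\<lambda>w. cmod (f w - c) powr q)" for c
  proof (rule Bochner_Integration.integrable_bound)
    show "integrable ?M (\<lambda>w. 2 powr q * (cmod (f w) powr q + cmod c powr q))"
      by (intro integrable_mult_right Bochner_Integration.integrable_add fq) simp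
    have "cmod (f w - c) powr q \<le> 2 powr q * (cmod (f w) powr q + cmod c powr q)" for w
      using cmod_diff_powr_le[of q "f w" c 0] q0 by simp
    then show "AE w in ?M. norm (cmod (f w - c) powr q) \<le> norm (2 powr q * (cmod (f w) powr q + cmod c powr q))" by simp
  qed measurable
  have fi: "integrable ?M f"
  proof (rule Bochner_Integration.integrable_bound)
    show "integrable ?M (\<lambda>w. 1 + cmod (f w) powr q)" by (intro Bochner_Integration.integrable_add fq) simp
    have "t \<le> 1 + t powr q" if "t \<ge> 0" for t :: real
    proof (cases "t \<le> 1")
      case False then show ?thesis using powr_mono[of 1 q t] q by simp
    qed (simp add: add_increasing2)
    then show "AE w in ?M. norm (f w) \<le> norm (1 + cmod (f w) powr q)" by simp
  qed measurable
  have avg: "?a = (\<integral>w. f w \<partial>?M)" by (rule bergman_avg_eq[OF r u f])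
  show "ennreal (mean_osc \<sigma> q r f u powr q) = (\<integral>\<^sup>+w. ennreal (cmod (f w - ?a) powr q) \<partial>?M)"
    unfolding mean_osc_eq[OF r u f] using q0
    by (subst nn_integral_eq_integral[OF int]) (simp_all add: powr_powr)
  have jensen: "cmod (?a - c) powr q \<le> (\<integral>w. cmod (f w - c) powr q \<partial>?M)"
  proof -
    let ?t = "cmod (?a - c)"
    have "?a - c = (\<integral>w. f w - c \<partial>?M)"
      unfolding avg using fi M1 by (subst Bochner_Integration.integral_diff) auto
    then have "?t \<le> (\<integral>w. cmod (f w - c) \<partial>?M)" by simp
    then have "q * ?t powr (q - 1) * ?t \<le> q * ?t powr (q - 1) * (\<integral>w. cmod (f w - c) \<partial>?M)"
      using q by (intro mult_left_mono) auto
    also have "\<dots> = (\<integral>w. q * (?t powr (q - 1) * cmod (f w - c)) \<partial>?M)" by simp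
    also have "\<dots> \<le> (\<integral>w. cmod (f w - c) powr q + (q - 1) * ?t powr q \<partial>?M)"
      using fi by (intro integral_mono powr_tangent[OF q] Bochner_Integration.integrable_add integrable_mult_right int) auto
    also have "\<dots> = (\<integral>w. cmod (f w - c) powr q \<partial>?M) + (q - 1) * ?t powr q"
      by (subst Bochner_Integration.integral_add[OF int]) (auto simp: M1)
    also have "q * ?t powr (q - 1) * ?t = q * ?t powr q" using powr_mult_base[of ?t "q - 1"] by (simp add: mult_ac)
    finally show ?thesis by (simp add: algebra_simps)
  qed
  have "(\<integral>w. cmod (f w - ?a) powr q \<partial>?M) \<le> (\<integral>w. 2 powr q * (cmod (f w - c) powr q + cmod (?a - c) powr q) \<partial>?M)"
    using q0 by (intro integral_mono int integrable_mult_right Bochner_Integration.integrable_add cmod_diff_powr_le) auto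
  also have "\<dots> = 2 powr q * ((\<integral>w. cmod (f w - c) powr q \<partial>?M) + cmod (?a - c) powr q)"
    by (simp add: M1 int)
  also have "\<dots> \<le> 2 powr q * ((\<integral>w. cmod (f w - c) powr q \<partial>?M) + (\<integral>w. cmod (f w - c) powr q \<partial>?M))"
    by (intro mult_left_mono add_left_mono jensen) simp
  finally show "(\<integral>\<^sup>+w. ennreal (cmod (f w - ?a) powr q) \<partial>?M) \<le> ennreal (2 * 2 powr q) * (\<integral>\<^sup>+w. ennreal (cmod (f w - c) powr q) \<partial>?M)"
    by (simp add: nn_integral_eq_integral[OF int] ennreal_leI flip: ennreal_mult')
qed

lemma mean_osc_cnj:
  assumes "r > 0" "u \<in> \<B>" and [measurable]: "measB f"
  shows "mean_osc \<sigma> q r (\<lambda>w. cnj (f w)) u = mean_osc \<sigma> q r f u"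
proof -
  have [measurable]: "measB (\<lambda>w. cnj (f w))"
    by (intro borel_measurable_continuous_on[OF _ assms(3)] continuous_intros)
  have "bergman_avg \<sigma> r (\<lambda>w. cnj (f w)) u = cnj (bergman_avg \<sigma> r f u)"
    by (subst (1 2) bergman_avg_eq[OF assms(1,2)]) auto
  then have "cmod (cnj (f w) - bergman_avg \<sigma> r (\<lambda>w. cnj (f w)) u) = cmod (f w - bergman_avg \<sigma> r f u)" for w
    by (metis complex_cnj_diff complex_mod_cnj)
  then show ?thesis by (subst (1 2) mean_osc_eq[OF assms(1,2)]) auto
qed

lemma eventually_norm_at_left_1:
  "eventually P (filtercomap norm (at_left (1 :: real))) \<longleftrightarrow> (\<exists>R<1. \<forall>z :: complex ^ 'n. R < norm z \<and> norm z < 1 \<longrightarrow> P z)"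
proof
  assume "eventually P (filtercomap norm (at_left (1 :: real)))"
  then obtain Q where Q: "eventually Q (at_left (1 :: real))" "\<And>x. Q (norm x) \<Longrightarrow> P x" by (auto simp: eventually_filtercomap)
  then show "\<exists>R<1. \<forall>z. R < norm z \<and> norm z < 1 \<longrightarrow> P z" unfolding eventually_at_left_field by blast
next
  assume "\<exists>R<1. \<forall>z. R < norm z \<and> norm z < 1 \<longrightarrow> P z"
  then obtain R where "R < 1" "\<And>z. R < norm z \<and> norm z < 1 \<Longrightarrow> P z" by blast
  then show "eventually P (filtercomap norm (at_left (1 :: real)))"
    unfolding eventually_filtercomap eventually_at_left_field
    by (intro exI[of _ "\<lambda>t. R < t \<and> t < 1"]) blast
qed

lemma mean_osc_nonneg [simp]: "mean_osc \<sigma> q r f u \<ge> 0"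
  by (simp add: mean_osc_def)

text \<open>Near the sphere the VMO condition gives the term with \<open>e\<close>. On the remaining
  compact part the oscillation is only bounded, but there the defect is bounded below, so an
  additional power \<open>\<kappa>\<close> costs no more than a constant, which goes into
  \<open>B\<close>. \<open>B\<close> depends on \<open>e\<close>.\<close>

lemma VMO_osc_bound:
  fixes f :: "complex ^ 'n \<Rightarrow> complex"
  assumes r: "r > 0" and q: "q > 1" and f[measurable]: "measB f" and L: "Lint q \<beta> f < \<infinity>"
    and V: "f \<in> VMO \<sigma> q r \<gamma>" and \<kappa>: "\<kappa> \<ge> 0" and e: "e > 0"
  obtains B where "B \<ge> 0" "osc_bound q r f (bergman_avg \<sigma> r f) (\<lambda>u. e * wt (- (\<gamma> * q)) u + B * wt (- (\<gamma> * q) + \<kappa>) u)"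
proof -
  let ?n = "real CARD('n) + 1" and ?m = "mean_osc \<sigma> q r f"
  have q0: "q > 0" using q by simp
  show ?thesis
  proof (cases rule: avg_measure_comparable[OF r, where 'n = 'n and \<sigma> = \<sigma>])
  case (1 C)
  note C = this(1,3)
  define \<delta> where "\<delta> = (e / C) powr (1 / q)"
  have \<delta>: "\<delta> > 0" "C * \<delta> powr q = e" using e C q0 by (auto simp: \<delta>_def powr_powr)
  have "((\<lambda>z. wt \<gamma> z * ?m z) \<longlongrightarrow> 0) (filtercomap norm (at_left 1))"
    using V by (simp add: VMO_def defect_def)
  then have "eventually (\<lambda>z. dist (wt \<gamma> z * ?m z) 0 < \<delta>) (filtercomap norm (at_left 1))"
    using \<delta>(1) by (rule tendstoD)
  then obtain R0 where R0: "R0 < 1" "\<And>z. R0 < norm z \<Longrightarrow> norm z < 1 \<Longrightarrow> wt \<gamma> z * ?m z < \<delta>"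
    unfolding eventually_norm_at_left_1 by auto
  define R where "R = max R0 0"
  have R: "0 \<le> R" "R < 1" "\<And>z. R < norm z \<Longrightarrow> norm z < 1 \<Longrightarrow> wt \<gamma> z * ?m z < \<delta>"
    using R0 by (auto simp: R_def)
  have "bdd_above ((\<lambda>z. wt \<gamma> z * ?m z) ` \<B>)" using V by (simp add: VMO_def BMO_def defect_def)
  then obtain S0 where "\<forall>z\<in>\<B>. wt \<gamma> z * ?m z \<le> S0" unfolding bdd_above_def by auto
  then have S: "\<And>z. z \<in> \<B> \<Longrightarrow> wt \<gamma> z * ?m z \<le> max S0 0" by (simp add: le_max_iff_disj)
  have R1: "1 - R\<^sup>2 > 0" using R by (simp add: power_less_one_iff abs_square_less_1)
  define B where "B = C * max S0 0 powr q * (1 - R\<^sup>2) powr (- \<kappa>)"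
  show ?thesis
  proof (rule that[of B])
    show B0: "B \<ge> 0" using C by (simp add: B_def)
    show "osc_bound q r f (bergman_avg \<sigma> r f) (\<lambda>u. e * wt (- (\<gamma> * q)) u + B * wt (- (\<gamma> * q) + \<kappa>) u)"
      unfolding osc_bound_def
    proof (intro conjI f ballI)
      fix u :: "complex ^ 'n" assume u: "u \<in> \<B>"
      have x: "defect u > 0" by (rule defect_pos[OF u])
      show "e * wt (- (\<gamma> * q)) u + B * wt (- (\<gamma> * q) + \<kappa>) u \<ge> 0" using e B0 by simp
      let ?y = "wt \<gamma> u * ?m u"
      have "?m u powr q = (wt (- \<gamma>) u * ?y) powr q" using x by (simp add: powr_minus flip: mult.assoc)
      also have "\<dots> = wt (- (\<gamma> * q)) u * ?y powr q"
        by (subst powr_mult) (auto simp: powr_powr)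
      finally have my: "?m u powr q = wt (- (\<gamma> * q)) u * ?y powr q" .
      have le: "C * ?m u powr q \<le> e * wt (- (\<gamma> * q)) u + B * wt (- (\<gamma> * q) + \<kappa>) u"
      proof (cases "norm u > R")
        case True
        then have "?y powr q \<le> \<delta> powr q" using R(3)[of u] u q0 by (intro powr_mono2) auto
        then have "C * ?m u powr q \<le> C * (wt (- (\<gamma> * q)) u * \<delta> powr q)"
          unfolding my using C by (intro mult_left_mono) auto
        also have "\<dots> = e * wt (- (\<gamma> * q)) u" unfolding \<delta>(2)[symmetric] by simp
        finally show ?thesis using B0 by (simp add: add_increasing2)
      next
        case False
        then have "(norm u)\<^sup>2 \<le> R\<^sup>2" by (intro power_mono) auto
        then have "1 - R\<^sup>2 \<le> defect u" by (simp add: defect_def)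
        then have "(1 - R\<^sup>2) powr \<kappa> \<le> wt \<kappa> u" using R1 \<kappa> by (intro powr_mono2) auto
        then have k: "1 \<le> (1 - R\<^sup>2) powr (- \<kappa>) * wt \<kappa> u" using R1 by (simp add: powr_minus field_simps)
        have "?y powr q \<le> max S0 0 powr q" using S[OF u] q0 by (intro powr_mono2) auto
        then have "C * ?m u powr q \<le> C * (wt (- (\<gamma> * q)) u * max S0 0 powr q) * 1"
          unfolding my mult_1_right using C by (intro mult_left_mono) auto
        also have "\<dots> \<le> C * (wt (- (\<gamma> * q)) u * max S0 0 powr q) * ((1 - R\<^sup>2) powr (- \<kappa>) * wt \<kappa> u)"
          using C by (intro mult_left_mono k) auto
        also have "\<dots> = B * wt (- (\<gamma> * q) + \<kappa>) u" unfolding B_def powr_add by (simp only: mult_ac)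
        finally show ?thesis using e by (simp add: add_increasing)
      qed
      have "(\<integral>B w. near r u w * cmod (f w - bergman_avg \<sigma> r f u) powr q) \<le> ennreal (C * wt ?n u) * (\<integral>\<^sup>+w. ennreal (cmod (f w - bergman_avg \<sigma> r f u) powr q) \<partial>avg_measure \<sigma> r u)"
        by (rule C(2)[OF u]) auto
      also have "\<dots> = ennreal (wt ?n u * (C * ?m u powr q))"
        unfolding mean_osc_powr(1)[OF r q u f L, symmetric] using C by (simp add: mult_ac flip: ennreal_mult')
      also have "\<dots> \<le> ennreal (wt ?n u * (e * wt (- (\<gamma> * q)) u + B * wt (- (\<gamma> * q) + \<kappa>) u))"
        by (intro ennreal_leI mult_left_mono le) simp
      finally show "(\<integral>B w. near r u w * cmod (f w - bergman_avg \<sigma> r f u) powr q)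
        \<le> ennreal (wt ?n u * (e * wt (- (\<gamma> * q)) u + B * wt (- (\<gamma> * q) + \<kappa>) u))" .
    qed
  qed qed
qed

section \<open>Growth, embedding and normal families in Bergman spaces\<close>

lemma bergman_growth:
  fixes p \<alpha> :: real
  assumes p: "p > 1"
  obtains C where "C > 0" "\<And>(g :: complex ^ 'n \<Rightarrow> complex) z. holomorphic_ball g \<Longrightarrow> z \<in> \<B> \<Longrightarrow>
    ennreal (cmod (g z) powr p) \<le> ennreal (C * wt (- (real CARD('n) + 1 + \<alpha>)) z) * Lint p \<alpha> g"
proof (cases rule: bergman_submean[OF zero_less_one p, where 'n = 'n])
  case (1 C1)
  note C1 = this
  let ?n = "real CARD('n) + 1"
  show ?thesis
  proof (cases rule: near_Lint_le[OF zero_less_one, where 'n = 'n and \<beta> = \<alpha> and q = p])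
  case (1 C2)
  note C2 = this
  show ?thesis
  proof (rule that[of "C1 * C2"])
    show "C1 * C2 > 0" using C1 C2 by simp
    fix g :: "complex ^ 'n \<Rightarrow> complex" and z :: "complex ^ 'n" assume g: "holomorphic_ball g" and z: "z \<in> \<B>"
    have "ennreal (cmod (g z) powr p) \<le> ennreal (C1 * wt (- ?n) z) * (ennreal (C2 * wt (- \<alpha>) z) * Lint p \<alpha> g)"
      using order_trans[OF C1(2)[OF g z] mult_left_mono[OF _ zero_le]] C2(2)[OF holomorphic_ball_measurable[OF g] z] by simp
    also have "\<dots> = ennreal (C1 * C2 * (wt (- ?n) z * wt (- \<alpha>) z)) * Lint p \<alpha> g"
      using C1 C2 by (simp add: ennreal_mult' mult_ac)
    also have "wt (- ?n) z * wt (- \<alpha>) z = wt (- (?n + \<alpha>)) z"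
      unfolding powr_add[symmetric] by (simp add: algebra_simps)
    finally show "ennreal (cmod (g z) powr p) \<le> ennreal (C1 * C2 * wt (- (?n + \<alpha>)) z) * Lint p \<alpha> g" .
  qed qed
qed

text \<open>Writing |g|^q as |g|^(q-p) |g|^p and estimating the first factor by the growth bound.
  The new weight exponent equals \<beta> - \<gamma>q, the one which the oscillation estimate
  produces.\<close>

lemma bergman_embedding:
  fixes p q \<alpha> :: real
  assumes p: "p > 1" "p \<le> q"
  obtains C where "C > 0"
    "\<And>(g :: complex ^ 'n \<Rightarrow> complex) L z. holomorphic_ball g \<Longrightarrow> L \<ge> 0 \<Longrightarrow> Lint p \<alpha> g \<le> ennreal L \<Longrightarrow> z \<in> \<B> \<Longrightarrow>
      cmod (g z) \<le> (C * L) powr (1 / p) * defect z powr (- ((real CARD('n) + 1 + \<alpha>) / p))"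
    "\<And>(g :: complex ^ 'n \<Rightarrow> complex) L. holomorphic_ball g \<Longrightarrow> L \<ge> 0 \<Longrightarrow> Lint p \<alpha> g \<le> ennreal L \<Longrightarrow>
      Lint q ((real CARD('n) + 1 + \<alpha>) * q / p - (real CARD('n) + 1)) g \<le> ennreal ((C * L) powr ((q - p) / p) * L)"
proof -
  let ?n = "real CARD('n) + 1"
  have p0: "p > 0" using p by simp
  show ?thesis
  proof (cases rule: bergman_growth[OF p(1), where 'n = 'n and \<alpha> = \<alpha>])
  case (1 C)
  note C = this
  have growth: "cmod (g z) \<le> (C * L) powr (1 / p) * wt (- ((?n + \<alpha>) / p)) z"
    if g: "holomorphic_ball g" and L: "L \<ge> 0" "Lint p \<alpha> g \<le> ennreal L" and z: "z \<in> \<B>" for g :: "complex ^ 'n \<Rightarrow> complex" and L z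
  proof -
    have "ennreal (cmod (g z) powr p) \<le> ennreal (C * wt (- (?n + \<alpha>)) z) * ennreal L"
      by (rule order_trans[OF C(2)[OF g z] mult_left_mono[OF L(2)]]) simp
    also have "\<dots> = ennreal (C * L * wt (- (?n + \<alpha>)) z)"
      using C L by (simp add: mult_ac flip: ennreal_mult'')
    finally have "cmod (g z) powr p \<le> C * L * wt (- (?n + \<alpha>)) z"
      using C L by (subst (asm) ennreal_le_iff) auto
    then have "(cmod (g z) powr p) powr (1 / p) \<le> (C * L * wt (- (?n + \<alpha>)) z) powr (1 / p)"
      using p0 by (intro powr_mono2) auto
    also have "\<dots> = (C * L) powr (1 / p) * wt (- ((?n + \<alpha>) / p)) z"
    proof -
      have "- (?n + \<alpha>) * (1 / p) = - ((?n + \<alpha>) / p)" by (simp only: minus_divide_left mult_1_right times_divide_eq_right)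
      then show ?thesis by (simp only: powr_mult powr_powr)
    qed
    finally show ?thesis using p0 by (simp add: powr_powr)
  qed
  show ?thesis
  proof (rule that[of C], rule C(1), rule growth, assumption+)
    fix g :: "complex ^ 'n \<Rightarrow> complex" and L :: real
    assume g: "holomorphic_ball g" and L: "L \<ge> 0" "Lint p \<alpha> g \<le> ennreal L"
    note [measurable] = holomorphic_ball_measurable[OF g]
    let ?\<alpha>' = "(?n + \<alpha>) * q / p - ?n" and ?c = "(C * L) powr ((q - p) / p)"
    have "Lint q ?\<alpha>' g \<le> (\<integral>\<^sup>+z. ennreal ?c * ennreal (wt \<alpha> z * cmod (g z) powr p) \<partial>ball_leb)"
      unfolding Lint_def
    proof (rule nn_integral_mono)
      fix z :: "complex ^ 'n" assume "z \<in> space ball_leb"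
      then have z: "z \<in> \<B>" by simp
      have "cmod (g z) powr (q - p) \<le> ((C * L) powr (1 / p) * wt (- ((?n + \<alpha>) / p)) z) powr (q - p)"
        using growth[OF g L z] p by (intro powr_mono2) auto
      also have "\<dots> = ?c * wt (- ((?n + \<alpha>) / p) * (q - p)) z"
        by (subst powr_mult) (auto simp: powr_powr)
      finally have "defect z powr ?\<alpha>' * (cmod (g z) powr (q - p) * cmod (g z) powr p) \<le> defect z powr ?\<alpha>' * ((?c * wt (- ((?n + \<alpha>) / p) * (q - p)) z) * cmod (g z) powr p)"
        by (intro mult_left_mono mult_right_mono) auto
      also have "\<dots> = ?c * ((defect z powr ?\<alpha>' * wt (- ((?n + \<alpha>) / p) * (q - p)) z) * cmod (g z) powr p)"
        by (simp only: mult_ac)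
      also have "defect z powr ?\<alpha>' * wt (- ((?n + \<alpha>) / p) * (q - p)) z = wt \<alpha> z"
        unfolding powr_add[symmetric] using p0 by (intro arg_cong[where f = "\<lambda>t. wt t z"]) (simp add: field_simps)
      also have "cmod (g z) powr (q - p) * cmod (g z) powr p = cmod (g z) powr q" unfolding powr_add[symmetric] by simp
      finally show "ennreal (defect z powr ?\<alpha>' * cmod (g z) powr q) \<le> ennreal ?c * ennreal (wt \<alpha> z * cmod (g z) powr p)"
        by (simp add: ennreal_leI flip: ennreal_mult')
    qed
    also have "\<dots> = ennreal ?c * Lint p \<alpha> g" unfolding Lint_def by (rule nn_integral_cmult) measurable
    also have "\<dots> \<le> ennreal ?c * ennreal L" by (rule mult_left_mono[OF L(2)]) simp
    also have "\<dots> = ennreal (?c * L)" by (simp add: ennreal_mult')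
    finally show "Lint q ?\<alpha>' g \<le> ennreal (?c * L)" .
  qed qed
qed

text \<open>As \<open>bergman_proj s\<close> reproduces \<open>g\<close>, the term f(z)g(z) is the
  projection of the function f(z)g at \<open>z\<close>; this puts the difference f(z) - f(w) under
  the integral.\<close>

lemma hankel_pointwise:
  fixes f g :: "complex ^ 'n \<Rightarrow> complex"
  assumes s: "s > -1" and g: "holomorphic_ball g" "L1w s g" and fg: "L1w s (\<lambda>w. f w * g w)" and z: "z \<in> \<B>"
  shows "ennreal (ball_mass TYPE('n) s * cmod (hankel s f g z))
    \<le> (\<integral>B w. cmod (f z - f w) * cmod (g w) * (wt s w * kern s z w))"
proof -
  have c: "L1w s (\<lambda>w. f z * g w)" using g(2) integrable_mult_right[of "f z"] by (fastforce simp: mult_ac)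
  have d: "L1w s (\<lambda>w. (f z - f w) * g w)" using Bochner_Integration.integrable_diff[OF c fg] by (simp add: algebra_simps)
  have "hankel s f g z = bergman_proj s (\<lambda>w. (f z - f w) * g w) z"
    unfolding hankel_def left_diff_distrib bergman_proj_diff[OF s c fg z] bergman_proj_cmult
    using bergman_proj_holomorphic[OF s g z] by simp
  then show ?thesis using bergman_proj_bound[OF s d z] by (simp add: norm_mult)
qed

text \<open>A form of Montel's theorem. The reproducing formula with weight \<open>s\<close> gives
  equicontinuity at each point, a diagonal argument gives convergence on a countable dense set, and
  by dominated convergence the limit satisfies the reproducing formula as well, which makes it
  holomorphic.\<close>

lemma holomorphic_pointwise_limit:
  fixes G :: "nat \<Rightarrow> complex ^ 'n \<Rightarrow> complex"
  assumes s: "s > -1" and \<kappa>: "\<kappa> \<le> s" and G: "\<And>k. holomorphic_ball (G k)"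
    and M: "\<And>k z. z \<in> \<B> \<Longrightarrow> cmod (G k z) \<le> M * wt (- \<kappa>) z"
  obtains \<phi> :: "nat \<Rightarrow> nat" and g where "strict_mono \<phi>" "holomorphic_ball g" "\<And>z. z \<in> \<B> \<Longrightarrow> (\<lambda>k. G (\<phi> k) z) \<longlonglongrightarrow> g z"
proof -
  let ?N = "real CARD('n) + 1 + s" and ?m = "ball_mass TYPE('n) s"
  have m: "?m > 0" by (rule ball_mass_pos[OF s])
  interpret finite_measure "ball_leb :: (complex ^ 'n) measure" by (rule finite_measure_ball_leb)
  have "cmod (G 0 0) \<le> M" using M[of 0 0] by (simp add: defect_def)
  then have M0: "M \<ge> 0" using norm_ge_zero order_trans by blast
  have Gs: "norm (wt s w *\<^sub>R G k w) \<le> M" if w: "w \<in> \<B>" for k w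
  proof -
    have "wt s w * cmod (G k w) \<le> wt s w * (M * wt (- \<kappa>) w)" by (intro mult_left_mono M w) simp
    also have "\<dots> = M * wt (s - \<kappa>) w" by (simp add: powr_diff powr_minus field_simps)
    also have "\<dots> \<le> M * 1" using defect_pos[OF w] defect_le_1[of w] \<kappa> M0 by (intro mult_left_mono powr_le1) auto
    finally show ?thesis by simp
  qed
  note Gm[measurable] = holomorphic_ball_measurable[OF G]
  have Gi: "L1w s (G k)" for k
  proof (rule Bochner_Integration.integrable_bound[of _ "\<lambda>_. M"])
    show "AE w in ball_leb. norm (wt s w *\<^sub>R G k w) \<le> norm M" using Gs M0 by (auto intro!: AE_I2)
  qed auto
  have rep: "G k z = of_real (1 / ?m) * bint s ?N (G k) z" if z: "z \<in> \<B>" for k z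
    using bergman_proj_holomorphic[OF s G Gi z] bergman_proj_eq[OF s Gm z] by simp
  have N: "?N \<ge> 0" using s by simp
  have equi: "\<exists>d>0. \<forall>k v. norm (v - z) < d \<longrightarrow> v \<in> \<B> \<and> cmod (G k z - G k v) < e" if z: "z \<in> \<B>" and e: "e > 0" for z e
  proof -
    define \<rho> where "\<rho> = (1 + norm z) / 2"
    have \<rho>: "norm z < \<rho>" "\<rho> < 1" using z by (auto simp: \<rho>_def)
    define V where "V = measure (ball_leb :: (complex ^ 'n) measure) \<B>"
    have V: "V \<ge> 0" by (simp add: V_def)
    define \<delta> where "\<delta> = e * ?m / (M * V + 1)"
    have \<delta>: "\<delta> > 0" using e m M0 V by (simp add: \<delta>_def add_nonneg_pos)
    have "uniformly_continuous_on (cball 0 \<rho>) (bkern ?N)"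
      using \<rho> by (intro compact_uniformly_continuous continuous_on_subset[OF continuous_on_bkern]) auto
    then obtain d where d: "d > 0" "\<And>x y. x \<in> cball 0 \<rho> \<Longrightarrow> y \<in> cball 0 \<rho> \<Longrightarrow> dist y x < d \<Longrightarrow> dist (bkern ?N y) (bkern ?N x) < \<delta>"
      using \<delta> unfolding uniformly_continuous_on_def by metis
    show ?thesis
    proof (intro exI[of _ "min d (\<rho> - norm z)"] conjI allI impI)
      show "min d (\<rho> - norm z) > 0" using d \<rho> by simp
      fix k v assume v: "norm (v - z) < min d (\<rho> - norm z)"
      have nv: "norm v \<le> \<rho>" using v norm_triangle_sub[of v z] by simp
      then show vb: "v \<in> \<B>" using \<rho> by simp
      have hb: "cmod (hinner y w) \<le> norm y" if "w \<in> \<B>" for y w :: "complex ^ 'n"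
        using norm_hinner_le[of y w] that mult_left_le[of "norm w" "norm y"] by simp
      have bk: "cmod (bkern ?N (hinner z w) - bkern ?N (hinner v w)) \<le> \<delta>" if w: "w \<in> \<B>" for w
      proof -
        have "dist (hinner z w) (hinner v w) < d"
          using hb[OF w, of "v - z"] v by (simp add: dist_norm hinner_diff_left norm_minus_commute)
        then show ?thesis using d(2)[of "hinner v w" "hinner z w"] hb[OF w, of z] hb[OF w, of v] nv \<rho> by (simp add: dist_norm)
      qed
      have "bint s ?N (G k) z - bint s ?N (G k) v = (\<integral>w. wt s w *\<^sub>R (G k w * bkern ?N (hinner z w)) - wt s w *\<^sub>R (G k w * bkern ?N (hinner v w)) \<partial>ball_leb)"
        unfolding bint_def by (rule Bochner_Integration.integral_diff[symmetric]) (intro L1w_bkern Gi z vb N)+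
      also have "norm \<dots> \<le> (\<integral>w. M * \<delta> \<partial>(ball_leb :: (complex ^ 'n) measure))"
      proof (rule Bochner_Integration.integral_norm_bound_integral)
        show "integrable ball_leb (\<lambda>w. wt s w *\<^sub>R (G k w * bkern ?N (hinner z w)) - wt s w *\<^sub>R (G k w * bkern ?N (hinner v w)))"
          by (intro Bochner_Integration.integrable_diff L1w_bkern Gi z vb N)
        fix w :: "complex ^ 'n" assume "w \<in> space ball_leb"
        then have w: "w \<in> \<B>" by simp
        have "norm (wt s w *\<^sub>R (G k w * bkern ?N (hinner z w)) - wt s w *\<^sub>R (G k w * bkern ?N (hinner v w)))
          = norm (wt s w *\<^sub>R G k w) * cmod (bkern ?N (hinner z w) - bkern ?N (hinner v w))"
          by (simp add: norm_mult mult.assoc flip: scaleR_right_diff_distrib right_diff_distrib)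
        also have "\<dots> \<le> M * \<delta>" using M0 by (intro mult_mono Gs bk w) auto
        finally show "norm (wt s w *\<^sub>R (G k w * bkern ?N (hinner z w)) - wt s w *\<^sub>R (G k w * bkern ?N (hinner v w))) \<le> M * \<delta>" .
      qed simp
      also have "\<dots> = M * V * \<delta>" by (simp add: V_def)
      also have "\<dots> < (M * V + 1) * \<delta>" using \<delta> by simp
      also have "\<dots> = e * ?m" using M0 V by (simp add: \<delta>_def add_nonneg_eq_0_iff)
      finally have "cmod (bint s ?N (G k) z - bint s ?N (G k) v) / ?m < e" using m by (simp add: field_simps)
      then show "cmod (G k z - G k v) < e"
        unfolding rep[OF z] rep[OF vb] using m by (simp add: norm_divide flip: diff_divide_distrib)
    qed
  qed
  obtain D where D: "countable D" "D \<subseteq> ball (0 :: complex ^ 'n) 1" "\<B> \<subseteq> closure D" using separable by blast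
  \<comment> \<open>The diagonal argument asks for one bound valid at all points of
    \<open>D\<close>; the factor \<open>wt \<kappa> x\<close> supplies it and is divided out again
    afterwards.\<close>
  have bd: "norm (wt \<kappa> x *\<^sub>R G k x) \<le> M" if "x \<in> D" for k x
  proof -
    have x: "x \<in> \<B>" using that D by blast
    have "wt \<kappa> x * cmod (G k x) \<le> wt \<kappa> x * (M * wt (- \<kappa>) x)" by (intro mult_left_mono M x) simp
    also have "\<dots> = M" using defect_pos[OF x] by (simp add: powr_minus)
    finally show ?thesis by simp
  qed
  obtain \<phi> :: "nat \<Rightarrow> nat" where \<phi>: "strict_mono \<phi>" "\<And>x. x \<in> D \<Longrightarrow> \<exists>l. (\<lambda>k. wt \<kappa> x *\<^sub>R G (\<phi> k) x) \<longlonglongrightarrow> l"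
    using function_convergent_subsequence[OF D(1), of "\<lambda>k x. wt \<kappa> x *\<^sub>R G k x" M] bd by blast
  have conv_D: "Cauchy (\<lambda>k. G (\<phi> k) x)" if "x \<in> D" for x
  proof -
    obtain l where "(\<lambda>k. wt \<kappa> x *\<^sub>R G (\<phi> k) x) \<longlonglongrightarrow> l" using \<phi>(2)[OF \<open>x \<in> D\<close>] by blast
    then have "(\<lambda>k. (1 / wt \<kappa> x) *\<^sub>R (wt \<kappa> x *\<^sub>R G (\<phi> k) x)) \<longlonglongrightarrow> (1 / wt \<kappa> x) *\<^sub>R l" by (intro tendsto_intros)
    moreover have "defect x > 0" using that D(2) defect_pos by blast
    ultimately have "(\<lambda>k. G (\<phi> k) x) \<longlonglongrightarrow> (1 / wt \<kappa> x) *\<^sub>R l" by simp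
    then show ?thesis by (rule LIMSEQ_imp_Cauchy)
  qed
  have "Cauchy (\<lambda>k. G (\<phi> k) z)" if z: "z \<in> \<B>" for z
  proof (rule CauchyI)
    fix e :: real assume "e > 0"
    then have e3: "e / 3 > 0" by simp
    obtain d where d: "d > 0" "\<And>k v. norm (v - z) < d \<Longrightarrow> cmod (G k z - G k v) < e / 3"
      using equi[OF z e3] by blast
    obtain v where v: "v \<in> D" "dist v z < d" using z D(3) d(1) closure_approachable by blast
    obtain k0 where k0: "\<And>m n. m \<ge> k0 \<Longrightarrow> n \<ge> k0 \<Longrightarrow> norm (G (\<phi> m) v - G (\<phi> n) v) < e / 3"
      using CauchyD[OF conv_D[OF v(1)] e3] by blast
    have "norm (G (\<phi> m) z - G (\<phi> n) z) < e" if mn: "m \<ge> k0" "n \<ge> k0" for m n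
    proof -
      have vd: "norm (v - z) < d" using v by (simp add: dist_norm)
      have "norm (G (\<phi> m) z - G (\<phi> n) z) \<le> norm (G (\<phi> m) z - G (\<phi> m) v) + norm (G (\<phi> m) v - G (\<phi> n) v) + norm (G (\<phi> n) v - G (\<phi> n) z)"
        using norm_triangle_ineq[of "G (\<phi> m) z - G (\<phi> m) v + (G (\<phi> m) v - G (\<phi> n) v)" "G (\<phi> n) v - G (\<phi> n) z"]
          norm_triangle_ineq[of "G (\<phi> m) z - G (\<phi> m) v" "G (\<phi> m) v - G (\<phi> n) v"] by simp
      then show ?thesis using d(2)[OF vd, of "\<phi> m"] d(2)[OF vd, of "\<phi> n"] k0[OF mn] by (simp add: norm_minus_commute)
    qed
    then show "\<exists>M. \<forall>m\<ge>M. \<forall>n\<ge>M. norm (G (\<phi> m) z - G (\<phi> n) z) < e" by blast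
  qed
  then have "\<forall>z\<in>\<B>. \<exists>l. (\<lambda>k. G (\<phi> k) z) \<longlonglongrightarrow> l" using Cauchy_convergent_iff convergent_def by blast
  then obtain g where g: "\<And>z. z \<in> \<B> \<Longrightarrow> (\<lambda>k. G (\<phi> k) z) \<longlonglongrightarrow> g z" unfolding bchoice_iff by blast
  have gm[measurable]: "measB g"
    by (rule borel_measurable_LIMSEQ_metric[of "\<lambda>k. G (\<phi> k)"]) (use g in auto)
  have gb: "norm (wt s w *\<^sub>R g w) \<le> M" if w: "w \<in> \<B>" for w
    by (rule LIMSEQ_le_const2[OF tendsto_norm[OF tendsto_scaleR[OF tendsto_const g[OF w]]]]) (use Gs[OF w] in auto)
  have gi: "L1w s g"
  proof (rule Bochner_Integration.integrable_bound[of _ "\<lambda>_. M"])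
    show "AE w in ball_leb. norm (wt s w *\<^sub>R g w) \<le> norm M" using gb M0 by (auto intro!: AE_I2)
  qed auto
  have lim: "g z = of_real (1 / ?m) * bint s ?N g z" if z: "z \<in> \<B>" for z
  proof -
    have km[measurable]: "measB (\<lambda>w. bkern ?N (hinner z w))"
      by (rule borel_measurable_bkern) (use norm_hinner_less_1[OF z] in auto)
    have "(\<lambda>k. bint s ?N (G (\<phi> k)) z) \<longlonglongrightarrow> bint s ?N g z"
      unfolding bint_def
    proof (rule integral_dominated_convergence[where w = "\<lambda>w. M * cmod (bkern ?N (hinner z w))"])
      show "integrable ball_leb (\<lambda>w. M * cmod (bkern ?N (hinner z w)))"
      proof (rule Bochner_Integration.integrable_bound[of _ "\<lambda>_. M * (1 - norm z) powr (- ?N)"])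
        have "cmod (bkern ?N (hinner z w)) \<le> (1 - norm z) powr (- ?N)" if "w \<in> \<B>" for w
          by (rule bkern_bound) (use that z N norm_hinner_le[of z w] mult_left_le[of "norm w" "norm z"] in auto)
        then show "AE w in ball_leb. norm (M * cmod (bkern ?N (hinner z w))) \<le> norm (M * (1 - norm z) powr (- ?N))"
          using M0 by (auto intro!: AE_I2 mult_left_mono simp: abs_mult)
      qed auto
      show "AE w in ball_leb. (\<lambda>k. wt s w *\<^sub>R (G (\<phi> k) w * bkern ?N (hinner z w))) \<longlonglongrightarrow> wt s w *\<^sub>R (g w * bkern ?N (hinner z w))"
        using g by (auto intro!: AE_I2 tendsto_intros)
      have "norm (wt s w *\<^sub>R (G (\<phi> k) w * bkern ?N (hinner z w))) \<le> M * cmod (bkern ?N (hinner z w))" if "w \<in> \<B>" for k w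
        using mult_right_mono[OF Gs[OF that, of "\<phi> k"], of "cmod (bkern ?N (hinner z w))"] by (simp add: norm_mult mult_ac)
      then show "AE w in ball_leb. norm (wt s w *\<^sub>R (G (\<phi> k) w * bkern ?N (hinner z w))) \<le> M * cmod (bkern ?N (hinner z w))" for k
        by (auto intro!: AE_I2)
    qed measurable
    then have "(\<lambda>k. of_real (1 / ?m) * bint s ?N (G (\<phi> k)) z) \<longlonglongrightarrow> of_real (1 / ?m) * bint s ?N g z" by (intro tendsto_intros)
    then have "(\<lambda>k. G (\<phi> k) z) \<longlonglongrightarrow> of_real (1 / ?m) * bint s ?N g z" unfolding rep[OF z, symmetric] .
    then show ?thesis using g[OF z] LIMSEQ_unique by blast
  qed
  have "holomorphic_ball g"
  proof (rule holomorphic_ball_cong)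
    show "holomorphic_ball (\<lambda>z. of_real (1 / ?m) * bint s ?N g z)"
      by (intro holomorphic_ball_cmult holomorphic_ball_bint gi) (use s in simp)
  qed (use lim in simp)
  then show ?thesis using that[OF \<phi>(1) _ g] by blast
qed

lemma Lp_norm_tendsto_0_iff:
  fixes F :: "nat \<Rightarrow> complex ^ 'n \<Rightarrow> complex"
  assumes \<beta>: "\<beta> > -1" and q: "q > 0" and F: "\<And>k. F k \<in> Lp_space q (v_prob \<beta>)"
  shows "(\<lambda>k. Lp_norm q (v_prob \<beta>) (F k)) \<longlonglongrightarrow> 0 \<longleftrightarrow> (\<lambda>k. Lint q \<beta> (F k)) \<longlonglongrightarrow> 0"
proof -
  let ?m = "ball_mass TYPE('n) \<beta>" and ?N = "\<lambda>k. Lp_norm q (v_prob \<beta>) (F k)"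
  have m: "?m > 0" by (rule ball_mass_pos[OF \<beta>])
  have L: "Lint q \<beta> (F k) = ennreal (?m * ?N k powr q)" for k by (rule Lp_norm_powr[OF \<beta> q F])
  have e: "(\<lambda>k. Lint q \<beta> (F k)) \<longlonglongrightarrow> 0 \<longleftrightarrow> (\<lambda>k. ?m * ?N k powr q) \<longlonglongrightarrow> 0"
    unfolding L ennreal_0[symmetric] using m by (intro tendsto_ennreal_iff) auto
  show ?thesis
  proof
    assume "?N \<longlonglongrightarrow> 0"
    then have "(\<lambda>k. ?m * ?N k powr q) \<longlonglongrightarrow> ?m * 0 powr q"
      using q by (intro tendsto_intros tendsto_powr') (auto simp: Lp_norm_nonneg)
    then show "(\<lambda>k. Lint q \<beta> (F k)) \<longlonglongrightarrow> 0" unfolding e by simp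
  next
    assume "(\<lambda>k. Lint q \<beta> (F k)) \<longlonglongrightarrow> 0"
    then have "(\<lambda>k. (1 / ?m * (?m * ?N k powr q)) powr (1 / q)) \<longlonglongrightarrow> (1 / ?m * 0) powr (1 / q)"
      unfolding e using q m by (intro tendsto_powr' tendsto_mult tendsto_const) auto
    moreover have "(1 / ?m * (?m * ?N k powr q)) powr (1 / q) = ?N k" for k
      using m q Lp_norm_nonneg[of q "v_prob \<beta>" "F k"] by (simp add: powr_powr)
    ultimately show "?N \<longlonglongrightarrow> 0" using q by simp
  qed
qed

lemma ennreal_add_cmult: "c \<ge> 0 \<Longrightarrow> x \<ge> 0 \<Longrightarrow> ennreal c * (y + ennreal x * y) = ennreal (c * (1 + x)) * y"
  by (simp add: ennreal_mult' distrib_left distrib_right mult.assoc)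

lemma Lint_diff_le:
  fixes f g :: "complex ^ 'n \<Rightarrow> complex"
  assumes q: "q \<ge> 0" and [measurable]: "measB f" "measB g"
  shows "Lint q \<beta> (\<lambda>z. f z - g z) \<le> ennreal (2 powr q) * (Lint q \<beta> f + Lint q \<beta> g)"
proof -
  have "Lint q \<beta> (\<lambda>z. f z - g z) \<le> (\<integral>\<^sup>+z. ennreal (2 powr q) * (ennreal (wt \<beta> z * cmod (f z) powr q) + ennreal (wt \<beta> z * cmod (g z) powr q)) \<partial>ball_leb)"
    unfolding Lint_def
  proof (rule nn_integral_mono)
    fix z
    have "wt \<beta> z * cmod (f z - g z) powr q \<le> wt \<beta> z * (2 powr q * (cmod (f z) powr q + cmod (g z) powr q))"
      using cmod_diff_powr_le[OF q, of "f z" "g z" 0] by (intro mult_left_mono) auto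
    also have "\<dots> = 2 powr q * (wt \<beta> z * cmod (f z) powr q + wt \<beta> z * cmod (g z) powr q)"
      by (simp only: distrib_left mult_ac)
    finally have "ennreal (wt \<beta> z * cmod (f z - g z) powr q) \<le> ennreal \<dots>" by (rule ennreal_leI)
    then show "ennreal (wt \<beta> z * cmod (f z - g z) powr q) \<le> ennreal (2 powr q) * (ennreal (wt \<beta> z * cmod (f z) powr q) + ennreal (wt \<beta> z * cmod (g z) powr q))"
      by (simp only: ennreal_mult' powr_ge_zero ennreal_plus mult_nonneg_nonneg)
  qed
  also have "\<dots> = ennreal (2 powr q) * (Lint q \<beta> f + Lint q \<beta> g)"
    unfolding Lint_def by (simp add: nn_integral_cmult nn_integral_add)
  finally show ?thesis .
qed

lemma Lint_cmult:
  fixes g :: "complex ^ 'n \<Rightarrow> complex"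
  assumes [measurable]: "measB g"
  shows "Lint q \<beta> (\<lambda>z. c * g z) = ennreal (cmod c powr q) * Lint q \<beta> g"
  unfolding Lint_def by (simp add: nn_integral_cmult[symmetric] norm_mult powr_mult mult_ac flip: ennreal_mult')

section \<open>Vanishing oscillation implies compactness\<close>

lemma hankel_linear:
  fixes f g h :: "complex ^ 'n \<Rightarrow> complex"
  assumes s: "s > -1" and g: "L1w s (\<lambda>w. f w * g w)" and h: "L1w s (\<lambda>w. f w * h w)" and z: "z \<in> \<B>"
  shows "hankel s f (\<lambda>w. a * g w + b * h w) z = a * hankel s f g z + b * hankel s f h z"
proof -
  have c: "L1w s (\<lambda>w. c * (f w * k w))" if "L1w s (\<lambda>w. f w * k w)" for c k
    using integrable_mult_right[OF that, of c] by (simp add: mult_ac)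
  have "(\<lambda>w. f w * (a * g w + b * h w)) = (\<lambda>w. a * (f w * g w) + b * (f w * h w))" by (simp add: algebra_simps)
  then show ?thesis
    unfolding hankel_def by (simp only: bergman_proj_add[OF s c[OF g] c[OF h] z] bergman_proj_cmult) (simp add: algebra_simps)
qed

lemma Lint_mult_bounded:
  fixes f g :: "complex ^ 'n \<Rightarrow> complex"
  assumes q: "q \<ge> 0" and [measurable]: "measB f" and B: "\<And>w. w \<in> \<B> \<Longrightarrow> cmod (g w) \<le> B"
  shows "Lint q \<beta> (\<lambda>w. f w * g w) \<le> ennreal (B powr q) * Lint q \<beta> f"
  unfolding Lint_def
proof (rule ball_nn_le1[OF _ order_refl])
  fix w :: "complex ^ 'n" assume "w \<in> \<B>"
  then have "cmod (g w) powr q \<le> B powr q" using B[of w] q by (intro powr_mono2) auto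
  then have "wt \<beta> w * cmod (f w) powr q * cmod (g w) powr q \<le> wt \<beta> w * cmod (f w) powr q * B powr q" by (intro mult_left_mono) auto
  then show "wt \<beta> w * cmod (f w * g w) powr q \<le> B powr q * (wt \<beta> w * cmod (f w) powr q)"
    by (simp add: norm_mult powr_mult mult_ac)
qed auto

lemma H_infinity_Lint:
  fixes f g :: "complex ^ 'n \<Rightarrow> complex"
  assumes q: "q > 0" and fm: "measB f" and fL: "Lint q \<beta> f < \<infinity>" and g: "g \<in> H_infinity"
  shows "Lint q \<beta> (\<lambda>w. f w * g w) < \<infinity>"
proof -
  have "bounded (g ` \<B>)" using g by (auto simp: H_infinity_def)
  then obtain B where B: "\<And>w. w \<in> \<B> \<Longrightarrow> cmod (g w) \<le> B" unfolding bounded_iff by blast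
  have "Lint q \<beta> (\<lambda>w. f w * g w) \<le> ennreal (B powr q) * Lint q \<beta> f"
    by (rule Lint_mult_bounded) (use q fm B in auto)
  also have "\<dots> < \<infinity>" using fL by (simp add: ennreal_mult_less_top)
  finally show ?thesis .
qed

text \<open>Everything follows from the boundedness of the projection. The last item holds because
  \<open>bergman_proj \<beta>\<close> reproduces its own holomorphic values; it is one of the two
  facts that force the limit in \<open>hankel_compact_null\<close> to vanish.\<close>

lemma hankel_Lint:
  fixes f g :: "complex ^ 'n \<Rightarrow> complex"
  assumes q: "q > 1" and \<beta>: "\<beta> > -1" and fm: "measB f" and fL: "Lint q \<beta> f < \<infinity>" and g: "g \<in> H_infinity"
  shows "L1w \<beta> (\<lambda>w. f w * g w)"
    and "holomorphic_ball (bergman_proj \<beta> (\<lambda>w. f w * g w))"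
    and "Lint q \<beta> (bergman_proj \<beta> (\<lambda>w. f w * g w)) < \<infinity>"
    and "hankel \<beta> f g \<in> borel_measurable ball_leb"
    and "Lint q \<beta> (hankel \<beta> f g) < \<infinity>"
    and "\<And>z. z \<in> \<B> \<Longrightarrow> bergman_proj \<beta> (hankel \<beta> f g) z = 0"
proof -
  let ?h = "\<lambda>w. f w * g w"
  note [measurable] = fm
  have gm[measurable]: "measB g" using g holomorphic_ball_measurable by (auto simp: H_infinity_def)
  have q': "q > 0" "q \<ge> 1" "q \<ge> 0" using q by auto
  have hm: "measB ?h" by measurable
  have hL: "Lint q \<beta> ?h < \<infinity>" by (rule H_infinity_Lint[OF q'(1) fm fL g])
  show h1: "L1w \<beta> ?h" by (rule L1w_Lint[OF q'(2) \<beta> order_refl hm hL])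
  show Ph: "holomorphic_ball (bergman_proj \<beta> ?h)" by (rule holomorphic_ball_bergman_proj[OF \<beta> h1])
  note Pm[measurable] = holomorphic_ball_measurable[OF Ph]
  obtain C where C: "C > 0" "\<And>g :: complex ^ 'n \<Rightarrow> complex. g \<in> borel_measurable ball_leb \<Longrightarrow> Lint q \<beta> g < \<infinity> \<Longrightarrow>
    Lint q \<beta> (bergman_proj \<beta> g) \<le> ennreal C * Lint q \<beta> g"
    by (rule bergman_proj_Lint[OF q \<beta> order_refl, where 'n = 'n]) (rule that, assumption, blast)
  have "ennreal C * Lint q \<beta> ?h < \<infinity>" using hL by (simp add: ennreal_mult_less_top)
  then show PL: "Lint q \<beta> (bergman_proj \<beta> ?h) < \<infinity>" using C(2)[OF hm hL] by (rule le_less_trans[rotated])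
  show um: "hankel \<beta> f g \<in> borel_measurable ball_leb" unfolding hankel_def by measurable
  have "Lint q \<beta> (hankel \<beta> f g) \<le> ennreal (2 powr q) * (Lint q \<beta> ?h + Lint q \<beta> (bergman_proj \<beta> ?h))"
    unfolding hankel_def by (rule Lint_diff_le[OF q'(3) hm Pm])
  also have "\<dots> < \<infinity>" using hL PL by (simp add: ennreal_mult_less_top)
  finally show "Lint q \<beta> (hankel \<beta> f g) < \<infinity>" .
  have P1: "L1w \<beta> (bergman_proj \<beta> ?h)" by (rule L1w_Lint[OF q'(2) \<beta> order_refl Pm PL])
  show "bergman_proj \<beta> (hankel \<beta> f g) z = 0" if z: "z \<in> \<B>" for z
    unfolding hankel_def bergman_proj_diff[OF \<beta> h1 P1 z] bergman_proj_holomorphic[OF \<beta> Ph P1 z] by simp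
qed

theorem VMO_imp_hankel_compact:
  fixes f :: "complex ^ 'n \<Rightarrow> complex"
  assumes p: "1 < p" "p \<le> q" and \<alpha>: "\<alpha> > -1" and \<beta>: "\<beta> > -1" and f: "f \<in> Lp_space q (v_prob \<beta>)"
    and \<gamma>: "\<gamma> = (real CARD('n) + 1 + \<beta>) / q - (real CARD('n) + 1 + \<alpha>) / p"
    and r: "r > 0" and V: "f \<in> VMO \<sigma> q r \<gamma>"
  shows "hankel_compact p \<alpha> q \<beta> f"
proof -
  let ?n = "real CARD('n) + 1"
  have q: "q > 1" "q > 0" "q \<ge> 1" "q \<ge> 0" and p1: "p \<ge> 1" "p > 0" "p \<ge> 0" using p by auto
  have fm[measurable]: "measB f" and fL: "Lint q \<beta> f < \<infinity>" using f Lp_space_iff[OF \<beta>] by blast+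
  define \<kappa> where "\<kappa> = (?n + \<alpha>) / p"
  define \<alpha>' where "\<alpha>' = (?n + \<alpha>) * q / p - ?n"
  have \<kappa>0: "\<kappa> > 0" using \<alpha> p1 by (simp add: \<kappa>_def)
  have \<alpha>'eq: "\<alpha>' + ?n = \<kappa> * q" "\<beta> - \<gamma> * q = \<alpha>'" using q p1 unfolding \<alpha>'_def \<kappa>_def \<gamma> by (auto simp: field_simps)
  have "(?n + \<alpha>) * 1 \<le> (?n + \<alpha>) * (q / p)" using \<alpha> p p1 by (intro mult_left_mono) auto
  then have \<alpha>': "\<alpha>' > -1" using \<alpha> by (simp add: \<alpha>'_def)
  define \<sigma>1 where "\<sigma>1 = - (\<gamma> * q)"
  \<comment> \<open>The extra exponent n+1 turns the weight \<alpha>' into \<kappa>q, for which the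
    growth bound makes |g|^q times the weight bounded; dominated convergence then applies.\<close>
  define \<sigma>2 where "\<sigma>2 = - (\<gamma> * q) + ?n"
  have \<sigma>: "\<beta> + \<sigma>1 = \<alpha>'" "\<beta> + \<sigma>2 = \<alpha>' + ?n" using \<alpha>'eq by (auto simp: \<sigma>1_def \<sigma>2_def)
  have \<beta>\<sigma>: "\<beta> + min \<sigma>1 0 > -1" "\<beta> + min \<sigma>2 0 > -1" using \<sigma> \<alpha>' \<beta> by (auto simp: min_def)
  let ?osc = "\<lambda>e B. osc_bound q r f (bergman_avg \<sigma> r f) (\<lambda>u. e * wt \<sigma>1 u + B * wt \<sigma>2 u)"
  \<comment> \<open>Large enough for all conditions of the next line: convergence of the chain
    integrals, integrability of \<open>g\<close> and of \<open>f * g\<close> for the weight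
    \<open>s\<close>, and boundedness of \<open>bergman_proj s\<close> on the space of weight
    \<beta>.\<close>
  define s where "s = \<bar>\<beta>\<bar> + \<bar>\<sigma>1\<bar> + \<bar>\<sigma>2\<bar> + \<kappa> + \<bar>\<alpha>\<bar> + 1"
  have s: "s > -1" "s > \<beta> + \<bar>\<sigma>1\<bar>" "s > \<beta> + \<bar>\<sigma>2\<bar>" "s \<ge> \<alpha>" "s \<ge> \<kappa>" "s - \<kappa> \<ge> \<beta>" "s \<ge> \<beta>" using \<kappa>0 by (auto simp: s_def)
  let ?m = "ball_mass TYPE('n) s"
  have m: "?m > 0" by (rule ball_mass_pos[OF s(1)])
  show ?thesis
  proof (cases rule: bergman_embedding[OF p, where 'n = 'n and \<alpha> = \<alpha>, folded \<kappa>_def \<alpha>'_def])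
  case (1 C1)
  note C1 = this
  show ?thesis
  proof (cases rule: oscillation_operator_bound[OF q(1) r \<beta>\<sigma> s(1-3), where 'n = 'n])
  case (1 C2)
  note C2 = this
  show ?thesis
  proof (cases rule: bergman_proj_Lint[OF q(1) \<beta> order_refl, where 'n = 'n])
  case (1 C3)
  note C3 = this
  show ?thesis
  proof (cases rule: bergman_proj_Lint[OF q(1) \<beta> s(7), where 'n = 'n])
  case (1 C4)
  note C4 = this
  define X where "X = {g :: complex ^ 'n \<Rightarrow> complex. holomorphic_ball g \<and> Lint p \<alpha> g < \<infinity>}"
  have Xeq: "bergman_space p \<alpha> = X"
    unfolding bergman_space_def X_def using Lp_space_iff[OF \<alpha>] holomorphic_ball_measurable by blast
  have Xh: "holomorphic_ball g" and Xm[measurable]: "measB g" and Xf: "Lint p \<alpha> g < \<infinity>" if "g \<in> X" for g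
    using that holomorphic_ball_measurable by (auto simp: X_def)
  have XL: "g \<in> Lp_space p (v_prob \<alpha>)" if "g \<in> X" for g
    using that unfolding Xeq[symmetric] bergman_space_def by blast
  have Xs: "L1w s g" if g: "g \<in> X" for g by (rule L1w_Lint[OF p1(1) \<alpha> s(4) Xm[OF g] Xf[OF g]])
  have f\<beta>: "L1w \<beta> f" by (rule L1w_Lint[OF q(3) \<beta> order_refl fm fL])
  have Xfs: "L1w s (\<lambda>w. f w * g w)" if g: "g \<in> X" for g
  proof -
    obtain L where L: "L \<ge> 0" "Lint p \<alpha> g = ennreal L" using Xf[OF g] by (cases "Lint p \<alpha> g") auto
    let ?M = "(C1 * L) powr (1 / p)"
    note [measurable] = Xm[OF g]
    show ?thesis
    proof (rule Bochner_Integration.integrable_bound[OF integrable_mult_right[OF f\<beta>, of "of_real ?M"]])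
      have "norm (wt s w *\<^sub>R (f w * g w)) \<le> norm (of_real ?M * (wt \<beta> w *\<^sub>R f w))" if w: "w \<in> \<B>" for w
      proof -
        have x: "0 < defect w" "defect w \<le> 1" using defect_pos[OF w] defect_le_1 by auto
        have "wt s w * cmod (g w) \<le> wt s w * (?M * wt (- \<kappa>) w)"
          using C1(2)[OF Xh[OF g] L(1) _ w] L by (intro mult_left_mono) auto
        also have "\<dots> = ?M * wt (s - \<kappa>) w" by (simp add: powr_diff powr_minus field_simps)
        also have "\<dots> \<le> ?M * wt \<beta> w" using x s(6) by (intro mult_left_mono powr_mono') auto
        finally have "wt s w * cmod (g w) * cmod (f w) \<le> ?M * wt \<beta> w * cmod (f w)" by (rule mult_right_mono) simp
        then show ?thesis by (simp add: norm_mult mult_ac)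
      qed
      then show "AE w in ball_leb. norm (wt s w *\<^sub>R (f w * g w)) \<le> norm (of_real ?M * (wt \<beta> w *\<^sub>R f w))" by (auto intro!: AE_I2)
    qed measurable
  qed
  have Xlin: "(\<lambda>w. a * g w + b * h w) \<in> X" if g: "g \<in> X" and h: "h \<in> X" for g h a b
  proof -
    have "Lint p \<alpha> (\<lambda>w. a * g w - (- b) * h w) \<le> ennreal (2 powr p) * (Lint p \<alpha> (\<lambda>w. a * g w) + Lint p \<alpha> (\<lambda>w. (- b) * h w))"
      using Xm[OF g] Xm[OF h] p1 by (intro Lint_diff_le) auto
    also have "\<dots> < \<infinity>" unfolding Lint_cmult[OF Xm[OF g]] Lint_cmult[OF Xm[OF h]] using Xf[OF g] Xf[OF h] by (simp add: ennreal_mult_less_top)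
    finally show ?thesis using Xh[OF g] Xh[OF h] by (simp add: X_def holomorphic_ball_add holomorphic_ball_cmult)
  qed
  define E where "E g = hankel s f g" for g
  define T where "T g z = E g z - bergman_proj \<beta> (E g) z" for g z
  have Em: "E g \<in> borel_measurable ball_leb" if g: "g \<in> X" for g
  proof -
    note [measurable] = Xm[OF g] holomorphic_ball_measurable[OF holomorphic_ball_bergman_proj[OF s(1) Xfs[OF g]]]
    show ?thesis unfolding E_def hankel_def by measurable
  qed
  have Ebound: "ennreal (?m powr q) * Lint q \<beta> (E g) \<le> ennreal C2 * (ennreal e * Lint q \<alpha>' g + ennreal B * Lint q (\<alpha>' + ?n) g)"
    if osc: "?osc e B" and e: "e \<ge> 0" and B: "B \<ge> 0" and g: "g \<in> X" for e B g
  proof -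
    note [measurable] = Xm[OF g] Em[OF g]
    have "ennreal (?m powr q) * Lint q \<beta> (E g) = (\<integral>B z. wt \<beta> z * (?m * cmod (E g z)) powr q)"
      unfolding Lint_def by (subst nn_integral_cmult[symmetric]) (auto simp: powr_mult mult_ac simp flip: ennreal_mult')
    also have "\<dots> \<le> ennreal C2 * (\<integral>B u. cmod (g u) powr q * (e * wt (\<beta> + \<sigma>1) u + B * wt (\<beta> + \<sigma>2) u))"
      using m unfolding E_def by (intro C2(2)[OF e B osc Xh[OF g]] hankel_pointwise[OF s(1) Xh[OF g] Xs[OF g] Xfs[OF g]]) auto
    also have "(\<integral>B u. cmod (g u) powr q * (e * wt (\<beta> + \<sigma>1) u + B * wt (\<beta> + \<sigma>2) u))
      = (\<integral>\<^sup>+u. ennreal e * ennreal (wt \<alpha>' u * cmod (g u) powr q) + ennreal B * ennreal (wt (\<alpha>' + ?n) u * cmod (g u) powr q) \<partial>ball_leb)"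
      using e B unfolding \<sigma> by (intro nn_integral_cong) (simp add: algebra_simps flip: ennreal_mult' ennreal_plus)
    also have "\<dots> = ennreal e * Lint q \<alpha>' g + ennreal B * Lint q (\<alpha>' + ?n) g"
      unfolding Lint_def by (simp add: nn_integral_add nn_integral_cmult)
    finally show ?thesis .
  qed
  have osc: "\<exists>B\<ge>0. ?osc e B" if "e > 0" for e
    by (rule VMO_osc_bound[OF r q(1) fm fL V _ that, where \<kappa> = ?n]) (simp, rule exI, rule conjI, assumption, simp only: \<sigma>1_def \<sigma>2_def)
  have wmono: "Lint q (\<alpha>' + ?n) g \<le> Lint q \<alpha>' g" for g :: "complex ^ 'n \<Rightarrow> complex"
    unfolding Lint_def
    by (intro nn_integral_mono ennreal_leI mult_right_mono powr_mono') (simp_all add: defect_le_1 less_imp_le[OF defect_pos])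
  have Xq: "Lint q \<alpha>' g < \<infinity>" if g: "g \<in> X" for g
  proof -
    obtain L where L: "L \<ge> 0" "Lint p \<alpha> g = ennreal L" using Xf[OF g] by (cases "Lint p \<alpha> g") auto
    show ?thesis using C1(3)[OF Xh[OF g] L(1)] L(2) by (auto simp: top_unique less_top[symmetric])
  qed
  have EL: "Lint q \<beta> (E g) < \<infinity>" if g: "g \<in> X" for g
  proof -
    obtain B where B: "B \<ge> 0" "?osc 1 B" using osc[of 1] by auto
    note Ebound[OF B(2) _ B(1) g]
    also have "ennreal C2 * (ennreal 1 * Lint q \<alpha>' g + ennreal B * Lint q (\<alpha>' + ?n) g) < \<infinity>"
      using Xq[OF g] le_less_trans[OF wmono[of g]] by (simp add: ennreal_mult_less_top)
    finally show ?thesis using m by (auto simp: ennreal_mult_less_top)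
  qed
  have E\<beta>: "L1w \<beta> (E g)" if g: "g \<in> X" for g by (rule L1w_Lint[OF q(3) \<beta> order_refl Em[OF g] EL[OF g]])
  have Tm: "T g \<in> borel_measurable ball_leb" if g: "g \<in> X" for g
  proof -
    note [measurable] = Em[OF g] holomorphic_ball_measurable[OF holomorphic_ball_bergman_proj[OF \<beta> E\<beta>[OF g]]]
    show ?thesis unfolding T_def by measurable
  qed
  have TE: "Lint q \<beta> (T g) \<le> ennreal (2 powr q * (1 + C3)) * Lint q \<beta> (E g)" if g: "g \<in> X" for g
  proof -
    have "Lint q \<beta> (T g) \<le> ennreal (2 powr q) * (Lint q \<beta> (E g) + Lint q \<beta> (bergman_proj \<beta> (E g)))"
      unfolding T_def by (intro Lint_diff_le q Em g holomorphic_ball_measurable holomorphic_ball_bergman_proj \<beta> E\<beta>)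
    also have "\<dots> \<le> ennreal (2 powr q) * (Lint q \<beta> (E g) + ennreal C3 * Lint q \<beta> (E g))"
      by (intro mult_left_mono add_left_mono C3 Em EL g) simp
    also have "\<dots> = ennreal (2 powr q * (1 + C3)) * Lint q \<beta> (E g)" using C3 by (intro ennreal_add_cmult) auto
    finally show ?thesis .
  qed
  have TX: "T g \<in> Lp_space q (v_prob \<beta>)" if g: "g \<in> X" for g
    unfolding Lp_space_iff[OF \<beta>] using Tm[OF g] TE[OF g] EL[OF g] by (auto simp: ennreal_mult_less_top intro: le_less_trans)
  have Tlin: "T (\<lambda>w. a * g w + b * h w) z = a * T g z + b * T h z" if g: "g \<in> X" and h: "h \<in> X" and z: "z \<in> \<B>" for g h a b z
  proof -
    have E: "E (\<lambda>w. a * g w + b * h w) v = a * E g v + b * E h v" if v: "v \<in> \<B>" for v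
      unfolding E_def by (rule hankel_linear[OF s(1) Xfs[OF g] Xfs[OF h] v])
    have c: "L1w \<beta> (\<lambda>w. c * E k w)" if "k \<in> X" for c k
      using integrable_mult_right[OF E\<beta>[OF that], of c] by (simp add: mult_ac)
    have "bergman_proj \<beta> (E (\<lambda>w. a * g w + b * h w)) z = bergman_proj \<beta> (\<lambda>v. a * E g v + b * E h v) z"
      using Em[OF g] Em[OF h] E by (intro bergman_proj_cong_AE \<beta> z Em Xlin g h) (auto intro!: AE_I2)
    then show ?thesis
      unfolding T_def E[OF z] by (simp only: bergman_proj_add[OF \<beta> c[OF g] c[OF h] z] bergman_proj_cmult) (simp add: algebra_simps)
  qed
  have Tcong: "T g z = T h z" if g: "g \<in> X" and h: "h \<in> X" and z: "z \<in> \<B>" and ae: "AE z in ball_leb. g z = h z" for g h z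
  proof -
    note [measurable] = Xm[OF g] Xm[OF h]
    have P: "bergman_proj s (\<lambda>w. f w * g w) v = bergman_proj s (\<lambda>w. f w * h w) v" if "v \<in> \<B>" for v
      using ae that s(1) by (intro bergman_proj_cong_AE) auto
    have "AE v in ball_leb. E g v = E h v" using ae AE_space by eventually_elim (auto simp: E_def hankel_def P)
    then have PE: "bergman_proj \<beta> (E g) z = bergman_proj \<beta> (E h) z"
      by (intro bergman_proj_cong_AE \<beta> z Em g h)
    \<comment> \<open>Holomorphic functions that agree almost everywhere agree at every point, since
      the reproducing integral sees only the class.\<close>
    have "g z = bergman_proj s g z" by (rule bergman_proj_holomorphic[OF s(1) Xh[OF g] Xs[OF g] z, symmetric])
    also have "\<dots> = bergman_proj s h z" by (rule bergman_proj_cong_AE[OF s(1) Xm[OF g] Xm[OF h] ae z])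
    also have "\<dots> = h z" by (rule bergman_proj_holomorphic[OF s(1) Xh[OF h] Xs[OF h] z])
    finally have gz: "g z = h z" .
    show ?thesis unfolding T_def PE unfolding E_def hankel_def P[OF z] gz ..
  qed
  have compact: "\<exists>h\<in>Lp_space q (v_prob \<beta>). \<exists>\<phi> :: nat \<Rightarrow> nat. strict_mono \<phi> \<and> (\<lambda>k. Lp_norm q (v_prob \<beta>) (\<lambda>x. T (G (\<phi> k)) x - h x)) \<longlonglongrightarrow> 0"
    if G: "\<And>k. G k \<in> X" and C: "\<And>k. Lp_norm p (v_prob \<alpha>) (G k) \<le> C" for G C
  proof -
    define L where "L = ball_mass TYPE('n) \<alpha> * C powr p"
    have L: "L \<ge> 0" using ball_mass_pos[OF \<alpha>, where 'n = 'n] by (simp add: L_def)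
    have GL: "Lint p \<alpha> (G k) \<le> ennreal L" for k
      unfolding L_def Lp_norm_powr[OF \<alpha> p1(2) XL[OF G]]
      using ball_mass_pos[OF \<alpha>, where 'n = 'n] by (intro ennreal_leI mult_left_mono powr_mono2 Lp_norm_nonneg C p1) simp
    let ?M = "(C1 * L) powr (1 / p)"
    have GM: "cmod (G k z) \<le> ?M * wt (- \<kappa>) z" if "z \<in> \<B>" for k z
      by (rule C1(2)[OF Xh[OF G] L GL that])
    obtain \<phi> :: "nat \<Rightarrow> nat" and g where \<phi>: "strict_mono \<phi>" and gh: "holomorphic_ball g" and lim: "\<And>z. z \<in> \<B> \<Longrightarrow> (\<lambda>k. G (\<phi> k) z) \<longlonglongrightarrow> g z"
      by (rule holomorphic_pointwise_limit[of s \<kappa> G, OF s(1) s(5) Xh[OF G] GM]) (assumption, rule that)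
    \<comment> \<open>Fatou's lemma keeps the pointwise limit in the Bergman space, so that
      \<open>T g\<close> can serve as the limit of the images.\<close>
    have "Lint p \<alpha> g \<le> liminf (\<lambda>k. Lint p \<alpha> (G (\<phi> k)))"
    proof -
      have "Lint p \<alpha> g = (\<integral>\<^sup>+z. liminf (\<lambda>k. ennreal (wt \<alpha> z * cmod (G (\<phi> k) z) powr p)) \<partial>ball_leb)"
        unfolding Lint_def
      proof (rule nn_integral_cong)
        fix z :: "complex ^ 'n" assume "z \<in> space ball_leb"
        then have "(\<lambda>k. ennreal (wt \<alpha> z * cmod (G (\<phi> k) z) powr p)) \<longlonglongrightarrow> ennreal (wt \<alpha> z * cmod (g z) powr p)"
          using p1 by (intro tendsto_ennrealI tendsto_mult tendsto_powr' tendsto_norm tendsto_const lim) auto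
        then show "ennreal (wt \<alpha> z * cmod (g z) powr p) = liminf (\<lambda>k. ennreal (wt \<alpha> z * cmod (G (\<phi> k) z) powr p))"
          by (rule lim_imp_Liminf[OF sequentially_bot, symmetric])
      qed
      also have "\<dots> \<le> liminf (\<lambda>k. Lint p \<alpha> (G (\<phi> k)))"
        unfolding Lint_def by (intro nn_integral_liminf) (use Xm[OF G] in simp)
      finally show ?thesis .
    qed
    also have "\<dots> \<le> ennreal L" by (rule order_trans[OF Liminf_le_Limsup Limsup_bounded]) (auto intro: always_eventually GL)
    finally have gL: "Lint p \<alpha> g \<le> ennreal L" .
    have gX: "g \<in> X" using gh gL by (auto simp: X_def less_top[symmetric] top_unique)
    \<comment> \<open>Written as a linear combination so that \<open>Xlin\<close> and
      \<open>Tlin\<close> apply literally.\<close>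
    define d where "d k = (\<lambda>w. 1 * G (\<phi> k) w + (- 1) * g w)" for k
    have dX: "d k \<in> X" for k unfolding d_def by (rule Xlin[OF G gX])
    note [measurable] = Xm[OF gX] Xm[OF dX]
    define L' where "L' = 2 powr p * (L + L)"
    have dL: "Lint p \<alpha> (d k) \<le> ennreal L'" for k
    proof -
      have "Lint p \<alpha> (d k) = Lint p \<alpha> (\<lambda>w. G (\<phi> k) w - g w)" by (simp add: d_def)
      also have "\<dots> \<le> ennreal (2 powr p) * (Lint p \<alpha> (G (\<phi> k)) + Lint p \<alpha> g)" by (intro Lint_diff_le p1 Xm G gX)
      also have "\<dots> \<le> ennreal (2 powr p) * (ennreal L + ennreal L)" by (intro mult_left_mono add_mono GL gL) simp
      finally show ?thesis using L by (simp add: L'_def ennreal_mult' flip: ennreal_plus)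
    qed
    have L': "L' \<ge> 0" using L by (simp add: L'_def)
    let ?M' = "(C1 * L') powr (1 / p)"
    define Q where "Q = (C1 * L') powr ((q - p) / p) * L'"
    have Q: "Q \<ge> 0" "\<And>k. Lint q \<alpha>' (d k) \<le> ennreal Q" using L' C1(3)[OF Xh[OF dX] L' dL] by (auto simp: Q_def)
    let ?D = "\<lambda>k. Lint q (\<alpha>' + ?n) (d k)"
    have "?D \<longlonglongrightarrow> (\<integral>\<^sup>+(z :: complex ^ 'n). 0 \<partial>ball_leb)"
      unfolding Lint_def
    proof (rule nn_integral_dominated_convergence[where w = "\<lambda>_. ennreal (?M' powr q)"])
      show "AE z in ball_leb. ennreal (wt (\<alpha>' + ?n) z * cmod (d k z) powr q) \<le> ennreal (?M' powr q)" for k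
      proof (rule AE_I2)
        fix z :: "complex ^ 'n" assume "z \<in> space ball_leb"
        then have z: "z \<in> \<B>" by simp
        have "cmod (d k z) powr q \<le> (?M' * wt (- \<kappa>) z) powr q"
          by (intro powr_mono2 C1(2)[OF Xh[OF dX] L' dL z] q) simp
        also have "\<dots> = ?M' powr q * wt (- (\<kappa> * q)) z" by (simp only: powr_mult powr_powr mult_minus_left)
        finally have "wt (\<kappa> * q) z * cmod (d k z) powr q \<le> wt (\<kappa> * q) z * (?M' powr q * wt (- (\<kappa> * q)) z)"
          by (intro mult_left_mono) auto
        also have "\<dots> = ?M' powr q" using defect_pos[OF z] by (simp add: powr_minus)
        finally show "ennreal (wt (\<alpha>' + ?n) z * cmod (d k z) powr q) \<le> ennreal (?M' powr q)"
          unfolding \<alpha>'eq(1) by (rule ennreal_leI)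
      qed
      show "AE z in ball_leb. (\<lambda>k. ennreal (wt (\<alpha>' + ?n) z * cmod (d k z) powr q)) \<longlonglongrightarrow> 0"
      proof (rule AE_I2)
        fix z :: "complex ^ 'n" assume "z \<in> space ball_leb"
        then have "(\<lambda>k. d k z) \<longlonglongrightarrow> 1 * g z + (- 1) * g z" unfolding d_def by (intro tendsto_intros lim) simp
        then have "(\<lambda>k. ennreal (wt (\<alpha>' + ?n) z * cmod (d k z) powr q)) \<longlonglongrightarrow> ennreal (wt (\<alpha>' + ?n) z * cmod (1 * g z + (- 1) * g z) powr q)"
          using q by (intro tendsto_ennrealI tendsto_mult tendsto_powr' tendsto_norm tendsto_const) auto
        then show "(\<lambda>k. ennreal (wt (\<alpha>' + ?n) z * cmod (d k z) powr q)) \<longlonglongrightarrow> 0" using q by simp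
      qed
      show "(\<integral>B (z :: complex ^ 'n). ?M' powr q) < \<infinity>" by (simp add: emeasure_ball_leb ennreal_mult_less_top)
    qed measurable
    then have dlim: "?D \<longlonglongrightarrow> 0" by simp
    define K where "K = 2 powr q * (1 + C3) * (C2 / ?m powr q)"
    have K: "K > 0" using C3 C2 m by (simp add: K_def add_pos_pos)
    have Td: "Lint q \<beta> (T (d k)) \<le> ennreal K * (ennreal e * ennreal Q + ennreal B * ?D k)"
      if osc: "?osc e B" and e: "e > 0" and B: "B \<ge> 0" for e B k
    proof -
      have "ennreal (1 / ?m powr q) * (ennreal (?m powr q) * Lint q \<beta> (E (d k))) \<le> ennreal (1 / ?m powr q) * (ennreal C2 * (ennreal e * Lint q \<alpha>' (d k) + ennreal B * ?D k))"
        by (intro mult_left_mono Ebound[OF osc _ B dX]) (use e in auto)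
      also have "\<dots> \<le> ennreal (1 / ?m powr q) * (ennreal C2 * (ennreal e * ennreal Q + ennreal B * ?D k))"
        by (intro mult_left_mono add_mono Q) auto
      also have "\<dots> = ennreal (C2 / ?m powr q) * (ennreal e * ennreal Q + ennreal B * ?D k)"
        using m C2 by (simp add: mult.assoc[symmetric] flip: ennreal_mult')
      also have "ennreal (1 / ?m powr q) * (ennreal (?m powr q) * Lint q \<beta> (E (d k))) = Lint q \<beta> (E (d k))"
        using m by (simp add: mult.assoc[symmetric] flip: ennreal_mult')
      finally have "ennreal (2 powr q * (1 + C3)) * Lint q \<beta> (E (d k)) \<le> ennreal (2 powr q * (1 + C3)) * (ennreal (C2 / ?m powr q) * (ennreal e * ennreal Q + ennreal B * ?D k))"
        by (rule mult_left_mono) simp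
      also have "\<dots> = ennreal K * (ennreal e * ennreal Q + ennreal B * ?D k)"
        unfolding K_def using C3 by (subst ennreal_mult') (simp_all only: mult.assoc, simp)
      finally show ?thesis using order_trans[OF TE[OF dX]] by blast
    qed
    have Tlim: "(\<lambda>k. Lint q \<beta> (T (d k))) \<longlonglongrightarrow> 0"
    proof (rule order_tendstoI)
      fix a :: ennreal assume a: "0 < a"
      obtain \<epsilon> where \<epsilon>: "\<epsilon> > 0" "ennreal \<epsilon> < a"
      proof -
        obtain b where b: "0 < b" "b < a" using dense[OF a] by blast
        show ?thesis
        proof (cases b)
          case (real \<epsilon>) then show ?thesis using b by (intro that[of \<epsilon>]) auto
        qed (use b in auto)
      qed
      \<comment> \<open>Makes the first term at most \<epsilon>/2; the summand 1 guards against Q =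
        0.\<close>
      define e where "e = \<epsilon> / (2 * K * (Q + 1))"
      have e: "e > 0" using \<epsilon> K Q by (simp add: e_def)
      have "K * (e * Q) \<le> K * (e * (Q + 1))" using K e by (intro mult_left_mono) auto
      also have "\<dots> = \<epsilon> / 2"
      proof -
        have "Q + 1 \<noteq> 0" "K \<noteq> 0" using K Q(1) by auto
        then show ?thesis by (simp add: e_def)
      qed
      finally have eQ: "K * (e * Q) \<le> \<epsilon> / 2" .
      \<comment> \<open>\<open>B\<close> may grow without control as \<open>e\<close> shrinks, but
        it is fixed before \<open>k\<close> tends to infinity.\<close>
      obtain B where B: "B \<ge> 0" "?osc e B" using osc[OF e] by blast
      have "(\<lambda>k. ennreal (K * B) * ?D k) \<longlonglongrightarrow> ennreal (K * B) * 0"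
        by (intro ennreal_tendsto_cmult dlim) simp
      then have "\<forall>\<^sub>F k in sequentially. ennreal (K * B) * ?D k < ennreal (\<epsilon> / 2)"
        by (rule order_tendstoD) (use \<epsilon> in simp)
      then show "\<forall>\<^sub>F k in sequentially. Lint q \<beta> (T (d k)) < a"
      proof eventually_elim
        fix k assume k: "ennreal (K * B) * ?D k < ennreal (\<epsilon> / 2)"
        have "Lint q \<beta> (T (d k)) \<le> ennreal (K * (e * Q)) + ennreal (K * B) * ?D k"
          using Td[OF B(2) e B(1), of k] K e Q B by (simp add: distrib_left ennreal_mult' mult.assoc)
        also have "\<dots> \<le> ennreal (\<epsilon> / 2) + ennreal (\<epsilon> / 2)" by (intro add_mono ennreal_leI eQ less_imp_le[OF k])
        also have "\<dots> = ennreal \<epsilon>" using \<epsilon> by (simp flip: ennreal_plus)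
        finally show "Lint q \<beta> (T (d k)) < a" using \<epsilon>(2) by (rule le_less_trans)
      qed
    qed (simp add: not_less_zero)
    have "Lint q \<beta> (\<lambda>x. T (G (\<phi> k)) x - T g x) = Lint q \<beta> (T (d k))" for k
      using Tlin[OF G gX, of _ 1 "\<phi> k" "- 1"] unfolding d_def by (intro Lint_cong_AE AE_I2) simp
    then have "(\<lambda>k. Lint q \<beta> (\<lambda>x. T (G (\<phi> k)) x - T g x)) \<longlonglongrightarrow> 0" using Tlim by simp
    moreover have "(\<lambda>x. T (G (\<phi> k)) x - T g x) \<in> Lp_space q (v_prob \<beta>)" for k
    proof -
      have "Lint q \<beta> (\<lambda>x. T (G (\<phi> k)) x - T g x) \<le> ennreal (2 powr q) * (Lint q \<beta> (T (G (\<phi> k))) + Lint q \<beta> (T g))"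
        by (intro Lint_diff_le q Tm G gX)
      also have "\<dots> < \<infinity>" using TX[OF G, of "\<phi> k"] TX[OF gX] by (simp add: Lp_space_iff[OF \<beta>] ennreal_mult_less_top)
      finally show ?thesis using Tm[OF G, of "\<phi> k"] Tm[OF gX] by (simp add: Lp_space_iff[OF \<beta>])
    qed
    ultimately have "(\<lambda>k. Lp_norm q (v_prob \<beta>) (\<lambda>x. T (G (\<phi> k)) x - T g x)) \<longlonglongrightarrow> 0"
      by (subst Lp_norm_tendsto_0_iff[OF \<beta> q(2)])
    then show ?thesis using TX[OF gX] \<phi> by blast
  qed
  have "compact_operator X p (v_prob \<alpha>) q (v_prob \<beta>) T"
    unfolding compact_operator_def
  proof (intro conjI ballI allI impI)
    fix g h assume g: "g \<in> X" and h: "h \<in> X"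
    show "AE x in v_prob \<beta>. T (\<lambda>y. g y + h y) x = T g x + T h x"
      unfolding AE_v_prob[OF \<beta>] using Tlin[OF g h, of _ 1 1] by (intro AE_I2) simp
    assume "AE x in v_prob \<alpha>. g x = h x"
    then show "AE x in v_prob \<beta>. T g x = T h x"
      unfolding AE_v_prob[OF \<beta>] AE_v_prob[OF \<alpha>] using Tcong[OF g h] by (intro AE_I2) simp
  next
    fix c g assume g: "g \<in> X"
    show "AE x in v_prob \<beta>. T (\<lambda>y. c * g y) x = c * T g x"
      unfolding AE_v_prob[OF \<beta>] using Tlin[OF g g, of _ c 0] by (intro AE_I2) simp
  next
    fix G :: "nat \<Rightarrow> complex ^ 'n \<Rightarrow> complex" assume "(\<forall>k. G k \<in> X) \<and> (\<exists>C. \<forall>k. Lp_norm p (v_prob \<alpha>) (G k) \<le> C)"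
    then show "\<exists>h\<in>Lp_space q (v_prob \<beta>). \<exists>\<phi> :: nat \<Rightarrow> nat. strict_mono \<phi> \<and> (\<lambda>k. Lp_norm q (v_prob \<beta>) (\<lambda>x. T (G (\<phi> k)) x - h x)) \<longlonglongrightarrow> 0"
      using compact[of G] by blast
  qed (rule TX)
  moreover have "AE z in v_prob \<beta>. T g z = hankel \<beta> f g z" if "g \<in> H_infinity" for g
  proof -
    let ?h = "\<lambda>w. f w * g w"
    have [measurable]: "measB g" using that holomorphic_ball_measurable by (auto simp: H_infinity_def)
    have hL: "Lint q \<beta> ?h < \<infinity>" by (rule H_infinity_Lint[OF q(2) fm fL that])
    have hm: "measB ?h" by measurable
    have h\<beta>: "L1w \<beta> ?h" by (rule hankel_Lint(1)[OF q(1) \<beta> fm fL that])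
    have hs: "L1w s ?h" by (rule L1w_Lint[OF q(3) \<beta> s(7) hm hL])
    have Ph: "holomorphic_ball (bergman_proj s ?h)" by (rule holomorphic_ball_bergman_proj[OF s(1) hs])
    have "Lint q \<beta> (bergman_proj s ?h) < \<infinity>"
      using C4(2)[OF hm hL] hL by (auto simp: ennreal_mult_less_top intro: le_less_trans)
    then have P\<beta>: "L1w \<beta> (bergman_proj s ?h)"
      by (rule L1w_Lint[OF q(3) \<beta> order_refl holomorphic_ball_measurable[OF Ph]])
    have "T g z = hankel \<beta> f g z" if z: "z \<in> \<B>" for z
    proof -
      have "bergman_proj \<beta> (E g) z = bergman_proj \<beta> ?h z - bergman_proj \<beta> (bergman_proj s ?h) z"
        unfolding E_def hankel_def by (rule bergman_proj_diff[OF \<beta> h\<beta> P\<beta> z])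
      then show ?thesis
        unfolding T_def bergman_proj_holomorphic[OF \<beta> Ph P\<beta> z] by (simp add: E_def hankel_def)
    qed
    then show ?thesis unfolding AE_v_prob[OF \<beta>] by (intro AE_I2) simp
  qed
  ultimately show ?thesis unfolding hankel_compact_def Xeq by blast
  qed qed qed qed
qed

lemma Lint_eq_0_iff:
  fixes f :: "complex ^ 'n \<Rightarrow> complex"
  assumes [measurable]: "measB f"
  shows "Lint q \<beta> f = 0 \<longleftrightarrow> (AE z in ball_leb. f z = 0)"
proof -
  have "Lint q \<beta> f = 0 \<longleftrightarrow> (AE z in ball_leb. ennreal (wt \<beta> z * cmod (f z) powr q) = 0)"
    unfolding Lint_def by (rule nn_integral_0_iff_AE) measurable
  also have "\<dots> \<longleftrightarrow> (AE z in ball_leb. f z = 0)"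
    by (intro AE_cong) (use defect_pos in \<open>force simp: ennreal_eq_0_iff mult_le_0_iff\<close>)
  finally show ?thesis .
qed

section \<open>Compactness implies vanishing oscillation\<close>

text \<open>Turns compactness of the abstract extension \<open>T\<close> into a statement about
  \<open>hankel\<close> itself, with which \<open>T\<close> agrees almost everywhere on bounded
  functions.\<close>

lemma hankel_compact_subsequence:
  fixes f :: "complex ^ 'n \<Rightarrow> complex" and G :: "nat \<Rightarrow> complex ^ 'n \<Rightarrow> complex"
  assumes p: "p > 1" and q: "q > 1" and \<alpha>: "\<alpha> > -1" and \<beta>: "\<beta> > -1" and fm: "measB f" and fL: "Lint q \<beta> f < \<infinity>"
    and c: "hankel_compact p \<alpha> q \<beta> f" and G: "\<And>k. G k \<in> H_infinity" and L: "L \<ge> 0" "\<And>k. Lint p \<alpha> (G k) \<le> ennreal L"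
  obtains \<phi> :: "nat \<Rightarrow> nat" and h where "strict_mono \<phi>" "measB h" "Lint q \<beta> h < \<infinity>"
    "(\<lambda>k. Lint q \<beta> (\<lambda>z. hankel \<beta> f (G (\<phi> k)) z - h z)) \<longlonglongrightarrow> 0"
proof -
  obtain T where T: "compact_operator (bergman_space p \<alpha>) p (v_prob \<alpha>) q (v_prob \<beta>) T"
    "\<And>g. g \<in> H_infinity \<Longrightarrow> AE z in v_prob \<beta>. T g z = hankel \<beta> f g z"
    using c unfolding hankel_compact_def by blast
  have q0: "q > 0" "q \<ge> 0" and p0: "p > 0" using p q by auto
  have m: "ball_mass TYPE('n) \<alpha> > 0" by (rule ball_mass_pos[OF \<alpha>])
  have GL: "G k \<in> Lp_space p (v_prob \<alpha>)" and GX: "G k \<in> bergman_space p \<alpha>" for k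
  proof -
    have h: "holomorphic_ball (G k)" using G[of k] by (simp add: H_infinity_def)
    show *: "G k \<in> Lp_space p (v_prob \<alpha>)"
      unfolding Lp_space_iff[OF \<alpha>] using holomorphic_ball_measurable[OF h] L(2)[of k] by (auto simp: less_top[symmetric] top_unique)
    then show "G k \<in> bergman_space p \<alpha>" using h by (simp add: bergman_space_def)
  qed
  have bd: "Lp_norm p (v_prob \<alpha>) (G k) \<le> (L / ball_mass TYPE('n) \<alpha>) powr (1 / p)" for k
  proof -
    let ?N = "Lp_norm p (v_prob \<alpha>) (G k)"
    have "ball_mass TYPE('n) \<alpha> * ?N powr p \<le> L"
      using L(2)[of k] L(1) m unfolding Lp_norm_powr[OF \<alpha> p0 GL] by (subst (asm) ennreal_le_iff) auto
    then have "?N powr p \<le> L / ball_mass TYPE('n) \<alpha>" using m by (simp add: field_simps)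
    then have "(?N powr p) powr (1 / p) \<le> (L / ball_mass TYPE('n) \<alpha>) powr (1 / p)" using p0 by (intro powr_mono2) auto
    then show ?thesis using p0 Lp_norm_nonneg[of p "v_prob \<alpha>" "G k"] by (simp add: powr_powr)
  qed
  obtain h and \<phi> :: "nat \<Rightarrow> nat" where h: "h \<in> Lp_space q (v_prob \<beta>)" "strict_mono \<phi>" "(\<lambda>k. Lp_norm q (v_prob \<beta>) (\<lambda>x. T (G (\<phi> k)) x - h x)) \<longlonglongrightarrow> 0"
    using T(1) GX bd unfolding compact_operator_def by blast
  have hm[measurable]: "measB h" and hL: "Lint q \<beta> h < \<infinity>" using h(1) by (auto simp: Lp_space_iff[OF \<beta>])
  have TL: "T (G k) \<in> Lp_space q (v_prob \<beta>)" for k using T(1) GX unfolding compact_operator_def by blast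
  have Tm[measurable]: "T (G k) \<in> borel_measurable ball_leb" and TLf: "Lint q \<beta> (T (G k)) < \<infinity>" for k
    using TL[of k] by (auto simp: Lp_space_iff[OF \<beta>])
  have D: "(\<lambda>x. T (G k) x - h x) \<in> Lp_space q (v_prob \<beta>)" for k
  proof -
    have "Lint q \<beta> (\<lambda>x. T (G k) x - h x) \<le> ennreal (2 powr q) * (Lint q \<beta> (T (G k)) + Lint q \<beta> h)"
      by (rule Lint_diff_le[OF q0(2) Tm hm])
    also have "\<dots> < \<infinity>" using TLf[of k] hL by (simp add: ennreal_mult_less_top)
    finally show ?thesis unfolding Lp_space_iff[OF \<beta>] by simp
  qed
  have lim: "(\<lambda>k. Lint q \<beta> (\<lambda>x. T (G (\<phi> k)) x - h x)) \<longlonglongrightarrow> 0"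
    using h(3) Lp_norm_tendsto_0_iff[OF \<beta> q0(1) D] by blast
  have "Lint q \<beta> (\<lambda>x. T (G (\<phi> k)) x - h x) = Lint q \<beta> (\<lambda>z. hankel \<beta> f (G (\<phi> k)) z - h z)" for k
    by (rule Lint_cong_AE) (use T(2)[OF G, of "\<phi> k"] in \<open>auto simp: AE_v_prob[OF \<beta>]\<close>)
  then show ?thesis using that[OF h(2) hm hL] lim by simp
qed

text \<open>The limit \<open>h\<close> of a subsequence is annihilated by
  \<open>bergman_proj \<beta>\<close>, and it is almost everywhere equal to the holomorphic function
  \<open>bergman_proj s h\<close>. Such a function is reproduced by
  \<open>bergman_proj \<beta>\<close>, hence zero.\<close>

lemma hankel_compact_null:
  fixes f :: "complex ^ 'n \<Rightarrow> complex" and G :: "nat \<Rightarrow> complex ^ 'n \<Rightarrow> complex"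
  assumes p: "p > 1" and q: "q > 1" and \<alpha>: "\<alpha> > -1" and \<beta>: "\<beta> > -1" and fm: "measB f" and fL: "Lint q \<beta> f < \<infinity>"
    and c: "hankel_compact p \<alpha> q \<beta> f" and G: "\<And>k. G k \<in> H_infinity" and L: "L \<ge> 0" "\<And>k. Lint p \<alpha> (G k) \<le> ennreal L"
    and G0: "\<And>z. z \<in> \<B> \<Longrightarrow> (\<lambda>k. G k z) \<longlonglongrightarrow> 0"
  obtains \<phi> :: "nat \<Rightarrow> nat" where "strict_mono \<phi>" "(\<lambda>k. Lint q \<beta> (hankel \<beta> f (G (\<phi> k)))) \<longlonglongrightarrow> 0"
proof -
  let ?n = "real CARD('n) + 1"
  have q0: "q > 0" "q \<ge> 0" "q \<ge> 1" using q by auto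
  define \<kappa> where "\<kappa> = (?n + \<alpha>) / p"
  have \<kappa>: "\<kappa> > 0" using \<alpha> p by (simp add: \<kappa>_def)
  \<comment> \<open>With s - \<kappa> = \<beta> the growth bound of the sequence dominates
    \<open>f * G k\<close> for the weight \<open>s\<close> by a multiple of \<open>f\<close> for the
    weight \<beta>, which is integrable.\<close>
  define s where "s = \<kappa> + \<beta>"
  have s: "s > -1" "s \<ge> \<beta>" "s - \<kappa> = \<beta>" using \<kappa> \<beta> by (auto simp: s_def)
  have ms: "ball_mass TYPE('n) s > 0" by (rule ball_mass_pos[OF s(1)])
  note [measurable] = fm
  have Gh: "holomorphic_ball (G k)" for k using G by (simp add: H_infinity_def)
  note Gm[measurable] = holomorphic_ball_measurable[OF Gh]
  show ?thesis
  proof (cases rule: bergman_embedding[OF p order_refl, where 'n = 'n and \<alpha> = \<alpha>, folded \<kappa>_def])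
  case (1 C1)
  note C1 = this
  let ?M = "(C1 * L) powr (1 / p)"
  have GM: "cmod (G k z) \<le> ?M * wt (- \<kappa>) z" if "z \<in> \<B>" for k z by (rule C1(2)[OF Gh L that])
  show ?thesis
  proof (cases rule: bergman_proj_Lint[OF q \<beta> s(2), where 'n = 'n])
  case (1 Cs)
  note Cs = this
  obtain C\<beta> where C\<beta>: "C\<beta> > 0" "\<And>g :: complex ^ 'n \<Rightarrow> complex. g \<in> borel_measurable ball_leb \<Longrightarrow> Lint q \<beta> g < \<infinity> \<Longrightarrow>
    Lint q \<beta> (bergman_proj \<beta> g) \<le> ennreal C\<beta> * Lint q \<beta> g"
    by (rule bergman_proj_Lint[OF q \<beta> order_refl, where 'n = 'n]) (rule that, assumption, blast)
  obtain \<phi> :: "nat \<Rightarrow> nat" and h where \<phi>: "strict_mono \<phi>" and hm[measurable]: "measB h" and hL: "Lint q \<beta> h < \<infinity>"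
    and lim: "(\<lambda>k. Lint q \<beta> (\<lambda>z. hankel \<beta> f (G (\<phi> k)) z - h z)) \<longlonglongrightarrow> 0"
    by (rule hankel_compact_subsequence[OF p q \<alpha> \<beta> fm fL c G L])
  define u where "u k = hankel \<beta> f (G (\<phi> k))" for k
  note H = hankel_Lint[OF q \<beta> fm fL G]
  have um[measurable]: "u k \<in> borel_measurable ball_leb" and uL: "Lint q \<beta> (u k) < \<infinity>" for k
    unfolding u_def by (rule H)+
  have L1: "L1w t g" if "measB g" "Lint q \<beta> g < \<infinity>" "t \<ge> \<beta>" for g t
    by (rule L1w_Lint[OF q0(3) \<beta> that(3,1,2)])
  have h\<beta>: "L1w \<beta> h" and hs: "L1w s h" and u\<beta>: "L1w \<beta> (u k)" and us: "L1w s (u k)" for k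
    using s(2) by (auto intro!: L1 hm hL um uL)
  have Psm: "bergman_proj s g \<in> borel_measurable ball_leb" if "L1w s g" for g
    by (rule holomorphic_ball_measurable[OF holomorphic_ball_bergman_proj[OF s(1) that]])
  define d where "d k z = u k z - h z" for k z
  have dm[measurable]: "d k \<in> borel_measurable ball_leb" for k unfolding d_def by measurable
  have dL: "Lint q \<beta> (d k) < \<infinity>" for k
  proof -
    have "Lint q \<beta> (d k) \<le> ennreal (2 powr q) * (Lint q \<beta> (u k) + Lint q \<beta> h)" unfolding d_def by (rule Lint_diff_le[OF q0(2) um hm])
    also have "\<dots> < \<infinity>" using uL[of k] hL by (simp add: ennreal_mult_less_top)
    finally show ?thesis .
  qed
  have d0: "(\<lambda>k. Lint q \<beta> (d k)) \<longlonglongrightarrow> 0" unfolding d_def u_def by (rule lim)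
  \<comment> \<open>The projection annihilates every \<open>u k\<close>, so that of
    \<open>d k\<close> is minus that of \<open>h\<close>; as \<open>d k\<close> tends to 0 and the
    projection is bounded, this is 0.\<close>
  have P\<beta>h: "AE z in ball_leb. bergman_proj \<beta> h z = 0"
  proof -
    have Pm: "bergman_proj \<beta> h \<in> borel_measurable ball_leb"
      by (rule holomorphic_ball_measurable[OF holomorphic_ball_bergman_proj[OF \<beta> h\<beta>]])
    have "bergman_proj \<beta> (d k) z = (- 1) * bergman_proj \<beta> h z" if "z \<in> \<B>" for k z
      unfolding d_def bergman_proj_diff[OF \<beta> u\<beta> h\<beta> that] using H(6)[OF that, of "\<phi> k"] by (simp add: u_def)
    then have "Lint q \<beta> (bergman_proj \<beta> (d k)) = Lint q \<beta> (\<lambda>z. (- 1) * bergman_proj \<beta> h z)" for k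
      by (intro Lint_cong_AE AE_I2) simp
    then have "Lint q \<beta> (bergman_proj \<beta> h) \<le> ennreal C\<beta> * Lint q \<beta> (d k)" for k
      using C\<beta>(2)[OF dm dL, of k] Lint_cmult[OF Pm, of q \<beta> "- 1"] by simp
    moreover have "(\<lambda>k. ennreal C\<beta> * Lint q \<beta> (d k)) \<longlonglongrightarrow> ennreal C\<beta> * 0" by (intro ennreal_tendsto_cmult d0) simp
    ultimately have "Lint q \<beta> (bergman_proj \<beta> h) \<le> ennreal C\<beta> * 0" by (intro LIMSEQ_le_const[of _ "ennreal C\<beta> * 0"]) auto
    then show ?thesis using Lint_eq_0_iff[OF Pm] by simp
  qed
  \<comment> \<open>Since \<open>bergman_proj s\<close> fixes the holomorphic part of
    \<open>u k\<close>, the difference \<open>D k\<close> equals \<open>f * G\<close> minus its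
    projection and tends to 0 pointwise. Fatou's lemma together with the norm convergence of
    \<open>d k\<close> identifies the limit.\<close>
  have Psh: "AE z in ball_leb. h z - bergman_proj s h z = 0"
  proof -
    note Pm[measurable] = Psm[OF hs] Psm[OF us]
    have fGs: "L1w s (\<lambda>w. f w * G k w)" for k
      by (rule L1[OF _ H_infinity_Lint[OF q0(1) fm fL G] s(2)]) measurable
    have f\<beta>: "L1w \<beta> f" by (rule L1[OF fm fL order_refl])
    have fG0: "(\<lambda>k. bergman_proj s (\<lambda>w. f w * G k w) z) \<longlonglongrightarrow> 0" if z: "z \<in> \<B>" for z
    proof -
      have kb: "kern s z w \<le> (1 - norm z) powr (- (?n + s))" if "w \<in> \<B>" for w
      proof -
        have "cmod (hinner z w) \<le> norm z" using norm_hinner_le[of z w] that mult_left_le[of "norm w" "norm z"] by simp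
        then have "1 - norm z \<le> cmod (1 - hinner z w)" using norm_triangle_ineq2[of 1 "hinner z w"] by simp
        then show ?thesis unfolding kern_def using z s by (intro powr_mono2') auto
      qed
      have "(\<lambda>k. (\<integral>B w. cmod (f w * G k w) * (wt s w * kern s z w))) \<longlonglongrightarrow> (\<integral>\<^sup>+(w :: complex ^ 'n). 0 \<partial>ball_leb)"
      proof (rule nn_integral_dominated_convergence[where w = "\<lambda>w. ennreal (?M * (1 - norm z) powr (- (?n + s))) * ennreal (norm (wt \<beta> w *\<^sub>R f w))"])
        show "AE w in ball_leb. ennreal (cmod (f w * G k w) * (wt s w * kern s z w)) \<le> ennreal (?M * (1 - norm z) powr (- (?n + s))) * ennreal (norm (wt \<beta> w *\<^sub>R f w))" for k
        proof (rule AE_I2)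
          fix w :: "complex ^ 'n" assume "w \<in> space ball_leb"
          then have w: "w \<in> \<B>" by simp
          have "cmod (f w * G k w) * (wt s w * kern s z w) = cmod (f w) * (cmod (G k w) * (wt s w * kern s z w))"
            by (simp add: norm_mult)
          also have "\<dots> \<le> cmod (f w) * ((?M * wt (- \<kappa>) w) * (wt s w * (1 - norm z) powr (- (?n + s))))"
            by (intro mult_left_mono mult_mono GM w kb) auto
          also have "\<dots> = ?M * (1 - norm z) powr (- (?n + s)) * (cmod (f w) * (wt (- \<kappa>) w * wt s w))" by (simp only: mult_ac)
          also have "wt (- \<kappa>) w * wt s w = wt \<beta> w" unfolding powr_add[symmetric] using s(3) by (simp add: algebra_simps)
          finally show "ennreal (cmod (f w * G k w) * (wt s w * kern s z w)) \<le> ennreal (?M * (1 - norm z) powr (- (?n + s))) * ennreal (norm (wt \<beta> w *\<^sub>R f w))"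
            by (simp add: mult_ac ennreal_leI flip: ennreal_mult')
        qed
        show "AE w in ball_leb. (\<lambda>k. ennreal (cmod (f w * G k w) * (wt s w * kern s z w))) \<longlonglongrightarrow> 0"
        proof (rule AE_I2)
          fix w :: "complex ^ 'n" assume "w \<in> space ball_leb"
          then have "(\<lambda>k. cmod (f w * G k w) * (wt s w * kern s z w)) \<longlonglongrightarrow> cmod (f w * 0) * (wt s w * kern s z w)"
            by (intro tendsto_intros G0) simp
          then show "(\<lambda>k. ennreal (cmod (f w * G k w) * (wt s w * kern s z w))) \<longlonglongrightarrow> 0"
            using tendsto_ennrealI by fastforce
        qed
        have "(\<integral>B w. norm (wt \<beta> w *\<^sub>R f w)) < \<infinity>" using f\<beta> by (simp only: integrable_iff_bounded)
        moreover have "(\<integral>\<^sup>+w. ennreal (?M * (1 - norm z) powr (- (?n + s))) * ennreal (norm (wt \<beta> w *\<^sub>R f w)) \<partial>ball_leb)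
          = ennreal (?M * (1 - norm z) powr (- (?n + s))) * (\<integral>B w. norm (wt \<beta> w *\<^sub>R f w))"
          by (rule nn_integral_cmult) measurable
        ultimately show "(\<integral>\<^sup>+w. ennreal (?M * (1 - norm z) powr (- (?n + s))) * ennreal (norm (wt \<beta> w *\<^sub>R f w)) \<partial>ball_leb) < \<infinity>"
          by (simp add: ennreal_mult_less_top)
      qed measurable
      then have l0: "(\<lambda>k. (\<integral>B w. cmod (f w * G k w) * (wt s w * kern s z w))) \<longlonglongrightarrow> 0" by simp
      have "(\<lambda>k. ennreal (ball_mass TYPE('n) s * cmod (bergman_proj s (\<lambda>w. f w * G k w) z))) \<longlonglongrightarrow> ennreal 0"
        unfolding ennreal_0 by (rule tendsto_sandwich[OF _ _ tendsto_const l0]) (auto intro!: always_eventually bergman_proj_bound s fGs z)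
      then have "(\<lambda>k. ball_mass TYPE('n) s * cmod (bergman_proj s (\<lambda>w. f w * G k w) z)) \<longlonglongrightarrow> 0"
        using ms by (subst (asm) tendsto_ennreal_iff) (auto intro!: always_eventually)
      then have "(\<lambda>k. (1 / ball_mass TYPE('n) s) * (ball_mass TYPE('n) s * cmod (bergman_proj s (\<lambda>w. f w * G k w) z))) \<longlonglongrightarrow> (1 / ball_mass TYPE('n) s) * 0"
        by (intro tendsto_intros)
      then show ?thesis using ms by (simp add: tendsto_norm_zero_iff)
    qed
    define D where "D k z = u k z - bergman_proj s (u k) z" for k z
    have D0: "(\<lambda>k. D k z) \<longlonglongrightarrow> 0" if z: "z \<in> \<B>" for z
    proof -
      have "D k z = f z * G (\<phi> k) z - bergman_proj s (\<lambda>w. f w * G (\<phi> k) w) z" for k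
      proof -
        have F: "holomorphic_ball (bergman_proj \<beta> (\<lambda>w. f w * G (\<phi> k) w))" and FL: "Lint q \<beta> (bergman_proj \<beta> (\<lambda>w. f w * G (\<phi> k) w)) < \<infinity>" by (rule H)+
        have Fs: "L1w s (bergman_proj \<beta> (\<lambda>w. f w * G (\<phi> k) w))" by (rule L1[OF holomorphic_ball_measurable[OF F] FL s(2)])
        have "bergman_proj s (u k) z = bergman_proj s (\<lambda>w. f w * G (\<phi> k) w) z - bergman_proj \<beta> (\<lambda>w. f w * G (\<phi> k) w) z"
          unfolding u_def hankel_def bergman_proj_diff[OF s(1) fGs Fs z] bergman_proj_holomorphic[OF s(1) F Fs z] ..
        then show ?thesis by (simp add: D_def u_def hankel_def)
      qed
      moreover have "(\<lambda>k. f z * G k z - bergman_proj s (\<lambda>w. f w * G k w) z) \<longlonglongrightarrow> f z * 0 - 0" by (intro tendsto_intros G0 fG0 z)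
      then have "(\<lambda>k. f z * G (\<phi> k) z - bergman_proj s (\<lambda>w. f w * G (\<phi> k) w) z) \<longlonglongrightarrow> 0"
        using LIMSEQ_subseq_LIMSEQ[OF _ \<phi>] by (fastforce simp: o_def)
      ultimately show ?thesis by simp
    qed
    have dD: "Lint q \<beta> (\<lambda>z. D k z - (h z - bergman_proj s h z)) \<le> ennreal (2 powr q * (1 + Cs)) * Lint q \<beta> (d k)" for k
    proof -
      have "D k z - (h z - bergman_proj s h z) = d k z - bergman_proj s (d k) z" if "z \<in> \<B>" for z
        unfolding D_def d_def bergman_proj_diff[OF s(1) us hs that] by simp
      then have "Lint q \<beta> (\<lambda>z. D k z - (h z - bergman_proj s h z)) = Lint q \<beta> (\<lambda>z. d k z - bergman_proj s (d k) z)"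
        by (intro Lint_cong_AE AE_I2) simp
      also have "\<dots> \<le> ennreal (2 powr q) * (Lint q \<beta> (d k) + Lint q \<beta> (bergman_proj s (d k)))"
        by (intro Lint_diff_le q0 dm Psm L1 dL s)
      also have "\<dots> \<le> ennreal (2 powr q) * (Lint q \<beta> (d k) + ennreal Cs * Lint q \<beta> (d k))"
        by (intro mult_left_mono add_left_mono Cs dm dL) simp
      also have "\<dots> = ennreal (2 powr q * (1 + Cs)) * Lint q \<beta> (d k)" using Cs by (intro ennreal_add_cmult) auto
      finally show ?thesis .
    qed
    have Dm[measurable]: "D k \<in> borel_measurable ball_leb" for k unfolding D_def by measurable
    have "Lint q \<beta> (\<lambda>z. h z - bergman_proj s h z) = (\<integral>\<^sup>+z. liminf (\<lambda>k. ennreal (wt \<beta> z * cmod (D k z - (h z - bergman_proj s h z)) powr q)) \<partial>ball_leb)"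
      unfolding Lint_def
    proof (rule nn_integral_cong)
      fix z :: "complex ^ 'n" assume "z \<in> space ball_leb"
      then have "(\<lambda>k. ennreal (wt \<beta> z * cmod (D k z - (h z - bergman_proj s h z)) powr q)) \<longlonglongrightarrow> ennreal (wt \<beta> z * cmod (0 - (h z - bergman_proj s h z)) powr q)"
        using q0 by (intro tendsto_ennrealI tendsto_mult tendsto_powr' tendsto_norm tendsto_diff tendsto_const D0) auto
      then have "liminf (\<lambda>k. ennreal (wt \<beta> z * cmod (D k z - (h z - bergman_proj s h z)) powr q)) = ennreal (wt \<beta> z * cmod (0 - (h z - bergman_proj s h z)) powr q)"
        by (rule lim_imp_Liminf[OF sequentially_bot])
      then show "ennreal (wt \<beta> z * cmod (h z - bergman_proj s h z) powr q) = liminf (\<lambda>k. ennreal (wt \<beta> z * cmod (D k z - (h z - bergman_proj s h z)) powr q))"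
        by (simp add: norm_minus_commute)
    qed
    also have "\<dots> \<le> liminf (\<lambda>k. Lint q \<beta> (\<lambda>z. D k z - (h z - bergman_proj s h z)))"
      unfolding Lint_def by (intro nn_integral_liminf) measurable
    also have "\<dots> \<le> liminf (\<lambda>k. ennreal (2 powr q * (1 + Cs)) * Lint q \<beta> (d k))" by (intro Liminf_mono always_eventually allI dD)
    also have "\<dots> = ennreal (2 powr q * (1 + Cs)) * 0"
      by (intro lim_imp_Liminf[OF sequentially_bot] ennreal_tendsto_cmult d0) simp
    finally have "Lint q \<beta> (\<lambda>z. h z - bergman_proj s h z) = 0" by simp
    then show ?thesis by (subst (asm) Lint_eq_0_iff) measurable
  qed
  \<comment> \<open>Almost everywhere \<open>h\<close> is the holomorphic function
    \<open>bergman_proj s h\<close>, which \<open>bergman_proj \<beta>\<close> reproduces, while it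
    annihilates \<open>h\<close>.\<close>
  have h0: "AE z in ball_leb. h z = 0"
  proof -
    have Ph: "holomorphic_ball (bergman_proj s h)" by (rule holomorphic_ball_bergman_proj[OF s(1) hs])
    have ae: "AE z in ball_leb. h z = bergman_proj s h z" using Psh by simp
    have PL: "Lint q \<beta> (bergman_proj s h) < \<infinity>" using hL Lint_cong_AE[OF ae, of q \<beta>] by simp
    have P\<beta>: "L1w \<beta> (bergman_proj s h)" by (rule L1[OF Psm[OF hs] PL order_refl])
    have "bergman_proj \<beta> h z = bergman_proj s h z" if z: "z \<in> \<B>" for z
      unfolding bergman_proj_cong_AE[OF \<beta> hm Psm[OF hs] ae z] by (rule bergman_proj_holomorphic[OF \<beta> Ph P\<beta> z])
    then have "AE z in ball_leb. bergman_proj \<beta> h z = bergman_proj s h z" by (intro AE_I2) simp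
    then show ?thesis using ae P\<beta>h by eventually_elim simp
  qed
  have "Lint q \<beta> (d k) = Lint q \<beta> (hankel \<beta> f (G (\<phi> k)))" for k
    by (rule Lint_cong_AE) (use h0 in \<open>auto simp: d_def u_def\<close>)
  then show ?thesis using that[OF \<phi>] d0 by simp
  qed qed
qed

text \<open>A power of the reproducing kernel at \<open>a\<close>. With \<kappa> = (n+1+\<alpha>)/p
  and b > \<kappa> the factor keeps the Bergman norm bounded while the function tends to 0 at fixed
  points as |a| tends to 1.\<close>

definition peak :: "real \<Rightarrow> real \<Rightarrow> complex ^ 'n \<Rightarrow> complex ^ 'n \<Rightarrow> complex" where
  "peak \<kappa> b a w = of_real (wt (b - \<kappa>) a) * bkern b (hinner w a)"

lemma cmod_peak: "a \<in> \<B> \<Longrightarrow> w \<in> \<B> \<Longrightarrow> cmod (peak \<kappa> b a w) = wt (b - \<kappa>) a * cmod (1 - hinner w a) powr (- b)"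
  unfolding peak_def using norm_hinner_less_1[of w a] by (simp add: norm_mult cmod_bkern)

lemma norm_hinner_le_right: "w \<in> \<B> \<Longrightarrow> cmod (hinner w a) \<le> norm a"
  using norm_hinner_le[of w a] mult_left_le_one_le[of "norm a" "norm w"] by simp

lemma peak_bound:
  fixes a w :: "complex ^ 'n"
  assumes a: "a \<in> \<B>" and w: "w \<in> \<B>" and b: "b \<ge> 0"
  shows "cmod (peak \<kappa> b a w) \<le> wt (b - \<kappa>) a * (1 - norm w) powr (- b)"
proof -
  have "cmod (hinner w a) \<le> norm w" using norm_hinner_le_right[OF a, of w] by (subst hinner_commute) simp
  then have "1 - norm w \<le> cmod (1 - hinner w a)" using norm_triangle_ineq2[of 1 "hinner w a"] by simp
  then have "cmod (1 - hinner w a) powr (- b) \<le> (1 - norm w) powr (- b)" using w b by (intro powr_mono2') auto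
  then show ?thesis unfolding cmod_peak[OF a w] by (rule mult_left_mono) simp
qed

lemma peak_H_infinity:
  fixes a :: "complex ^ 'n"
  assumes a: "a \<in> \<B>" and b: "b \<ge> 0"
  shows "peak \<kappa> b a \<in> H_infinity"
proof -
  have "holomorphic_ball (peak \<kappa> b a)"
    unfolding peak_def[abs_def] by (intro holomorphic_ball_cmult holomorphic_ball_bkern) (use a in simp)
  moreover have "cmod (peak \<kappa> b a w) \<le> wt (b - \<kappa>) a * (1 - norm a) powr (- b)" if "w \<in> \<B>" for w
    unfolding peak_def using a b by (simp add: norm_mult mult_left_mono bkern_bound[OF norm_hinner_le_right[OF that]])
  then have "bounded (peak \<kappa> b a ` \<B>)" unfolding bounded_iff by blast
  ultimately show ?thesis by (simp add: H_infinity_def)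
qed

text \<open>The \<open>p\<close>-th power of the modulus is a multiple of the kernel with parameter
  s = bp-(n+1); its Forelli-Rudin integral is a power of the defect of \<open>a\<close> that the
  normalizing factor cancels.\<close>

lemma peak_Lint:
  fixes p \<alpha> b :: real
  assumes p: "p > 0" and \<alpha>: "\<alpha> > -1" and b: "b > (real CARD('n) + 1 + \<alpha>) / p"
  obtains C where "C > 0" "\<And>a :: complex ^ 'n. a \<in> \<B> \<Longrightarrow> Lint p \<alpha> (peak ((real CARD('n) + 1 + \<alpha>) / p) b a) \<le> ennreal C"
proof -
  let ?n = "real CARD('n) + 1" and ?\<kappa> = "(real CARD('n) + 1 + \<alpha>) / p"
  define s where "s = b * p - ?n"
  have s: "s - \<alpha> > 0" using b p by (simp add: s_def field_simps)
  show ?thesis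
  proof (cases rule: forelli_rudin_kern[OF \<alpha> s, where 'n = 'n])
  case (1 C)
  note C = this
  show ?thesis
  proof (rule that[OF C(1)])
    fix a :: "complex ^ 'n" assume a: "a \<in> \<B>"
    have e: "(b - ?\<kappa>) * p = s - \<alpha>" using p by (simp add: s_def field_simps)
    have "Lint p \<alpha> (peak ?\<kappa> b a) = (\<integral>\<^sup>+w. ennreal (wt (s - \<alpha>) a) * ennreal (wt \<alpha> w * kern s a w) \<partial>ball_leb)"
      unfolding Lint_def
    proof (rule nn_integral_cong)
      fix w :: "complex ^ 'n" assume "w \<in> space ball_leb"
      then have "cmod (peak ?\<kappa> b a w) powr p = wt (s - \<alpha>) a * kern s w a"
        using a by (simp add: cmod_peak powr_mult powr_powr e kern_def) (simp add: s_def)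
      then show "ennreal (wt \<alpha> w * cmod (peak ?\<kappa> b a w) powr p) = ennreal (wt (s - \<alpha>) a) * ennreal (wt \<alpha> w * kern s a w)"
        by (simp add: kern_commute[of s w a] mult_ac flip: ennreal_mult')
    qed
    also have "\<dots> = ennreal (wt (s - \<alpha>) a) * (\<integral>B w. wt \<alpha> w * kern s a w)"
      by (rule nn_integral_cmult) measurable
    also have "\<dots> \<le> ennreal (wt (s - \<alpha>) a) * ennreal (C * wt (\<alpha> - s) a)"
      by (intro mult_left_mono C(2) a) simp
    also have "\<dots> = ennreal (C * (wt (s - \<alpha>) a * wt (\<alpha> - s) a))"
      by (simp add: mult_ac flip: ennreal_mult')
    also have "wt (s - \<alpha>) a * wt (\<alpha> - s) a = 1"
      using defect_pos[OF a] by (simp flip: powr_add)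
    finally show "Lint p \<alpha> (peak ?\<kappa> b a) \<le> ennreal C" by simp
  qed qed
qed

lemma peak_tendsto_0:
  fixes a :: "nat \<Rightarrow> complex ^ 'n"
  assumes a: "\<And>k. a k \<in> \<B>" "(\<lambda>k. norm (a k)) \<longlonglongrightarrow> 1" and b: "b \<ge> 0" "b > \<kappa>" and z: "z \<in> \<B>"
  shows "(\<lambda>k. peak \<kappa> b (a k) z) \<longlonglongrightarrow> 0"
proof (rule Lim_null_comparison)
  show "\<forall>\<^sub>F k in sequentially. norm (peak \<kappa> b (a k) z) \<le> wt (b - \<kappa>) (a k) * (1 - norm z) powr (- b)"
    using peak_bound[OF a(1) z b(1)] by simp
  have "(\<lambda>k. defect (a k)) \<longlonglongrightarrow> 1 - 1\<^sup>2" unfolding defect_def by (intro tendsto_intros a)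
  then have "(\<lambda>k. wt (b - \<kappa>) (a k) * (1 - norm z) powr (- b)) \<longlonglongrightarrow> 0 powr (b - \<kappa>) * (1 - norm z) powr (- b)"
    using b a(1) by (intro tendsto_mult tendsto_powr' tendsto_const) (auto intro!: always_eventually less_imp_le[OF defect_pos])
  then show "(\<lambda>k. wt (b - \<kappa>) (a k) * (1 - norm z) powr (- b)) \<longlonglongrightarrow> 0" by simp
qed

lemma Lint_cong_norm:
  "(\<And>z. z \<in> \<B> \<Longrightarrow> cmod (f z) = cmod (g z)) \<Longrightarrow> Lint q \<beta> f = Lint q \<beta> g"
  unfolding Lint_def by (intro nn_integral_cong) simp

text \<open>Because \<open>b\<close> is the exponent of the kernel of \<open>bergman_proj s\<close>,
  conjugating the integral exchanges the roles of \<open>a\<close> and \<open>z\<close> and leaves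
  the reproducing formula at \<open>a\<close> for the holomorphic function \<open>k\<close>.\<close>

lemma bergman_proj_cnj_peak:
  fixes G :: "complex ^ 'n \<Rightarrow> complex"
  assumes s: "s > -1" and G: "holomorphic_ball G" "L1w s G" and a: "a \<in> \<B>" and z: "z \<in> \<B>"
  defines "b \<equiv> real CARD('n) + 1 + s"
  shows "bergman_proj s (\<lambda>w. cnj (G w) * peak \<kappa> b a w) z = cnj (G a) * peak \<kappa> b a z"
proof -
  let ?m = "ball_mass TYPE('n) s" and ?X = "complex_of_real (wt (b - \<kappa>) a)"
  have m: "?m > 0" by (rule ball_mass_pos[OF s])
  have b: "b \<ge> 0" using s by (simp add: b_def)
  note [measurable] = holomorphic_ball_measurable[OF G(1)]
  have pm[measurable]: "peak \<kappa> b a \<in> borel_measurable ball_leb"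
    using peak_H_infinity[OF a b, of \<kappa>] holomorphic_ball_measurable by (auto simp: H_infinity_def)
  have [measurable]: "measB (\<lambda>w. cnj (G w))"
    by (intro borel_measurable_continuous_on[OF _ holomorphic_ball_measurable[OF G(1)]] continuous_intros)
  define k where "k w = G w * bkern b (hinner w z)" for w
  have bh: "holomorphic_ball (\<lambda>w. bkern b (hinner w z))" by (rule holomorphic_ball_bkern) (use z in simp)
  have k: "holomorphic_ball k" unfolding k_def[abs_def] by (intro holomorphic_ball_mult G bh)
  have k1: "L1w s k"
    unfolding k_def[abs_def]
    by (rule L1w_mult_bounded[OF G(2) holomorphic_ball_measurable[OF bh] bkern_bound[OF norm_hinner_le_right]]) (use z b in auto)
  have cb: "cnj (bkern b (hinner x y)) = bkern b (hinner y x)" if "x \<in> \<B>" "y \<in> \<B>" for x y :: "complex ^ 'n"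
    using bkern_cnj[of "hinner x y" b] norm_hinner_less_1[of x y] that by (simp add: hinner_commute[of y x])
  have "bint s b (\<lambda>w. cnj (G w) * peak \<kappa> b a w) z = (\<integral>w. ?X * cnj (wt s w *\<^sub>R (k w * bkern b (hinner a w))) \<partial>ball_leb)"
    unfolding bint_def
  proof (rule Bochner_Integration.integral_cong)
    fix w :: "complex ^ 'n" assume "w \<in> space ball_leb"
    then have w: "w \<in> \<B>" by simp
    show "wt s w *\<^sub>R (cnj (G w) * peak \<kappa> b a w * bkern b (hinner z w)) = ?X * cnj (wt s w *\<^sub>R (k w * bkern b (hinner a w)))"
      unfolding k_def peak_def using cb[OF a w] cb[OF w z] by (simp add: scaleR_conv_of_real mult_ac)
  qed simp
  also have "\<dots> = ?X * cnj (bint s b k a)"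
    unfolding bint_def integral_mult_right_zero by (simp only: Bochner_Integration.integral_cnj)
  also have "bint s b k a = ?m * k a"
    using bergman_proj_holomorphic[OF s k k1 a] bergman_proj_eq[OF s L1w_measurable[OF k1] a, folded b_def] m by (simp add: field_simps)
  finally have "bint s b (\<lambda>w. cnj (G w) * peak \<kappa> b a w) z = ?X * cnj (?m * (G a * bkern b (hinner a z)))" by (simp add: k_def)
  then have "bint s b (\<lambda>w. cnj (G w) * peak \<kappa> b a w) z = ?m * (cnj (G a) * peak \<kappa> b a z)"
    using cb[OF a z] by (simp add: peak_def mult_ac)
  moreover have "bergman_proj s (\<lambda>w. cnj (G w) * peak \<kappa> b a w) z = of_real (1 / ?m) * bint s b (\<lambda>w. cnj (G w) * peak \<kappa> b a w) z"
    by (rule bergman_proj_eq[OF s _ z, folded b_def]) measurable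
  ultimately show ?thesis using m by simp
qed

text \<open>Take for \<open>G\<close> the projection of \<open>cnj f\<close> times the peak, divided
  by the peak. The Hankel operator of \<open>cnj f\<close> says that \<open>cnj G\<close> times the
  peak is close to \<open>f\<close> times the peak, the one of \<open>f\<close> says the same of the
  holomorphic \<open>P\<close>. Applying \<open>bergman_proj s\<close> keeps \<open>P\<close> and
  freezes \<open>cnj G\<close> at its value at \<open>a\<close>, which is the constant
  \<open>c\<close>.\<close>

lemma hankel_peak_approximation:
  fixes \<beta> s q :: real
  assumes q: "q > 1" and \<beta>: "\<beta> > -1" and s: "s \<ge> \<beta>"
  defines "b \<equiv> real CARD('n) + 1 + s"
  obtains C where "C > 0" "\<And>(f :: complex ^ 'n \<Rightarrow> complex) a \<kappa>. f \<in> borel_measurable ball_leb \<Longrightarrow> Lint q \<beta> f < \<infinity> \<Longrightarrow> a \<in> \<B> \<Longrightarrow>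
    \<exists>c. Lint q \<beta> (\<lambda>w. (f w - c) * peak \<kappa> b a w) \<le> ennreal C * (Lint q \<beta> (hankel \<beta> f (peak \<kappa> b a)) + Lint q \<beta> (hankel \<beta> (\<lambda>w. cnj (f w)) (peak \<kappa> b a)))"
proof -
  have q0: "q > 0" "q \<ge> 0" "q \<ge> 1" using q by auto
  have s1: "s > -1" using s \<beta> by simp
  have b: "b > 0" "b \<ge> 0" using s1 by (auto simp: b_def)
  show ?thesis
  proof (cases rule: bergman_proj_Lint[OF q \<beta> s, where 'n = 'n])
  case (1 Cs)
  note Cs = this
  show ?thesis
  proof (rule that[of "2 powr q * (1 + Cs * 2 powr q)"])
    show "2 powr q * (1 + Cs * 2 powr q) > 0" using Cs by (simp add: add_pos_pos)
    fix f :: "complex ^ 'n \<Rightarrow> complex" and a :: "complex ^ 'n" and \<kappa> :: real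
    assume fm[measurable]: "measB f" and fL: "Lint q \<beta> f < \<infinity>" and a: "a \<in> \<B>"
    let ?g = "peak \<kappa> b a" and ?f' = "\<lambda>w. cnj (f w)"
    have gH: "?g \<in> H_infinity" by (rule peak_H_infinity[OF a b(2)])
    then have gh: "holomorphic_ball ?g" by (simp add: H_infinity_def)
    note gm[measurable] = holomorphic_ball_measurable[OF gh]
    have fm'[measurable]: "measB ?f'"
      by (intro borel_measurable_continuous_on[OF _ fm] continuous_intros)
    have fL': "Lint q \<beta> ?f' < \<infinity>" using fL Lint_cong_norm[of ?f' f q \<beta>] by simp
    note H = hankel_Lint[OF q \<beta> fm fL gH] and H' = hankel_Lint[OF q \<beta> fm' fL' gH]
    define u where "u = hankel \<beta> f ?g"
    define u' where "u' = hankel \<beta> ?f' ?g"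
    define P where "P = bergman_proj \<beta> (\<lambda>w. f w * ?g w)"
    define P' where "P' = bergman_proj \<beta> (\<lambda>w. ?f' w * ?g w)"
    have um[measurable]: "measB u" and um'[measurable]: "measB u'"
      and uL: "Lint q \<beta> u < \<infinity>" and uL': "Lint q \<beta> u' < \<infinity>" unfolding u_def u'_def by (fact H H')+
    have Ph: "holomorphic_ball P" and Ph': "holomorphic_ball P'" and PL: "Lint q \<beta> P < \<infinity>" and PL': "Lint q \<beta> P' < \<infinity>"
      unfolding P_def P'_def by (fact H H')+
    note Pm[measurable] = holomorphic_ball_measurable[OF Ph] and Pm'[measurable] = holomorphic_ball_measurable[OF Ph']
    have L1: "L1w s g" if "measB g" "Lint q \<beta> g < \<infinity>" for g
      by (rule L1w_Lint[OF q0(3) \<beta> s that])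
    \<comment> \<open>The reciprocal of the peak function, which has no zeros; it is bounded, so
      \<open>G\<close> inherits the integrability of \<open>P'\<close>.\<close>
    define i where "i w = complex_of_real (wt (\<kappa> - b) a) * bkern (- b) (hinner w a)" for w
    have ih: "holomorphic_ball i" unfolding i_def[abs_def] by (intro holomorphic_ball_cmult holomorphic_ball_bkern) (use a in simp)
    have gi: "i w * ?g w = 1" if "w \<in> \<B>" for w
    proof -
      have "wt (\<kappa> - b) a * wt (b - \<kappa>) a = 1" using defect_pos[OF a] by (simp flip: powr_add)
      moreover have "bkern (- b) (hinner w a) * bkern b (hinner w a) = 1"
        unfolding bkern_mult using norm_hinner_less_1[of w a] that a by (auto simp: bkern_def)
      ultimately show ?thesis unfolding i_def peak_def
        by (metis (no_types, opaque_lifting) mult.assoc mult.left_commute mult_1_right of_real_1 of_real_mult)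
    qed
    define G where "G w = P' w * i w" for w
    have Gh: "holomorphic_ball G" unfolding G_def[abs_def] by (intro holomorphic_ball_mult Ph' ih)
    note Gm[measurable] = holomorphic_ball_measurable[OF Gh]
    have ib: "cmod (i w) \<le> wt (\<kappa> - b) a * 2 powr b" if w: "w \<in> \<B>" for w
    proof -
      have h: "cmod (hinner w a) < 1" using norm_hinner_less_1[of w a] w a by simp
      then have "cmod (1 - hinner w a) \<le> 2" using norm_triangle_ineq4[of 1 "hinner w a"] by simp
      then have "cmod (1 - hinner w a) powr b \<le> 2 powr b" using b by (intro powr_mono2) auto
      then show ?thesis unfolding i_def using cmod_bkern[OF h, of "- b"] by (simp add: norm_mult mult_left_mono)
    qed
    have "Lint q \<beta> G \<le> ennreal ((wt (\<kappa> - b) a * 2 powr b) powr q) * Lint q \<beta> P'"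
      unfolding G_def[abs_def] by (rule Lint_mult_bounded[OF q0(2) Pm' ib])
    also have "\<dots> < \<infinity>" using PL' by (simp add: ennreal_mult_less_top)
    finally have G1: "L1w s G" by (rule L1[OF Gm])
    have Gg: "G w * ?g w = P' w" if "w \<in> \<B>" for w using gi[OF that] by (simp add: G_def mult.assoc)
    have cGm[measurable]: "measB (\<lambda>w. cnj (G w))"
      by (intro borel_measurable_continuous_on[OF _ Gm] continuous_intros)
    have cGL: "Lint q \<beta> (\<lambda>w. cnj (G w) * ?g w) < \<infinity>"
    proof -
      have "cmod (cnj (G w) * ?g w) = cmod (P' w)" if "w \<in> \<B>" for w
        unfolding Gg[OF that, symmetric] by (simp add: norm_mult)
      then have "Lint q \<beta> (\<lambda>w. cnj (G w) * ?g w) = Lint q \<beta> P'" by (rule Lint_cong_norm)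
      then show ?thesis using PL' by simp
    qed
    \<comment> \<open>\<open>P\<close> and \<open>cnj G\<close> times the peak approximate
      \<open>f\<close> times the peak with errors of modulus |u| and |u'|, so \<open>v\<close> is
      small, and its image under the bounded \<open>bergman_proj s\<close> is too.\<close>
    define v where "v w = P w - cnj (G w) * ?g w" for w
    have vm[measurable]: "measB v" unfolding v_def by measurable
    have vL: "Lint q \<beta> v \<le> ennreal (2 powr q) * (Lint q \<beta> u + Lint q \<beta> u')"
    proof -
      define x where "x w = (f w - cnj (G w)) * ?g w" for w
      have xm[measurable]: "measB x" unfolding x_def by measurable
      have "cmod (x w) = cmod (u' w)" if w: "w \<in> \<B>" for w
      proof -
        have "u' w = (cnj (f w) - G w) * ?g w" using Gg[OF w] by (simp add: u'_def hankel_def P'_def algebra_simps)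
        moreover have "cmod (f w - cnj (G w)) = cmod (cnj (f w) - G w)" by (metis complex_cnj_cnj complex_cnj_diff complex_mod_cnj)
        ultimately show ?thesis by (simp add: x_def norm_mult)
      qed
      then have "Lint q \<beta> x = Lint q \<beta> u'" by (rule Lint_cong_norm)
      moreover have "v = (\<lambda>w. x w - u w)" by (auto simp: v_def x_def u_def hankel_def P_def algebra_simps)
      ultimately show ?thesis using Lint_diff_le[OF q0(2) xm um, of \<beta>] by (simp add: add.commute)
    qed
    have vf: "Lint q \<beta> v < \<infinity>" by (rule le_less_trans[OF vL]) (use uL uL' in \<open>simp add: ennreal_mult_less_top\<close>)
    have Pv: "bergman_proj s v z = P z - cnj (G a) * ?g z" if z: "z \<in> \<B>" for z
    proof -
      have cG1: "L1w s (\<lambda>w. cnj (G w) * ?g w)" by (rule L1[OF _ cGL]) measurable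
      have "bergman_proj s v z = bergman_proj s P z - bergman_proj s (\<lambda>w. cnj (G w) * ?g w) z"
        unfolding v_def[abs_def] by (rule bergman_proj_diff[OF s1 L1[OF Pm PL] cG1 z])
      then show ?thesis
        unfolding bergman_proj_holomorphic[OF s1 Ph L1[OF Pm PL] z] b_def bergman_proj_cnj_peak[OF s1 Gh G1 a z] .
    qed
    define y where "y z = (cnj (G a)) * ?g z - P z" for z
    have ym: "measB y" unfolding y_def by measurable
    have "Lint q \<beta> y = Lint q \<beta> (bergman_proj s v)"
      by (rule Lint_cong_norm) (simp add: Pv y_def norm_minus_commute)
    also have "\<dots> \<le> ennreal Cs * Lint q \<beta> v" by (rule Cs(2)[OF vm vf])
    also have "\<dots> \<le> ennreal Cs * (ennreal (2 powr q) * (Lint q \<beta> u + Lint q \<beta> u'))" by (rule mult_left_mono[OF vL]) simp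
    finally have yL: "Lint q \<beta> y \<le> ennreal (Cs * 2 powr q) * (Lint q \<beta> u + Lint q \<beta> u')"
      using Cs by (simp add: ennreal_mult' mult.assoc)
    have "(\<lambda>w. (f w - cnj (G a)) * ?g w) = (\<lambda>w. u w - y w)" by (auto simp: u_def y_def hankel_def P_def algebra_simps)
    then have "Lint q \<beta> (\<lambda>w. (f w - cnj (G a)) * ?g w) \<le> ennreal (2 powr q) * (Lint q \<beta> u + Lint q \<beta> y)"
      using Lint_diff_le[OF q0(2) um ym, of \<beta>] by simp
    also have "\<dots> \<le> ennreal (2 powr q) * ((Lint q \<beta> u + Lint q \<beta> u') + ennreal (Cs * 2 powr q) * (Lint q \<beta> u + Lint q \<beta> u'))"
      by (intro mult_left_mono add_mono yL) auto
    also have "\<dots> = ennreal (2 powr q * (1 + Cs * 2 powr q)) * (Lint q \<beta> u + Lint q \<beta> u')"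
      using Cs by (intro ennreal_add_cmult) auto
    finally show "\<exists>c. Lint q \<beta> (\<lambda>w. (f w - c) * ?g w) \<le> ennreal (2 powr q * (1 + Cs * 2 powr q)) * (Lint q \<beta> (hankel \<beta> f ?g) + Lint q \<beta> (hankel \<beta> ?f' ?g))"
      unfolding u_def u'_def by blast
  qed qed
qed

text \<open>On the Bergman ball at \<open>a\<close> the modulus of the peak is at least a constant
  times \<open>wt (- \<kappa>) a\<close>; dividing by it turns the approximation of \<open>f\<close>
  times the peak by a constant multiple into local closeness of \<open>f\<close> to a constant, and
  the convexity estimate replaces this constant by the average.\<close>

lemma mean_osc_le_hankel:
  fixes \<beta> s q r \<sigma> \<kappa> :: real
  assumes q: "q > 1" and \<beta>: "\<beta> > -1" and s: "s \<ge> \<beta>" and r: "r > 0"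
  defines "b \<equiv> real CARD('n) + 1 + s"
  obtains C where "C > 0" "\<And>(f :: complex ^ 'n \<Rightarrow> complex) a. f \<in> borel_measurable ball_leb \<Longrightarrow> Lint q \<beta> f < \<infinity> \<Longrightarrow> a \<in> \<B> \<Longrightarrow>
    ennreal (wt (real CARD('n) + 1 + \<beta> - \<kappa> * q) a * mean_osc \<sigma> q r f a powr q)
    \<le> ennreal C * (Lint q \<beta> (hankel \<beta> f (peak \<kappa> b a)) + Lint q \<beta> (hankel \<beta> (\<lambda>w. cnj (f w)) (peak \<kappa> b a)))"
proof -
  let ?n = "real CARD('n) + 1"
  have q0: "q > 0" "q \<ge> 0" using q by auto
  have b: "b \<ge> 0" using s \<beta> by (simp add: b_def)
  show ?thesis
  proof (cases rule: hankel_peak_approximation[OF q \<beta> s, where 'n = 'n, folded b_def])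
  case (1 C1)
  note C1 = this
  show ?thesis
  proof (cases rule: avg_measure_comparable[OF r, where 'n = 'n and \<sigma> = \<sigma>])
  case (1 C2)
  note C2 = this
  show ?thesis
  proof (cases rule: near_comparable[OF r, where 'n = 'n])
  case (1 K1)
  note K1 = this(1,3)
  show ?thesis
  proof (cases rule: near_powr_le[OF r, where 'n = 'n])
  case (1 K2)
  note K2 = this
  define k where "k = K2 powr \<bar>- \<beta>\<bar> * K1 powr (b * q)"
  have k: "k > 0" using K1 K2 by (simp add: k_def)
  define C where "C = 2 * 2 powr q * C2 * k * C1"
  show ?thesis
  proof (rule that[of C])
    show "C > 0" using C1 C2 k by (simp add: C_def)
    fix f :: "complex ^ 'n \<Rightarrow> complex" and a :: "complex ^ 'n"
    assume fm[measurable]: "measB f" and fL: "Lint q \<beta> f < \<infinity>" and a: "a \<in> \<B>"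
    let ?g = "peak \<kappa> b a" and ?H = "Lint q \<beta> (hankel \<beta> f (peak \<kappa> b a)) + Lint q \<beta> (hankel \<beta> (\<lambda>w. cnj (f w)) (peak \<kappa> b a))"
    have [measurable]: "measB ?g"
      using peak_H_infinity[OF a b, of \<kappa>] holomorphic_ball_measurable by (auto simp: H_infinity_def)
    have x: "defect a > 0" by (rule defect_pos[OF a])
    obtain c where c: "Lint q \<beta> (\<lambda>w. (f w - c) * ?g w) \<le> ennreal C1 * ?H" using C1(2)[OF fm fL a] by blast
    let ?e = "?n + \<beta> - \<kappa> * q"
    have c': "(\<integral>B w. wt \<beta> w * cmod ((f w - c) * ?g w) powr q) \<le> ennreal C1 * ?H"
      using c by (simp only: Lint_def[of q \<beta> "\<lambda>w. (f w - c) * ?g w"])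
    have p2: "wt (- \<beta>) a * wt (\<kappa> * q) a = wt (\<kappa> * q - \<beta>) a" unfolding powr_add[symmetric] by (simp add: algebra_simps)
    have n: "(\<integral>B w. near r a w * cmod (f w - c) powr q) \<le> ennreal (k * wt (\<kappa> * q - \<beta>) a) * (ennreal C1 * ?H)"
    proof (rule ball_nn_le1[OF _ c'])
      fix w :: "complex ^ 'n" assume w: "w \<in> \<B>"
      let ?P = "cmod (f w - c) powr q"
      show "near r a w * ?P \<le> k * wt (\<kappa> * q - \<beta>) a * (wt \<beta> w * cmod ((f w - c) * ?g w) powr q)"
      proof (cases "bergman_dist a w < r")
        case True
        let ?t = "cmod (1 - hinner w a)"
        have t0: "?t > 0" using one_minus_hinner_nonzero[OF w a] by simp
        have "cmod (1 - hinner a a) = defect a" unfolding defect_alt[symmetric] using x by simp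
        then have "?t \<le> K1 * defect a" using K1(2)[OF a w True a] by simp
        then have "?t powr b \<le> (K1 * defect a) powr b" using b by (intro powr_mono2) auto
        then have "1 \<le> (K1 powr b * wt b a) * ?t powr (- b)" using t0 by (simp add: powr_mult powr_minus field_simps)
        also have "wt b a = wt \<kappa> a * wt (b - \<kappa>) a" by (simp flip: powr_add)
        finally have "1 \<le> K1 powr b * wt \<kappa> a * cmod (?g w)" unfolding cmod_peak[OF a w] by (simp only: mult_ac)
        from ge_one_powr_ge_zero[OF this q0(2)] have g1: "1 \<le> K1 powr (b * q) * wt (\<kappa> * q) a * cmod (?g w) powr q"
          by (simp only: powr_mult powr_powr)
        have "wt (- \<beta>) w \<le> K2 powr \<bar>- \<beta>\<bar> * wt (- \<beta>) a" using K2(2)[OF a w, of "- \<beta>"] True by (simp add: near_def)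
        from mult_mono[OF this g1] have "wt (- \<beta>) w * (wt \<beta> w * ?P) \<le> (K2 powr \<bar>- \<beta>\<bar> * wt (- \<beta>) a) * (K1 powr (b * q) * wt (\<kappa> * q) a * cmod (?g w) powr q) * (wt \<beta> w * ?P)"
          by (intro mult_right_mono) auto
        moreover have "wt (- \<beta>) w * (wt \<beta> w * ?P) = ?P" using defect_pos[OF w] by (simp flip: mult.assoc powr_add)
        moreover have "(K2 powr \<bar>- \<beta>\<bar> * wt (- \<beta>) a) * (K1 powr (b * q) * wt (\<kappa> * q) a * cmod (?g w) powr q) * (wt \<beta> w * ?P)
          = k * (wt (- \<beta>) a * wt (\<kappa> * q) a) * (wt \<beta> w * (?P * cmod (?g w) powr q))" unfolding k_def by (simp only: mult_ac)
        ultimately show ?thesis using True unfolding p2 by (simp only: near_def norm_mult powr_mult if_True mult_1_left)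
      qed (use k in \<open>simp add: near_def\<close>)
    qed (use k in auto)
    have "ennreal (mean_osc \<sigma> q r f a powr q) \<le> ennreal (2 * 2 powr q) * (\<integral>\<^sup>+w. ennreal (cmod (f w - c) powr q) \<partial>avg_measure \<sigma> r a)"
      unfolding mean_osc_powr(1)[OF r q a fm fL] by (rule mean_osc_powr(2)[OF r q a fm fL])
    also have "\<dots> \<le> ennreal (2 * 2 powr q) * (ennreal (C2 * wt (- ?n) a) * (ennreal (k * wt (\<kappa> * q - \<beta>) a) * (ennreal C1 * ?H)))"
      by (intro mult_left_mono order_trans[OF C2(2)[OF a] mult_left_mono[OF n]]) auto
    finally have "ennreal (wt ?e a) * ennreal (mean_osc \<sigma> q r f a powr q)
      \<le> ennreal (wt ?e a) * (ennreal (2 * 2 powr q) * (ennreal (C2 * wt (- ?n) a) * (ennreal (k * wt (\<kappa> * q - \<beta>) a) * (ennreal C1 * ?H))))"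
      by (rule mult_left_mono) simp
    also have "\<dots> = ennreal (wt ?e a * (2 * 2 powr q * (C2 * wt (- ?n) a * (k * wt (\<kappa> * q - \<beta>) a * C1)))) * ?H"
      using C1 C2 k by (simp add: ennreal_mult' mult.assoc)
    also have "wt ?e a * (2 * 2 powr q * (C2 * wt (- ?n) a * (k * wt (\<kappa> * q - \<beta>) a * C1))) = C * (wt ?e a * wt (- ?n) a * wt (\<kappa> * q - \<beta>) a)"
      unfolding C_def by (simp only: mult_ac)
    also have "wt ?e a * wt (- ?n) a * wt (\<kappa> * q - \<beta>) a = 1"
      unfolding powr_add[symmetric] using x by simp
    finally show "ennreal (wt ?e a * mean_osc \<sigma> q r f a powr q) \<le> ennreal C * ?H"
      by (simp add: ennreal_mult')
  qed qed qed qed qed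
qed

text \<open>Both parts argue by contradiction along a sequence of points. Boundedness follows from
  norm convergence of a subsequence; for the second part the points approach the sphere, so the
  peaks tend to 0 pointwise and \<open>hankel_compact_null\<close> applies.\<close>

lemma hankel_compact_peak:
  fixes f :: "complex ^ 'n \<Rightarrow> complex" and p q \<alpha> \<beta> b :: real
  assumes p: "p > 1" and q: "q > 1" and \<alpha>: "\<alpha> > -1" and \<beta>: "\<beta> > -1" and fm: "measB f" and fL: "Lint q \<beta> f < \<infinity>"
    and c: "hankel_compact p \<alpha> q \<beta> f"
  defines "\<kappa> \<equiv> (real CARD('n) + 1 + \<alpha>) / p"
  assumes b: "b > \<kappa>"
  shows "\<exists>B\<ge>0. \<forall>a\<in>\<B>. Lint q \<beta> (hankel \<beta> f (peak \<kappa> b a)) \<le> ennreal B"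
    and "\<And>e. e > 0 \<Longrightarrow> \<exists>R<1. \<forall>a :: complex ^ 'n. R < norm a \<and> norm a < 1 \<longrightarrow> Lint q \<beta> (hankel \<beta> f (peak \<kappa> b a)) \<le> ennreal e"
proof -
  have \<kappa>: "\<kappa> > 0" using \<alpha> p by (simp add: \<kappa>_def)
  have b0: "b \<ge> 0" using b \<kappa> by simp
  have p0: "p > 0" and q0: "q \<ge> 0" using p q by auto
  have b': "b > (real CARD('n) + 1 + \<alpha>) / p" using b by (simp add: \<kappa>_def)
  obtain L where L: "L > 0" "\<And>a :: complex ^ 'n. a \<in> \<B> \<Longrightarrow> Lint p \<alpha> (peak \<kappa> b a) \<le> ennreal L"
    by (rule peak_Lint[OF p0 \<alpha> b', folded \<kappa>_def]) (rule that, assumption, blast)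
  have L0: "L \<ge> 0" using L by simp
  show "\<exists>B\<ge>0. \<forall>a\<in>\<B>. Lint q \<beta> (hankel \<beta> f (peak \<kappa> b a)) \<le> ennreal B"
  proof (rule ccontr)
    assume "\<not> ?thesis"
    then have "\<forall>k :: nat. \<exists>a\<in>\<B>. Lint q \<beta> (hankel \<beta> f (peak \<kappa> b a)) > ennreal (real k)" by (meson not_le of_nat_0_le_iff)
    then obtain a where a: "\<And>k :: nat. a k \<in> \<B>" "\<And>k :: nat. Lint q \<beta> (hankel \<beta> f (peak \<kappa> b (a k))) > ennreal (real k)" by metis
    obtain \<phi> :: "nat \<Rightarrow> nat" and h where \<phi>: "strict_mono \<phi>" and hm: "measB h" and hL: "Lint q \<beta> h < \<infinity>"
      and lim: "(\<lambda>k. Lint q \<beta> (\<lambda>z. hankel \<beta> f (peak \<kappa> b (a (\<phi> k))) z - h z)) \<longlonglongrightarrow> 0"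
      by (rule hankel_compact_subsequence[OF p q \<alpha> \<beta> fm fL c peak_H_infinity[OF a(1) b0] L0 L(2)[OF a(1)]])
    define M where "M = ennreal (2 powr q) * (1 + Lint q \<beta> h)"
    have "M < \<infinity>" using hL by (simp add: M_def ennreal_mult_less_top)
    then obtain m where m: "m \<ge> 0" "M = ennreal m" by (cases M) auto
    have "\<forall>\<^sub>F k in sequentially. Lint q \<beta> (\<lambda>z. hankel \<beta> f (peak \<kappa> b (a (\<phi> k))) z - h z) < 1" by (rule order_tendstoD(2)[OF lim]) simp
    moreover have "\<forall>\<^sub>F k in sequentially. m < real (\<phi> k)"
    proof -
      have "filterlim (\<lambda>k. real (\<phi> k)) at_top sequentially"
        by (rule filterlim_compose[OF filterlim_real_sequentially filterlim_subseq[OF \<phi>]])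
      then show ?thesis by (simp add: filterlim_at_top_dense)
    qed
    ultimately have "\<forall>\<^sub>F k in sequentially. False"
    proof eventually_elim
      case (elim k)
      let ?u = "hankel \<beta> f (peak \<kappa> b (a (\<phi> k)))"
      have um: "measB ?u" by (rule hankel_Lint(4)[OF q \<beta> fm fL peak_H_infinity[OF a(1) b0]])
      have "Lint q \<beta> ?u = Lint q \<beta> (\<lambda>z. (?u z - h z) - (- 1) * h z)" by simp
      also have "\<dots> \<le> ennreal (2 powr q) * (Lint q \<beta> (\<lambda>z. ?u z - h z) + Lint q \<beta> (\<lambda>z. (- 1) * h z))"
        using um hm by (intro Lint_diff_le q0) auto
      also have "\<dots> \<le> ennreal (2 powr q) * (1 + Lint q \<beta> h)"
        unfolding Lint_cmult[OF hm] using elim(1) by (intro mult_left_mono add_mono) auto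
      also have "\<dots> = ennreal m" using m(2) by (simp add: M_def)
      also have "\<dots> < ennreal (real (\<phi> k))" using elim(2) m by (simp add: ennreal_lessI)
      finally show False using a(2)[of "\<phi> k"] by simp
    qed
    then show False by simp
  qed
  show "\<exists>R<1. \<forall>a :: complex ^ 'n. R < norm a \<and> norm a < 1 \<longrightarrow> Lint q \<beta> (hankel \<beta> f (peak \<kappa> b a)) \<le> ennreal e" if e: "e > 0" for e
  proof (rule ccontr)
    assume "\<not> ?thesis"
    then have "\<forall>k :: nat. \<exists>a :: complex ^ 'n. 1 - 1 / real (Suc k) < norm a \<and> norm a < 1 \<and> Lint q \<beta> (hankel \<beta> f (peak \<kappa> b a)) > ennreal e"
      by (auto simp: not_le)
    then obtain a :: "nat \<Rightarrow> complex ^ 'n" where a: "\<And>k. 1 - 1 / real (Suc k) < norm (a k)" "\<And>k. norm (a k) < 1" "\<And>k. Lint q \<beta> (hankel \<beta> f (peak \<kappa> b (a k))) > ennreal e" by metis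
    have a1: "a k \<in> \<B>" for k using a(2) by simp
    have l1: "(\<lambda>k. 1 - 1 / real (Suc k)) \<longlonglongrightarrow> 1"
      using tendsto_diff[OF tendsto_const LIMSEQ_Suc[OF lim_1_over_n], of "1 :: real"] by simp
    have "(\<lambda>k. norm (a k)) \<longlonglongrightarrow> 1"
      by (rule tendsto_sandwich[OF _ _ l1 tendsto_const]; intro always_eventually allI less_imp_le a)
    then obtain \<phi> :: "nat \<Rightarrow> nat" where \<phi>: "strict_mono \<phi>" and lim: "(\<lambda>k. Lint q \<beta> (hankel \<beta> f (peak \<kappa> b (a (\<phi> k))))) \<longlonglongrightarrow> 0"
      by (rule hankel_compact_null[OF p q \<alpha> \<beta> fm fL c peak_H_infinity[OF a1 b0] L0 L(2)[OF a1] peak_tendsto_0[OF a1 _ b0 b]])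
    have "\<forall>\<^sub>F k in sequentially. Lint q \<beta> (hankel \<beta> f (peak \<kappa> b (a (\<phi> k)))) < ennreal e" by (rule order_tendstoD(2)[OF lim]) (use e in simp)
    then obtain k where "Lint q \<beta> (hankel \<beta> f (peak \<kappa> b (a (\<phi> k)))) < ennreal e" by (auto simp: eventually_sequentially)
    then show False using a(3)[of "\<phi> k"] by simp
  qed
qed

section \<open>From Hankel operators on peaks to VMO, and the equivalence\<close>

lemma Lp_space_Lq_loc:
  fixes f :: "complex ^ 'n \<Rightarrow> complex"
  assumes fm: "measB f" and fL: "Lint q \<beta> f < \<infinity>"
  shows "f \<in> Lq_loc q"
proof -
  have meas: "borel_measurable ball_vol = borel_measurable (ball_leb :: (complex ^ 'n) measure)" by (simp add: ball_vol_eq measurable_def)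
  have "set_integrable ball_vol K (\<lambda>z. norm (f z) powr q)" if K: "compact K" "K \<subseteq> \<B>" for K
  proof -
    have "continuous_on K (\<lambda>w. wt \<beta> w)"
      unfolding defect_def using K(2) defect_pos by (intro continuous_intros) (fastforce simp: defect_def)
    then obtain c where c: "c > 0" "\<And>w. w \<in> K \<Longrightarrow> c \<le> wt \<beta> w"
    proof (cases "K = {}")
      case False
      then obtain x where "x \<in> K" "\<And>w. w \<in> K \<Longrightarrow> wt \<beta> x \<le> wt \<beta> w"
        using continuous_attains_inf[OF K(1) False \<open>continuous_on K _\<close>] by blast
      moreover from this(1) have "defect x > 0" using K(2) defect_pos by blast
      ultimately show ?thesis by (intro that[of "wt \<beta> x"]) auto
    qed (use that[of 1] in simp)
    have Km[measurable]: "K \<in> sets ball_leb"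
      using K sets_restrict_space_iff[of "\<B>" lebesgue K] by (auto simp: ball_leb_def compact_imp_closed)
    note [measurable] = fm
    have "(\<integral>B w. indicator K w * cmod (f w) powr q) \<le> (\<integral>\<^sup>+w. ennreal (1 / c) * ennreal (wt \<beta> w * cmod (f w) powr q) \<partial>ball_leb)"
    proof (rule nn_integral_mono)
      fix w
      have "indicator K w * cmod (f w) powr q \<le> 1 / c * (wt \<beta> w * cmod (f w) powr q)"
      proof (cases "w \<in> K")
        case True
        then have "1 * cmod (f w) powr q \<le> (1 / c * wt \<beta> w) * cmod (f w) powr q"
          using c by (intro mult_right_mono) (auto simp: field_simps)
        then show ?thesis using True by (simp add: mult.assoc)
      qed (use c in simp)
      then show "ennreal (indicator K w * cmod (f w) powr q) \<le> ennreal (1 / c) * ennreal (wt \<beta> w * cmod (f w) powr q)"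
        using c by (simp add: ennreal_leI flip: ennreal_mult')
    qed
    also have "\<dots> = ennreal (1 / c) * Lint q \<beta> f" unfolding Lint_def by (rule nn_integral_cmult) measurable
    also have "\<dots> < \<infinity>" using fL by (simp add: ennreal_mult_less_top)
    finally have "integrable ball_leb (\<lambda>w. indicator K w * cmod (f w) powr q)"
      by (intro integrableI_bounded) (auto simp: abs_mult)
    moreover have "ball_mass TYPE('n) 0 > 0" by (rule ball_mass_pos) simp
    ultimately show ?thesis
      unfolding set_integrable_def ball_vol_eq by (subst integrable_density) (auto intro!: integrable_mult_right)
  qed
  then show ?thesis unfolding Lq_loc_def meas using fm by blast
qed

theorem hankel_compact_imp_VMO:
  fixes f :: "complex ^ 'n \<Rightarrow> complex"
  assumes p: "1 < p" "p \<le> q" and \<alpha>: "\<alpha> > -1" and \<beta>: "\<beta> > -1" and f: "f \<in> Lp_space q (v_prob \<beta>)"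
    and \<gamma>: "\<gamma> = (real CARD('n) + 1 + \<beta>) / q - (real CARD('n) + 1 + \<alpha>) / p"
    and r: "r > 0" and c: "hankel_compact p \<alpha> q \<beta> f" and c': "hankel_compact p \<alpha> q \<beta> (\<lambda>z. cnj (f z))"
  shows "f \<in> VMO \<sigma> q r \<gamma>"
proof -
  let ?n = "real CARD('n) + 1" and ?f' = "\<lambda>z. cnj (f z)"
  have q: "q > 1" "q > 0" using p by auto
  have fm: "measB f" and fL: "Lint q \<beta> f < \<infinity>" using f Lp_space_iff[OF \<beta>] by blast+
  have fm': "measB ?f'" by (intro borel_measurable_continuous_on[OF _ fm] continuous_intros)
  have fL': "Lint q \<beta> ?f' < \<infinity>" using fL Lint_cong_norm[of ?f' f q \<beta>] by simp
  define \<kappa> where "\<kappa> = (?n + \<alpha>) / p"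
  have \<kappa>: "\<kappa> > 0" using \<alpha> p by (simp add: \<kappa>_def)
  \<comment> \<open>This gives s \<ge> \<beta> and b - \<kappa> = n+1+\<beta> > 0, the two
    conditions for the peak estimates.\<close>
  define s where "s = \<kappa> + \<beta>"
  have s: "s \<ge> \<beta>" using \<kappa> by (simp add: s_def)
  define b where "b = ?n + s"
  have b: "b > \<kappa>" using \<beta> by (simp add: b_def s_def)
  have e: "?n + \<beta> - \<kappa> * q = \<gamma> * q" using q p unfolding \<gamma> \<kappa>_def by (simp add: field_simps)
  show ?thesis
  proof (cases rule: mean_osc_le_hankel[OF q(1) \<beta> s r, where 'n = 'n and \<sigma> = \<sigma> and \<kappa> = \<kappa>, folded b_def, unfolded e])
  case (1 C)
  note C = this
  let ?M = "\<lambda>a. wt \<gamma> a * mean_osc \<sigma> q r f a"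
  have M: "?M a \<le> (C * (A + B)) powr (1 / q)" if a: "a \<in> \<B>" and AB: "A \<ge> 0" "B \<ge> 0"
    and le: "Lint q \<beta> (hankel \<beta> f (peak \<kappa> b a)) \<le> ennreal A" "Lint q \<beta> (hankel \<beta> ?f' (peak \<kappa> b a)) \<le> ennreal B" for a A B
  proof -
    have "ennreal (?M a powr q) = ennreal (wt (\<gamma> * q) a * mean_osc \<sigma> q r f a powr q)" by (simp only: powr_mult powr_powr)
    also have "\<dots> \<le> ennreal C * (ennreal A + ennreal B)" by (rule order_trans[OF C(2)[OF fm fL a]]) (intro mult_left_mono add_mono le, simp)
    also have "\<dots> = ennreal (C * (A + B))" using AB C by (simp add: ennreal_mult')
    finally have "?M a powr q \<le> C * (A + B)" using AB C by (subst (asm) ennreal_le_iff) auto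
    then have "(?M a powr q) powr (1 / q) \<le> (C * (A + B)) powr (1 / q)" using q by (intro powr_mono2) auto
    then show ?thesis using q by (simp add: powr_powr)
  qed
  note H = hankel_compact_peak[OF p(1) q(1) \<alpha> \<beta> fm fL c, folded \<kappa>_def, OF b]
    and H' = hankel_compact_peak[OF p(1) q(1) \<alpha> \<beta> fm' fL' c', folded \<kappa>_def, OF b]
  obtain A where A: "A \<ge> 0" "\<And>a. a \<in> \<B> \<Longrightarrow> Lint q \<beta> (hankel \<beta> f (peak \<kappa> b a)) \<le> ennreal A" using H(1) by blast
  obtain B where B: "B \<ge> 0" "\<And>a. a \<in> \<B> \<Longrightarrow> Lint q \<beta> (hankel \<beta> ?f' (peak \<kappa> b a)) \<le> ennreal B" using H'(1) by blast
  have "bdd_above (?M ` \<B>)" using M[OF _ A(1) B(1) A(2) B(2)] unfolding bdd_above_def by blast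
  then have "f \<in> BMO \<sigma> q r \<gamma>" using Lp_space_Lq_loc[OF fm fL] by (simp add: BMO_def defect_def)
  moreover have "(?M \<longlongrightarrow> 0) (filtercomap norm (at_left 1))"
  proof (rule tendstoI)
    fix \<epsilon> :: real assume \<epsilon>: "\<epsilon> > 0"
    define d where "d = (\<epsilon> / 2) powr q / (2 * C)"
    have d: "d > 0" "(C * (d + d)) powr (1 / q) = \<epsilon> / 2" using \<epsilon> C q by (auto simp: d_def powr_powr)
    obtain R1 where R1: "R1 < 1" "\<And>a :: complex ^ 'n. R1 < norm a \<Longrightarrow> norm a < 1 \<Longrightarrow> Lint q \<beta> (hankel \<beta> f (peak \<kappa> b a)) \<le> ennreal d" using H(2)[OF d(1)] by blast
    obtain R2 where R2: "R2 < 1" "\<And>a :: complex ^ 'n. R2 < norm a \<Longrightarrow> norm a < 1 \<Longrightarrow> Lint q \<beta> (hankel \<beta> ?f' (peak \<kappa> b a)) \<le> ennreal d" using H'(2)[OF d(1)] by blast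
    show "\<forall>\<^sub>F a in filtercomap norm (at_left 1). dist (?M a) 0 < \<epsilon>"
      unfolding eventually_norm_at_left_1
    proof (intro exI[of _ "max R1 R2"] conjI allI impI)
      fix a :: "complex ^ 'n" assume "max R1 R2 < norm a \<and> norm a < 1"
      then have "?M a \<le> \<epsilon> / 2" using M[of a d d] R1 R2 d by simp
      then show "dist (?M a) 0 < \<epsilon>" using \<epsilon> by simp
    qed (use R1 R2 in simp)
  qed
  ultimately show ?thesis by (simp add: VMO_def defect_def)
  qed
qed

text \<open>Supplies the second Hankel operator: mean oscillation is invariant under conjugation, so
  the compactness theorem applies to the conjugate symbol too.\<close>

lemma VMO_cnj:
  fixes f :: "complex ^ 'n \<Rightarrow> complex"
  assumes r: "r > 0" and fm: "measB f" and V: "f \<in> VMO \<sigma> q r \<gamma>"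
  shows "(\<lambda>z. cnj (f z)) \<in> VMO \<sigma> q r \<gamma>"
proof -
  have e: "mean_osc \<sigma> q r (\<lambda>w. cnj (f w)) u = mean_osc \<sigma> q r f u" if "u \<in> \<B>" for u by (rule mean_osc_cnj[OF r that fm])
  have "(\<lambda>z. cnj (f z)) \<in> Lq_loc q"
    using V unfolding VMO_def BMO_def Lq_loc_def by (auto intro!: borel_measurable_continuous_on[where f = cnj] continuous_intros)
  moreover have "(\<lambda>z. (1 - (norm z)\<^sup>2) powr \<gamma> * mean_osc \<sigma> q r (\<lambda>w. cnj (f w)) z) ` \<B> = (\<lambda>z. (1 - (norm z)\<^sup>2) powr \<gamma> * mean_osc \<sigma> q r f z) ` \<B>"
    using e by (intro image_cong) auto
  moreover have "\<forall>\<^sub>F z in filtercomap norm (at_left 1). (1 - (norm z)\<^sup>2) powr \<gamma> * mean_osc \<sigma> q r (\<lambda>w. cnj (f w)) z = (1 - (norm z)\<^sup>2) powr \<gamma> * mean_osc \<sigma> q r f z"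
    unfolding eventually_norm_at_left_1 using e by (intro exI[of _ 0]) auto
  then have "((\<lambda>z. (1 - (norm z)\<^sup>2) powr \<gamma> * mean_osc \<sigma> q r (\<lambda>w. cnj (f w)) z) \<longlongrightarrow> 0) (filtercomap norm (at_left 1))
    \<longleftrightarrow> ((\<lambda>z. (1 - (norm z)\<^sup>2) powr \<gamma> * mean_osc \<sigma> q r f z) \<longlongrightarrow> 0) (filtercomap norm (at_left 1))" by (rule tendsto_cong)
  ultimately show ?thesis using V unfolding VMO_def BMO_def by (simp only: mem_Collect_eq)
qed

theorem theorem6p1:
  fixes f :: "complex ^ 'n \<Rightarrow> complex"
    and p q \<alpha> \<beta> \<gamma> \<sigma> r :: real
  assumes "1 < p" and "p \<le> q" and "\<alpha> > -1" and "\<beta> > -1"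
    and "f \<in> Lp_space q (v_prob \<beta>)"
    and "\<gamma> = (real CARD('n) + 1 + \<beta>) / q - (real CARD('n) + 1 + \<alpha>) / p"
    and "r > 0"
  shows "hankel_compact p \<alpha> q \<beta> f \<and> hankel_compact p \<alpha> q \<beta> (\<lambda>z. cnj (f z))
           \<longleftrightarrow> f \<in> VMO \<sigma> q r \<gamma>"
proof
  assume "hankel_compact p \<alpha> q \<beta> f \<and> hankel_compact p \<alpha> q \<beta> (\<lambda>z. cnj (f z))"
  then show "f \<in> VMO \<sigma> q r \<gamma>" using hankel_compact_imp_VMO[OF assms] by blast
next
  assume V: "f \<in> VMO \<sigma> q r \<gamma>"
  have fm: "measB f" and fL: "Lint q \<beta> f < \<infinity>" using assms(5) Lp_space_iff[OF assms(4)] by blast+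
  have "measB (\<lambda>z. cnj (f z))" by (intro borel_measurable_continuous_on[OF _ fm] continuous_intros)
  then have "(\<lambda>z. cnj (f z)) \<in> Lp_space q (v_prob \<beta>)"
    using fL Lint_cong_norm[of "\<lambda>z. cnj (f z)" f q \<beta>] by (simp add: Lp_space_iff[OF assms(4)])
  then show "hankel_compact p \<alpha> q \<beta> f \<and> hankel_compact p \<alpha> q \<beta> (\<lambda>z. cnj (f z))"
    using VMO_imp_hankel_compact[OF assms(1-4) _ assms(6,7)] VMO_cnj[OF assms(7) fm V] V assms(5) by blast
qed

end
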